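(* Consider two pure 2-spin spherical systems with the same disorder and with parameters $(\beta_1,h_1)$ and $(\beta_2,h_2)$. For $j=1,2$: if $h_j=0$, assume $\beta_j>1$ and let $q_j=1-1/\beta_j$; if $h_j\ne0$, assume $\beta_j>0$ and let $q_j\in[0,1]$ be the unique solution of $$h_j^2+\beta_j^2q_j=\frac{q_j}{(1-q_j)^2}.$$ Let $u_0=0$ if $h_1=0$ and $h_2\neq0$, and let $$u_0=\frac{h_1h_2(1-q_1)(1-q_2)}{1-\beta_1\beta_2(1-q_1)(1-q_2)}$$ if both $h_1\ne0$ and $h_2\neq0$. Then, in each of these two cases, for any $\varepsilon>0$, $$\lim_{N\to\infty}\mathbb E\bigl\langle I\{|R_{1,2}-u_0|\ge\varepsilon\}\bigr\rangle=0.$$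
   Context: $S_N$ is the sphere of radius $\sqrt N$ in $\mathbb R^N$ centered at $0$, and $\lambda_N$ is the uniform probability measure on $S_N$. The pure 2-spin Hamiltonian is $$H_N(\boldsymbol\sigma)=\frac{1}{\sqrt{2}\,N^{1/2}}\sum_{1\le i_1,i_2\le N}g_{i_1,i_2}\sigma_{i_1}\sigma_{i_2},$$ with $(g_{i_1,i_2})$ i.i.d. standard Gaussian. For $j=1,2$ the (random) Gibbs measure $G_j$ is the probability measure on $S_N$ with density proportional to $\exp\bigl(\beta_jH_N(\boldsymbol\sigma)+h_j\sum_{i\le N}\sigma_i\bigr)$ with respect to $\lambda_N$, with the same $H_N$ for $j=1$ and $j=2$. $\langle\cdot\rangle$ denotes the average over $(\boldsymbol\sigma^1,\boldsymbol\sigma^2)\in S_N^2$ with respect to the product measure $G_1\otimes G_2$, $\mathbb E$ is the expectation over the Gaussian disorder, $R_{1,2}=N^{-1}\sum_{i\le N}\sigma_i^1\sigma_i^2$, and $I$ denotes the indicator. *)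

theory Defs
  imports "HOL-Probability.Probability"
begin

text \<open>Vectors of \<open>\<real>\<^sup>N\<close> are functions in \<open>{..<N} \<rightarrow>\<^sub>E UNIV\<close>, so that the
  dimension can tend to infinity.\<close>

abbreviation lborel_N :: "nat \<Rightarrow> (nat \<Rightarrow> real) measure" where
  "lborel_N N \<equiv> \<Pi>\<^sub>M i\<in>{..<N}. lborel"

definition norm_N :: "nat \<Rightarrow> (nat \<Rightarrow> real) \<Rightarrow> real" where
  "norm_N N x = sqrt (\<Sum>i<N. (x i)\<^sup>2)"

definition unit_ball_N :: "nat \<Rightarrow> (nat \<Rightarrow> real) set" where
  "unit_ball_N N = {x \<in> {..<N} \<rightarrow>\<^sub>E UNIV. norm_N N x \<le> 1}"

definition sphere_N :: "nat \<Rightarrow> (nat \<Rightarrow> real) set" where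
  "sphere_N N = {\<sigma> \<in> {..<N} \<rightarrow>\<^sub>E UNIV. norm_N N \<sigma> = sqrt (real N)}"

definition radial_projection :: "nat \<Rightarrow> (nat \<Rightarrow> real) \<Rightarrow> nat \<Rightarrow> real" where
  "radial_projection N x = (\<lambda>i\<in>{..<N}. sqrt (real N) * x i / norm_N N x)"

text \<open>Normalised surface measure on the sphere, in the form of the cone measure: the radial
  projection of the uniform distribution on the ball. The origin, whose projection is not on
  the sphere, is a null set for \<open>N \<ge> 1\<close>.\<close>

definition uniform_sphere :: "nat \<Rightarrow> (nat \<Rightarrow> real) measure" where
  "uniform_sphere N =
     restrict_space
       (distr (uniform_measure (lborel_N N) (unit_ball_N N)) (lborel_N N) (radial_projection N))
       (sphere_N N)"

definition hamiltonian :: "nat \<Rightarrow> (nat \<Rightarrow> nat \<Rightarrow> real) \<Rightarrow> (nat \<Rightarrow> real) \<Rightarrow> real" where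
  "hamiltonian N a \<sigma> =
     1 / (sqrt 2 * sqrt (real N)) * (\<Sum>i<N. \<Sum>j<N. a i j * \<sigma> i * \<sigma> j)"

definition gibbs_weight ::
  "nat \<Rightarrow> (nat \<Rightarrow> nat \<Rightarrow> real) \<Rightarrow> real \<Rightarrow> real \<Rightarrow> (nat \<Rightarrow> real) \<Rightarrow> real" where
  "gibbs_weight N a \<beta> h \<sigma> = exp (\<beta> * hamiltonian N a \<sigma> + h * (\<Sum>i<N. \<sigma> i))"

definition partition_function :: "nat \<Rightarrow> (nat \<Rightarrow> nat \<Rightarrow> real) \<Rightarrow> real \<Rightarrow> real \<Rightarrow> real" where
  "partition_function N a \<beta> h = (\<integral>\<sigma>. gibbs_weight N a \<beta> h \<sigma> \<partial>uniform_sphere N)"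

definition gibbs_measure ::
  "nat \<Rightarrow> (nat \<Rightarrow> nat \<Rightarrow> real) \<Rightarrow> real \<Rightarrow> real \<Rightarrow> (nat \<Rightarrow> real) measure" where
  "gibbs_measure N a \<beta> h =
     density (uniform_sphere N)
       (\<lambda>\<sigma>. ennreal (gibbs_weight N a \<beta> h \<sigma> / partition_function N a \<beta> h))"

definition overlap :: "nat \<Rightarrow> (nat \<Rightarrow> real) \<Rightarrow> (nat \<Rightarrow> real) \<Rightarrow> real" where
  "overlap N \<sigma> \<tau> = (\<Sum>i<N. \<sigma> i * \<tau> i) / real N"

text \<open>\<open>q = 1\<close> never satisfies the equation below for \<open>h \<noteq> 0\<close>, also under the convention
  \<open>x / 0 = 0\<close>; see \<open>q_equation_ex1\<close>.\<close>

definition q_equation :: "real \<Rightarrow> real \<Rightarrow> real \<Rightarrow> bool" where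
  "q_equation \<beta> h q \<longleftrightarrow> h\<^sup>2 + \<beta>\<^sup>2 * q = q / (1 - q)\<^sup>2"

definition q_param :: "real \<Rightarrow> real \<Rightarrow> real" where
  "q_param \<beta> h = (if h = 0 then 1 - 1 / \<beta> else (THE q. q \<in> {0..1} \<and> q_equation \<beta> h q))"

lemma q_equation_ex1:
  assumes "h \<noteq> 0"
  shows "\<exists>!q. q \<in> {0..1} \<and> q_equation \<beta> h q"
proof -
  have eq: "q_equation \<beta> h q \<longleftrightarrow> (h\<^sup>2 + \<beta>\<^sup>2 * q) * (1 - q)\<^sup>2 = q" if "q \<in> {0..1}" for q
  proof (cases "q = 1")
    case True
    have "h\<^sup>2 + \<beta>\<^sup>2 > 0"
      using assms by (simp add: add_pos_nonneg)
    with True assms show ?thesis by (simp add: q_equation_def)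
  next
    case False
    then show ?thesis by (simp add: q_equation_def field_simps)
  qed
  define f where "f q = q - (h\<^sup>2 + \<beta>\<^sup>2 * q) * (1 - q)\<^sup>2" for q
  have "\<exists>q\<ge>0. q \<le> 1 \<and> f q = 0"
    by (rule IVT') (auto simp: f_def intro!: continuous_intros)
  then have ex: "\<exists>q. q \<in> {0..1} \<and> q_equation \<beta> h q"
    using eq by (auto simp: f_def)
  have less: False
    if ab: "a \<in> {0..1}" "b \<in> {0..1}" "q_equation \<beta> h a" "q_equation \<beta> h b" "a < b" for a b
  proof -
    have b1: "b < 1" using ab eq[of b] by (cases "b = 1") auto
    have a0: "0 < a"
      using ab eq[of a] assms by (cases "a = 0") auto
    have A: "h\<^sup>2 = a * (1 / (1 - a)\<^sup>2 - \<beta>\<^sup>2)" and B: "h\<^sup>2 = b * (1 / (1 - b)\<^sup>2 - \<beta>\<^sup>2)"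
      using ab(3,4) by (auto simp: q_equation_def algebra_simps)
    have pos: "1 / (1 - a)\<^sup>2 - \<beta>\<^sup>2 > 0"
      using A a0 assms by (metis zero_less_mult_pos zero_less_power2)
    have "1 / (1 - a)\<^sup>2 \<le> 1 / (1 - b)\<^sup>2"
      using ab(5) b1 by (intro divide_left_mono power_mono mult_pos_pos) auto
    then have "a * (1 / (1 - a)\<^sup>2 - \<beta>\<^sup>2) < b * (1 / (1 - b)\<^sup>2 - \<beta>\<^sup>2)"
      using ab(5) a0 pos by (intro mult_less_le_imp_less) auto
    with A B show False by simp
  qed
  show ?thesis
    using ex less by (metis linorder_neqE)
qed

text \<open>Well-definedness: for \<open>N \<ge> 1\<close> the reference measure and the Gibbs measures are
  probability measures, so the integrals over them are not degenerate.\<close>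

lemma norm_N_measurable [measurable]: "norm_N N \<in> borel_measurable (lborel_N N)"
  unfolding norm_N_def by measurable

lemma unit_ball_N_sets [measurable]: "unit_ball_N N \<in> sets (lborel_N N)"
proof -
  have "unit_ball_N N = {x \<in> space (lborel_N N). norm_N N x \<le> 1}"
    by (simp add: unit_ball_N_def space_PiM)
  then show ?thesis by simp
qed

lemma sphere_N_sets [measurable]: "sphere_N N \<in> sets (lborel_N N)"
proof -
  have "sphere_N N = {x \<in> space (lborel_N N). norm_N N x = sqrt N}"
    by (simp add: sphere_N_def space_PiM)
  then show ?thesis by simp
qed

lemma radial_projection_measurable [measurable]:
  "radial_projection N \<in> lborel_N N \<rightarrow>\<^sub>M lborel_N N"
  unfolding radial_projection_def by measurable

lemma emeasure_box: "emeasure (lborel_N N) ({..<N} \<rightarrow>\<^sub>E {-a..a}) = ennreal (2*a) ^ N" if "a \<ge> 0"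
proof -
  interpret product_sigma_finite "\<lambda>_::nat. lborel :: real measure" ..
  show ?thesis using that by (subst emeasure_PiM) auto
qed

lemma prob_space_uniform_sphere:
  assumes "N \<ge> 1"
  shows "prob_space (uniform_sphere N)"
proof -
  interpret product_sigma_finite "\<lambda>_::nat. lborel :: real measure" ..
  have sub1: "({..<N} \<rightarrow>\<^sub>E {-(1/N)..1/N}) \<subseteq> unit_ball_N N"
  proof
    fix x assume x: "x \<in> {..<N} \<rightarrow>\<^sub>E {-(1/real N)..1/real N}"
    have "(\<Sum>i<N. (x i)\<^sup>2) \<le> (\<Sum>i<N. (1/real N)\<^sup>2)"
    proof (intro sum_mono)
      fix i assume "i \<in> {..<N}"
      then have "x i \<in> {-(1/real N)..1/real N}" using x by (rule PiE_mem[rotated])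
      then have "\<bar>x i\<bar> \<le> \<bar>1/real N\<bar>" by (simp add: abs_le_iff)
      then show "(x i)\<^sup>2 \<le> (1/real N)\<^sup>2" by (simp only: abs_le_square_iff)
    qed
    also have "\<dots> \<le> 1" using assms by (simp add: power2_eq_square field_simps)
    finally show "x \<in> unit_ball_N N"
      using x by (auto simp: unit_ball_N_def norm_N_def PiE_iff)
  qed
  have sub2: "unit_ball_N N \<subseteq> ({..<N} \<rightarrow>\<^sub>E {-1..1})"
  proof
    fix x assume x: "x \<in> unit_ball_N N"
    have "\<bar>x i\<bar> \<le> 1" if "i < N" for i
    proof -
      have "(x i)\<^sup>2 \<le> (\<Sum>i<N. (x i)\<^sup>2)" using that by (intro member_le_sum) auto
      also have "\<dots> \<le> 1" using x by (auto simp: unit_ball_N_def norm_N_def)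
      finally show ?thesis by (simp add: abs_square_le_1)
    qed
    then have "x i \<in> {-1..1}" if "i < N" for i using that by (simp add: abs_le_iff minus_le_iff)
    then show "x \<in> ({..<N} \<rightarrow>\<^sub>E {-1..1})" using x by (simp add: unit_ball_N_def PiE_iff)
  qed
  have box: "({..<N} \<rightarrow>\<^sub>E {-a..a}) \<in> sets (lborel_N N)" for a :: real by (intro sets_PiM_I_finite) auto
  have "0 < ennreal (2*(1/N)) ^ N" using assms by (simp add: ennreal_power)
  also have "\<dots> \<le> emeasure (lborel_N N) (unit_ball_N N)"
    using emeasure_mono[OF sub1 unit_ball_N_sets] emeasure_box[of "1/N" N] by simp
  finally have pos: "emeasure (lborel_N N) (unit_ball_N N) \<noteq> 0" by simp
  have "emeasure (lborel_N N) (unit_ball_N N) \<le> ennreal (2*1) ^ N"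
    using emeasure_mono[OF sub2 box] emeasure_box[of 1 N] by simp
  also have "\<dots> < \<infinity>" by (simp add: ennreal_power less_top[symmetric] del: ennreal_numeral)
  finally have fin: "emeasure (lborel_N N) (unit_ball_N N) \<noteq> \<infinity>" by simp
  interpret U: prob_space "uniform_measure (lborel_N N) (unit_ball_N N)"
    using pos fin by (rule prob_space_uniform_measure)
  interpret D: prob_space "distr (uniform_measure (lborel_N N) (unit_ball_N N)) (lborel_N N) (radial_projection N)"
    by (rule U.prob_space_distr) simp
  have "emeasure (lborel_N N) ({..<N} \<rightarrow>\<^sub>E {-0..0::real}) = 0"
    using assms emeasure_box[of 0 N] by simp
  then have "AE x in lborel_N N. x \<notin> ({..<N} \<rightarrow>\<^sub>E {-0..0::real})"
    using box[of 0] by (intro AE_not_in) (auto simp: null_sets_def)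
  then have ae: "AE x in lborel_N N. radial_projection N x \<in> sphere_N N"
    using AE_space
  proof eventually_elim
    fix x :: "nat \<Rightarrow> real" assume x: "x \<notin> ({..<N} \<rightarrow>\<^sub>E {-0..0::real})"
    assume xs: "x \<in> space (lborel_N N)"
    have "\<exists>i<N. x i \<noteq> 0" using x xs by (auto simp: space_PiM PiE_def extensional_def fun_eq_iff split: if_splits)
    then have "(\<Sum>i<N. (x i)\<^sup>2) > 0" by (auto intro!: sum_pos2)
    then have "(\<Sum>i<N. (sqrt (real N) * x i / norm_N N x)\<^sup>2) = N"
      by (simp add: norm_N_def power_divide power_mult_distrib sum_nonneg
          flip: sum_divide_distrib sum_distrib_left)
    then show "radial_projection N x \<in> sphere_N N"
      by (simp add: sphere_N_def norm_N_def radial_projection_def)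
  qed
  have "AE x in uniform_measure (lborel_N N) (unit_ball_N N). radial_projection N x \<in> sphere_N N"
    using ae by (intro AE_uniform_measureI) auto
  then have "AE x in distr (uniform_measure (lborel_N N) (unit_ball_N N)) (lborel_N N) (radial_projection N). x \<in> sphere_N N"
    by (subst AE_distr_iff) simp_all
  then have "emeasure (distr (uniform_measure (lborel_N N) (unit_ball_N N)) (lborel_N N) (radial_projection N)) (sphere_N N) = 1"
    by (intro D.emeasure_eq_1_AE) auto
  moreover have "sphere_N N \<inter> ({..<N} \<rightarrow>\<^sub>E UNIV) = sphere_N N"
    by (auto simp: sphere_N_def)
  ultimately show ?thesis
    unfolding uniform_sphere_def
    by (intro prob_spaceI) (simp add: emeasure_restrict_space space_restrict_space space_PiM)
qed

lemma gibbs_weight_measurable [measurable]: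
  "gibbs_weight N a \<beta> h \<in> borel_measurable (uniform_sphere N)"
proof -
  have "gibbs_weight N a \<beta> h \<in> borel_measurable (lborel_N N)"
    unfolding gibbs_weight_def hamiltonian_def by measurable
  then show ?thesis
    unfolding uniform_sphere_def by (intro measurable_restrict_space1) simp
qed

lemma gibbs_weight_bound:
  assumes "\<sigma> \<in> sphere_N N"
  shows "gibbs_weight N a \<beta> h \<sigma>
    \<le> exp (\<bar>\<beta>\<bar> * (1 / (sqrt 2 * sqrt (real N)) * (\<Sum>i<N. \<Sum>j<N. \<bar>a i j\<bar> * real N))
        + \<bar>h\<bar> * (\<Sum>i<N. sqrt (real N)))"
proof -
  have le: "\<bar>\<sigma> i\<bar> \<le> sqrt (real N)" if "i < N" for i
  proof -
    have "(\<sigma> i)\<^sup>2 \<le> (\<Sum>i<N. (\<sigma> i)\<^sup>2)" using that by (intro member_le_sum) auto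
    also have "\<dots> = N" using assms by (simp add: sphere_N_def norm_N_def)
    finally show ?thesis by (simp add: real_le_rsqrt)
  qed
  have "\<bar>\<Sum>i<N. \<Sum>j<N. a i j * \<sigma> i * \<sigma> j\<bar> \<le> (\<Sum>i<N. \<Sum>j<N. \<bar>a i j\<bar> * real N)"
  proof (intro order.trans[OF sum_abs] sum_mono)
    fix i j assume "i \<in> {..<N}" "j \<in> {..<N}"
    then have "\<bar>\<sigma> i\<bar> * \<bar>\<sigma> j\<bar> \<le> sqrt N * sqrt N" by (intro mult_mono le) auto
    then show "\<bar>a i j * \<sigma> i * \<sigma> j\<bar> \<le> \<bar>a i j\<bar> * real N"
      by (simp add: abs_mult mult.assoc mult_left_mono)
  qed
  then have "\<bar>hamiltonian N a \<sigma>\<bar> \<le> 1 / (sqrt 2 * sqrt (real N)) * (\<Sum>i<N. \<Sum>j<N. \<bar>a i j\<bar> * real N)"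
    unfolding hamiltonian_def abs_mult by (intro mult_mono) auto
  moreover have "\<bar>\<Sum>i<N. \<sigma> i\<bar> \<le> (\<Sum>i<N. sqrt (real N))"
    by (intro order.trans[OF sum_abs] sum_mono le) auto
  ultimately have "\<bar>\<beta> * hamiltonian N a \<sigma>\<bar> \<le> \<bar>\<beta>\<bar> * (1 / (sqrt 2 * sqrt (real N)) * (\<Sum>i<N. \<Sum>j<N. \<bar>a i j\<bar> * real N))"
    "\<bar>h * (\<Sum>i<N. \<sigma> i)\<bar> \<le> \<bar>h\<bar> * (\<Sum>i<N. sqrt (real N))"
    unfolding abs_mult by (intro mult_left_mono; simp)+
  then show ?thesis unfolding gibbs_weight_def by simp
qed

lemma prob_space_gibbs_measure:
  assumes "N \<ge> 1"
  shows "prob_space (gibbs_measure N a \<beta> h)"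
proof -
  interpret prob_space "uniform_sphere N"
    using assms by (rule prob_space_uniform_sphere)
  have sp: "space (uniform_sphere N) \<subseteq> sphere_N N"
    by (auto simp: uniform_sphere_def space_restrict_space)
  have pos: "gibbs_weight N a \<beta> h \<sigma> > 0" for \<sigma> by (simp add: gibbs_weight_def)
  obtain B where B: "\<And>\<sigma>. \<sigma> \<in> sphere_N N \<Longrightarrow> gibbs_weight N a \<beta> h \<sigma> \<le> B"
    using gibbs_weight_bound by blast
  have int: "integrable (uniform_sphere N) (gibbs_weight N a \<beta> h)"
    using B pos sp by (intro integrable_const_bound[of _ B]) (auto simp: less_imp_le intro!: AE_I2)
  have Z: "partition_function N a \<beta> h > 0"
  proof -
    have "\<not> (AE \<sigma> in uniform_sphere N. gibbs_weight N a \<beta> h \<sigma> = 0)"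
      using pos by (simp add: less_imp_neq[symmetric])
    then have "partition_function N a \<beta> h \<noteq> 0"
      unfolding partition_function_def
      using int pos by (subst integral_nonneg_eq_0_iff_AE) (auto simp: less_imp_le)
    moreover have "partition_function N a \<beta> h \<ge> 0"
      unfolding partition_function_def using pos by (intro integral_nonneg_AE AE_I2 less_imp_le)
    ultimately show ?thesis by simp
  qed
  have "(\<integral>\<^sup>+\<sigma>. ennreal (gibbs_weight N a \<beta> h \<sigma> / partition_function N a \<beta> h) \<partial>uniform_sphere N)
    = ennreal (\<integral>\<sigma>. gibbs_weight N a \<beta> h \<sigma> / partition_function N a \<beta> h \<partial>uniform_sphere N)"
    using int pos Z by (intro nn_integral_eq_integral) (auto simp: less_imp_le)
  also have "\<dots> = 1"
    using Z by (simp add: partition_function_def[symmetric])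
  finally show ?thesis
    unfolding gibbs_measure_def
    by (intro prob_spaceI) (simp add: emeasure_density cong: nn_integral_cong)
qed

end

theory Submission
  imports Defs "HOL-Real_Asymp.Real_Asymp"
begin

text \<open>Write the Hamiltonian as \<open>\<sigma> \<cdot> A \<sigma>\<close> with a symmetric Gaussian matrix \<open>A\<close>, and put
  \<open>b = \<beta> (1 - q) < 1\<close>, \<open>\<zeta> = (b + 1 / b) / 2 > 1\<close>. On the sphere \<open>\<zeta> (\<sigma> \<cdot> \<sigma>)\<close> is constant, so the Gibbs
  measure is the Gaussian with precision \<open>2 \<beta> (\<zeta> - A)\<close> and mean \<open>m = (h / 2 \<beta>) (\<zeta> - A)\<^sup>-\<^sup>1 (1, \<dots>, 1)\<close>,
  conditioned on the sphere; the equation for \<open>q\<close> says precisely that this Gaussian has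
  \<open>\<bar>x\<bar>\<^sup>2\<close> close to \<open>N\<close> with probability near 1. Comparing the two measures on a thin shell costs a factor
  \<open>exp (\<eta> N)\<close> with small \<open>\<eta>\<close>, while linear functionals of the Gaussian have exponentially small
  deviations; so \<open>\<sigma> \<cdot> t\<close> is close to \<open>m \<cdot> t\<close> under the Gibbs measure whenever \<open>h \<noteq> 0\<close>.

  By rotation invariance the required resolvent quantities \<open>u \<cdot> (\<zeta> - A)\<^sup>-\<^sup>1 u\<close> and
  \<open>(\<zeta> - A)\<^sup>-\<^sup>1 u \<cdot> (\<zeta>' - A)\<^sup>-\<^sup>1 u\<close> for a unit vector \<open>u\<close> may be computed with \<open>u\<close> a basis vector.
  Schur's complement formula expresses them through the same quantities for one coordinate less,
  and the resulting recursions contract to the fixed points \<open>2 b\<close> and \<open>4 b b' / (1 - b b')\<close>; the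
  second one is \<open>u\<^sub>0\<close> up to normalisation. If \<open>h\<^sub>1 = 0\<close>, conjugating the disorder by a random diagonal sign
  matrix shows that the second moment of \<open>\<sigma> \<cdot> m\<close> under the first Gibbs measure is of order \<open>N\<close>.\<close>

section \<open>Quadratic forms and resolvents on finite index sets\<close>

text \<open>The number \<zeta> may lie arbitrarily close to 1, the edge of the limiting spectrum of
  \<open>A\<close>, so the bound on the norm of \<open>A\<close> has to be sharp. It comes from the
  same removal of coordinates as the resolvent limits; besides the invariances of the Gaussian law,
  the only probabilistic input on the disorder is the concentration of a single row, that is of its
  length and its diagonal entry. Since 2 b is the limit of the diagonal entries of the resolvent,
  the covariance of the Gaussian contributes 2 b / (2 \<beta>) = 1 - q to the mean of |x|^2 / N and
  the centre \<open>m\<close> contributes q; this is how the equation for q enters. No determinant,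
  sphere volume or free energy is computed: numerator and denominator of a Gibbs probability are
  compared with the same Gaussian on the same shell, and all normalising constants cancel. For h = 0
  the value q = 1 - 1 / \<beta> gives b = 1, so \<zeta> falls on the edge and the precision loses
  its lower bound; this is why the system without field is treated by symmetry and a second
  moment.\<close>

definition dot :: "'i set \<Rightarrow> ('i \<Rightarrow> real) \<Rightarrow> ('i \<Rightarrow> real) \<Rightarrow> real" where
  "dot I x y = (\<Sum>i\<in>I. x i * y i)"

text \<open>Vectors and matrices are plain functions of which only the values on \<open>I\<close>
  count. A principal submatrix is then the same function over a smaller index set, and removing a
  coordinate involves no change of type.\<close>

definition mv :: "'i set \<Rightarrow> ('i \<Rightarrow> 'i \<Rightarrow> real) \<Rightarrow> ('i \<Rightarrow> real) \<Rightarrow> 'i \<Rightarrow> real" where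
  "mv I A y i = (\<Sum>j\<in>I. A i j * y j)"

definition unitv :: "'i \<Rightarrow> 'i \<Rightarrow> real" where
  "unitv i j = (if j = i then 1 else 0)"

definition symm_on :: "'i set \<Rightarrow> ('i \<Rightarrow> 'i \<Rightarrow> real) \<Rightarrow> bool" where
  "symm_on I A \<longleftrightarrow> (\<forall>i\<in>I. \<forall>j\<in>I. A i j = A j i)"

definition pos_def :: "'i set \<Rightarrow> ('i \<Rightarrow> 'i \<Rightarrow> real) \<Rightarrow> bool" where
  "pos_def I P \<longleftrightarrow> symm_on I P \<and> (\<forall>y. (\<exists>i\<in>I. y i \<noteq> 0) \<longrightarrow> dot I y (mv I P y) > 0)"

definition shifted :: "real \<Rightarrow> ('i \<Rightarrow> 'i \<Rightarrow> real) \<Rightarrow> 'i \<Rightarrow> 'i \<Rightarrow> real" where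
  "shifted z A i j = z * unitv i j - A i j"

text \<open>The vector \<open>y\<close> is (z - A)^-1 u on \<open>I\<close>. A relation replaces the
  inverse matrix, so that statements about resolvents transform under rotations without a choice of
  solution.\<close>

definition resolves ::
  "'i set \<Rightarrow> ('i \<Rightarrow> 'i \<Rightarrow> real) \<Rightarrow> real \<Rightarrow> ('i \<Rightarrow> real) \<Rightarrow> ('i \<Rightarrow> real) \<Rightarrow> bool" where
  "resolves I A z u y \<longleftrightarrow> (\<forall>i\<in>I. z * y i - mv I A y i = u i)"

text \<open>The rank-one term makes the bound pass from \<open>J\<close> to \<open>insert i J\<close> with the same constants,
  see \<open>form_bound_insert\<close>: it absorbs the new off-diagonal row, a multiple of \<open>u\<close>.\<close>

definition form_bound ::
  "'i set \<Rightarrow> ('i \<Rightarrow> 'i \<Rightarrow> real) \<Rightarrow> real \<Rightarrow> real \<Rightarrow> ('i \<Rightarrow> real) \<Rightarrow> bool" where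
  "form_bound I A L s u \<longleftrightarrow> (\<forall>y. \<bar>dot I y (mv I A y)\<bar> \<le> L * dot I y y - s * (dot I u y)\<^sup>2)"

section \<open>Bilinear calculus on a finite index set\<close>

lemma dot_commute: "dot I x y = dot I y x"
  by (simp add: dot_def mult.commute)

lemma dot_add_left: "dot I (\<lambda>i. x i + x' i) y = dot I x y + dot I x' y"
  and dot_add_right: "dot I y (\<lambda>i. x i + x' i) = dot I y x + dot I y x'"
  and dot_diff_left: "dot I (\<lambda>i. x i - x' i) y = dot I x y - dot I x' y"
  and dot_diff_right: "dot I y (\<lambda>i. x i - x' i) = dot I y x - dot I y x'"
  and dot_scale_left: "dot I (\<lambda>i. c * x i) y = c * dot I x y"
  and dot_scale_right: "dot I y (\<lambda>i. c * x i) = c * dot I y x"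
  by (simp_all add: dot_def algebra_simps sum.distrib sum_subtractf sum_distrib_left)

lemma mv_add: "mv I A (\<lambda>i. x i + y i) i = mv I A x i + mv I A y i"
  and mv_diff: "mv I A (\<lambda>i. x i - y i) i = mv I A x i - mv I A y i"
  and mv_scale: "mv I A (\<lambda>i. c * x i) i = c * mv I A x i"
  by (simp_all add: mv_def algebra_simps sum.distrib sum_subtractf sum_distrib_left)

lemma dot_cong: "(\<And>i. i \<in> I \<Longrightarrow> x i = x' i) \<Longrightarrow> (\<And>i. i \<in> I \<Longrightarrow> y i = y' i) \<Longrightarrow> dot I x y = dot I x' y'"
  by (simp add: dot_def)

lemma mv_cong: "(\<And>j. j \<in> I \<Longrightarrow> A i j = A' i j) \<Longrightarrow> (\<And>j. j \<in> I \<Longrightarrow> y j = y' j) \<Longrightarrow> mv I A y i = mv I A' y' i"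
  by (simp add: mv_def)

lemma dot_self_nonneg: "0 \<le> dot I x x"
  by (simp add: dot_def sum_nonneg)

lemma dot_self_pos: "finite I \<Longrightarrow> i \<in> I \<Longrightarrow> x i \<noteq> 0 \<Longrightarrow> 0 < dot I x x"
  by (auto simp: dot_def zero_less_mult_iff linorder_neq_iff intro!: sum_pos2[of _ i])

lemma dot_self_eq_0: "finite I \<Longrightarrow> dot I x x = 0 \<Longrightarrow> i \<in> I \<Longrightarrow> x i = 0"
  using dot_self_pos by fastforce

lemma dot_unitv: "finite I \<Longrightarrow> i \<in> I \<Longrightarrow> dot I (unitv i) y = y i"
  by (simp add: dot_def unitv_def if_distrib if_distribR cong: if_cong)

lemma dot_Cauchy_Schwarz: "(dot I x y)\<^sup>2 \<le> dot I x x * dot I y y"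
  using Cauchy_Schwarz_ineq_sum[of x y I] by (simp add: dot_def power2_eq_square)

lemma abs_dot_le: "\<bar>dot I x y\<bar> \<le> sqrt (dot I x x) * sqrt (dot I y y)"
  using dot_Cauchy_Schwarz[of I x y] by (simp add: real_le_rsqrt flip: real_sqrt_mult)

lemma dot_mv_symm:
  assumes "symm_on I A"
  shows "dot I x (mv I A y) = dot I (mv I A x) y"
proof -
  have "dot I x (mv I A y) = (\<Sum>i\<in>I. \<Sum>j\<in>I. x i * A i j * y j)"
    by (simp add: dot_def mv_def sum_distrib_left mult.assoc)
  also have "\<dots> = (\<Sum>j\<in>I. \<Sum>i\<in>I. x i * A i j * y j)"
    by (rule sum.swap)
  also have "\<dots> = dot I (mv I A x) y"
    using assms by (auto simp: dot_def mv_def sum_distrib_right symm_on_def intro!: sum.cong)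
  finally show ?thesis .
qed

lemma mv_shifted:
  assumes "finite I" "i \<in> I"
  shows "mv I (shifted z A) y i = z * y i - mv I A y i"
proof -
  have "mv I (shifted z A) y i = (\<Sum>j\<in>I. (if j = i then z * y j else 0) - A i j * y j)"
    unfolding mv_def shifted_def unitv_def by (intro sum.cong) (auto simp: algebra_simps)
  then show ?thesis using assms by (simp add: sum_subtractf mv_def)
qed

lemma symm_on_shifted: "symm_on I A \<Longrightarrow> symm_on I (shifted z A)"
  by (auto simp: symm_on_def shifted_def unitv_def)

lemma dot_shifted:
  "finite I \<Longrightarrow> dot I x (mv I (shifted z A) y) = z * dot I x y - dot I x (mv I A y)"
proof -
  assume "finite I"
  then have "dot I x (mv I (shifted z A) y) = dot I x (\<lambda>i. z * y i - mv I A y i)"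
    by (intro dot_cong) (simp_all add: mv_shifted)
  then show ?thesis by (simp add: dot_diff_right dot_scale_right)
qed

section \<open>Elimination of one variable and measurable linear systems\<close>

lemma quadratic_insert:
  assumes "finite J" "i \<notin> J" "symm_on (insert i J) A"
  shows "dot (insert i J) y (mv (insert i J) A y)
    = A i i * (y i)\<^sup>2 + 2 * y i * dot J (A i) y + dot J y (mv J A y)"
proof -
  have "(\<Sum>j\<in>J. y j * (A j i * y i)) = y i * dot J (A i) y"
    unfolding dot_def sum_distrib_left using assms(3)
    by (intro sum.cong refl) (metis insertCI mult.assoc mult.commute symm_on_def)
  then show ?thesis
    using assms by (simp add: dot_def mv_def distrib_left sum.distrib power2_eq_square algebra_simps)
qed

text \<open>Gaussian elimination: pivot and Schur complement of a positive definite matrix are again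
  positive, so elimination never divides by zero, and its output is a rational function of the
  entries, hence measurable. Where the matrix is not positive definite the same formulas still give
  some value, so no measurable set has to be cut out.\<close>

lemma measurable_solution:
  fixes P :: "'w \<Rightarrow> 'i \<Rightarrow> 'i \<Rightarrow> real"
  assumes "finite I"
    and "\<And>i j. i \<in> I \<Longrightarrow> j \<in> I \<Longrightarrow> (\<lambda>w. P w i j) \<in> borel_measurable M"
    and "\<And>i. i \<in> I \<Longrightarrow> (\<lambda>w. t w i) \<in> borel_measurable M"
  shows "\<exists>y. (\<forall>i\<in>I. (\<lambda>w. y w i) \<in> borel_measurable M) \<and>
    (\<forall>w. pos_def I (P w) \<longrightarrow> (\<forall>i\<in>I. mv I (P w) (y w) i = t w i))"
  using assms
proof (induction I arbitrary: P t rule: finite_induct)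
  case empty
  then show ?case by simp
next
  case (insert i J)
  \<comment> \<open>The Schur complement of the pivot \<open>P w i i\<close>, followed by the
    right-hand side after elimination of coordinate \<open>i\<close>.\<close>
  define P' where "P' w j k = P w j k - P w j i * P w i k / P w i i" for w j k
  define t' where "t' w j = t w j - P w j i * t w i / P w i i" for w j
  have meas: "(\<lambda>w. P' w j k) \<in> borel_measurable M" "(\<lambda>w. t' w j) \<in> borel_measurable M"
    if "j \<in> J" "k \<in> J" for j k
    unfolding P'_def t'_def using insert.prems that
    by (intro borel_measurable_diff borel_measurable_divide borel_measurable_times; simp)+
  obtain x where x: "\<forall>j\<in>J. (\<lambda>w. x w j) \<in> borel_measurable M"
    "\<forall>w. pos_def J (P' w) \<longrightarrow> (\<forall>j\<in>J. mv J (P' w) (x w) j = t' w j)"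
    using insert.IH[of P' t'] meas by blast
  define y where "y w = (x w)(i := (t w i - dot J (P w i) (x w)) / P w i i)" for w
  have y_meas: "\<forall>j\<in>insert i J. (\<lambda>w. y w j) \<in> borel_measurable M"
  proof
    fix j assume "j \<in> insert i J"
    have "(\<lambda>w. (t w i - dot J (P w i) (x w)) / P w i i) \<in> borel_measurable M"
      unfolding dot_def using insert.prems x(1)
      by (intro borel_measurable_divide borel_measurable_diff borel_measurable_sum borel_measurable_times) auto
    then show "(\<lambda>w. y w j) \<in> borel_measurable M"
      using x(1) \<open>j \<in> insert i J\<close> by (auto simp: y_def)
  qed
  have "mv (insert i J) (P w) (y w) j = t w j" if pd: "pos_def (insert i J) (P w)" and j: "j \<in> insert i J" for w j
  proof -
    have sym: "symm_on (insert i J) (P w)" using pd by (simp add: pos_def_def)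
    have "dot (insert i J) (unitv i) (mv (insert i J) (P w) (unitv i)) > 0"
      using pd by (auto simp: pos_def_def unitv_def)
    moreover have "mv (insert i J) (P w) (unitv i) i = P w i i"
      using insert.hyps by (simp add: mv_def unitv_def if_distrib cong: if_cong)
    ultimately have a: "P w i i > 0"
      using insert.hyps by (simp add: dot_unitv)
    have sym': "P w j i = P w i j" if "j \<in> J" for j
      using sym that unfolding symm_on_def by blast
    have mv_P': "mv J (P' w) v j = mv J (P w) v j - P w j i * dot J (P w i) v / P w i i" for v j
    proof -
      have "P' w j k * v k = P w j k * v k - P w j i / P w i i * (P w i k * v k)" for k
        by (simp add: P'_def left_diff_distrib)
      then have "mv J (P' w) v j = mv J (P w) v j - P w j i / P w i i * dot J (P w i) v"
        unfolding mv_def dot_def by (simp only: sum_subtractf sum_distrib_left)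
      then show ?thesis by simp
    qed
    have pd': "pos_def J (P' w)"
      unfolding pos_def_def
    proof (intro conjI allI impI)
      have "P w j k = P w k j" "P w j i = P w i j" "P w k i = P w i k" if "j \<in> J" "k \<in> J" for j k
        using sym that unfolding symm_on_def by blast+
      then show "symm_on J (P' w)" unfolding symm_on_def P'_def by (metis mult.commute)
      fix v :: "'i \<Rightarrow> real" assume v: "\<exists>i\<in>J. v i \<noteq> 0"
      define d where "d = dot J (P w i) v"
      \<comment> \<open>Coordinate \<open>i\<close> takes the value that minimises the form of
        \<open>P w\<close> for given \<open>v\<close> on \<open>J\<close>. The minimum is the form
        of the Schur complement, which is therefore positive.\<close>
      define V where "V = v(i := - d / P w i i)"
      have V: "V j = v j" if "j \<in> J" for j using that insert.hyps by (auto simp: V_def)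
      have "dot J v (mv J (P' w) v) = (\<Sum>j\<in>J. v j * mv J (P w) v j - v j * P w j i * (d / P w i i))"
        by (simp add: dot_def mv_P' d_def right_diff_distrib mult.assoc)
      also have "\<dots> = dot J v (mv J (P w) v) - (\<Sum>j\<in>J. v j * P w j i) * d / P w i i"
        unfolding dot_def sum_subtractf sum_distrib_right[symmetric] by simp
      also have "(\<Sum>j\<in>J. v j * P w j i) = d"
        by (simp add: d_def dot_def sym' mult.commute)
      finally have "dot J v (mv J (P' w) v) = dot J v (mv J (P w) v) - d * d / P w i i" .
      moreover have "dot J V (mv J (P w) V) = dot J v (mv J (P w) v)" "dot J (P w i) V = d"
        using V by (auto simp: d_def intro!: dot_cong mv_cong)
      then have "dot (insert i J) V (mv (insert i J) (P w) V) = dot J v (mv J (P w) v) - d * d / P w i i"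
        using a quadratic_insert[OF insert.hyps sym, of V]
        by (simp add: V_def power2_eq_square field_simps)
      moreover have "dot (insert i J) V (mv (insert i J) (P w) V) > 0"
        using pd v V by (auto simp: pos_def_def)
      ultimately show "0 < dot J v (mv J (P' w) v)" by simp
    qed
    have yJ: "y w j = x w j" if "j \<in> J" for j using that insert.hyps by (auto simp: y_def)
    have yi: "P w i i * y w i = t w i - dot J (P w i) (x w)" using a by (simp add: y_def)
    have exp: "mv (insert i J) (P w) (y w) j = P w j i * y w i + mv J (P w) (x w) j" for j
      using insert.hyps yJ by (simp add: mv_def)
    show ?thesis
    proof (cases "j = i")
      case True
      then show ?thesis using yi by (simp add: exp) (simp add: mv_def dot_def)
    next
      case False
      then have jJ: "j \<in> J" using j by simp
      have "t' w j = mv J (P' w) (x w) j" using x(2) pd' jJ by simp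
      also have "\<dots> = mv J (P w) (x w) j - P w j i * dot J (P w i) (x w) / P w i i"
        by (rule mv_P')
      finally have "mv J (P w) (x w) j = t w j - P w j i * (t w i - dot J (P w i) (x w)) / P w i i"
        by (simp add: t'_def diff_divide_distrib right_diff_distrib)
      moreover have "y w i = (t w i - dot J (P w i) (x w)) / P w i i" by (simp add: y_def)
      ultimately show ?thesis by (simp add: exp)
    qed
  qed
  with y_meas show ?case by blast
qed

section \<open>Resolvents above a form bound\<close>

lemma form_bound_pos_def:
  assumes "finite I" "symm_on I A" "form_bound I A L s u" "L < z" "0 \<le> s"
  shows "pos_def I (shifted z A)"
  unfolding pos_def_def
proof (intro conjI allI impI symm_on_shifted assms)
  fix y :: "'a \<Rightarrow> real" assume "\<exists>i\<in>I. y i \<noteq> 0"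
  then have "0 < (z - L) * dot I y y" using assms dot_self_pos[of I] by auto
  moreover have "dot I y (mv I A y) \<le> L * dot I y y - s * (dot I u y)\<^sup>2"
    using assms(3) by (auto simp: form_bound_def abs_le_iff)
  moreover have "0 \<le> s * (dot I u y)\<^sup>2" using assms by simp
  ultimately show "0 < dot I y (mv I (shifted z A) y)"
    unfolding dot_shifted[OF assms(1)] left_diff_distrib by linarith
qed

lemma resolves_iff_shifted:
  "finite I \<Longrightarrow> resolves I A z u y \<longleftrightarrow> (\<forall>i\<in>I. mv I (shifted z A) y i = u i)"
  by (simp add: resolves_def mv_shifted)

lemma pos_def_unique:
  assumes "finite I" "pos_def I P" "\<forall>i\<in>I. mv I P y i = u i" "\<forall>i\<in>I. mv I P y' i = u i" "i \<in> I"
  shows "y i = y' i"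
proof (rule ccontr)
  assume "y i \<noteq> y' i"
  then have "dot I (\<lambda>i. y i - y' i) (mv I P (\<lambda>i. y i - y' i)) > 0"
    using assms unfolding pos_def_def by (metis right_minus_eq)
  moreover have "dot I (\<lambda>i. y i - y' i) (mv I P (\<lambda>i. y i - y' i)) = dot I (\<lambda>i. y i - y' i) (\<lambda>i. 0)"
    using assms by (intro dot_cong) (auto simp: mv_diff)
  ultimately show False by (simp add: dot_def)
qed

lemma resolves_unique:
  assumes "finite I" "symm_on I A" "form_bound I A L s u'" "L < z" "0 \<le> s"
    and "resolves I A z u y" "resolves I A z u y'" "i \<in> I"
  shows "y i = y' i"
  using pos_def_unique[OF assms(1) form_bound_pos_def[OF assms(1-5)]] assms by (simp add: resolves_iff_shifted)

text \<open>A constant family of matrices over a one-point space turns the measurable solution into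
  plain existence.\<close>

lemma ex_resolves:
  assumes "finite I" "symm_on I A" "form_bound I A L s u'" "L < z" "0 \<le> s"
  shows "\<exists>y. resolves I A z u y"
  using measurable_solution[of I "\<lambda>_::unit. shifted z A" "count_space UNIV" "\<lambda>_. u"] assms(1)
    form_bound_pos_def[OF assms] by (auto simp: resolves_iff_shifted)

text \<open>Pair the equation with \<open>y\<close> itself: u \<cdot> y equals y \<cdot> (z - A) y.
  The direction \<open>u'\<close> of the rank-one term may differ from the right-hand side
  \<open>u\<close>.\<close>

lemma resolves_dot:
  assumes "form_bound I A L s u'" "resolves I A z u y"
  shows "s * (dot I u' y)\<^sup>2 + (z - L) * dot I y y \<le> dot I u y"
proof -
  have "dot I u y = dot I y (\<lambda>i. z * y i - mv I A y i)"
    using assms(2) by (simp add: resolves_def dot_def mult.commute)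
  also have "\<dots> = z * dot I y y - dot I y (mv I A y)"
    by (simp add: dot_diff_right dot_scale_right)
  finally show ?thesis
    using assms(1) by (auto simp: form_bound_def abs_le_iff algebra_simps dest: spec[of _ y])
qed

text \<open>When the rank-one direction is the right-hand side, \<rho> = u \<cdot> y satisfies s
  \<rho>^2 \<le> \<rho>. The resulting bound 1 / s does not involve the gap z - L; with s above 1 /
  2 it is the bound 2 on which the contraction of the recursions rests.\<close>

lemma resolves_dot_bounds:
  assumes "form_bound I A L s u" "resolves I A z u y" "0 < s" "L < z"
  shows "0 \<le> dot I u y" "dot I u y \<le> 1 / s" "dot I y y \<le> 1 / (s * (z - L))"
proof -
  have *: "s * (dot I u y)\<^sup>2 + (z - L) * dot I y y \<le> dot I u y"
    using resolves_dot assms by blast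
  moreover have "0 \<le> s * (dot I u y)\<^sup>2" "0 \<le> (z - L) * dot I y y"
    using assms dot_self_nonneg[of I y] by auto
  ultimately show nonneg: "0 \<le> dot I u y" by linarith
  have "s * dot I u y * dot I u y \<le> 1 * dot I u y"
    using * \<open>0 \<le> (z - L) * dot I y y\<close> by (simp add: power2_eq_square)
  then have "dot I u y = 0 \<or> s * dot I u y \<le> 1"
    using nonneg by (metis less_eq_real_def mult_right_le_imp_le)
  then show le: "dot I u y \<le> 1 / s" using assms(3) by (auto simp: field_simps)
  have "(z - L) * dot I y y \<le> 1 / s" using * le \<open>0 \<le> s * (dot I u y)\<^sup>2\<close> by linarith
  then show "dot I y y \<le> 1 / (s * (z - L))" using assms by (simp add: field_simps)
qed

text \<open>Since 2 |y_i d| \<le> y_i^2 + d^2 for d = v \<cdot> y, the cross term costs s d^2, which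
  the old rank-one term pays, and s y_i^2. The coefficient of y_i^2 has to cover this, the diagonal
  entry and the new rank-one term: that is \<open>2 * s + \<delta> \<le> L\<close>.\<close>

lemma form_bound_insert:
  assumes "finite J" "i \<notin> J" "symm_on (insert i J) A" "form_bound J A L s v"
    and row: "\<And>j. j \<in> J \<Longrightarrow> A i j = r * v j"
    and "0 \<le> r" "r \<le> s" "\<bar>A i i\<bar> \<le> \<delta>" "2 * s + \<delta> \<le> L"
  shows "form_bound (insert i J) A L s (unitv i)"
  unfolding form_bound_def
proof
  fix y
  let ?d = "dot J v y"
  have Ai: "dot J (A i) y = r * ?d"
    using row by (simp add: dot_def sum_distrib_left mult.assoc)
  have "2 * \<bar>y i\<bar> * \<bar>?d\<bar> \<le> (y i)\<^sup>2 + ?d\<^sup>2"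
    using sum_squares_bound[of "\<bar>y i\<bar>" "\<bar>?d\<bar>"] by simp
  then have "r * (2 * \<bar>y i\<bar> * \<bar>?d\<bar>) \<le> s * ((y i)\<^sup>2 + ?d\<^sup>2)"
    using assms by (intro mult_mono) auto
  then have 1: "\<bar>2 * y i * dot J (A i) y\<bar> \<le> s * ((y i)\<^sup>2 + ?d\<^sup>2)"
    using \<open>0 \<le> r\<close> by (simp add: Ai abs_mult mult_ac)
  have 2: "\<bar>dot J y (mv J A y)\<bar> \<le> L * dot J y y - s * ?d\<^sup>2"
    using assms(4) by (simp add: form_bound_def)
  have 3: "\<bar>A i i * (y i)\<^sup>2\<bar> \<le> \<delta> * (y i)\<^sup>2"
    using assms by (simp add: abs_mult mult_right_mono)
  have 4: "(2 * s + \<delta>) * (y i)\<^sup>2 \<le> L * (y i)\<^sup>2"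
    using assms by (intro mult_right_mono) auto
  have "dot (insert i J) y (mv (insert i J) A y)
    = A i i * (y i)\<^sup>2 + 2 * y i * dot J (A i) y + dot J y (mv J A y)"
    using assms by (intro quadratic_insert) auto
  moreover have "dot (insert i J) y y = (y i)\<^sup>2 + dot J y y"
    using assms by (simp add: dot_def power2_eq_square)
  moreover have "dot (insert i J) (unitv i) y = y i"
    using assms by (simp add: dot_unitv)
  ultimately show "\<bar>dot (insert i J) y (mv (insert i J) A y)\<bar>
    \<le> L * dot (insert i J) y y - s * (dot (insert i J) (unitv i) y)\<^sup>2"
    using 1 2 3 4 by (simp add: algebra_simps)
qed

text \<open>Schur complement for the resolvent: the equations off \<open>i\<close> say that
  \<open>y\<close> solves the smaller system with right-hand side y_i r v, so it equals y_i r Y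
  there by uniqueness; the equation at \<open>i\<close> then closes on y_i alone.\<close>

lemma resolves_insert:
  assumes fin: "finite J" "i \<notin> J" and sym: "symm_on (insert i J) A" and fb: "form_bound J A L s v" "L < z" "0 \<le> s"
    and row: "\<And>j. j \<in> J \<Longrightarrow> A i j = r * v j"
    and y: "resolves (insert i J) A z (unitv i) y" and Y: "resolves J A z v Y"
  shows "\<And>j. j \<in> J \<Longrightarrow> y j = y i * r * Y j"
    and "y i * (z - A i i - r\<^sup>2 * dot J v Y) = 1"
proof -
  have symJ: "symm_on J A" using sym by (auto simp: symm_on_def)
  have 1: "resolves J A z (\<lambda>j. y i * r * v j) y"
    unfolding resolves_def
  proof
    fix j assume j: "j \<in> J"
    then have "j \<noteq> i" using fin by auto
    then have "z * y j - mv (insert i J) A y j = 0"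
      using y j by (auto simp: resolves_def unitv_def)
    moreover have "A j i = A i j" using sym j unfolding symm_on_def by blast
    ultimately show "z * y j - mv J A y j = y i * r * v j"
      using fin j row[OF j] by (simp add: mv_def)
  qed
  have 2: "resolves J A z (\<lambda>j. y i * r * v j) (\<lambda>j. y i * r * Y j)"
    unfolding resolves_def mv_scale
  proof
    fix j assume "j \<in> J"
    then have "v j = z * Y j - mv J A Y j" using Y by (simp add: resolves_def)
    moreover have "z * (y i * r * Y j) - y i * r * mv J A Y j = y i * r * (z * Y j - mv J A Y j)"
      by (simp add: algebra_simps)
    ultimately show "z * (y i * r * Y j) - y i * r * mv J A Y j = y i * r * v j"
      by simp
  qed
  show eq: "y j = y i * r * Y j" if "j \<in> J" for j
    using resolves_unique[OF fin(1) symJ fb 1 2 that] .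
  have "z * y i - mv (insert i J) A y i = 1" using y by (auto simp: resolves_def unitv_def)
  moreover have "mv (insert i J) A y i = A i i * y i + (\<Sum>j\<in>J. r * v j * (y i * r * Y j))"
    using fin row eq by (simp add: mv_def)
  moreover have "(\<Sum>j\<in>J. r * v j * (y i * r * Y j)) = y i * r\<^sup>2 * dot J v Y"
    by (simp add: dot_def sum_distrib_left power2_eq_square mult_ac)
  ultimately show "y i * (z - A i i - r\<^sup>2 * dot J v Y) = 1" by (simp add: algebra_simps)
qed

text \<open>Source of the recursion for inner products of two resolvents: a factor r^2, near 1 / 4,
  multiplies the same quantity for one coordinate less.\<close>

lemma resolves_insert_dot:
  assumes "finite J" "i \<notin> J" "\<And>j. j \<in> J \<Longrightarrow> y j = y i * r * Y j" "\<And>j. j \<in> J \<Longrightarrow> y' j = y' i * r * Y' j"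
  shows "dot (insert i J) y y' = y i * y' i * (1 + r\<^sup>2 * dot J Y Y')"
proof -
  have "dot (insert i J) y y' = y i * y' i + (\<Sum>j\<in>J. (y i * r * Y j) * (y' i * r * Y' j))"
    using assms by (simp add: dot_def)
  also have "(\<Sum>j\<in>J. (y i * r * Y j) * (y' i * r * Y' j)) = y i * y' i * r\<^sup>2 * dot J Y Y'"
    by (simp add: dot_def sum_distrib_left power2_eq_square mult_ac)
  finally show ?thesis by (simp add: algebra_simps)
qed

section \<open>Gaussian product measures and isometric involutions\<close>

abbreviation lebP :: "'k set \<Rightarrow> ('k \<Rightarrow> real) measure" where
  "lebP K \<equiv> \<Pi>\<^sub>M k\<in>K. lborel"

definition std_gauss :: "real measure" where
  "std_gauss = density lborel (\<lambda>x. ennreal (std_normal_density x))"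

abbreviation gaussP :: "'k set \<Rightarrow> ('k \<Rightarrow> real) measure" where
  "gaussP K \<equiv> \<Pi>\<^sub>M k\<in>K. std_gauss"

text \<open>Cut off outside \<open>K\<close>, because the space of a product measure consists of
  extensional functions.\<close>

definition plusP :: "'k set \<Rightarrow> ('k \<Rightarrow> real) \<Rightarrow> ('k \<Rightarrow> real) \<Rightarrow> 'k \<Rightarrow> real" where
  "plusP K x y = (\<lambda>k\<in>K. x k + y k)"

definition minusP :: "'k set \<Rightarrow> ('k \<Rightarrow> real) \<Rightarrow> 'k \<Rightarrow> real" where
  "minusP K x = (\<lambda>k\<in>K. - x k)"

section \<open>Product Gaussian measures, translations and linear maps\<close>

lemma prob_space_std_gauss: "prob_space std_gauss"
  unfolding std_gauss_def by (rule prob_space_normal_density) simp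

lemma sets_std_gauss [simp, measurable_cong]: "sets std_gauss = sets borel"
  by (simp add: std_gauss_def)

lemma space_std_gauss [simp]: "space std_gauss = UNIV"
  by (simp add: std_gauss_def)

lemma sets_gaussP [measurable_cong]: "sets (gaussP K) = sets (lebP K)"
  by (intro sets_PiM_cong) auto

lemma space_gaussP: "space (gaussP K) = space (lebP K)"
  by (simp add: space_PiM)

lemma plusP_space [simp]: "plusP K x y \<in> space (lebP K)"
  by (auto simp: plusP_def space_PiM)

lemma minusP_space [simp]: "minusP K x \<in> space (lebP K)"
  by (auto simp: minusP_def space_PiM)

lemma measurable_lebP_component:
  assumes "f \<in> M \<rightarrow>\<^sub>M lebP K" "k \<in> K"
  shows "(\<lambda>w. f w k) \<in> borel_measurable M"
  using measurable_compose[OF assms(1) measurable_component_singleton[OF assms(2)]] by simp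

lemma plusP_measurable [measurable]:
  assumes "f \<in> M \<rightarrow>\<^sub>M lebP K" "g \<in> M \<rightarrow>\<^sub>M lebP K"
  shows "(\<lambda>w. plusP K (f w) (g w)) \<in> M \<rightarrow>\<^sub>M lebP K"
  unfolding plusP_def using assms
  by (intro measurable_restrict) (simp add: borel_measurable_add measurable_lebP_component)

lemma plusP_const_measurable [measurable]: "(\<lambda>x. plusP K x a) \<in> lebP K \<rightarrow>\<^sub>M lebP K"
  unfolding plusP_def by (intro measurable_restrict) simp

lemma minusP_measurable [measurable]:
  assumes "f \<in> M \<rightarrow>\<^sub>M lebP K"
  shows "(\<lambda>w. minusP K (f w)) \<in> M \<rightarrow>\<^sub>M lebP K"
  unfolding minusP_def using assms
  by (intro measurable_restrict) (simp add: borel_measurable_uminus measurable_lebP_component)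

lemma product_sigma_finite_lborel: "product_sigma_finite (\<lambda>_. lborel :: real measure)" ..

lemma product_sigma_finite_gauss: "product_sigma_finite (\<lambda>_. std_gauss)"
  by (simp add: product_sigma_finite_def prob_space_imp_sigma_finite prob_space_std_gauss)

lemma prob_space_gaussP: "prob_space (gaussP K)"
  by (intro prob_space_PiM prob_space_std_gauss)

lemma distr_lebP_translate:
  assumes "finite K"
  shows "distr (lebP K) (lebP K) (\<lambda>x. plusP K x a) = lebP K"
proof -
  interpret product_sigma_finite "\<lambda>_::'a. lborel :: real measure" ..
  show ?thesis
  proof (rule PiM_eqI[OF assms])
    fix A :: "'a \<Rightarrow> real set" assume A: "\<And>i. i \<in> K \<Longrightarrow> A i \<in> sets lborel"
    have meas: "(\<lambda>x. plusP K x a) \<in> lebP K \<rightarrow>\<^sub>M lebP K" by measurable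
    have "emeasure (distr (lebP K) (lebP K) (\<lambda>x. plusP K x a)) (Pi\<^sub>E K A)
      = emeasure (lebP K) ((\<lambda>x. plusP K x a) -` Pi\<^sub>E K A \<inter> space (lebP K))"
      using A assms by (intro emeasure_distr meas sets_PiM_I_finite) auto
    also have "(\<lambda>x. plusP K x a) -` Pi\<^sub>E K A \<inter> space (lebP K)
      = (\<Pi>\<^sub>E k\<in>K. (\<lambda>x. a k + x) -` A k \<inter> space lborel)"
      by (auto simp: plusP_def space_PiM PiE_def Pi_def extensional_def add.commute)
    also have "emeasure (lebP K) \<dots> = (\<Prod>k\<in>K. emeasure lborel ((\<lambda>x. a k + x) -` A k \<inter> space lborel))"
      using A assms by (intro emeasure_PiM measurable_sets[of _ lborel lborel]) auto
    also have "\<dots> = (\<Prod>k\<in>K. emeasure (distr lborel borel (\<lambda>x. a k + x)) (A k))"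
      using A by (intro prod.cong refl) (subst emeasure_distr, auto)
    also have "\<dots> = (\<Prod>k\<in>K. emeasure lborel (A k))"
      by (simp add: lborel_distr_plus)
    finally show "emeasure (distr (lebP K) (lebP K) (\<lambda>x. plusP K x a)) (Pi\<^sub>E K A)
      = (\<Prod>k\<in>K. emeasure lborel (A k))" .
  qed simp
qed

lemma nn_integral_translate:
  assumes "finite K" and [measurable]: "f \<in> borel_measurable (lebP K)"
  shows "(\<integral>\<^sup>+x. f (plusP K x a) \<partial>lebP K) = (\<integral>\<^sup>+x. f x \<partial>lebP K)"
proof -
  have "(\<integral>\<^sup>+x. f x \<partial>distr (lebP K) (lebP K) (\<lambda>x. plusP K x a)) = (\<integral>\<^sup>+x. f (plusP K x a) \<partial>lebP K)"
    by (rule nn_integral_distr) measurable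
  then show ?thesis by (simp add: distr_lebP_translate assms)
qed

lemma sigma_finite_lebP: "finite K \<Longrightarrow> sigma_finite_measure (lebP K)"
  using product_sigma_finite.sigma_finite[OF product_sigma_finite_lborel] .

text \<open>Integrate \<open>f (T x + y) g y\<close> over \<open>x\<close> and \<open>y\<close> in both orders; translation invariance
  decouples the two factors. No determinants are needed.\<close>

lemma nn_integral_linear_bijection:
  assumes fin: "finite K"
    and T [measurable]: "T \<in> lebP K \<rightarrow>\<^sub>M lebP K"
    and T': "\<And>y. y \<in> space (lebP K) \<Longrightarrow> T' y \<in> space (lebP K) \<and> T (T' y) = y"
    and add: "\<And>x y. x \<in> space (lebP K) \<Longrightarrow> y \<in> space (lebP K) \<Longrightarrow> T (plusP K x y) = plusP K (T x) (T y)"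
    and f [measurable]: "f \<in> borel_measurable (lebP K)"
    and g [measurable]: "g \<in> borel_measurable (lebP K)"
  shows "(\<integral>\<^sup>+x. f (T x) \<partial>lebP K) * (\<integral>\<^sup>+x. g x \<partial>lebP K)
    = (\<integral>\<^sup>+x. g (minusP K (T x)) \<partial>lebP K) * (\<integral>\<^sup>+x. f x \<partial>lebP K)"
proof -
  let ?\<nu> = "lebP K"
  interpret sigma_finite_measure ?\<nu> using fin by (rule sigma_finite_lebP)
  interpret P: pair_sigma_finite ?\<nu> ?\<nu> ..
  have T_space: "T x \<in> space ?\<nu>" if "x \<in> space ?\<nu>" for x
    using measurable_space[OF T that] .
  \<comment> \<open>Shifting \<open>x\<close> by the preimage \<open>T' y\<close> shifts
    \<open>T x\<close> by \<open>y\<close>, and the integral over \<open>x\<close> does not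
    change.\<close>
  have fT: "(\<integral>\<^sup>+x. f (T x) \<partial>?\<nu>) = (\<integral>\<^sup>+x. f (plusP K (T x) y) \<partial>?\<nu>)" if y: "y \<in> space ?\<nu>" for y
  proof -
    have "(\<integral>\<^sup>+x. f (T x) \<partial>?\<nu>) = (\<integral>\<^sup>+x. f (T (plusP K x (T' y))) \<partial>?\<nu>)"
      by (rule nn_integral_translate[OF fin, symmetric]) measurable
    also have "\<dots> = (\<integral>\<^sup>+x. f (plusP K (T x) y) \<partial>?\<nu>)"
      using add T'[OF y] by (intro nn_integral_cong) simp
    finally show ?thesis .
  qed
  have gT: "(\<integral>\<^sup>+x. g (plusP K y (minusP K (T x))) \<partial>?\<nu>) = (\<integral>\<^sup>+x. g (minusP K (T x)) \<partial>?\<nu>)"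
    if y: "y \<in> space ?\<nu>" for y
  proof -
    have [measurable]: "(\<lambda>x. y) \<in> ?\<nu> \<rightarrow>\<^sub>M ?\<nu>" using y by simp
    have [measurable]: "(\<lambda>x. g (plusP K y (minusP K (T x)))) \<in> borel_measurable ?\<nu>" by measurable
    have "(\<integral>\<^sup>+x. g (plusP K y (minusP K (T x))) \<partial>?\<nu>)
      = (\<integral>\<^sup>+x. g (plusP K y (minusP K (T (plusP K x (T' y))))) \<partial>?\<nu>)"
      by (rule nn_integral_translate[OF fin, symmetric, of "\<lambda>x. g (plusP K y (minusP K (T x)))"]) fact
    also have "\<dots> = (\<integral>\<^sup>+x. g (minusP K (T x)) \<partial>?\<nu>)"
    proof (rule nn_integral_cong)
      fix x assume "x \<in> space ?\<nu>"
      then have "T (plusP K x (T' y)) = plusP K (T x) y" using add T'[OF y] by simp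
      then have "plusP K y (minusP K (T (plusP K x (T' y)))) = minusP K (T x)"
        by (simp add: plusP_def minusP_def fun_eq_iff)
      then show "g (plusP K y (minusP K (T (plusP K x (T' y))))) = g (minusP K (T x))" by simp
    qed
    finally show ?thesis .
  qed
  have "(\<integral>\<^sup>+x. f (T x) \<partial>?\<nu>) * (\<integral>\<^sup>+x. g x \<partial>?\<nu>) = (\<integral>\<^sup>+y. (\<integral>\<^sup>+x. f (T x) \<partial>?\<nu>) * g y \<partial>?\<nu>)"
    by (rule nn_integral_cmult[symmetric]) measurable
  also have "\<dots> = (\<integral>\<^sup>+y. (\<integral>\<^sup>+x. f (plusP K (T x) y) * g y \<partial>?\<nu>) \<partial>?\<nu>)"
  proof (rule nn_integral_cong)
    fix y assume y: "y \<in> space ?\<nu>"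
    then have [measurable]: "(\<lambda>x. y) \<in> ?\<nu> \<rightarrow>\<^sub>M ?\<nu>" by simp
    have "(\<integral>\<^sup>+x. f (plusP K (T x) y) * g y \<partial>?\<nu>) = (\<integral>\<^sup>+x. f (plusP K (T x) y) \<partial>?\<nu>) * g y"
      by (rule nn_integral_multc) measurable
    then show "(\<integral>\<^sup>+x. f (T x) \<partial>?\<nu>) * g y = (\<integral>\<^sup>+x. f (plusP K (T x) y) * g y \<partial>?\<nu>)"
      by (simp only: fT[OF y])
  qed
  also have "\<dots> = (\<integral>\<^sup>+x. (\<integral>\<^sup>+y. f (plusP K (T x) y) * g y \<partial>?\<nu>) \<partial>?\<nu>)"
    by (rule P.Fubini') measurable
  also have "\<dots> = (\<integral>\<^sup>+x. (\<integral>\<^sup>+y. f y * g (plusP K y (minusP K (T x))) \<partial>?\<nu>) \<partial>?\<nu>)"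
  proof (rule nn_integral_cong)
    fix x assume x: "x \<in> space ?\<nu>"
    then have [measurable]: "(\<lambda>y. T x) \<in> ?\<nu> \<rightarrow>\<^sub>M ?\<nu>" using T_space by simp
    have [measurable]: "(\<lambda>y. f (plusP K (T x) y) * g y) \<in> borel_measurable ?\<nu>" by measurable
    have "(\<integral>\<^sup>+y. f (plusP K (T x) y) * g y \<partial>?\<nu>)
      = (\<integral>\<^sup>+y. f (plusP K (T x) (plusP K y (minusP K (T x)))) * g (plusP K y (minusP K (T x))) \<partial>?\<nu>)"
      by (rule nn_integral_translate[OF fin, symmetric, of "\<lambda>y. f (plusP K (T x) y) * g y"]) fact
    also have "\<dots> = (\<integral>\<^sup>+y. f y * g (plusP K y (minusP K (T x))) \<partial>?\<nu>)"
    proof (rule nn_integral_cong)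
      fix y assume "y \<in> space ?\<nu>"
      then have "plusP K (T x) (plusP K y (minusP K (T x))) = y"
        by (auto simp: plusP_def minusP_def fun_eq_iff space_PiM PiE_def extensional_def)
      then show "f (plusP K (T x) (plusP K y (minusP K (T x)))) * g (plusP K y (minusP K (T x)))
        = f y * g (plusP K y (minusP K (T x)))" by simp
    qed
    finally show "(\<integral>\<^sup>+y. f (plusP K (T x) y) * g y \<partial>?\<nu>)
      = (\<integral>\<^sup>+y. f y * g (plusP K y (minusP K (T x))) \<partial>?\<nu>)" .
  qed
  also have "\<dots> = (\<integral>\<^sup>+y. (\<integral>\<^sup>+x. f y * g (plusP K y (minusP K (T x))) \<partial>?\<nu>) \<partial>?\<nu>)"
    by (rule P.Fubini'[symmetric]) measurable
  also have "\<dots> = (\<integral>\<^sup>+y. f y * (\<integral>\<^sup>+x. g (minusP K (T x)) \<partial>?\<nu>) \<partial>?\<nu>)"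
  proof (rule nn_integral_cong)
    fix y assume y: "y \<in> space ?\<nu>"
    then have "(\<lambda>x. y) \<in> ?\<nu> \<rightarrow>\<^sub>M ?\<nu>" by simp
    then have "(\<lambda>x. g (plusP K y (minusP K (T x)))) \<in> borel_measurable ?\<nu>" by measurable
    then have "(\<integral>\<^sup>+x. f y * g (plusP K y (minusP K (T x))) \<partial>?\<nu>)
      = f y * (\<integral>\<^sup>+x. g (plusP K y (minusP K (T x))) \<partial>?\<nu>)"
      by (rule nn_integral_cmult)
    then show "(\<integral>\<^sup>+x. f y * g (plusP K y (minusP K (T x))) \<partial>?\<nu>) = f y * (\<integral>\<^sup>+x. g (minusP K (T x)) \<partial>?\<nu>)"
      by (simp only: gT[OF y])
  qed
  also have "\<dots> = (\<integral>\<^sup>+y. f y \<partial>?\<nu>) * (\<integral>\<^sup>+x. g (minusP K (T x)) \<partial>?\<nu>)"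
    by (rule nn_integral_multc) measurable
  finally show ?thesis by (simp only: mult.commute)
qed

lemma gaussP_eq_density:
  assumes "finite K"
  shows "gaussP K = density (lebP K) (\<lambda>x. \<Prod>k\<in>K. ennreal (std_normal_density (x k)))"
proof -
  interpret product_sigma_finite "\<lambda>_::'a. lborel :: real measure" ..
  show ?thesis
  proof (rule product_sigma_finite.PiM_eqI[OF product_sigma_finite_gauss assms, symmetric])
    show "sets (density (lebP K) (\<lambda>x. \<Prod>k\<in>K. ennreal (std_normal_density (x k)))) = sets (gaussP K)"
      by (simp add: sets_gaussP)
    fix A :: "'a \<Rightarrow> real set" assume A: "\<And>i. i \<in> K \<Longrightarrow> A i \<in> sets std_gauss"
    then have A': "A i \<in> sets lborel" if "i \<in> K" for i using that by simp
    then have PiA: "Pi\<^sub>E K A \<in> sets (lebP K)" using assms by (intro sets_PiM_I_finite) auto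
    have "emeasure (density (lebP K) (\<lambda>x. \<Prod>k\<in>K. ennreal (std_normal_density (x k)))) (Pi\<^sub>E K A)
      = (\<integral>\<^sup>+x. (\<Prod>k\<in>K. ennreal (std_normal_density (x k))) * indicator (Pi\<^sub>E K A) x \<partial>lebP K)"
      by (rule emeasure_density[OF _ PiA]) measurable
    also have "\<dots> = (\<integral>\<^sup>+x. (\<Prod>k\<in>K. ennreal (std_normal_density (x k)) * indicator (A k) (x k)) \<partial>lebP K)"
    proof (rule nn_integral_cong)
      fix x :: "'a \<Rightarrow> real" assume x: "x \<in> space (lebP K)"
      have "indicator (Pi\<^sub>E K A) x = (\<Prod>k\<in>K. indicator (A k) (x k) :: ennreal)"
      proof (cases "x \<in> Pi\<^sub>E K A")
        case True
        then show ?thesis by (auto simp: PiE_def Pi_def intro!: prod.neutral[symmetric])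
      next
        case False
        then obtain k where "k \<in> K" "x k \<notin> A k" using x by (auto simp: space_PiM PiE_def Pi_def)
        then have "(\<Prod>k\<in>K. indicator (A k) (x k) :: ennreal) = 0"
          using assms by (intro prod_zero bexI[of _ k]) simp_all
        then show ?thesis using False by simp
      qed
      then show "(\<Prod>k\<in>K. ennreal (std_normal_density (x k))) * indicator (Pi\<^sub>E K A) x
        = (\<Prod>k\<in>K. ennreal (std_normal_density (x k)) * indicator (A k) (x k))"
        by (simp only: prod.distrib)
    qed
    also have "\<dots> = (\<Prod>k\<in>K. \<integral>\<^sup>+x. ennreal (std_normal_density x) * indicator (A k) x \<partial>lborel)"
    proof (rule product_nn_integral_prod[OF assms])
      fix k assume "k \<in> K"
      then have [measurable]: "A k \<in> sets borel" using A' by simp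
      show "(\<lambda>x. ennreal (std_normal_density x) * indicator (A k) x) \<in> borel_measurable lborel" by measurable
    qed
    also have "\<dots> = (\<Prod>k\<in>K. emeasure std_gauss (A k))"
    proof (rule prod.cong[OF refl])
      fix k assume "k \<in> K"
      then show "(\<integral>\<^sup>+x. ennreal (std_normal_density x) * indicator (A k) x \<partial>lborel) = emeasure std_gauss (A k)"
        unfolding std_gauss_def by (intro emeasure_density[symmetric] A') simp_all
    qed
    finally show "emeasure (density (lebP K) (\<lambda>x. \<Prod>k\<in>K. ennreal (std_normal_density (x k)))) (Pi\<^sub>E K A)
      = (\<Prod>k\<in>K. emeasure std_gauss (A k))" .
  qed
qed

lemma prod_std_normal_density:
  assumes "finite K"
  shows "(\<Prod>k\<in>K. ennreal (std_normal_density (x k)))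
    = ennreal ((1 / sqrt (2 * pi)) ^ card K * exp (- dot K x x / 2))"
proof -
  have "(\<Prod>k\<in>K. ennreal (std_normal_density (x k))) = ennreal (\<Prod>k\<in>K. std_normal_density (x k))"
    by (rule prod_ennreal) simp
  also have "(\<Prod>k\<in>K. std_normal_density (x k)) = (\<Prod>k\<in>K. 1 / sqrt (2 * pi) * exp (- (x k * x k) / 2))"
    by (intro prod.cong refl) (simp add: normal_density_def power2_eq_square)
  also have "\<dots> = (1 / sqrt (2 * pi)) ^ card K * exp (\<Sum>k\<in>K. - (x k * x k) / 2)"
    using assms by (simp only: prod.distrib exp_sum prod_constant)
  also have "(\<Sum>k\<in>K. - (x k * x k) / 2) = - dot K x x / 2"
    by (simp add: dot_def sum_negf sum_divide_distrib)
  finally show ?thesis .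
qed

text \<open>Every symmetry of the proof is of this kind: reflections, sign changes, the mixing of
  transposed entries. An involution is its own inverse, so the right inverse asked for by the change
  of variables comes for free.\<close>

locale isometric_involution =
  fixes K :: "'k set" and T :: "('k \<Rightarrow> real) \<Rightarrow> 'k \<Rightarrow> real"
  assumes fin: "finite K"
    and T_measurable [measurable]: "T \<in> lebP K \<rightarrow>\<^sub>M lebP K"
    and T_T: "\<And>x. x \<in> space (lebP K) \<Longrightarrow> T (T x) = x"
    and T_plus: "\<And>x y. x \<in> space (lebP K) \<Longrightarrow> y \<in> space (lebP K) \<Longrightarrow> T (plusP K x y) = plusP K (T x) (T y)"
    and T_dot: "\<And>x. x \<in> space (lebP K) \<Longrightarrow> dot K (T x) (T x) = dot K x x"
begin

lemma T_space: "x \<in> space (lebP K) \<Longrightarrow> T x \<in> space (lebP K)"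
  using measurable_space[OF T_measurable] .

text \<open>The Gaussian density is a test function of integral 1 that \<open>T\<close> and the
  change of sign both preserve; comparison with it shows that the Jacobian constant is 1.\<close>

lemma nn_integral_lebP:
  assumes [measurable]: "f \<in> borel_measurable (lebP K)"
  shows "(\<integral>\<^sup>+x. f (T x) \<partial>lebP K) = (\<integral>\<^sup>+x. f x \<partial>lebP K)"
proof -
  define g where "g x = (\<Prod>k\<in>K. ennreal (std_normal_density (x k)))" for x :: "'k \<Rightarrow> real"
  have [measurable]: "g \<in> borel_measurable (lebP K)" unfolding g_def by measurable
  have g: "(\<integral>\<^sup>+x. g x \<partial>lebP K) = 1"
  proof -
    interpret prob_space "gaussP K" by (rule prob_space_gaussP)
    have "(\<integral>\<^sup>+x. 1 \<partial>gaussP K) = (\<integral>\<^sup>+x. g x * 1 \<partial>lebP K)"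
      unfolding gaussP_eq_density[OF fin] g_def by (rule nn_integral_density) measurable
    then show ?thesis using emeasure_space_1 by simp
  qed
  have "g (minusP K (T x)) = g x" if "x \<in> space (lebP K)" for x
  proof -
    have "dot K (minusP K (T x)) (minusP K (T x)) = dot K x x"
      using T_dot[OF that] by (simp add: minusP_def dot_def)
    then show ?thesis using fin by (simp add: g_def prod_std_normal_density)
  qed
  then have "(\<integral>\<^sup>+x. g (minusP K (T x)) \<partial>lebP K) = 1"
    using g by (simp cong: nn_integral_cong)
  moreover have "(\<integral>\<^sup>+x. f (T x) \<partial>lebP K) * (\<integral>\<^sup>+x. g x \<partial>lebP K)
    = (\<integral>\<^sup>+x. g (minusP K (T x)) \<partial>lebP K) * (\<integral>\<^sup>+x. f x \<partial>lebP K)"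
    using T_T T_space by (intro nn_integral_linear_bijection[where T' = T, OF fin T_measurable _ T_plus]) simp_all
  ultimately show ?thesis using g by (simp only: mult_1 mult_1_right)
qed

lemma nn_integral_gaussP:
  assumes [measurable]: "f \<in> borel_measurable (lebP K)"
  shows "(\<integral>\<^sup>+x. f (T x) \<partial>gaussP K) = (\<integral>\<^sup>+x. f x \<partial>gaussP K)"
proof -
  define g where "g x = (\<Prod>k\<in>K. ennreal (std_normal_density (x k)))" for x :: "'k \<Rightarrow> real"
  have [measurable]: "g \<in> borel_measurable (lebP K)" unfolding g_def by measurable
  have "g (T x) = g x" if "x \<in> space (lebP K)" for x
    using fin T_dot[OF that] by (simp add: g_def prod_std_normal_density)
  then have "(\<integral>\<^sup>+x. g x * f (T x) \<partial>lebP K) = (\<integral>\<^sup>+x. g (T x) * f (T x) \<partial>lebP K)"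
    by (simp cong: nn_integral_cong)
  also have "\<dots> = (\<integral>\<^sup>+x. g x * f x \<partial>lebP K)"
    by (rule nn_integral_lebP) measurable
  finally show ?thesis
    by (simp add: gaussP_eq_density[OF fin] nn_integral_density flip: g_def)
qed

end

section \<open>Rotation of the disorder\<close>

text \<open>Symmetric orthogonal matrices: transposes disappear, and conjugation is an involution.
  Reflections and diagonal sign matrices belong here.\<close>

definition orth :: "'i set \<Rightarrow> ('i \<Rightarrow> 'i \<Rightarrow> real) \<Rightarrow> bool" where
  "orth I Q \<longleftrightarrow> symm_on I Q \<and> (\<forall>i\<in>I. \<forall>j\<in>I. (\<Sum>k\<in>I. Q i k * Q k j) = unitv i j)"

text \<open>This is Q A Q^T, hence Q A Q for symmetric Q. The transpose is carried by the order of
  the indices.\<close>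

definition conjm :: "'i set \<Rightarrow> ('i \<Rightarrow> 'i \<Rightarrow> real) \<Rightarrow> ('i \<Rightarrow> 'i \<Rightarrow> real) \<Rightarrow> 'i \<Rightarrow> 'i \<Rightarrow> real" where
  "conjm I Q A i j = mv I Q (\<lambda>k. mv I Q (A k) j) i"

definition conjP :: "'i set \<Rightarrow> ('i \<Rightarrow> 'i \<Rightarrow> real) \<Rightarrow> ('i \<times> 'i \<Rightarrow> real) \<Rightarrow> 'i \<times> 'i \<Rightarrow> real" where
  "conjP I Q g = (\<lambda>(i, j)\<in>I \<times> I. conjm I Q (\<lambda>k l. g (k, l)) i j)"

text \<open>The symmetric matrix of the Hamiltonian. Off-diagonal entries have variance 1 / (4 N),
  so a full row has squared length near 1 / 4 and the spectrum fills [-1, 1] in the limit. The size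
  \<open>N\<close> is a parameter apart from the index set, so that submatrices keep the
  normalisation.\<close>

definition gmat :: "nat \<Rightarrow> ('i \<times> 'i \<Rightarrow> real) \<Rightarrow> 'i \<Rightarrow> 'i \<Rightarrow> real" where
  "gmat N g i j = (g (i, j) + g (j, i)) / (2 * sqrt (2 * real N))"

lemma symm_on_gmat: "symm_on I (gmat N g)"
  by (simp add: symm_on_def gmat_def add.commute)

section \<open>Conjugation by symmetric orthogonal matrices\<close>

lemma mv_swap: "mv I P (\<lambda>l. mv I Q (\<lambda>k. B k l) i) j = mv I Q (\<lambda>k. mv I P (B k) j) i"
proof -
  have "mv I P (\<lambda>l. mv I Q (\<lambda>k. B k l) i) j = (\<Sum>l\<in>I. \<Sum>k\<in>I. P j l * (Q i k * B k l))"
    by (simp add: mv_def sum_distrib_left)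
  also have "\<dots> = (\<Sum>k\<in>I. \<Sum>l\<in>I. P j l * (Q i k * B k l))"
    by (rule sum.swap)
  also have "\<dots> = mv I Q (\<lambda>k. mv I P (B k) j) i"
    by (simp add: mv_def sum_distrib_left mult.left_commute)
  finally show ?thesis .
qed

lemma orth_mv_mv:
  assumes "finite I" "orth I Q" "i \<in> I"
  shows "mv I Q (mv I Q y) i = y i"
proof -
  have "mv I Q (mv I Q y) i = (\<Sum>k\<in>I. \<Sum>j\<in>I. Q i k * Q k j * y j)"
    by (simp add: mv_def sum_distrib_left mult.assoc)
  also have "\<dots> = (\<Sum>j\<in>I. \<Sum>k\<in>I. Q i k * Q k j * y j)"
    by (rule sum.swap)
  also have "\<dots> = (\<Sum>j\<in>I. unitv i j * y j)"
    using assms by (simp add: orth_def flip: sum_distrib_right)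
  also have "\<dots> = y i"
    using assms dot_unitv[of I i y] by (simp add: dot_def)
  finally show ?thesis .
qed

lemma orth_symm: "orth I Q \<Longrightarrow> symm_on I Q"
  by (simp add: orth_def)

lemma orth_dot:
  assumes "finite I" "orth I Q"
  shows "dot I (mv I Q x) (mv I Q y) = dot I x y"
proof -
  have "dot I (mv I Q x) (mv I Q y) = dot I x (mv I Q (mv I Q y))"
    using assms by (simp add: dot_mv_symm orth_symm)
  also have "\<dots> = dot I x y" using assms by (intro dot_cong) (simp_all add: orth_mv_mv)
  finally show ?thesis .
qed

lemma mv_conjm:
  assumes "finite I" "orth I Q" "i \<in> I"
  shows "mv I (conjm I Q A) y i = mv I Q (mv I A (mv I Q y)) i"
proof -
  have "mv I (conjm I Q A) y i = (\<Sum>j\<in>I. \<Sum>k\<in>I. Q i k * mv I Q (A k) j * y j)"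
    by (simp add: mv_def[of I "conjm I Q A"] conjm_def mv_def[of I Q "\<lambda>k. mv I Q (A k) _"] sum_distrib_right)
  also have "\<dots> = (\<Sum>k\<in>I. \<Sum>j\<in>I. Q i k * mv I Q (A k) j * y j)"
    by (rule sum.swap)
  also have "\<dots> = (\<Sum>k\<in>I. Q i k * dot I (mv I Q (A k)) y)"
    by (simp add: dot_def sum_distrib_left mult.assoc)
  also have "\<dots> = (\<Sum>k\<in>I. Q i k * dot I (A k) (mv I Q y))"
    using assms by (simp add: dot_mv_symm[OF orth_symm, symmetric])
  also have "\<dots> = mv I Q (mv I A (mv I Q y)) i"
    by (simp add: mv_def dot_def)
  finally show ?thesis .
qed

lemma dot_conjm:
  assumes "finite I" "orth I Q"
  shows "dot I x (mv I (conjm I Q A) y) = dot I (mv I Q x) (mv I A (mv I Q y))"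
proof -
  have "dot I x (mv I (conjm I Q A) y) = dot I x (mv I Q (mv I A (mv I Q y)))"
    using assms by (intro dot_cong) (simp_all add: mv_conjm)
  then show ?thesis using assms by (simp add: dot_mv_symm orth_symm)
qed

lemma form_bound_conjm:
  assumes "finite I" "orth I Q" "form_bound I A L s u"
  shows "form_bound I (conjm I Q A) L s (mv I Q u)"
  unfolding form_bound_def
proof
  fix y
  have "\<bar>dot I (mv I Q y) (mv I A (mv I Q y))\<bar> \<le> L * dot I (mv I Q y) (mv I Q y) - s * (dot I u (mv I Q y))\<^sup>2"
    using assms(3) by (simp add: form_bound_def)
  moreover have "dot I u (mv I Q y) = dot I (mv I Q u) y"
    using assms by (simp add: dot_mv_symm orth_symm)
  ultimately show "\<bar>dot I y (mv I (conjm I Q A) y)\<bar> \<le> L * dot I y y - s * (dot I (mv I Q u) y)\<^sup>2"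
    using assms by (simp add: dot_conjm orth_dot)
qed

lemma resolves_conjm:
  assumes "finite I" "orth I Q" "resolves I A z u y"
  shows "resolves I (conjm I Q A) z (mv I Q u) (mv I Q y)"
  unfolding resolves_def
proof
  fix i assume i: "i \<in> I"
  have "mv I (conjm I Q A) (mv I Q y) i = mv I Q (mv I A (mv I Q (mv I Q y))) i"
    using assms i by (simp add: mv_conjm)
  also have "\<dots> = mv I Q (mv I A y) i"
    using assms by (intro mv_cong refl) (simp add: orth_mv_mv)
  finally have "z * mv I Q y i - mv I (conjm I Q A) (mv I Q y) i = mv I Q (\<lambda>i. z * y i - mv I A y i) i"
    by (simp add: mv_diff mv_scale)
  also have "\<dots> = mv I Q u i"
    using assms by (intro mv_cong refl) (simp add: resolves_def)
  finally show "z * mv I Q y i - mv I (conjm I Q A) (mv I Q y) i = mv I Q u i" .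
qed

lemma conjm_conjm:
  assumes "finite I" "orth I Q" "i \<in> I" "j \<in> I"
  shows "conjm I Q (conjm I Q A) i j = A i j"
proof -
  have "mv I Q (\<lambda>k. mv I Q (conjm I Q A k) j) i
    = mv I Q (\<lambda>k. mv I Q (\<lambda>k'. mv I Q (mv I Q (A k')) j) k) i"
    unfolding conjm_def by (intro mv_cong refl mv_swap)
  also have "\<dots> = mv I Q (mv I Q (\<lambda>k'. A k' j)) i"
    using assms by (intro mv_cong refl) (simp add: orth_mv_mv)
  also have "\<dots> = A i j" using assms by (simp add: orth_mv_mv)
  finally show ?thesis by (simp add: conjm_def)
qed

lemma conjm_cong:
  "i \<in> I \<Longrightarrow> j \<in> I \<Longrightarrow> (\<And>k l. k \<in> I \<Longrightarrow> l \<in> I \<Longrightarrow> A k l = A' k l) \<Longrightarrow> conjm I Q A i j = conjm I Q A' i j"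
  by (simp add: conjm_def mv_def)

lemma conjm_transpose: "conjm I Q (\<lambda>k l. A l k) i j = conjm I Q A j i"
  unfolding conjm_def by (rule mv_swap)

lemma gmat_conjP:
  assumes "i \<in> I" "j \<in> I"
  shows "gmat N (conjP I Q g) i j = conjm I Q (gmat N g) i j"
proof -
  have "conjm I Q (gmat N g) i j
    = (conjm I Q (\<lambda>k l. g (k, l)) i j + conjm I Q (\<lambda>k l. g (l, k)) i j) / (2 * sqrt (2 * real N))"
    by (simp add: conjm_def mv_def gmat_def sum_distrib_left sum_divide_distrib add_divide_distrib
        distrib_left sum.distrib)
  then show ?thesis
    using assms conjm_transpose[of I Q "\<lambda>k l. g (k, l)" i j] by (simp add: gmat_def conjP_def)
qed

lemma dot_conjm_entries:
  assumes "finite I" "orth I Q"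
  shows "(\<Sum>i\<in>I. \<Sum>j\<in>I. conjm I Q A i j * conjm I Q A i j) = (\<Sum>i\<in>I. \<Sum>j\<in>I. A i j * A i j)"
proof -
  have "(\<Sum>i\<in>I. \<Sum>j\<in>I. conjm I Q A i j * conjm I Q A i j)
    = (\<Sum>j\<in>I. dot I (mv I Q (\<lambda>k. mv I Q (A k) j)) (mv I Q (\<lambda>k. mv I Q (A k) j)))"
    unfolding conjm_def dot_def by (rule sum.swap)
  also have "\<dots> = (\<Sum>j\<in>I. \<Sum>k\<in>I. mv I Q (A k) j * mv I Q (A k) j)"
    using assms by (simp add: orth_dot) (simp add: dot_def)
  also have "\<dots> = (\<Sum>k\<in>I. dot I (mv I Q (A k)) (mv I Q (A k)))"
    unfolding dot_def by (rule sum.swap)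
  also have "\<dots> = (\<Sum>k\<in>I. dot I (A k) (A k))"
    using assms by (simp add: orth_dot)
  finally show ?thesis by (simp add: dot_def)
qed

section \<open>Conjugations and rotations as isometric involutions\<close>

lemma isometric_involution_conjP:
  assumes fin: "finite I" and Q: "orth I Q"
  shows "isometric_involution (I \<times> I) (conjP I Q)"
proof
  show "finite (I \<times> I)" using fin by simp
  show "conjP I Q \<in> lebP (I \<times> I) \<rightarrow>\<^sub>M lebP (I \<times> I)"
    unfolding conjP_def
  proof (rule measurable_restrict)
    fix p assume "p \<in> I \<times> I"
    have "(\<lambda>g. conjm I Q (\<lambda>k l. g (k, l)) i j) \<in> borel_measurable (lebP (I \<times> I))" for i j
      unfolding conjm_def mv_def by (intro borel_measurable_sum borel_measurable_times) simp_all
    then show "(\<lambda>g. case p of (i, j) \<Rightarrow> conjm I Q (\<lambda>k l. g (k, l)) i j) \<in> lebP (I \<times> I) \<rightarrow>\<^sub>M lborel"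
      by (simp add: split_beta)
  qed
  fix x :: "'a \<times> 'a \<Rightarrow> real" assume x: "x \<in> space (lebP (I \<times> I))"
  show "conjP I Q (conjP I Q x) = x"
  proof
    fix p
    show "conjP I Q (conjP I Q x) p = x p"
    proof (cases "p \<in> I \<times> I")
      case True
      then obtain i j where p: "p = (i, j)" "i \<in> I" "j \<in> I" by auto
      have "conjm I Q (\<lambda>k l. conjP I Q x (k, l)) i j = conjm I Q (conjm I Q (\<lambda>k l. x (k, l))) i j"
        using p by (intro conjm_cong) (simp_all add: conjP_def)
      then show ?thesis using p assms by (simp add: conjm_conjm) (simp add: conjP_def conjm_conjm)
    next
      case False
      then show ?thesis using x by (cases p) (auto simp: conjP_def space_PiM PiE_def extensional_def)
    qed
  qed
  have dot_eq: "dot (I \<times> I) f f = (\<Sum>i\<in>I. \<Sum>j\<in>I. f (i, j) * f (i, j))" for f :: "'a \<times> 'a \<Rightarrow> real"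
    using fin by (simp add: dot_def sum.cartesian_product)
  have "(\<Sum>i\<in>I. \<Sum>j\<in>I. conjP I Q x (i, j) * conjP I Q x (i, j))
    = (\<Sum>i\<in>I. \<Sum>j\<in>I. conjm I Q (\<lambda>k l. x (k, l)) i j * conjm I Q (\<lambda>k l. x (k, l)) i j)"
    by (intro sum.cong refl) (simp add: conjP_def)
  then show "dot (I \<times> I) (conjP I Q x) (conjP I Q x) = dot (I \<times> I) x x"
    unfolding dot_eq dot_conjm_entries[OF assms] .
  fix y :: "'a \<times> 'a \<Rightarrow> real"
  have "conjm I Q (\<lambda>k l. plusP (I \<times> I) x y (k, l)) i j
    = conjm I Q (\<lambda>k l. x (k, l)) i j + conjm I Q (\<lambda>k l. y (k, l)) i j" if "i \<in> I" "j \<in> I" for i j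
  proof -
    have "conjm I Q (\<lambda>k l. plusP (I \<times> I) x y (k, l)) i j = conjm I Q (\<lambda>k l. x (k, l) + y (k, l)) i j"
      using that by (intro conjm_cong) (simp_all add: plusP_def)
    then show ?thesis by (simp add: conjm_def mv_add)
  qed
  then show "conjP I Q (plusP (I \<times> I) x y) = plusP (I \<times> I) (conjP I Q x) (conjP I Q y)"
    by (auto simp: conjP_def plusP_def fun_eq_iff)
qed

lemma isometric_involution_mv:
  assumes fin: "finite I" and Q: "orth I Q"
  shows "isometric_involution I (\<lambda>x. restrict (mv I Q x) I)"
proof
  show "finite I" by fact
  show "(\<lambda>x. restrict (mv I Q x) I) \<in> lebP I \<rightarrow>\<^sub>M lebP I"
    unfolding mv_def by (intro measurable_restrict) simp
  fix x :: "'a \<Rightarrow> real" assume x: "x \<in> space (lebP I)"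
  have "mv I Q (restrict (mv I Q x) I) i = mv I Q (mv I Q x) i" for i by (intro mv_cong) auto
  then show "restrict (mv I Q (restrict (mv I Q x) I)) I = x"
    using x assms by (auto simp: orth_mv_mv fun_eq_iff space_PiM PiE_def extensional_def)
  have "dot I (restrict (mv I Q x) I) (restrict (mv I Q x) I) = dot I (mv I Q x) (mv I Q x)"
    by (intro dot_cong) auto
  then show "dot I (restrict (mv I Q x) I) (restrict (mv I Q x) I) = dot I x x"
    using assms by (simp add: orth_dot)
  fix y :: "'a \<Rightarrow> real"
  have "mv I Q (plusP I x y) i = mv I Q x i + mv I Q y i" for i
    unfolding mv_add[symmetric] by (intro mv_cong) (auto simp: plusP_def)
  then show "restrict (mv I Q (plusP I x y)) I = plusP I (restrict (mv I Q x) I) (restrict (mv I Q y) I)"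
    by (auto simp: plusP_def fun_eq_iff)
qed

text \<open>The Householder reflection in \<open>u - v\<close>; for \<open>u = v\<close> the junk value \<open>x / 0 = 0\<close> yields the
  identity.\<close>

lemma ex_orth:
  assumes fin: "finite I" and norm: "dot I u u = dot I v v"
  shows "\<exists>Q. orth I Q \<and> (\<forall>i\<in>I. mv I Q u i = v i)"
proof -
  define w where "w i = u i - v i" for i
  define c where "c = 2 / dot I w w"
  define Q where "Q i j = unitv i j - c * w i * w j" for i j
  have cw: "c * c * dot I w w = 2 * c" by (simp add: c_def)
  have mvQ: "mv I Q y i = y i - c * w i * dot I w y" if "i \<in> I" for y i
  proof -
    have "mv I Q y i = (\<Sum>j\<in>I. unitv i j * y j) - (\<Sum>j\<in>I. c * w i * (w j * y j))"
      by (simp add: mv_def Q_def left_diff_distrib sum_subtractf mult.assoc)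
    also have "\<dots> = y i - c * w i * dot I w y"
      using dot_unitv[OF fin that, of y] by (simp add: dot_def sum_distrib_left)
    finally show ?thesis .
  qed
  have sym: "symm_on I Q" by (auto simp: symm_on_def Q_def unitv_def)
  have "(\<Sum>k\<in>I. Q i k * Q k j) = unitv i j" if "i \<in> I" "j \<in> I" for i j
  proof -
    have "(\<Sum>k\<in>I. Q i k * Q k j) = mv I Q (\<lambda>k. Q k j) i" by (simp add: mv_def)
    also have "\<dots> = Q i j - c * w i * dot I w (\<lambda>k. Q k j)" using that by (simp add: mvQ)
    also have "dot I w (\<lambda>k. Q k j) = mv I Q w j"
      unfolding dot_def mv_def by (intro sum.cong refl) (simp add: Q_def unitv_def)
    also have "\<dots> = w j - c * w j * dot I w w" using that by (simp add: mvQ)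
    also have "Q i j - c * w i * (w j - c * w j * dot I w w) = unitv i j - 2 * c * w i * w j + (c * c * dot I w w) * w i * w j"
      by (simp add: Q_def algebra_simps)
    finally show ?thesis by (simp add: cw)
  qed
  with sym have "orth I Q" by (simp add: orth_def)
  moreover have "mv I Q u i = v i" if "i \<in> I" for i
  proof (cases "dot I w w = 0")
    case True
    then have "w i = 0" using dot_self_eq_0[OF fin] that by blast
    then show ?thesis using that by (simp add: mvQ) (simp add: w_def)
  next
    case False
    have "dot I w w = dot I u u - 2 * dot I u v + dot I v v"
      by (simp add: w_def[abs_def] dot_diff_left dot_diff_right dot_commute)
    moreover have "dot I w u = dot I u u - dot I u v"
      by (simp add: w_def[abs_def] dot_diff_left dot_commute)
    ultimately have "c * dot I w u = 1" using norm False by (simp add: c_def)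
    then have "c * w i * dot I w u = w i" by (metis mult.assoc mult.commute mult_1)
    then show ?thesis using that by (simp only: mvQ) (simp add: w_def)
  qed
  ultimately show ?thesis by blast
qed

text \<open>Conjugation by a symmetric orthogonal matrix that takes \<open>u\<close> to
  \<open>v\<close> preserves the Gaussian law and carries the event for \<open>u\<close> into the
  event for \<open>v\<close>. The congruence rule is there because the matrix of the conjugated
  disorder is the conjugated matrix only on \<open>I\<close>.\<close>

lemma emeasure_rotate:
  fixes P :: "('i \<Rightarrow> real) \<Rightarrow> ('i \<Rightarrow> 'i \<Rightarrow> real) \<Rightarrow> bool"
  assumes fin: "finite I" and norm: "dot I u u = dot I v v"
    and meas: "\<And>u. {g \<in> space (gaussP (I \<times> I)). P u (gmat N g)} \<in> sets (gaussP (I \<times> I))"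
    and inv: "\<And>Q u A. orth I Q \<Longrightarrow> symm_on I A \<Longrightarrow> P u A \<Longrightarrow> P (mv I Q u) (conjm I Q A)"
    and cong: "\<And>u u' A A'. (\<And>i. i \<in> I \<Longrightarrow> u i = u' i) \<Longrightarrow> (\<And>i j. i \<in> I \<Longrightarrow> j \<in> I \<Longrightarrow> A i j = A' i j) \<Longrightarrow> P u A \<Longrightarrow> P u' A'"
  shows "emeasure (gaussP (I \<times> I)) {g \<in> space (gaussP (I \<times> I)). P u (gmat N g)}
    \<le> emeasure (gaussP (I \<times> I)) {g \<in> space (gaussP (I \<times> I)). P v (gmat N g)}"
proof -
  let ?M = "gaussP (I \<times> I)"
  obtain Q where Q: "orth I Q" "\<forall>i\<in>I. mv I Q u i = v i" using ex_orth[OF fin norm] by blast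
  interpret isometric_involution "I \<times> I" "conjP I Q"
    using fin Q(1) by (rule isometric_involution_conjP)
  let ?S = "\<lambda>u. {g \<in> space ?M. P u (gmat N g)}"
  have sets: "?S u \<in> sets (lebP (I \<times> I))" for u using meas by (simp only: sets_gaussP)
  have "emeasure ?M (?S u) = (\<integral>\<^sup>+g. indicator (?S u) g \<partial>?M)" using meas by simp
  also have "\<dots> \<le> (\<integral>\<^sup>+g. indicator (?S v) (conjP I Q g) \<partial>?M)"
  proof (rule nn_integral_mono)
    fix g assume g: "g \<in> space ?M"
    have "P v (gmat N (conjP I Q g))" if "P u (gmat N g)"
      using inv[OF Q(1) symm_on_gmat that] by (rule cong[rotated 2]) (use Q(2) in \<open>simp_all add: gmat_conjP\<close>)
    moreover have "conjP I Q g \<in> space ?M" using T_space g by (simp add: space_gaussP)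
    ultimately show "indicator (?S u) g \<le> (indicator (?S v) (conjP I Q g) :: ennreal)"
      by (auto simp: indicator_def)
  qed
  also have "\<dots> = (\<integral>\<^sup>+g. indicator (?S v) g \<partial>?M)"
    using sets by (intro nn_integral_gaussP borel_measurable_indicator)
  also have "\<dots> = emeasure ?M (?S v)" using meas by simp
  finally show ?thesis .
qed

section \<open>A single row of the disorder\<close>

text \<open>The standard normal density times exp (t (x^2 - 1)) is exp (- t) \<sigma> times a
  centred normal density of variance 1 / (1 - 2 t). The factor 4 in the exponent is half of the 8 in
  |ln (1 - 2 t) + 2 t| \<le> 8 t^2, valid for |t| \<le> 1 / 4.\<close>

lemma chi_square_mgf:
  assumes "\<bar>t\<bar> \<le> 1 / 4"
  shows "(\<integral>\<^sup>+x. ennreal (exp (t * (x\<^sup>2 - 1))) \<partial>std_gauss) \<le> ennreal (exp (4 * t\<^sup>2))"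
proof -
  define \<sigma> where "\<sigma> = 1 / sqrt (1 - 2 * t)"
  have t: "0 < 1 - 2 * t" using assms by auto
  then have \<sigma>: "\<sigma> > 0" "\<sigma>\<^sup>2 = 1 / (1 - 2 * t)" by (simp_all add: \<sigma>_def power_divide)
  have eq: "std_normal_density x * exp (t * (x\<^sup>2 - 1)) = exp (- t) * \<sigma> * normal_density 0 \<sigma> x" for x
  proof -
    have "sqrt (2 * pi * \<sigma>\<^sup>2) = sqrt (2 * pi) * \<sigma>"
      using \<sigma>(1) by (simp add: real_sqrt_mult)
    then have "exp (- t) * \<sigma> * normal_density 0 \<sigma> x = exp (- t) * exp (- x\<^sup>2 / (2 * \<sigma>\<^sup>2)) / sqrt (2 * pi)"
      using \<sigma>(1) by (simp add: normal_density_def)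
    also have "exp (- t) * exp (- x\<^sup>2 / (2 * \<sigma>\<^sup>2)) = exp (- x\<^sup>2 / 2) * exp (t * (x\<^sup>2 - 1))"
    proof -
      have "- x\<^sup>2 / (2 * \<sigma>\<^sup>2) = - x\<^sup>2 / 2 + t * x\<^sup>2"
        using t by (simp add: \<sigma>(2) field_simps)
      then show ?thesis by (simp add: algebra_simps flip: exp_add)
    qed
    finally show ?thesis by (simp add: normal_density_def)
  qed
  have "(\<integral>\<^sup>+x. ennreal (exp (t * (x\<^sup>2 - 1))) \<partial>std_gauss)
    = (\<integral>\<^sup>+x. ennreal (std_normal_density x) * ennreal (exp (t * (x\<^sup>2 - 1))) \<partial>lborel)"
    unfolding std_gauss_def by (rule nn_integral_density) measurable
  also have "\<dots> = (\<integral>\<^sup>+x. ennreal (exp (- t) * \<sigma>) * ennreal (normal_density 0 \<sigma> x) \<partial>lborel)"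
    using \<sigma>(1) by (intro nn_integral_cong) (simp add: eq flip: ennreal_mult)
  also have "\<dots> = ennreal (exp (- t) * \<sigma>) * (\<integral>\<^sup>+x. ennreal (normal_density 0 \<sigma> x) \<partial>lborel)"
    by (rule nn_integral_cmult) measurable
  also have "(\<integral>\<^sup>+x. ennreal (normal_density 0 \<sigma> x) \<partial>lborel) = 1"
    using \<sigma>(1) integral_normal_density[OF \<sigma>(1), of 0] integrable_normal_density[OF \<sigma>(1), of 0]
    by (subst nn_integral_eq_integral) auto
  finally have "(\<integral>\<^sup>+x. ennreal (exp (t * (x\<^sup>2 - 1))) \<partial>std_gauss) = ennreal (exp (- t) * \<sigma>)" by simp
  moreover have "exp (- t) * \<sigma> \<le> exp (4 * t\<^sup>2)"
  proof -
    have "\<bar>ln (1 + (- 2 * t)) - (- 2 * t)\<bar> \<le> 2 * (- 2 * t)\<^sup>2"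
      using assms by (intro abs_ln_one_plus_x_minus_x_bound) auto
    then have "- t - ln (1 - 2 * t) / 2 \<le> 4 * t\<^sup>2" by (simp add: abs_le_iff power_mult_distrib)
    moreover have "\<sigma> = exp (- ln (1 - 2 * t) / 2)"
      using t by (simp add: \<sigma>_def exp_minus ln_sqrt[symmetric] inverse_eq_divide)
    ultimately show ?thesis by (simp flip: exp_add)
  qed
  ultimately show ?thesis by (simp add: ennreal_leI)
qed

lemma chi_square_tail:
  assumes fin: "finite K" "S \<subseteq> K" and t: "\<bar>t\<bar> \<le> 1 / 4"
  shows "emeasure (gaussP K) {x \<in> space (gaussP K). a \<le> t * (\<Sum>k\<in>S. (x k)\<^sup>2 - 1)}
    \<le> ennreal (exp (4 * t\<^sup>2 * card S - a))"
proof -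
  interpret product_sigma_finite "\<lambda>_::'a. std_gauss" by (rule product_sigma_finite_gauss)
  have meas [measurable]: "(\<lambda>x. t * (\<Sum>k\<in>S. (x k)\<^sup>2 - 1)) \<in> borel_measurable (gaussP K)"
    using fin(2) by (intro borel_measurable_times borel_measurable_sum borel_measurable_diff borel_measurable_power) auto
  let ?A = "{x \<in> space (gaussP K). a \<le> t * (\<Sum>k\<in>S. (x k)\<^sup>2 - 1)}"
  define f where "f k x = (if k \<in> S then ennreal (exp (t * (x\<^sup>2 - 1))) else 1)" for k and x :: real
  have [measurable]: "f k \<in> borel_measurable std_gauss" for k by (cases "k \<in> S") (simp_all add: f_def[abs_def])
  have prod_f: "(\<Prod>k\<in>K. f k (x k)) = ennreal (exp (t * (\<Sum>k\<in>S. (x k)\<^sup>2 - 1)))" for x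
  proof -
    have "(\<Prod>k\<in>K. f k (x k)) = (\<Prod>k\<in>S. ennreal (exp (t * ((x k)\<^sup>2 - 1))))"
      using fin unfolding f_def by (intro prod.mono_neutral_cong_right) auto
    also have "\<dots> = ennreal (exp (\<Sum>k\<in>S. t * ((x k)\<^sup>2 - 1)))"
      using fin by (simp add: prod_ennreal exp_sum finite_subset)
    finally show ?thesis by (simp add: sum_distrib_left)
  qed
  have "emeasure (gaussP K) ?A = (\<integral>\<^sup>+x. indicator ?A x \<partial>gaussP K)"
    by (rule nn_integral_indicator[symmetric]) measurable
  also have "\<dots> \<le> (\<integral>\<^sup>+x. ennreal (exp (- a)) * (\<Prod>k\<in>K. f k (x k)) \<partial>gaussP K)"
    by (intro nn_integral_mono) (auto simp: prod_f indicator_def simp flip: ennreal_mult exp_add)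
  also have "\<dots> = ennreal (exp (- a)) * (\<integral>\<^sup>+x. (\<Prod>k\<in>K. f k (x k)) \<partial>gaussP K)"
    by (rule nn_integral_cmult) measurable
  also have "(\<integral>\<^sup>+x. (\<Prod>k\<in>K. f k (x k)) \<partial>gaussP K) = (\<Prod>k\<in>K. \<integral>\<^sup>+x. f k x \<partial>std_gauss)"
    by (rule product_nn_integral_prod[OF fin(1)]) measurable
  also have "\<dots> = (\<Prod>k\<in>S. \<integral>\<^sup>+x. f k x \<partial>std_gauss)"
    using fin prob_space.emeasure_space_1[OF prob_space_std_gauss]
    by (intro prod.mono_neutral_right) (auto simp: f_def)
  also have "\<dots> \<le> (\<Prod>k\<in>S. ennreal (exp (4 * t\<^sup>2)))"
    using chi_square_mgf[OF t] by (intro prod_mono_ennreal) (simp add: f_def)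
  also have "\<dots> = ennreal (exp (4 * t\<^sup>2 * card S))"
    using fin by (simp add: ennreal_power exp_of_nat_mult[symmetric] mult.commute)
  finally show ?thesis by (simp add: mult_left_mono ennreal_mult[symmetric] exp_add[symmetric])
qed

text \<open>Take t = \<delta> / 2 and t = - \<delta> / 2 with threshold 2 \<delta>^2 N: the term 4
  t^2 |S| is at most \<delta>^2 N, so the exponent is at most - \<delta>^2 N.\<close>

lemma chi_square_concentration:
  assumes fin: "finite K" "S \<subseteq> K" and "card S \<le> N" and \<delta>: "0 < \<delta>" "\<delta> \<le> 1 / 2"
  shows "emeasure (gaussP K) {x \<in> space (gaussP K). 4 * \<delta> * N \<le> \<bar>\<Sum>k\<in>S. (x k)\<^sup>2 - 1\<bar>}
    \<le> ennreal (2 * exp (- \<delta>\<^sup>2 * N))"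
proof -
  have meas [measurable]: "(\<lambda>x. \<Sum>k\<in>S. (x k)\<^sup>2 - 1) \<in> borel_measurable (gaussP K)"
    using fin(2) by (intro borel_measurable_sum borel_measurable_diff borel_measurable_power) auto
  let ?A = "\<lambda>t. {x \<in> space (gaussP K). 2 * \<delta>\<^sup>2 * N \<le> t * (\<Sum>k\<in>S. (x k)\<^sup>2 - 1)}"
  have sets: "?A t \<in> sets (gaussP K)" for t by measurable
  have A: "emeasure (gaussP K) (?A t) \<le> ennreal (exp (- \<delta>\<^sup>2 * N))" if "t = \<delta> / 2 \<or> t = - \<delta> / 2" for t
  proof -
    have "4 * t\<^sup>2 = \<delta>\<^sup>2" using that by (auto simp: power_divide)
    then have "4 * t\<^sup>2 * card S - 2 * \<delta>\<^sup>2 * N \<le> - \<delta>\<^sup>2 * N"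
      using \<open>card S \<le> N\<close> mult_left_mono[of "real (card S)" "real N" "\<delta>\<^sup>2"]
      by (simp add: mult.commute)
    then have "ennreal (exp (4 * t\<^sup>2 * card S - 2 * \<delta>\<^sup>2 * N)) \<le> ennreal (exp (- \<delta>\<^sup>2 * N))"
      by (intro ennreal_leI) simp
    moreover have "\<bar>t\<bar> \<le> 1 / 4" using that \<delta> by auto
    ultimately show ?thesis
      by (intro order_trans[OF chi_square_tail[OF fin]])
  qed
  have "{x \<in> space (gaussP K). 4 * \<delta> * N \<le> \<bar>\<Sum>k\<in>S. (x k)\<^sup>2 - 1\<bar>} \<subseteq> ?A (\<delta> / 2) \<union> ?A (- \<delta> / 2)"
  proof
    fix x assume x: "x \<in> {x \<in> space (gaussP K). 4 * \<delta> * N \<le> \<bar>\<Sum>k\<in>S. (x k)\<^sup>2 - 1\<bar>}"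
    define z where "z = (\<Sum>k\<in>S. (x k)\<^sup>2 - 1)"
    have "4 * \<delta> * N \<le> \<bar>z\<bar>" using x by (simp only: mem_Collect_eq z_def)
    then have "\<delta> / 2 * (4 * \<delta> * N) \<le> \<delta> / 2 * \<bar>z\<bar>" using \<delta> by (intro mult_left_mono) simp_all
    then have "2 * \<delta>\<^sup>2 * N \<le> \<delta> / 2 * z \<or> 2 * \<delta>\<^sup>2 * N \<le> - \<delta> / 2 * z"
      by (cases "z \<ge> 0") (auto simp: power2_eq_square)
    then show "x \<in> ?A (\<delta> / 2) \<union> ?A (- \<delta> / 2)" using x by (simp only: mem_Collect_eq Un_iff z_def) blast
  qed
  then have "emeasure (gaussP K) {x \<in> space (gaussP K). 4 * \<delta> * N \<le> \<bar>\<Sum>k\<in>S. (x k)\<^sup>2 - 1\<bar>}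
    \<le> emeasure (gaussP K) (?A (\<delta> / 2) \<union> ?A (- \<delta> / 2))"
    using sets by (intro emeasure_mono sets.Un) auto
  also have "\<dots> \<le> emeasure (gaussP K) (?A (\<delta> / 2)) + emeasure (gaussP K) (?A (- \<delta> / 2))"
    by (intro emeasure_subadditive sets)
  also have "\<dots> \<le> ennreal (exp (- \<delta>\<^sup>2 * N)) + ennreal (exp (- \<delta>\<^sup>2 * N))"
    by (intro add_mono A) auto
  also have "\<dots> = ennreal (2 * exp (- \<delta>\<^sup>2 * N))" by (simp flip: ennreal_plus)
  finally show ?thesis .
qed

text \<open>The threshold is the size of \<open>x k\<close> at which a diagonal entry x / sqrt (2 N)
  of the matrix reaches \<delta>. The bound is the chi-square tail of one coordinate at t = 1 /
  4.\<close>

lemma gauss_tail: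
  assumes fin: "finite K" "k \<in> K" and "0 \<le> \<delta>"
  shows "emeasure (gaussP K) {x \<in> space (gaussP K). \<delta> * sqrt (2 * real N) \<le> \<bar>x k\<bar>}
    \<le> ennreal (2 * exp (- \<delta>\<^sup>2 * N / 2))"
proof -
  have "emeasure (gaussP K) {x \<in> space (gaussP K). \<delta> * sqrt (2 * real N) \<le> \<bar>x k\<bar>}
    \<le> emeasure (gaussP K) {x \<in> space (gaussP K). (2 * \<delta>\<^sup>2 * N - 1) / 4 \<le> 1 / 4 * (\<Sum>k\<in>{k}. (x k)\<^sup>2 - 1)}"
  proof (rule emeasure_mono)
    show "{x \<in> space (gaussP K). (2 * \<delta>\<^sup>2 * N - 1) / 4 \<le> 1 / 4 * (\<Sum>k\<in>{k}. (x k)\<^sup>2 - 1)} \<in> sets (gaussP K)"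
    proof -
      have [measurable]: "(\<lambda>x. x k) \<in> borel_measurable (gaussP K)" using fin by simp
      show ?thesis by simp
    qed
    show "{x \<in> space (gaussP K). \<delta> * sqrt (2 * real N) \<le> \<bar>x k\<bar>}
      \<subseteq> {x \<in> space (gaussP K). (2 * \<delta>\<^sup>2 * N - 1) / 4 \<le> 1 / 4 * (\<Sum>k\<in>{k}. (x k)\<^sup>2 - 1)}"
    proof safe
      fix x assume "\<delta> * sqrt (2 * real N) \<le> \<bar>x k\<bar>"
      then have "(\<delta> * sqrt (2 * real N))\<^sup>2 \<le> \<bar>x k\<bar>\<^sup>2" using assms by (intro power_mono) auto
      then show "(2 * \<delta>\<^sup>2 * N - 1) / 4 \<le> 1 / 4 * (\<Sum>k\<in>{k}. (x k)\<^sup>2 - 1)"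
        by (simp add: power_mult_distrib mult_ac)
    qed
  qed
  also have "\<dots> \<le> ennreal (exp (4 * (1 / 4)\<^sup>2 * card {k} - (2 * \<delta>\<^sup>2 * N - 1) / 4))"
    using fin by (intro chi_square_tail) auto
  also have "\<dots> \<le> ennreal (2 * exp (- \<delta>\<^sup>2 * N / 2))"
  proof (rule ennreal_leI)
    \<comment> \<open>The exponent is 1 / 4 + 1 / 4 - \<delta>^2 N / 2, which leaves the constant
      exp (1 / 2) \<le> 7 / 4.\<close>
    have "exp (1 / 2 :: real) \<le> 1 + 1 / 2 + (1 / 2)\<^sup>2" by (rule exp_bound) auto
    then have "exp (1 / 2) * exp (- \<delta>\<^sup>2 * N / 2) \<le> 2 * exp (- \<delta>\<^sup>2 * N / 2)"
      by (intro mult_right_mono) (simp_all add: power2_eq_square)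
    then show "exp (4 * (1 / 4)\<^sup>2 * card {k} - (2 * \<delta>\<^sup>2 * N - 1) / 4) \<le> 2 * exp (- \<delta>\<^sup>2 * N / 2)"
      by (simp add: power2_eq_square diff_divide_distrib mult.assoc flip: exp_add)
  qed
  finally show ?thesis .
qed

text \<open>Rotating each pair \<open>(g (i, j), g (j, i))\<close> by 45 degrees makes the \<open>i\<close>-th row of
  the symmetrised matrix a vector of independent Gaussians.\<close>

definition pair_rotation :: "'i \<Rightarrow> 'i set \<Rightarrow> ('i \<times> 'i \<Rightarrow> real) \<Rightarrow> 'i \<times> 'i \<Rightarrow> real" where
  "pair_rotation i J x = (\<lambda>p\<in>insert i J \<times> insert i J - J \<times> J.
     if p = (i, i) then x p
     else if fst p = i then (x p + x (prod.swap p)) / sqrt 2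
     else (x (prod.swap p) - x p) / sqrt 2)"

text \<open>On each pair the map has the matrix ((1, 1), (1, -1)) / sqrt 2, a reflection, hence it
  is an involution. The index set is the cross formed by row and column \<open>i\<close>.\<close>

lemma isometric_involution_pair_rotation:
  assumes fin: "finite J" and i: "i \<notin> J"
  shows "isometric_involution (insert i J \<times> insert i J - J \<times> J) (pair_rotation i J)"
proof
  let ?K = "insert i J \<times> insert i J - J \<times> J"
  have K: "?K = {(i, i)} \<union> (\<lambda>j. (i, j)) ` J \<union> (\<lambda>j. (j, i)) ` J" using i by auto
  have ne: "j \<noteq> i" if "j \<in> J" for j using i that by auto
  show "finite ?K" using fin by simp
  show "pair_rotation i J \<in> lebP ?K \<rightarrow>\<^sub>M lebP ?K"
    unfolding pair_rotation_def
  proof (rule measurable_restrict)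
    fix p assume p: "p \<in> ?K"
    then have swap: "prod.swap p \<in> ?K" by auto
    have comp: "(\<lambda>x. x q) \<in> borel_measurable (lebP ?K)" if "q \<in> ?K" for q
      using measurable_component_singleton[OF that, of "\<lambda>_. lborel"] by simp
    show "(\<lambda>x. if p = (i, i) then x p
     else if fst p = i then (x p + x (prod.swap p)) / sqrt 2
     else (x (prod.swap p) - x p) / sqrt 2) \<in> lebP ?K \<rightarrow>\<^sub>M lborel"
      unfolding measurable_lborel1 by (intro measurable_If borel_measurable_divide borel_measurable_add borel_measurable_diff comp p swap) simp_all
  qed
  have vals: "pair_rotation i J x (i, i) = x (i, i)"
    "j \<in> J \<Longrightarrow> pair_rotation i J x (i, j) = (x (i, j) + x (j, i)) / sqrt 2"
    "j \<in> J \<Longrightarrow> pair_rotation i J x (j, i) = (x (i, j) - x (j, i)) / sqrt 2" for x j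
    using i ne by (auto simp: pair_rotation_def)
  have ext: "pair_rotation i J x p = undefined" if "p \<notin> ?K" for x p
    unfolding pair_rotation_def restrict_def using that by (rule if_not_P)
  have s2: "a / sqrt 2 / sqrt 2 = a / 2" for a :: real by (simp add: divide_divide_eq_left)
  fix x :: "'a \<times> 'a \<Rightarrow> real" assume x: "x \<in> space (lebP ?K)"
  show "pair_rotation i J (pair_rotation i J x) = x"
  proof
    fix p
    consider "p = (i, i)" | j where "j \<in> J" "p = (i, j)" | j where "j \<in> J" "p = (j, i)" | "p \<notin> ?K"
      using K by blast
    then show "pair_rotation i J (pair_rotation i J x) p = x p"
    proof cases
      case 4
      have "x p = undefined" using x 4 unfolding space_PiM by (rule PiE_arb)
      then show ?thesis using ext[OF 4] by (simp only:)
    qed (simp_all add: vals add_divide_distrib diff_divide_distrib s2)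
  qed
  have dot_K: "dot ?K f f = f (i, i) * f (i, i) + (\<Sum>j\<in>J. f (i, j) * f (i, j) + f (j, i) * f (j, i))"
    for f :: "'a \<times> 'a \<Rightarrow> real"
  proof -
    let ?R = "(\<lambda>j. (i, j)) ` J" and ?C = "(\<lambda>j. (j, i)) ` J" and ?h = "\<lambda>p. f p * f p"
    have "dot ?K f f = sum ?h ({(i, i)} \<union> ?R \<union> ?C)" by (simp only: dot_def K)
    also have "\<dots> = sum ?h ({(i, i)} \<union> ?R) + sum ?h ?C"
      using fin ne by (intro sum.union_disjoint) blast+
    also have "sum ?h ({(i, i)} \<union> ?R) = sum ?h {(i, i)} + sum ?h ?R"
      using fin ne by (intro sum.union_disjoint) blast+
    also have "sum ?h ?R = (\<Sum>j\<in>J. ?h (i, j))"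
      by (subst sum.reindex) (simp_all add: inj_on_def)
    also have "sum ?h ?C = (\<Sum>j\<in>J. ?h (j, i))"
      by (subst sum.reindex) (simp_all add: inj_on_def)
    finally show ?thesis by (simp add: sum.distrib)
  qed
  have sq: "(a + b) / sqrt 2 * ((a + b) / sqrt 2) + (a - b) / sqrt 2 * ((a - b) / sqrt 2) = a * a + b * b" for a b :: real
  proof -
    have "(a + b) / sqrt 2 * ((a + b) / sqrt 2) = (a + b) * (a + b) / 2"
      "(a - b) / sqrt 2 * ((a - b) / sqrt 2) = (a - b) * (a - b) / 2" by simp_all
    then have "(a + b) / sqrt 2 * ((a + b) / sqrt 2) + (a - b) / sqrt 2 * ((a - b) / sqrt 2)
      = ((a + b) * (a + b) + (a - b) * (a - b)) / 2" by (simp only: add_divide_distrib)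
    also have "(a + b) * (a + b) + (a - b) * (a - b) = 2 * (a * a + b * b)" by (simp add: algebra_simps)
    also have "\<dots> / 2 = a * a + b * b" by simp
    finally show ?thesis .
  qed
  show "dot ?K (pair_rotation i J x) (pair_rotation i J x) = dot ?K x x"
  proof -
    let ?y = "pair_rotation i J x"
    have "(\<Sum>j\<in>J. ?y (i, j) * ?y (i, j) + ?y (j, i) * ?y (j, i))
      = (\<Sum>j\<in>J. x (i, j) * x (i, j) + x (j, i) * x (j, i))"
    proof (rule sum.cong[OF refl])
      fix j assume j: "j \<in> J"
      show "?y (i, j) * ?y (i, j) + ?y (j, i) * ?y (j, i) = x (i, j) * x (i, j) + x (j, i) * x (j, i)"
        unfolding vals(2)[OF j] vals(3)[OF j] by (rule sq)
    qed
    then show ?thesis unfolding dot_K vals(1) by simp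
  qed
  fix y
  show "pair_rotation i J (plusP ?K x y) = plusP ?K (pair_rotation i J x) (pair_rotation i J y)"
  proof
    fix p
    consider "p = (i, i)" | j where "j \<in> J" "p = (i, j)" | j where "j \<in> J" "p = (j, i)" | "p \<notin> ?K"
      using K by blast
    then show "pair_rotation i J (plusP ?K x y) p = plusP ?K (pair_rotation i J x) (pair_rotation i J y) p"
    proof cases
      case 4
      have "plusP ?K f f' p = undefined" for f f' :: "'a \<times> 'a \<Rightarrow> real"
        unfolding plusP_def restrict_def using 4 by (rule if_not_P)
      then show ?thesis using ext[OF 4] by (simp only:)
    next
      case 1
      then have "p \<in> ?K" using i by simp
      then show ?thesis by (simp only: 1 vals(1) plusP_def restrict_apply if_True)
    next
      case (2 j)
      then have "(i, j) \<in> ?K" "(j, i) \<in> ?K" using i by simp_all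
      then show ?thesis using 2(1)
        by (simp only: 2(2) vals(2) plusP_def restrict_apply if_True) (simp add: add_divide_distrib)
    next
      case (3 j)
      then have "(i, j) \<in> ?K" "(j, i) \<in> ?K" using i by simp_all
      then show ?thesis using 3(1)
        by (simp only: 3(2) vals(3) plusP_def restrict_apply if_True) (simp add: add_divide_distrib diff_divide_distrib)
    qed
  qed
qed

text \<open>In the rotated variables y, again independent standard Gaussians, the row entries are y
  / (2 sqrt N) and the diagonal entry is y / sqrt (2 N). The squared row length is thus a chi-square
  sum over 4 N with mean |J| / (4 N).\<close>

lemma row_concentration:
  assumes fin: "finite J" and i: "i \<notin> J" and N: "card J \<le> N" "0 < N" and \<delta>: "0 < \<delta>" "\<delta> \<le> 1 / 2"
  defines "K \<equiv> insert i J \<times> insert i J - J \<times> J"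
  shows "emeasure (gaussP K) {x \<in> space (gaussP K). \<delta> \<le> \<bar>gmat N x i i\<bar> \<or>
      \<delta> \<le> \<bar>dot J (gmat N x i) (gmat N x i) - real (card J) / (4 * real N)\<bar>}
    \<le> ennreal (4 * exp (- \<delta>\<^sup>2 * N / 2))"
proof -
  interpret isometric_involution K "pair_rotation i J"
    unfolding K_def using fin i by (rule isometric_involution_pair_rotation)
  let ?S = "(\<lambda>j. (i, j)) ` J"
  have "inj_on (\<lambda>j. (i, j)) J" by (simp add: inj_on_def)
  then have "card ?S = card J" by (rule card_image)
  moreover have "?S \<subseteq> K" using i by (auto simp: K_def)
  ultimately have S: "?S \<subseteq> K" "card ?S = card J" by blast+
  have iK: "(i, i) \<in> K" using i by (auto simp: K_def)
  define A where "A = {x \<in> space (gaussP K). \<delta> * sqrt (2 * real N) \<le> \<bar>x (i, i)\<bar>}"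
  define B where "B = {x \<in> space (gaussP K). 4 * \<delta> * N \<le> \<bar>\<Sum>k\<in>?S. (x k)\<^sup>2 - 1\<bar>}"
  have A_sets [measurable]: "A \<in> sets (gaussP K)" unfolding A_def using iK by measurable
  have "(\<lambda>x. \<Sum>k\<in>?S. (x k)\<^sup>2 - 1) \<in> borel_measurable (gaussP K)"
    using S(1) by (intro borel_measurable_sum borel_measurable_diff borel_measurable_power) auto
  then have B_sets [measurable]: "B \<in> sets (gaussP K)" unfolding B_def by measurable
  let ?E = "{x \<in> space (gaussP K). \<delta> \<le> \<bar>gmat N x i i\<bar> \<or>
      \<delta> \<le> \<bar>dot J (gmat N x i) (gmat N x i) - real (card J) / (4 * real N)\<bar>}"
  have comp: "(\<lambda>x. x (k, l)) \<in> borel_measurable (gaussP K)" if "(k, l) \<in> K" for k l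
    using that by simp
  have gm: "(\<lambda>x. gmat N x i j) \<in> borel_measurable (gaussP K)" if "j \<in> insert i J" for j
    unfolding gmat_def using that i
    by (intro borel_measurable_divide borel_measurable_add comp borel_measurable_const) (auto simp: K_def)
  have "(\<lambda>x. dot J (gmat N x i) (gmat N x i)) \<in> borel_measurable (gaussP K)"
    unfolding dot_def using gm by (intro borel_measurable_sum borel_measurable_times) auto
  then have E_sets: "?E \<in> sets (gaussP K)" using gm[of i] by measurable
  have key: "indicator ?E x \<le> (indicator (A \<union> B) (pair_rotation i J x) :: ennreal)" if x: "x \<in> space (gaussP K)" for x
  proof (cases "x \<in> ?E")
    case True
    let ?y = "pair_rotation i J x"
    have y: "?y \<in> space (gaussP K)" using T_space x by (simp add: space_gaussP)
    have "gmat N x i i = ?y (i, i) / sqrt (2 * real N)"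
      using i by (simp add: gmat_def pair_rotation_def)
    then have a: "\<bar>gmat N x i i\<bar> = \<bar>?y (i, i)\<bar> / sqrt (2 * real N)" by simp
    have "gmat N x i j * gmat N x i j = (?y (i, j))\<^sup>2 / (4 * N)" if "j \<in> J" for j
    proof -
      have "?y (i, j) = (x (i, j) + x (j, i)) / sqrt 2" using i that by (auto simp: pair_rotation_def)
      then have "gmat N x i j = ?y (i, j) / (2 * sqrt N)"
        using N by (simp add: gmat_def real_sqrt_mult field_simps)
      then show ?thesis by (simp add: power2_eq_square field_simps)
    qed
    then have "dot J (gmat N x i) (gmat N x i) = (\<Sum>j\<in>J. (?y (i, j))\<^sup>2) / (4 * N)"
      by (simp add: dot_def sum_divide_distrib)
    moreover have "(\<Sum>k\<in>?S. (?y k)\<^sup>2 - 1) = (\<Sum>j\<in>J. (?y (i, j))\<^sup>2) - card J"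
      by (subst sum.reindex) (simp_all add: inj_on_def sum_subtractf)
    ultimately have "dot J (gmat N x i) (gmat N x i) - real (card J) / (4 * real N) = (\<Sum>k\<in>?S. (?y k)\<^sup>2 - 1) / (4 * N)"
      by (simp add: diff_divide_distrib)
    then have b: "\<bar>dot J (gmat N x i) (gmat N x i) - real (card J) / (4 * real N)\<bar> = \<bar>\<Sum>k\<in>?S. (?y k)\<^sup>2 - 1\<bar> / (4 * N)"
      by simp
    have "\<delta> \<le> \<bar>gmat N x i i\<bar> \<or> \<delta> \<le> \<bar>dot J (gmat N x i) (gmat N x i) - real (card J) / (4 * real N)\<bar>" using True by simp
    then have "?y \<in> A \<union> B"
      unfolding A_def B_def a b using y N by (auto simp: field_simps)
    then show ?thesis by (simp add: indicator_def)
  next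
    case False
    then have "indicator ?E x = (0 :: ennreal)" by (rule indicator_simps(2))
    then show ?thesis by (simp only: zero_le)
  qed
  have "emeasure (gaussP K) ?E = (\<integral>\<^sup>+x. indicator ?E x \<partial>gaussP K)" using E_sets by simp
  also have "\<dots> \<le> (\<integral>\<^sup>+x. indicator (A \<union> B) (pair_rotation i J x) \<partial>gaussP K)"
    by (intro nn_integral_mono key)
  also have "\<dots> = (\<integral>\<^sup>+x. indicator (A \<union> B) x \<partial>gaussP K)"
    using sets.Un[OF A_sets B_sets] unfolding sets_gaussP
    by (intro nn_integral_gaussP borel_measurable_indicator)
  also have "\<dots> = emeasure (gaussP K) (A \<union> B)" by simp
  also have "\<dots> \<le> emeasure (gaussP K) A + emeasure (gaussP K) B"
    by (rule emeasure_subadditive) measurable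
  also have "\<dots> \<le> ennreal (2 * exp (- \<delta>\<^sup>2 * N / 2)) + ennreal (2 * exp (- \<delta>\<^sup>2 * N))"
    unfolding A_def B_def
    by (intro add_mono gauss_tail chi_square_concentration fin iK S(1)) (use N \<delta> S(2) in auto)
  also have "\<dots> \<le> ennreal (4 * exp (- \<delta>\<^sup>2 * N / 2))"
  proof -
    have "exp (- \<delta>\<^sup>2 * N) \<le> exp (- \<delta>\<^sup>2 * N / 2)" by simp
    then show ?thesis by (simp add: ennreal_leI flip: ennreal_plus)
  qed
  finally show ?thesis .
qed

text \<open>Fubini over the cross of row and column \<open>i\<close> and the remaining block. The
  cross fixes the unit direction \<open>v\<close> of the row; the block is independent of it, so a
  bound \<open>p\<close> for each fixed \<open>v\<close> is enough. Outside the exceptional rows,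
  membership in \<open>S\<close> forces the block into \<open>B v\<close>.\<close>

lemma row_step:
  fixes J :: "'i set"
  assumes fin: "finite J" and i: "i \<notin> J" and J: "J \<noteq> {}" and N: "card J \<le> N" "0 < N" and \<delta>: "0 < \<delta>" "\<delta> \<le> 1 / 2"
  defines "I \<equiv> insert i J"
  assumes S: "S \<in> sets (gaussP (I \<times> I))"
    and B: "\<And>v. dot J v v = 1 \<Longrightarrow> B v \<in> sets (gaussP (J \<times> J))"
    and p: "\<And>v. dot J v v = 1 \<Longrightarrow> emeasure (gaussP (J \<times> J)) (B v) \<le> p"
    and imp: "\<And>g v. g \<in> S \<Longrightarrow> \<bar>gmat N g i i\<bar> \<le> \<delta> \<Longrightarrow>
      \<bar>dot J (gmat N g i) (gmat N g i) - real (card J) / (4 * real N)\<bar> \<le> \<delta> \<Longrightarrow> dot J v v = 1 \<Longrightarrow>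
      (\<And>j. j \<in> J \<Longrightarrow> gmat N g i j = sqrt (dot J (gmat N g i) (gmat N g i)) * v j) \<Longrightarrow>
      restrict g (J \<times> J) \<in> B v"
  shows "emeasure (gaussP (I \<times> I)) S \<le> ennreal (4 * exp (- \<delta>\<^sup>2 * N / 2)) + p"
proof -
  interpret product_sigma_finite "\<lambda>_::'i \<times> 'i. std_gauss" by (rule product_sigma_finite_gauss)
  define K where "K = I \<times> I - J \<times> J"
  interpret K: prob_space "gaussP K" by (rule prob_space_gaussP)
  interpret JJ: prob_space "gaussP (J \<times> J)" by (rule prob_space_gaussP)
  let ?E = "{x \<in> space (gaussP K). \<delta> \<le> \<bar>gmat N x i i\<bar> \<or>
      \<delta> \<le> \<bar>dot J (gmat N x i) (gmat N x i) - real (card J) / (4 * real N)\<bar>}"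
  have II: "K \<union> J \<times> J = I \<times> I" by (auto simp: K_def I_def)
  have E: "emeasure (gaussP K) ?E \<le> ennreal (4 * exp (- \<delta>\<^sup>2 * N / 2))"
    unfolding K_def I_def by (rule row_concentration[OF fin i N \<delta>])
  have comp: "(\<lambda>x. x (k, l)) \<in> borel_measurable (gaussP K)" if "(k, l) \<in> K" for k l
    using that by simp
  have gm: "(\<lambda>x. gmat N x i j) \<in> borel_measurable (gaussP K)" if "j \<in> insert i J" for j
    unfolding gmat_def using that i
    by (intro borel_measurable_divide borel_measurable_add comp borel_measurable_const) (auto simp: K_def I_def)
  have "(\<lambda>x. dot J (gmat N x i) (gmat N x i)) \<in> borel_measurable (gaussP K)"
    unfolding dot_def using gm by (intro borel_measurable_sum borel_measurable_times) auto
  then have E_sets [measurable]: "?E \<in> sets (gaussP K)" using gm[of i] by measurable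
  have key: "(\<integral>\<^sup>+y. indicator S (merge K (J \<times> J) (x, y)) \<partial>gaussP (J \<times> J)) \<le> indicator ?E x + p"
    if x: "x \<in> space (gaussP K)" for x
  proof (cases "x \<in> ?E")
    case True
    have "(\<integral>\<^sup>+y. indicator S (merge K (J \<times> J) (x, y)) \<partial>gaussP (J \<times> J)) \<le> (\<integral>\<^sup>+y. 1 \<partial>gaussP (J \<times> J))"
      by (intro nn_integral_mono) (simp add: indicator_def)
    then have "(\<integral>\<^sup>+y. indicator S (merge K (J \<times> J) (x, y)) \<partial>gaussP (J \<times> J)) \<le> 1"
      using JJ.emeasure_space_1 by simp
    also have "\<dots> \<le> indicator ?E x + p" using True by simp
    finally show ?thesis .
  next
    case False
    define r where "r = sqrt (dot J (gmat N x i) (gmat N x i))"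
    obtain j0 where j0: "j0 \<in> J" using J by blast
    \<comment> \<open>A vanishing row has no direction; any unit vector serves then, and its
      existence uses a point of \<open>J\<close>.\<close>
    define v where "v = (if r = 0 then unitv j0 else (\<lambda>j. 1 / r * gmat N x i j))"
    have v: "dot J v v = 1"
    proof (cases "r = 0")
      case True
      then show ?thesis using fin j0 by (simp add: v_def dot_unitv) (simp add: unitv_def)
    next
      case False
      have rr: "dot J (gmat N x i) (gmat N x i) = r * r" by (simp add: r_def dot_self_nonneg)
      have "v = (\<lambda>j. 1 / r * gmat N x i j)" using False by (simp only: v_def if_False)
      then have "dot J v v = 1 / r * (1 / r * (r * r))"
        by (simp only: dot_scale_left dot_scale_right rr)
      then show ?thesis using False by simp
    qed
    have rv: "gmat N x i j = r * v j" if "j \<in> J" for j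
    proof (cases "r = 0")
      case True
      then have "dot J (gmat N x i) (gmat N x i) = 0" by (simp add: r_def)
      then have "gmat N x i j = 0" by (rule dot_self_eq_0[OF fin _ that])
      then show ?thesis using True by simp
    next
      case False
      then show ?thesis unfolding v_def by simp
    qed
    have "indicator S (merge K (J \<times> J) (x, y)) \<le> (indicator (B v) y :: ennreal)" if y: "y \<in> space (gaussP (J \<times> J))" for y
    proof (cases "merge K (J \<times> J) (x, y) \<in> S")
      case True
      let ?g = "merge K (J \<times> J) (x, y)"
      have "(i, j) \<in> K" "(j, i) \<in> K" if "j \<in> I" for j using that i by (simp_all add: K_def I_def)
      then have g: "gmat N ?g i j = gmat N x i j" if "j \<in> I" for j
        using that by (simp add: gmat_def merge_def)
      then have dg: "dot J (gmat N ?g i) (gmat N ?g i) = dot J (gmat N x i) (gmat N x i)"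
        by (intro dot_cong) (auto simp: I_def)
      have "restrict ?g (J \<times> J) = y"
      proof
        fix p
        show "restrict ?g (J \<times> J) p = y p"
        proof (cases "p \<in> J \<times> J")
          case True
          then have "p \<notin> K" by (simp add: K_def)
          with True show ?thesis by (simp only: merge_def restrict_apply if_True if_False prod.case)
        next
          case False
          moreover have "y p = undefined" using y False unfolding space_PiM by (rule PiE_arb)
          ultimately show ?thesis by (simp only: restrict_apply if_False)
        qed
      qed
      moreover have "restrict ?g (J \<times> J) \<in> B v"
        using True False x v rv g by (intro imp) (auto simp: dg I_def r_def)
      ultimately show ?thesis by (simp add: indicator_def)
    qed simp
    then have "(\<integral>\<^sup>+y. indicator S (merge K (J \<times> J) (x, y)) \<partial>gaussP (J \<times> J)) \<le> (\<integral>\<^sup>+y. indicator (B v) y \<partial>gaussP (J \<times> J))"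
      by (intro nn_integral_mono)
    also have "\<dots> \<le> p" using B[OF v] p[OF v] by simp
    finally show ?thesis using add_increasing[of "indicator ?E x" "\<integral>\<^sup>+y. indicator S (merge K (J \<times> J) (x, y)) \<partial>gaussP (J \<times> J)" p] by simp
  qed
  have "emeasure (gaussP (I \<times> I)) S = (\<integral>\<^sup>+g. indicator S g \<partial>gaussP (K \<union> J \<times> J))"
    using S by (simp add: II)
  also have "\<dots> = (\<integral>\<^sup>+x. (\<integral>\<^sup>+y. indicator S (merge K (J \<times> J) (x, y)) \<partial>gaussP (J \<times> J)) \<partial>gaussP K)"
  proof (rule product_nn_integral_fold)
    show "K \<inter> J \<times> J = {}" by (auto simp: K_def)
    show "finite K" "finite (J \<times> J)" using fin by (simp_all add: K_def I_def)
    show "indicator S \<in> borel_measurable (gaussP (K \<union> J \<times> J))"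
      unfolding II using S by (rule borel_measurable_indicator)
  qed
  also have "\<dots> \<le> (\<integral>\<^sup>+x. indicator ?E x + p \<partial>gaussP K)"
    by (intro nn_integral_mono key)
  also have "\<dots> = emeasure (gaussP K) ?E + p"
    using K.emeasure_space_1 by (subst nn_integral_add) auto
  also have "\<dots> \<le> ennreal (4 * exp (- \<delta>\<^sup>2 * N / 2)) + p" using E by (rule add_right_mono)
  finally show ?thesis .
qed

section \<open>Removing one coordinate\<close>

lemma form_bound_cong:
  assumes "\<And>i. i \<in> I \<Longrightarrow> u i = u' i" "\<And>i j. i \<in> I \<Longrightarrow> j \<in> I \<Longrightarrow> A i j = A' i j"
  shows "form_bound I A L s u \<longleftrightarrow> form_bound I A' L s u'"
proof -
  have "dot I y (mv I A y) = dot I y (mv I A' y)" "dot I u y = dot I u' y" for y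
    using assms by (auto intro!: dot_cong mv_cong)
  then show ?thesis by (simp add: form_bound_def)
qed

lemma resolves_cong:
  assumes "\<And>i. i \<in> I \<Longrightarrow> u i = u' i" "\<And>i j. i \<in> I \<Longrightarrow> j \<in> I \<Longrightarrow> A i j = A' i j"
  shows "resolves I A z u y \<longleftrightarrow> resolves I A' z u' y"
proof -
  have "mv I A y i = mv I A' y i" if "i \<in> I" for i using assms that by (auto intro!: mv_cong)
  then show ?thesis using assms by (simp add: resolves_def)
qed

lemma form_bound_conjm_iff:
  assumes "finite I" "orth I Q"
  shows "form_bound I (conjm I Q A) L s (mv I Q u) \<longleftrightarrow> form_bound I A L s u"
proof
  have "form_bound I (conjm I Q (conjm I Q A)) L s (mv I Q (mv I Q u)) \<longleftrightarrow> form_bound I A L s u"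
    by (intro form_bound_cong orth_mv_mv conjm_conjm assms)
  moreover assume "form_bound I (conjm I Q A) L s (mv I Q u)"
  ultimately show "form_bound I A L s u" using form_bound_conjm[OF assms] by blast
qed (rule form_bound_conjm[OF assms])

text \<open>Both sides are continuous in \<open>y\<close>, so vectors with a common denominator
  suffice. The bound becomes countably many measurable conditions on the disorder.\<close>

lemma form_bound_countable:
  assumes fin: "finite I"
  shows "form_bound I A L s u \<longleftrightarrow> (\<forall>n::nat. \<forall>f\<in>I \<rightarrow>\<^sub>E (UNIV :: int set).
    \<bar>dot I (\<lambda>i. f i / real (Suc n)) (mv I A (\<lambda>i. f i / real (Suc n)))\<bar>
    \<le> L * dot I (\<lambda>i. f i / real (Suc n)) (\<lambda>i. f i / real (Suc n)) - s * (dot I u (\<lambda>i. f i / real (Suc n)))\<^sup>2)"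
    (is "_ \<longleftrightarrow> ?R")
proof
  assume "form_bound I A L s u"
  then show ?R by (simp add: form_bound_def)
next
  assume R: ?R
  show "form_bound I A L s u"
    unfolding form_bound_def
  proof
    fix y :: "'a \<Rightarrow> real"
    define f where "f n = (\<lambda>i\<in>I. \<lfloor>real (Suc n) * y i\<rfloor>)" for n
    define Y where "Y n i = real_of_int (f n i) / real (Suc n)" for n i
    have lim: "(\<lambda>n. Y n i) \<longlonglongrightarrow> y i" if "i \<in> I" for i
    proof (rule tendsto_sandwich)
      have "real (Suc n) * y i - 1 \<le> real_of_int (f n i)" "real_of_int (f n i) \<le> real (Suc n) * y i" for n
        using that by (simp_all add: f_def)
      then have "(real (Suc n) * y i - 1) / real (Suc n) \<le> Y n i" "Y n i \<le> (real (Suc n) * y i) / real (Suc n)" for n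
        unfolding Y_def by (intro divide_right_mono; simp)+
      then have "y i - 1 / real (Suc n) \<le> Y n i" "Y n i \<le> y i" for n
        by (simp_all add: diff_divide_distrib)
      then show "\<forall>\<^sub>F n in sequentially. y i - 1 / real (Suc n) \<le> Y n i" "\<forall>\<^sub>F n in sequentially. Y n i \<le> y i"
        by simp_all
      have "(\<lambda>n. 1 / real (Suc n)) \<longlonglongrightarrow> 0" using LIMSEQ_inverse_real_of_nat by (simp add: inverse_eq_divide)
      then show "(\<lambda>n. y i - 1 / real (Suc n)) \<longlonglongrightarrow> y i" using tendsto_diff[OF tendsto_const, of _ 0 sequentially "y i"] by simp
    qed simp
    have "\<bar>dot I (Y n) (mv I A (Y n))\<bar> \<le> L * dot I (Y n) (Y n) - s * (dot I u (Y n))\<^sup>2" for n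
    proof -
      have "f n \<in> I \<rightarrow>\<^sub>E UNIV" by (simp add: f_def)
      then show ?thesis unfolding Y_def[abs_def] by (rule R[rule_format])
    qed
    then show "\<bar>dot I y (mv I A y)\<bar> \<le> L * dot I y y - s * (dot I u y)\<^sup>2"
      unfolding dot_def mv_def
      by (intro LIMSEQ_le[of "\<lambda>n. \<bar>\<Sum>i\<in>I. Y n i * (\<Sum>j\<in>I. A i j * Y n j)\<bar>" _
        "\<lambda>n. L * (\<Sum>i\<in>I. Y n i * Y n i) - s * (\<Sum>i\<in>I. u i * Y n i)\<^sup>2"])
        (auto intro!: tendsto_intros lim)
  qed
qed

lemma gmat_component_measurable:
  "i \<in> I \<Longrightarrow> j \<in> I \<Longrightarrow> (\<lambda>g. gmat N g i j) \<in> borel_measurable (gaussP (I \<times> I))"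
  unfolding gmat_def by (intro borel_measurable_divide borel_measurable_add) simp_all

lemma form_bound_sets:
  assumes fin: "finite I"
  shows "{g \<in> space (gaussP (I \<times> I)). form_bound I (gmat N g) L s u} \<in> sets (gaussP (I \<times> I))"
proof -
  have q: "(\<lambda>g. dot I y (mv I (gmat N g) y)) \<in> borel_measurable (gaussP (I \<times> I))" for y
    unfolding dot_def mv_def
    by (intro borel_measurable_sum borel_measurable_times gmat_component_measurable) simp_all
  have count: "countable (I \<rightarrow>\<^sub>E (UNIV :: int set))" using fin by (intro countable_PiE) auto
  have "(I \<rightarrow>\<^sub>E (UNIV :: int set)) \<noteq> {}" by (simp add: PiE_eq_empty_iff)
  then have range: "range (from_nat_into (I \<rightarrow>\<^sub>E UNIV)) = (I \<rightarrow>\<^sub>E (UNIV :: int set))"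
    using count by (rule range_from_nat_into)
  have all: "(\<forall>f\<in>I \<rightarrow>\<^sub>E (UNIV :: int set). P f) \<longleftrightarrow> (\<forall>m. P (from_nat_into (I \<rightarrow>\<^sub>E UNIV) m))" for P
    by (subst range[symmetric]) simp
  show ?thesis
    unfolding form_bound_countable[OF fin] all
    by (rule sets.sets_Collect_countable_All, rule sets.sets_Collect_countable_All, rule borel_measurable_le)
      (intro borel_measurable_abs borel_measurable_const q)+
qed

text \<open>The constants are the balance 2 s + \<delta> = L at s = 1 / 2 + \<delta>: here 1 / 2 is
  the limiting length of a row and 1 the edge of the limiting spectrum.\<close>

definition bad_norm :: "real \<Rightarrow> 'i set \<Rightarrow> ('i \<Rightarrow> real) \<Rightarrow> ('i \<Rightarrow> 'i \<Rightarrow> real) \<Rightarrow> bool" where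
  "bad_norm \<delta> I u A \<longleftrightarrow> \<not> form_bound I A (1 + 3 * \<delta>) (1 / 2 + \<delta>) u"

text \<open>Off \<open>bad_norm\<close>, and for \<open>z\<close> beyond the form bound, the
  resolvent vector exists and is unique, so the existential speaks of one vector; as a formula it is
  invariant under rotations.\<close>

definition bad_rho ::
  "real \<Rightarrow> real \<Rightarrow> real \<Rightarrow> real \<Rightarrow> 'i set \<Rightarrow> ('i \<Rightarrow> real) \<Rightarrow> ('i \<Rightarrow> 'i \<Rightarrow> real) \<Rightarrow> bool" where
  "bad_rho \<delta> z c e I u A \<longleftrightarrow> bad_norm \<delta> I u A \<or> (\<exists>y. resolves I A z u y \<and> e < \<bar>dot I u y - c\<bar>)"

definition bad_kappa ::
  "real \<Rightarrow> real \<Rightarrow> real \<Rightarrow> real \<Rightarrow> real \<Rightarrow> 'i set \<Rightarrow> ('i \<Rightarrow> real) \<Rightarrow> ('i \<Rightarrow> 'i \<Rightarrow> real) \<Rightarrow> bool" where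
  "bad_kappa \<delta> z z' c e I u A \<longleftrightarrow> bad_norm \<delta> I u A \<or>
    (\<exists>y y'. resolves I A z u y \<and> resolves I A z' u y' \<and> e < \<bar>dot I y y' - c\<bar>)"

definition event :: "nat \<Rightarrow> 'i set \<Rightarrow> ('i \<Rightarrow> real) \<Rightarrow> ('i set \<Rightarrow> ('i \<Rightarrow> real) \<Rightarrow> ('i \<Rightarrow> 'i \<Rightarrow> real) \<Rightarrow> bool) \<Rightarrow> ('i \<times> 'i \<Rightarrow> real) set"
  where "event N I u B = {g \<in> space (gaussP (I \<times> I)). B I u (gmat N g)}"

text \<open>What the removal of a coordinate asks of an event: measurability, invariance under
  conjugation, and dependence on the values over \<open>I\<close> alone. With \<open>I\<close> as a
  parameter the same event makes sense for submatrices.\<close>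

definition admissible :: "('i set \<Rightarrow> ('i \<Rightarrow> real) \<Rightarrow> ('i \<Rightarrow> 'i \<Rightarrow> real) \<Rightarrow> bool) \<Rightarrow> bool" where
  "admissible B \<longleftrightarrow>
    (\<forall>N I u. finite I \<longrightarrow> event N I u B \<in> sets (gaussP (I \<times> I))) \<and>
    (\<forall>I Q u A. finite I \<longrightarrow> orth I Q \<longrightarrow> B I u A \<longrightarrow> B I (mv I Q u) (conjm I Q A)) \<and>
    (\<forall>I u u' A A'. (\<forall>i\<in>I. u i = u' i) \<longrightarrow> (\<forall>i\<in>I. \<forall>j\<in>I. A i j = A' i j) \<longrightarrow> B I u A \<longrightarrow> B I u' A')"

lemma admissible_sets: "admissible B \<Longrightarrow> finite I \<Longrightarrow> event N I u B \<in> sets (gaussP (I \<times> I))"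
  by (simp add: admissible_def)

lemma admissible_cong:
  assumes "admissible B" "\<And>i. i \<in> I \<Longrightarrow> u i = u' i" "\<And>i j. i \<in> I \<Longrightarrow> j \<in> I \<Longrightarrow> A i j = A' i j" "B I u A"
  shows "B I u' A'"
proof -
  have "\<forall>I u u' A A'. (\<forall>i\<in>I. u i = u' i) \<longrightarrow> (\<forall>i\<in>I. \<forall>j\<in>I. A i j = A' i j) \<longrightarrow> B I u A \<longrightarrow> B I u' A'"
    using assms(1) unfolding admissible_def by (elim conjE)
  from this[rule_format, OF assms(2-4)] show ?thesis .
qed

section \<open>Admissibility of the bad events\<close>

lemma admissible_bad_norm: "admissible (bad_norm \<delta> :: 'i set \<Rightarrow> _)"
  unfolding admissible_def
proof (intro conjI allI impI)
  fix N and I :: "'i set" and u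
  assume fin: "finite I"
  have "event N I u (bad_norm \<delta>) = space (gaussP (I \<times> I)) -
    {g \<in> space (gaussP (I \<times> I)). form_bound I (gmat N g) (1 + 3 * \<delta>) (1 / 2 + \<delta>) u}"
    by (auto simp: event_def bad_norm_def)
  then show "event N I u (bad_norm \<delta>) \<in> sets (gaussP (I \<times> I))"
    using form_bound_sets[OF fin] by (simp only:) (intro sets.Diff sets.top)
next
  fix I :: "'i set" and Q u A
  assume "finite I" "orth I Q" "bad_norm \<delta> I u A"
  then show "bad_norm \<delta> I (mv I Q u) (conjm I Q A)" by (simp add: bad_norm_def form_bound_conjm_iff)
next
  fix I :: "'i set" and u u' A A'
  assume "\<forall>i\<in>I. u i = u' i" "\<forall>i\<in>I. \<forall>j\<in>I. A i j = A' i j" "bad_norm \<delta> I u A"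
  then show "bad_norm \<delta> I u' A'" unfolding bad_norm_def using form_bound_cong[of I u u' A A'] by blast
qed

lemma bad_kappa_mono: "e' \<le> e \<Longrightarrow> bad_kappa \<delta> z z' c e I u A \<Longrightarrow> bad_kappa \<delta> z z' c e' I u A"
  unfolding bad_kappa_def by fastforce

lemma bad_rho_mono: "e' \<le> e \<Longrightarrow> bad_rho \<delta> z c e I u A \<Longrightarrow> bad_rho \<delta> z c e' I u A"
  unfolding bad_rho_def by fastforce

text \<open>The shifted matrix is positive definite as soon as the form bound holds in some
  direction, so one measurable vector serves all directions \<open>u'\<close>; elsewhere its value
  is arbitrary.\<close>

lemma measurable_resolvent:
  assumes "finite I" "1 + 3 * \<delta> < z" "0 \<le> \<delta>"
  shows "\<exists>y. (\<forall>i\<in>I. (\<lambda>g. y g i) \<in> borel_measurable (gaussP (I \<times> I))) \<and>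
    (\<forall>g u'. form_bound I (gmat N g) (1 + 3 * \<delta>) (1 / 2 + \<delta>) u' \<longrightarrow> resolves I (gmat N g) z u (y g))"
proof -
  have "(\<lambda>g. shifted z (gmat N g) i j) \<in> borel_measurable (gaussP (I \<times> I))" if "i \<in> I" "j \<in> I" for i j
    unfolding shifted_def using that by (intro borel_measurable_diff gmat_component_measurable) simp_all
  then obtain y where "\<forall>i\<in>I. (\<lambda>g. y g i) \<in> borel_measurable (gaussP (I \<times> I))"
    "\<forall>g. pos_def I (shifted z (gmat N g)) \<longrightarrow> (\<forall>i\<in>I. mv I (shifted z (gmat N g)) (y g) i = u i)"
    using measurable_solution[OF assms(1), of "\<lambda>g. shifted z (gmat N g)" "gaussP (I \<times> I)" "\<lambda>_. u"] by auto
  then show ?thesis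
    using form_bound_pos_def[OF assms(1) symm_on_gmat] assms by (auto simp: resolves_iff_shifted)
qed

text \<open>Uniqueness off \<open>bad_norm\<close> replaces the existential by the measurable
  solution. Invariance holds because rotations carry resolvents to resolvents and preserve inner
  products.\<close>

lemma admissible_bad_kappa:
  assumes z: "1 + 3 * \<delta> < z" "1 + 3 * \<delta> < z'" and \<delta>: "0 \<le> \<delta>"
  shows "admissible (bad_kappa \<delta> z z' c e :: 'i set \<Rightarrow> _)"
  unfolding admissible_def
proof (intro conjI allI impI)
  fix N and I :: "'i set" and u
  assume fin: "finite I"
  let ?M = "gaussP (I \<times> I)"
  obtain y where y: "\<forall>i\<in>I. (\<lambda>g. y g i) \<in> borel_measurable ?M"
    "\<And>g u'. form_bound I (gmat N g) (1 + 3 * \<delta>) (1 / 2 + \<delta>) u' \<Longrightarrow> resolves I (gmat N g) z u (y g)"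
    using measurable_resolvent[OF fin z(1) \<delta>] by blast
  obtain y' where y': "\<forall>i\<in>I. (\<lambda>g. y' g i) \<in> borel_measurable ?M"
    "\<And>g u'. form_bound I (gmat N g) (1 + 3 * \<delta>) (1 / 2 + \<delta>) u' \<Longrightarrow> resolves I (gmat N g) z' u (y' g)"
    using measurable_resolvent[OF fin z(2) \<delta>] by blast
  have "event N I u (bad_kappa \<delta> z z' c e)
    = event N I u (bad_norm \<delta>) \<union> {g \<in> space ?M. e < \<bar>dot I (y g) (y' g) - c\<bar>}"
  proof (intro set_eqI iffI)
    fix g assume g: "g \<in> event N I u (bad_kappa \<delta> z z' c e)"
    show "g \<in> event N I u (bad_norm \<delta>) \<union> {g \<in> space ?M. e < \<bar>dot I (y g) (y' g) - c\<bar>}"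
    proof (cases "bad_norm \<delta> I u (gmat N g)")
      case False
      then have fb: "form_bound I (gmat N g) (1 + 3 * \<delta>) (1 / 2 + \<delta>) u" by (simp add: bad_norm_def)
      from False g obtain w w' where w: "resolves I (gmat N g) z u w" "resolves I (gmat N g) z' u w'"
        "e < \<bar>dot I w w' - c\<bar>" by (auto simp: event_def bad_kappa_def)
      have "dot I w w' = dot I (y g) (y' g)"
        using resolves_unique[OF fin symm_on_gmat fb z(1) _ w(1) y(2)[OF fb]]
          resolves_unique[OF fin symm_on_gmat fb z(2) _ w(2) y'(2)[OF fb]] \<delta>
        by (intro dot_cong) simp_all
      then show ?thesis using w g by (simp add: event_def)
    qed (use g in \<open>simp add: event_def\<close>)
  next
    fix g assume g: "g \<in> event N I u (bad_norm \<delta>) \<union> {g \<in> space ?M. e < \<bar>dot I (y g) (y' g) - c\<bar>}"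
    then show "g \<in> event N I u (bad_kappa \<delta> z z' c e)"
      using y(2)[of g u] y'(2)[of g u] by (auto simp: event_def bad_kappa_def bad_norm_def)
  qed
  moreover have "(\<lambda>g. dot I (y g) (y' g)) \<in> borel_measurable ?M"
    unfolding dot_def using y(1) y'(1) by (intro borel_measurable_sum borel_measurable_times) auto
  then have "{g \<in> space ?M. e < \<bar>dot I (y g) (y' g) - c\<bar>} \<in> sets ?M" by measurable
  ultimately show "event N I u (bad_kappa \<delta> z z' c e) \<in> sets ?M"
    using admissible_sets[OF admissible_bad_norm fin] by auto
next
  fix I :: "'i set" and Q u A
  assume Q: "finite I" "orth I Q" and bad: "bad_kappa \<delta> z z' c e I u A"
  show "bad_kappa \<delta> z z' c e I (mv I Q u) (conjm I Q A)"
  proof (cases "bad_norm \<delta> I u A")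
    case True
    then show ?thesis using Q by (simp add: bad_kappa_def bad_norm_def form_bound_conjm_iff)
  next
    case False
    then obtain y y' where "resolves I A z u y" "resolves I A z' u y'" "e < \<bar>dot I y y' - c\<bar>"
      using bad by (auto simp: bad_kappa_def)
    then have "resolves I (conjm I Q A) z (mv I Q u) (mv I Q y)" "resolves I (conjm I Q A) z' (mv I Q u) (mv I Q y')"
      "e < \<bar>dot I (mv I Q y) (mv I Q y') - c\<bar>" using Q by (simp_all add: resolves_conjm orth_dot)
    then show ?thesis unfolding bad_kappa_def by blast
  qed
next
  fix I :: "'i set" and u u' A A'
  assume "\<forall>i\<in>I. u i = u' i" "\<forall>i\<in>I. \<forall>j\<in>I. A i j = A' i j" and bad: "bad_kappa \<delta> z z' c e I u A"
  then have "resolves I A z u y \<longleftrightarrow> resolves I A' z u' y" "bad_norm \<delta> I u A \<longleftrightarrow> bad_norm \<delta> I u' A'" for z y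
    unfolding bad_norm_def by (intro resolves_cong form_bound_cong arg_cong[of _ _ Not]; simp)+
  then show "bad_kappa \<delta> z z' c e I u' A'"
    using bad unfolding bad_kappa_def by simp
qed

lemma admissible_bad_rho:
  assumes z: "1 + 3 * \<delta> < z" and \<delta>: "0 \<le> \<delta>"
  shows "admissible (bad_rho \<delta> z c e :: 'i set \<Rightarrow> _)"
  unfolding admissible_def
proof (intro conjI allI impI)
  fix N and I :: "'i set" and u
  assume fin: "finite I"
  let ?M = "gaussP (I \<times> I)"
  obtain y where y: "\<forall>i\<in>I. (\<lambda>g. y g i) \<in> borel_measurable ?M"
    "\<And>g u'. form_bound I (gmat N g) (1 + 3 * \<delta>) (1 / 2 + \<delta>) u' \<Longrightarrow> resolves I (gmat N g) z u (y g)"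
    using measurable_resolvent[OF fin z \<delta>] by blast
  have "event N I u (bad_rho \<delta> z c e)
    = event N I u (bad_norm \<delta>) \<union> {g \<in> space ?M. e < \<bar>dot I u (y g) - c\<bar>}"
  proof (intro set_eqI iffI)
    fix g assume g: "g \<in> event N I u (bad_rho \<delta> z c e)"
    show "g \<in> event N I u (bad_norm \<delta>) \<union> {g \<in> space ?M. e < \<bar>dot I u (y g) - c\<bar>}"
    proof (cases "bad_norm \<delta> I u (gmat N g)")
      case False
      then have fb: "form_bound I (gmat N g) (1 + 3 * \<delta>) (1 / 2 + \<delta>) u" by (simp add: bad_norm_def)
      from False g obtain w where w: "resolves I (gmat N g) z u w" "e < \<bar>dot I u w - c\<bar>"
        by (auto simp: event_def bad_rho_def)
      have "dot I u w = dot I u (y g)"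
        using resolves_unique[OF fin symm_on_gmat fb z _ w(1) y(2)[OF fb]] \<delta>
        by (intro dot_cong) simp_all
      then show ?thesis using w g by (simp add: event_def)
    qed (use g in \<open>simp add: event_def\<close>)
  next
    fix g assume g: "g \<in> event N I u (bad_norm \<delta>) \<union> {g \<in> space ?M. e < \<bar>dot I u (y g) - c\<bar>}"
    then show "g \<in> event N I u (bad_rho \<delta> z c e)"
      using y(2)[of g u] by (auto simp: event_def bad_rho_def bad_norm_def)
  qed
  moreover have "(\<lambda>g. dot I u (y g)) \<in> borel_measurable ?M"
    unfolding dot_def using y(1) by (intro borel_measurable_sum borel_measurable_times) auto
  then have "{g \<in> space ?M. e < \<bar>dot I u (y g) - c\<bar>} \<in> sets ?M" by measurable
  ultimately show "event N I u (bad_rho \<delta> z c e) \<in> sets ?M"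
    using admissible_sets[OF admissible_bad_norm fin] by auto
next
  fix I :: "'i set" and Q u A
  assume Q: "finite I" "orth I Q" and bad: "bad_rho \<delta> z c e I u A"
  show "bad_rho \<delta> z c e I (mv I Q u) (conjm I Q A)"
  proof (cases "bad_norm \<delta> I u A")
    case True
    then show ?thesis using Q by (simp add: bad_rho_def bad_norm_def form_bound_conjm_iff)
  next
    case False
    then obtain y where "resolves I A z u y" "e < \<bar>dot I u y - c\<bar>"
      using bad by (auto simp: bad_rho_def)
    then have "resolves I (conjm I Q A) z (mv I Q u) (mv I Q y)"
      "e < \<bar>dot I (mv I Q u) (mv I Q y) - c\<bar>" using Q by (simp_all add: resolves_conjm orth_dot)
    then show ?thesis unfolding bad_rho_def by blast
  qed
next
  fix I :: "'i set" and u u' A A'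
  assume u: "\<forall>i\<in>I. u i = u' i" "\<forall>i\<in>I. \<forall>j\<in>I. A i j = A' i j" and bad: "bad_rho \<delta> z c e I u A"
  then have "resolves I A z u y \<longleftrightarrow> resolves I A' z u' y" "bad_norm \<delta> I u A \<longleftrightarrow> bad_norm \<delta> I u' A'" for z y
    unfolding bad_norm_def by (intro resolves_cong form_bound_cong arg_cong[of _ _ Not]; simp)+
  moreover from u have "dot I u y = dot I u' y" for y by (intro dot_cong) simp_all
  ultimately show "bad_rho \<delta> z c e I u' A'"
    using bad unfolding bad_rho_def by simp
qed

lemma admissible_disj:
  assumes "admissible B" "admissible B'"
  shows "admissible (\<lambda>I u A. B I u A \<or> B' I u A)"
proof -
  have "event N I u (\<lambda>I u A. B I u A \<or> B' I u A) = event N I u B \<union> event N I u B'" for N I u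
    by (auto simp: event_def)
  moreover have "event N I u B \<union> event N I u B' \<in> sets (gaussP (I \<times> I))" if "finite I" for N I u
    using assms that by (intro sets.Un admissible_sets)
  ultimately show ?thesis
    using assms unfolding admissible_def by (elim conjE, intro conjI) simp_all
qed

lemma emeasure_event_rotate:
  assumes B: "admissible B" and fin: "finite I" and "dot I u u = dot I v v"
  shows "emeasure (gaussP (I \<times> I)) (event N I u B) \<le> emeasure (gaussP (I \<times> I)) (event N I v B)"
  unfolding event_def
proof (rule emeasure_rotate[OF fin assms(3)])
  show "{g \<in> space (gaussP (I \<times> I)). B I u (gmat N g)} \<in> sets (gaussP (I \<times> I))" for u
    using admissible_sets[OF B fin] by (simp add: event_def)
  show "B I (mv I Q u) (conjm I Q A)" if "orth I Q" "B I u A" for Q u A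
    using B that fin by (auto simp: admissible_def)
qed (rule admissible_cong[OF B])

text \<open>One removal: \<open>u\<close> is rotated to the basis vector at \<open>i\<close>, then
  row \<open>i\<close> is conditioned on. The implication to be supplied is deterministic: for a
  typical row, \<open>B'\<close> at the basis vector entails \<open>B\<close> for the smaller matrix
  in the direction of that row.\<close>

lemma event_step:
  fixes J :: "'i set"
  assumes adm: "admissible B" "admissible B'"
    and fin: "finite J" and i: "i \<notin> J" and J: "J \<noteq> {}" and N: "card J \<le> N" "0 < N" and \<delta>: "0 < \<delta>" "\<delta> \<le> 1 / 2"
    and u: "dot (insert i J) u u = 1"
    and p: "\<And>v. dot J v v = 1 \<Longrightarrow> emeasure (gaussP (J \<times> J)) (event N J v B) \<le> p"
    and imp: "\<And>A v r. symm_on (insert i J) A \<Longrightarrow> \<bar>A i i\<bar> \<le> \<delta> \<Longrightarrow> 0 \<le> r \<Longrightarrow>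
      \<bar>r\<^sup>2 - real (card J) / (4 * real N)\<bar> \<le> \<delta> \<Longrightarrow> dot J v v = 1 \<Longrightarrow>
      (\<And>j. j \<in> J \<Longrightarrow> A i j = r * v j) \<Longrightarrow> B' (insert i J) (unitv i) A \<Longrightarrow> B J v A"
  shows "emeasure (gaussP (insert i J \<times> insert i J)) (event N (insert i J) u B') \<le> ennreal (4 * exp (- \<delta>\<^sup>2 * N / 2)) + p"
proof -
  let ?I = "insert i J"
  have finI: "finite ?I" using fin by simp
  have "dot ?I (unitv i) (unitv i) = 1" using finI by (simp add: dot_unitv) (simp add: unitv_def)
  then have "emeasure (gaussP (?I \<times> ?I)) (event N ?I u B') \<le> emeasure (gaussP (?I \<times> ?I)) (event N ?I (unitv i) B')"
    using u by (intro emeasure_event_rotate adm finI) simp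
  also have "\<dots> \<le> ennreal (4 * exp (- \<delta>\<^sup>2 * N / 2)) + p"
  proof (rule row_step[OF fin i J N \<delta>, where B = "\<lambda>v. event N J v B"])
    show "event N ?I (unitv i) B' \<in> sets (gaussP (?I \<times> ?I))" by (rule admissible_sets[OF adm(2) finI])
    show "event N J v B \<in> sets (gaussP (J \<times> J))" for v by (rule admissible_sets[OF adm(1) fin])
    show "emeasure (gaussP (J \<times> J)) (event N J v B) \<le> p" if "dot J v v = 1" for v using p that .
    fix g v
    assume g: "g \<in> event N ?I (unitv i) B'" and a: "\<bar>gmat N g i i\<bar> \<le> \<delta>"
      and r: "\<bar>dot J (gmat N g i) (gmat N g i) - real (card J) / (4 * real N)\<bar> \<le> \<delta>"
      and v: "dot J v v = 1" and row: "\<And>j. j \<in> J \<Longrightarrow> gmat N g i j = sqrt (dot J (gmat N g i) (gmat N g i)) * v j"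
    have "B J v (gmat N g)"
    proof (rule imp[OF symm_on_gmat a _ _ v row])
      show "0 \<le> sqrt (dot J (gmat N g i) (gmat N g i))" by (simp add: dot_self_nonneg)
      show "\<bar>(sqrt (dot J (gmat N g i) (gmat N g i)))\<^sup>2 - real (card J) / (4 * real N)\<bar> \<le> \<delta>"
        using r by (simp add: dot_self_nonneg)
      show "B' ?I (unitv i) (gmat N g)" using g by (simp add: event_def)
    qed
    then have "B J v (gmat N (restrict g (J \<times> J)))"
      by (rule admissible_cong[OF adm(1), rotated 2]) (simp_all add: gmat_def)
    moreover have "restrict g (J \<times> J) \<in> space (gaussP (J \<times> J))" by (auto simp: space_PiM)
    ultimately show "restrict g (J \<times> J) \<in> event N J v B" by (simp add: event_def)
  qed
  finally show ?thesis .
qed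

section \<open>The norm of the disorder\<close>

lemma bad_norm_insert:
  assumes "finite J" "i \<notin> J" "symm_on (insert i J) A" "\<bar>A i i\<bar> \<le> \<delta>" "0 \<le> r" "r\<^sup>2 \<le> 1 / 4 + \<delta>" "0 \<le> \<delta>"
    and "\<And>j. j \<in> J \<Longrightarrow> A i j = r * v j" and "bad_norm \<delta> (insert i J) (unitv i) A"
  shows "bad_norm \<delta> J v A"
proof (rule ccontr)
  assume "\<not> bad_norm \<delta> J v A"
  then have fb: "form_bound J A (1 + 3 * \<delta>) (1 / 2 + \<delta>) v" by (simp add: bad_norm_def)
  \<comment> \<open>A typical row is no longer than the rank-one coefficient 1 / 2 + \<delta>, which
    is what the insertion allows.\<close>
  have "r\<^sup>2 \<le> (1 / 2 + \<delta>)\<^sup>2" proof -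
    have "(1 / 2 + \<delta>)\<^sup>2 = 1 / 4 + \<delta> + \<delta>\<^sup>2" by (simp add: power2_eq_square algebra_simps)
    then show ?thesis using assms(6) zero_le_power2[of \<delta>] by linarith
  qed
  then have r_le: "r \<le> 1 / 2 + \<delta>" by (rule power2_le_imp_le) (use assms(7) in simp)
  have "2 * (1 / 2 + \<delta>) + \<delta> \<le> 1 + 3 * \<delta>" by simp
  from form_bound_insert[OF assms(1-3) fb assms(8,5) r_le assms(4) this]
  show False using assms(9) unfolding bad_norm_def by blast
qed

text \<open>Each removed coordinate costs the probability of an exceptional row, whence the factor
  \<open>card I\<close>. The union runs over coordinates and not over a net of directions, so the
  threshold 1 + 3 \<delta> can be taken arbitrarily close to 1.\<close>

lemma emeasure_bad_norm:
  assumes \<delta>: "0 < \<delta>" "\<delta> \<le> 1 / 2" and "finite I" "card I \<le> N" "dot I u u = 1"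
  shows "emeasure (gaussP (I \<times> I)) (event N I u (bad_norm \<delta>)) \<le> ennreal (card I * (4 * exp (- \<delta>\<^sup>2 * N / 2)))"
  using assms(3-)
proof (induction I arbitrary: u rule: finite_induct)
  case empty
  then show ?case by (simp add: dot_def)
next
  case (insert i J u)
  let ?c = "4 * exp (- \<delta>\<^sup>2 * N / 2)"
  have N: "card J \<le> N" "0 < N" using insert by auto
  show ?case
  proof (cases "J = {}")
    \<comment> \<open>With a single coordinate no block remains to carry a unit vector; here the
      diagonal entry is the whole matrix.\<close>
    case True
    let ?K = "insert i J \<times> insert i J - J \<times> J"
    have K: "insert i J \<times> insert i J = ?K" using True by simp
    have "dot {i} (unitv i) (unitv i) = 1" by (simp add: dot_def unitv_def)
    then have "emeasure (gaussP (insert i J \<times> insert i J)) (event N (insert i J) u (bad_norm \<delta>))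
      \<le> emeasure (gaussP (insert i J \<times> insert i J)) (event N (insert i J) (unitv i) (bad_norm \<delta>))"
      using insert.prems insert.hyps True by (intro emeasure_event_rotate admissible_bad_norm) simp_all
    also have "\<dots> \<le> emeasure (gaussP ?K) {x \<in> space (gaussP ?K). \<delta> * sqrt (2 * real N) \<le> \<bar>x (i, i)\<bar>}"
      unfolding K[symmetric]
    proof (rule emeasure_mono)
      show "event N (insert i J) (unitv i) (bad_norm \<delta>)
        \<subseteq> {x \<in> space (gaussP (insert i J \<times> insert i J)). \<delta> * sqrt (2 * real N) \<le> \<bar>x (i, i)\<bar>}"
      proof
        fix g assume g: "g \<in> event N (insert i J) (unitv i) (bad_norm \<delta>)"
        \<comment> \<open>Over the empty block the form bound reads 0 \<le> 0, so the insertion with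
          r = 0 applies.\<close>
        have "\<not> \<bar>gmat N g i i\<bar> \<le> \<delta>"
        proof
          assume "\<bar>gmat N g i i\<bar> \<le> \<delta>"
          moreover have "bad_norm \<delta> (insert i {}) (unitv i) (gmat N g)" using g True by (simp add: event_def)
          ultimately have "bad_norm \<delta> {} (\<lambda>_. 0) (gmat N g)"
            using \<delta>(1) by (intro bad_norm_insert[where r = 0 and i = i and J = "{}"] symm_on_gmat) simp_all
          then show False by (simp add: bad_norm_def form_bound_def dot_def)
        qed
        moreover have "gmat N g i i = g (i, i) / sqrt (2 * real N)" by (simp add: gmat_def)
        ultimately have "\<delta> < \<bar>g (i, i)\<bar> / sqrt (2 * real N)" by simp
        then have "\<delta> * sqrt (2 * real N) \<le> \<bar>g (i, i)\<bar>" using N by (simp add: pos_less_divide_eq)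
        then show "g \<in> {x \<in> space (gaussP (insert i J \<times> insert i J)). \<delta> * sqrt (2 * real N) \<le> \<bar>x (i, i)\<bar>}"
          using g by (simp add: event_def)
      qed
      show "{x \<in> space (gaussP (insert i J \<times> insert i J)). \<delta> * sqrt (2 * real N) \<le> \<bar>x (i, i)\<bar>}
        \<in> sets (gaussP (insert i J \<times> insert i J))"
      proof -
        have [measurable]: "(\<lambda>x. x (i, i)) \<in> borel_measurable (gaussP (insert i J \<times> insert i J))" by simp
        show ?thesis by measurable
      qed
    qed
    also have "\<dots> \<le> ennreal (2 * exp (- \<delta>\<^sup>2 * N / 2))"
      using insert.hyps \<delta> by (intro gauss_tail) auto
    also have "\<dots> \<le> ennreal (card (insert i J) * ?c)"
      using True by (intro ennreal_leI) simp
    finally show ?thesis .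
  next
    case False
    have "emeasure (gaussP (insert i J \<times> insert i J)) (event N (insert i J) u (bad_norm \<delta>)) \<le> ennreal ?c + ennreal (card J * ?c)"
    proof (rule event_step[OF admissible_bad_norm admissible_bad_norm insert.hyps False N \<delta> insert.prems(2)])
      show "emeasure (gaussP (J \<times> J)) (event N J v (bad_norm \<delta>)) \<le> ennreal (card J * ?c)" if "dot J v v = 1" for v
        using insert.IH[OF N(1) that] .
      fix A v r
      assume A: "symm_on (insert i J) A" "\<bar>A i i\<bar> \<le> \<delta>" "0 \<le> r" "\<bar>r\<^sup>2 - real (card J) / (4 * real N)\<bar> \<le> \<delta>"
        "\<And>j. j \<in> J \<Longrightarrow> A i j = r * v j" "bad_norm \<delta> (insert i J) (unitv i) A"
      have "real (card J) / (4 * real N) \<le> 1 / 4" using N by (simp add: field_simps)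
      then show "bad_norm \<delta> J v A"
        using A \<delta> insert.hyps by (intro bad_norm_insert[of J i A \<delta> r v]) auto
    qed
    also have "\<dots> = ennreal (card (insert i J) * ?c)"
      using insert.hyps by (simp add: distrib_right flip: ennreal_plus)
    finally show ?thesis .
  qed
qed

section \<open>Limits of the resolvent entries\<close>

text \<open>The normalisation \<open>N\<close> stays fixed when coordinates are removed; \<open>k\<close> counts the removed ones.\<close>

definition small :: "('i set \<Rightarrow> ('i \<Rightarrow> real) \<Rightarrow> ('i \<Rightarrow> 'i \<Rightarrow> real) \<Rightarrow> bool) \<Rightarrow> bool" where
  "small B \<longleftrightarrow> (\<forall>k. \<forall>\<eta>>0. \<exists>N0. \<forall>N\<ge>N0. \<forall>I u. finite I \<longrightarrow> card I + k = N \<longrightarrow> dot I u u = 1 \<longrightarrow>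
     emeasure (gaussP (I \<times> I)) (event N I u B) \<le> ennreal \<eta>)"

lemma small_mono:
  assumes "small B" "admissible B"
    and "\<And>I u A. finite I \<Longrightarrow> symm_on I A \<Longrightarrow> dot I u u = 1 \<Longrightarrow> B' I u A \<Longrightarrow> B I u A"
  shows "small B'"
  unfolding small_def
proof (intro allI impI)
  fix k and \<eta> :: real assume "\<eta> > 0"
  then obtain N0 where N0: "\<And>N I u. N \<ge> N0 \<Longrightarrow> finite I \<Longrightarrow> card I + k = N \<Longrightarrow> dot I u u = 1 \<Longrightarrow>
     emeasure (gaussP (I \<times> I)) (event N I u B) \<le> ennreal \<eta>"
    using assms(1) unfolding small_def by meson
  show "\<exists>N0. \<forall>N\<ge>N0. \<forall>I u. finite I \<longrightarrow> card I + k = N \<longrightarrow> dot I u u = 1 \<longrightarrow>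
     emeasure (gaussP (I \<times> I)) (event N I u B') \<le> ennreal \<eta>"
  proof (intro exI[of _ N0] allI impI)
    fix N and I :: "'a set" and u assume *: "N0 \<le> N" "finite I" "card I + k = N" "dot I u u = 1"
    have "event N I u B' \<subseteq> event N I u B"
      using assms(3)[OF *(2) symm_on_gmat *(4)] by (auto simp: event_def)
    then have "emeasure (gaussP (I \<times> I)) (event N I u B') \<le> emeasure (gaussP (I \<times> I)) (event N I u B)"
      by (intro emeasure_mono admissible_sets assms *)
    also have "\<dots> \<le> ennreal \<eta>" using N0 * by blast
    finally show "emeasure (gaussP (I \<times> I)) (event N I u B') \<le> ennreal \<eta>" .
  qed
qed

lemma small_disj:
  assumes "small B" "small B'" "admissible B" "admissible B'"
  shows "small (\<lambda>I u A. B I u A \<or> B' I u A)"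
  unfolding small_def
proof (intro allI impI)
  fix k and \<eta> :: real assume \<eta>: "\<eta> > 0"
  then have "\<eta> / 2 > 0" by simp
  then obtain N1 N2 where N1: "\<And>N I u. N \<ge> N1 \<Longrightarrow> finite I \<Longrightarrow> card I + k = N \<Longrightarrow> dot I u u = 1 \<Longrightarrow>
     emeasure (gaussP (I \<times> I)) (event N I u B) \<le> ennreal (\<eta> / 2)"
    and N2: "\<And>N I u. N \<ge> N2 \<Longrightarrow> finite I \<Longrightarrow> card I + k = N \<Longrightarrow> dot I u u = 1 \<Longrightarrow>
     emeasure (gaussP (I \<times> I)) (event N I u B') \<le> ennreal (\<eta> / 2)"
    using assms(1,2) unfolding small_def by meson
  show "\<exists>N0. \<forall>N\<ge>N0. \<forall>I u. finite I \<longrightarrow> card I + k = N \<longrightarrow> dot I u u = 1 \<longrightarrow>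
     emeasure (gaussP (I \<times> I)) (event N I u (\<lambda>I u A. B I u A \<or> B' I u A)) \<le> ennreal \<eta>"
  proof (intro exI[of _ "max N1 N2"] allI impI)
    fix N and I :: "'a set" and u assume *: "max N1 N2 \<le> N" "finite I" "card I + k = N" "dot I u u = 1"
    have "event N I u (\<lambda>I u A. B I u A \<or> B' I u A) = event N I u B \<union> event N I u B'"
      by (auto simp: event_def)
    then have "emeasure (gaussP (I \<times> I)) (event N I u (\<lambda>I u A. B I u A \<or> B' I u A))
      \<le> emeasure (gaussP (I \<times> I)) (event N I u B) + emeasure (gaussP (I \<times> I)) (event N I u B')"
      using admissible_sets[OF assms(3) *(2)] admissible_sets[OF assms(4) *(2)]
      by (simp add: emeasure_subadditive)
    also have "\<dots> \<le> ennreal (\<eta> / 2) + ennreal (\<eta> / 2)"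
      using * by (intro add_mono N1 N2) auto
    also have "\<dots> = ennreal \<eta>" using \<eta> by (simp flip: ennreal_plus)
    finally show "emeasure (gaussP (I \<times> I)) (event N I u (\<lambda>I u A. B I u A \<or> B' I u A)) \<le> ennreal \<eta>" .
  qed
qed

lemma small_bad_norm:
  assumes \<delta>: "0 < \<delta>" "\<delta> \<le> 1 / 2"
  shows "small (bad_norm \<delta> :: 'a set \<Rightarrow> _)"
  unfolding small_def
proof (intro allI impI)
  fix k and \<eta> :: real assume \<eta>: "\<eta> > 0"
  have "(\<lambda>N. real N * (4 * exp (- \<delta>\<^sup>2 * real N / 2))) \<longlonglongrightarrow> 0" using \<delta> by real_asymp
  then have "\<forall>\<^sub>F N in sequentially. real N * (4 * exp (- \<delta>\<^sup>2 * real N / 2)) < \<eta>"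
    using \<eta> by (rule order_tendstoD)
  then obtain N0 where N0: "\<And>N. N \<ge> N0 \<Longrightarrow> real N * (4 * exp (- \<delta>\<^sup>2 * real N / 2)) < \<eta>"
    unfolding eventually_sequentially by blast
  show "\<exists>N0. \<forall>N\<ge>N0. \<forall>(I :: 'a set) u. finite I \<longrightarrow> card I + k = N \<longrightarrow> dot I u u = 1 \<longrightarrow>
     emeasure (gaussP (I \<times> I)) (event N I u (bad_norm \<delta>)) \<le> ennreal \<eta>"
  proof (intro exI[of _ N0] allI impI)
    fix N and I :: "'a set" and u assume *: "N0 \<le> N" "finite I" "card I + k = N" "dot I u u = 1"
    have "emeasure (gaussP (I \<times> I)) (event N I u (bad_norm \<delta>)) \<le> ennreal (card I * (4 * exp (- \<delta>\<^sup>2 * N / 2)))"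
      using * by (intro emeasure_bad_norm \<delta>) auto
    also have "\<dots> \<le> ennreal \<eta>"
    proof (rule ennreal_leI)
      have "card I * (4 * exp (- \<delta>\<^sup>2 * N / 2)) \<le> N * (4 * exp (- \<delta>\<^sup>2 * N / 2))"
        using * by (intro mult_right_mono) auto
      also have "\<dots> \<le> \<eta>" using N0[OF *(1)] by simp
      finally show "card I * (4 * exp (- \<delta>\<^sup>2 * N / 2)) \<le> \<eta>" .
    qed
    finally show "emeasure (gaussP (I \<times> I)) (event N I u (bad_norm \<delta>)) \<le> ennreal \<eta>" .
  qed
qed

text \<open>Removal turns a deficit of k coordinates into k + 1, which is why smallness is asked for
  every fixed k. The squared row length is centred at 1 / 4 - (k + 1) / (4 N); for large
  \<open>N\<close> the correction is below \<delta>, whence the asymmetric window for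
  \<open>r\<^sup>2\<close>.\<close>

lemma small_step:
  assumes adm: "admissible B" "admissible B'" and small: "small B" and \<delta>: "0 < \<delta>" "\<delta> \<le> 1 / 2"
    and imp: "\<And>J i A v r. finite J \<Longrightarrow> i \<notin> J \<Longrightarrow> symm_on (insert i J) A \<Longrightarrow> \<bar>A i i\<bar> \<le> \<delta> \<Longrightarrow> 0 \<le> r \<Longrightarrow>
      r\<^sup>2 \<le> 1 / 4 + \<delta> \<Longrightarrow> 1 / 4 - 2 * \<delta> \<le> r\<^sup>2 \<Longrightarrow> dot J v v = 1 \<Longrightarrow>
      (\<And>j. j \<in> J \<Longrightarrow> A i j = r * v j) \<Longrightarrow> B' (insert i J) (unitv i) A \<Longrightarrow> B J v A"
  shows "small B'"
  unfolding small_def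
proof (intro allI impI)
  fix k and \<eta> :: real assume \<eta>: "\<eta> > 0"
  then have \<eta>2: "\<eta> / 2 > 0" by simp
  then obtain N1 where N1: "\<And>N I u. N \<ge> N1 \<Longrightarrow> finite I \<Longrightarrow> card I + Suc k = N \<Longrightarrow> dot I u u = 1 \<Longrightarrow>
     emeasure (gaussP (I \<times> I)) (event N I u B) \<le> ennreal (\<eta> / 2)"
    using small unfolding small_def by meson
  have "(\<lambda>N. 4 * exp (- \<delta>\<^sup>2 * real N / 2)) \<longlonglongrightarrow> 0" using \<delta> by real_asymp
  then have "\<forall>\<^sub>F N in sequentially. 4 * exp (- \<delta>\<^sup>2 * real N / 2) < \<eta> / 2"
    using \<eta>2 by (rule order_tendstoD)
  moreover have "(\<lambda>N. real (Suc k) / (4 * real N)) \<longlonglongrightarrow> 0" by real_asymp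
  then have "\<forall>\<^sub>F N in sequentially. real (Suc k) / (4 * real N) < \<delta>"
    using \<delta>(1) by (rule order_tendstoD)
  ultimately have "\<forall>\<^sub>F N in sequentially. 4 * exp (- \<delta>\<^sup>2 * real N / 2) < \<eta> / 2 \<and> real (Suc k) / (4 * real N) < \<delta>"
    by (rule eventually_conj)
  then obtain N2 where N2: "\<And>N. N \<ge> N2 \<Longrightarrow> 4 * exp (- \<delta>\<^sup>2 * real N / 2) < \<eta> / 2 \<and> real (Suc k) / (4 * real N) < \<delta>"
    unfolding eventually_sequentially by blast
  show "\<exists>N0. \<forall>N\<ge>N0. \<forall>I u. finite I \<longrightarrow> card I + k = N \<longrightarrow> dot I u u = 1 \<longrightarrow>
     emeasure (gaussP (I \<times> I)) (event N I u B') \<le> ennreal \<eta>"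
  proof (intro exI[of _ "max (k + 2) (max N1 N2)"] allI impI)
    fix N and I :: "'a set" and u assume *: "max (k + 2) (max N1 N2) \<le> N" "finite I" "card I + k = N" "dot I u u = 1"
    \<comment> \<open>The summand k + 2 in the threshold leaves at least two coordinates, so that a
      nonempty block remains after removal.\<close>
    then have "card I \<ge> 2" by auto
    then obtain i where i: "i \<in> I" by fastforce
    define J where "J = I - {i}"
    have J: "I = insert i J" "finite J" "i \<notin> J" "card J + Suc k = N"
      using i * by (auto simp: J_def card_Diff_singleton)
    have "card J \<ge> 1" using * J by auto
    then have ne: "J \<noteq> {}" by auto
    have "emeasure (gaussP (insert i J \<times> insert i J)) (event N (insert i J) u B')
      \<le> ennreal (4 * exp (- \<delta>\<^sup>2 * N / 2)) + ennreal (\<eta> / 2)"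
    proof (rule event_step[OF adm J(2,3) ne _ _ \<delta>])
      show "card J \<le> N" "0 < N" using J by auto
      show "dot (insert i J) u u = 1" using * J by simp
      show "emeasure (gaussP (J \<times> J)) (event N J v B) \<le> ennreal (\<eta> / 2)" if "dot J v v = 1" for v
        using N1 * J that by auto
      fix A v r
      assume A: "symm_on (insert i J) A" "\<bar>A i i\<bar> \<le> \<delta>" "0 \<le> r" "\<bar>r\<^sup>2 - real (card J) / (4 * real N)\<bar> \<le> \<delta>"
        "dot J v v = 1" "\<And>j. j \<in> J \<Longrightarrow> A i j = r * v j" "B' (insert i J) (unitv i) A"
      have "real (card J) = real N - real (Suc k)" using J(4) by simp
      then have "real (card J) / (4 * real N) = real N / (4 * real N) - real (Suc k) / (4 * real N)"
        by (simp only: diff_divide_distrib)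
      moreover have "real N / (4 * real N) = 1 / 4" using J(4) by auto
      ultimately have "real (card J) / (4 * real N) = 1 / 4 - real (Suc k) / (4 * real N)" by simp
      moreover have "real (Suc k) / (4 * real N) < \<delta>" "0 \<le> real (Suc k) / (4 * real N)" using N2 * by auto
      ultimately have "r\<^sup>2 \<le> 1 / 4 + \<delta>" "1 / 4 - 2 * \<delta> \<le> r\<^sup>2" using A(4) by linarith+
      from imp[OF J(2,3) A(1,2,3) this A(5,6,7)] show "B J v A" .
    qed
    also have "\<dots> \<le> ennreal (\<eta> / 2) + ennreal (\<eta> / 2)"
      using N2[of N] * by (intro add_mono ennreal_leI) auto
    also have "\<dots> = ennreal \<eta>" using \<eta> by (simp flip: ennreal_plus)
    finally show "emeasure (gaussP (I \<times> I)) (event N I u B') \<le> ennreal \<eta>" using J by simp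
  qed
qed

section \<open>Diagonal entries of the resolvent\<close>

lemma bad_rho_bad_norm: "bad_norm \<delta> I u A \<Longrightarrow> bad_rho \<delta> z c e I u A"
  by (simp add: bad_rho_def)

text \<open>Schur's formula against the fixed point 2 b (z - b / 2) = 1 gives y_i - 2 b = 2 b y_i
  (A_ii + r^2 \<rho> - b / 2). The a priori bound y_i \<le> 2 makes the old error \<open>e\<close>
  return as b e, a contraction.\<close>

lemma rho_step:
  fixes b :: real
  assumes z: "z = (b + 1 / b) / 2" and b: "0 < b" "b < 1" and \<delta>: "0 < \<delta>" "1 + 3 * \<delta> < z" and d: "0 < d" "d \<le> \<delta>"
    and J: "finite J" "i \<notin> J" "symm_on (insert i J) A" "\<bar>A i i\<bar> \<le> d" "0 \<le> r" "r\<^sup>2 \<le> 1 / 4 + d" "1 / 4 - 2 * d \<le> r\<^sup>2"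
    and row: "\<And>j. j \<in> J \<Longrightarrow> A i j = r * v j"
    and good: "\<not> bad_rho \<delta> z (2 * b) e J v A"
    and y: "resolves (insert i J) A z (unitv i) y"
  shows "\<not> bad_norm \<delta> (insert i J) (unitv i) A" "0 \<le> y i" "y i \<le> 2" "\<bar>y i - 2 * b\<bar> \<le> b * e + 20 * d"
proof -
  let ?I = "insert i J"
  have finI: "finite ?I" using J by simp
  have gJ: "\<not> bad_norm \<delta> J v A" using good bad_rho_bad_norm by blast
  then have fb: "form_bound J A (1 + 3 * \<delta>) (1 / 2 + \<delta>) v" by (simp add: bad_norm_def)
  show gI: "\<not> bad_norm \<delta> ?I (unitv i) A"
  proof
    assume bad: "bad_norm \<delta> ?I (unitv i) A"
    have "\<bar>A i i\<bar> \<le> \<delta>" "r\<^sup>2 \<le> 1 / 4 + \<delta>" "0 \<le> \<delta>" using J d \<delta> by auto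
    from bad_norm_insert[OF J(1-3) this(1) J(5) this(2,3) row bad] gJ show False by blast
  qed
  then have fbI: "form_bound ?I A (1 + 3 * \<delta>) (1 / 2 + \<delta>) (unitv i)" by (simp add: bad_norm_def)
  have s: "0 < 1 / 2 + \<delta>" "1 / (1 / 2 + \<delta>) \<le> 2" using \<delta> by (simp_all add: field_simps)
  have "dot ?I (unitv i) y = y i" using finI by (simp add: dot_unitv)
  then show yi: "0 \<le> y i" "y i \<le> 2"
    using resolves_dot_bounds[OF fbI y s(1) \<delta>(2)] s(2) by auto
  have symJ: "symm_on J A" using J(3) by (auto simp: symm_on_def)
  obtain Y where Y: "resolves J A z v Y"
    using ex_resolves[OF J(1) symJ fb \<delta>(2)] s(1) by auto
  define \<rho> where "\<rho> = dot J v Y"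
  have \<rho>: "0 \<le> \<rho>" "\<rho> \<le> 2" "\<bar>\<rho> - 2 * b\<bar> \<le> e"
    using resolves_dot_bounds[OF fb Y s(1) \<delta>(2)] s(2) good Y by (auto simp: \<rho>_def bad_rho_def not_less)
  have eq: "y i * (z - A i i - r\<^sup>2 * \<rho>) = 1"
    using resolves_insert(2)[OF J(1-3) fb \<delta>(2) less_imp_le[OF s(1)] row y Y] by (simp add: \<rho>_def)
  have zb: "2 * b * (z - b / 2) = 1" using b by (simp add: z field_simps)
  have "y i - 2 * b = y i * (2 * b * (z - b / 2)) - 2 * b * (y i * (z - A i i - r\<^sup>2 * \<rho>))"
    unfolding zb eq by simp
  also have "\<dots> = y i * (2 * b) * (A i i + r\<^sup>2 * \<rho> - b / 2)" by (simp add: algebra_simps)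
  finally have diff: "\<bar>y i - 2 * b\<bar> = y i * (2 * b) * \<bar>A i i + r\<^sup>2 * \<rho> - b / 2\<bar>"
    using yi b by (simp add: abs_mult)
  \<comment> \<open>The diagonal entry costs d, the replacement of r^2 by 1 / 4 costs at most 4 d,
    and what remains is a quarter of the old error.\<close>
  have "A i i + r\<^sup>2 * \<rho> - b / 2 = A i i + (r\<^sup>2 - 1 / 4) * \<rho> + (\<rho> - 2 * b) / 4"
    by (simp add: left_diff_distrib diff_divide_distrib)
  moreover have "\<bar>(r\<^sup>2 - 1 / 4) * \<rho>\<bar> \<le> (2 * d) * 2"
    unfolding abs_mult using J d \<rho> by (intro mult_mono) (auto simp: abs_le_iff)
  moreover have "\<bar>a + x + w / 4\<bar> \<le> 5 * d + e / 4" if "\<bar>a\<bar> \<le> d" "\<bar>x\<bar> \<le> 2 * d * 2" "\<bar>w\<bar> \<le> e" for a x w :: real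
    using that by linarith
  ultimately have "\<bar>A i i + r\<^sup>2 * \<rho> - b / 2\<bar> \<le> 5 * d + e / 4" using J(4) \<rho>(3) by metis
  then have "y i * (2 * b) * \<bar>A i i + r\<^sup>2 * \<rho> - b / 2\<bar> \<le> 2 * (2 * b) * (5 * d + e / 4)"
    using yi b by (intro mult_mono mult_nonneg_nonneg) auto
  also have "\<dots> = b * e + 20 * (b * d)" by (simp add: algebra_simps)
  also have "\<dots> \<le> b * e + 20 * d" using b d by simp
  finally show "\<bar>y i - 2 * b\<bar> \<le> b * e + 20 * d" using diff by simp
qed

text \<open>The error starts at 2, since \<rho> and 2 b both lie in [0, 2], and each removal
  multiplies it by (1 + b) / 2. The number of removals depends on \<open>b\<close> and
  \<open>e\<close> but not on \<open>N\<close>.\<close>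

lemma small_bad_rho:
  fixes b :: real
  assumes z: "z = (b + 1 / b) / 2" and b: "0 < b" "b < 1" and \<delta>: "0 < \<delta>" "\<delta> \<le> 1 / 2" "1 + 3 * \<delta> < z" and e: "0 < e"
  shows "small (bad_rho \<delta> z (2 * b) e :: 'i set \<Rightarrow> _)"
proof -
  let ?B = "\<lambda>e. bad_rho \<delta> z (2 * b) e :: 'i set \<Rightarrow> _"
  have adm: "admissible (?B e)" for e using \<delta> by (intro admissible_bad_rho) auto
  have base: "small (?B 2)"
  proof (rule small_mono[OF small_bad_norm[OF \<delta>(1,2)] admissible_bad_norm])
    fix I :: "'i set" and u A assume bad: "?B 2 I u A"
    show "bad_norm \<delta> I u A"
    proof (rule ccontr)
      assume good: "\<not> bad_norm \<delta> I u A"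
      then have fb: "form_bound I A (1 + 3 * \<delta>) (1 / 2 + \<delta>) u" by (simp add: bad_norm_def)
      obtain y where y: "resolves I A z u y" "2 < \<bar>dot I u y - 2 * b\<bar>"
        using bad good by (auto simp: bad_rho_def)
      have "1 / (1 / 2 + \<delta>) \<le> 2" using \<delta> by (simp add: field_simps)
      then have "0 \<le> dot I u y" "dot I u y \<le> 2"
        using resolves_dot_bounds[OF fb y(1) _ \<delta>(3)] \<delta> by auto
      then show False using y(2) b by auto
    qed
  qed
  have step: "small (?B ((1 + b) / 2 * e))" if "small (?B e)" "0 < e" for e
  proof -
    \<comment> \<open>The factor (1 + b) / 2 exceeds the contraction factor b by (1 - b) / 2; this
      margin pays for the fluctuation term 20 d.\<close>
    define d where "d = min \<delta> ((1 - b) * e / 40)"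
    have d: "0 < d" "d \<le> \<delta>" "d \<le> 1 / 2" using \<delta> b that by (auto simp: d_def)
    have "20 * d \<le> (1 - b) * e / 2" by (simp add: d_def min_def)
    then have de: "b * e + 20 * d \<le> (1 + b) / 2 * e" by (simp add: algebra_simps)
    show ?thesis
    proof (rule small_step[OF adm adm that(1) d(1,3)])
      fix J :: "'i set" and i A v r
      assume A: "finite J" "i \<notin> J" "symm_on (insert i J) A" "\<bar>A i i\<bar> \<le> d" "0 \<le> r" "r\<^sup>2 \<le> 1 / 4 + d"
        "1 / 4 - 2 * d \<le> r\<^sup>2" "dot J v v = 1" "\<And>j. j \<in> J \<Longrightarrow> A i j = r * v j"
        and bad: "?B ((1 + b) / 2 * e) (insert i J) (unitv i) A"
      show "?B e J v A"
      proof (rule ccontr)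
        assume good: "\<not> ?B e J v A"
        have st: "\<bar>y i - 2 * b\<bar> \<le> b * e + 20 * d" if "resolves (insert i J) A z (unitv i) y" for y
          using rho_step(4)[OF z b \<delta>(1,3) d(1,2) A(1-7,9) good that] by simp
        have "\<not> bad_norm \<delta> J v A" using good bad_rho_bad_norm by blast
        have "\<not> bad_norm \<delta> (insert i J) (unitv i) A"
        proof
          assume bad: "bad_norm \<delta> (insert i J) (unitv i) A"
          have "\<bar>A i i\<bar> \<le> \<delta>" "r\<^sup>2 \<le> 1 / 4 + \<delta>" "0 \<le> \<delta>" using A d \<delta> by auto
          from bad_norm_insert[OF A(1-3) this(1) A(5) this(2,3) A(9) bad] \<open>\<not> bad_norm \<delta> J v A\<close>
          show False by blast
        qed
        then obtain y where y: "resolves (insert i J) A z (unitv i) y"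
          "(1 + b) / 2 * e < \<bar>dot (insert i J) (unitv i) y - 2 * b\<bar>"
          using bad by (auto simp: bad_rho_def)
        moreover have "dot (insert i J) (unitv i) y = y i" using A by (simp add: dot_unitv)
        ultimately show False using st[OF y(1)] de by simp
      qed
    qed
  qed
  define c where "c = (1 + b) / 2"
  have c: "0 < c" "c < 1" using b by (auto simp: c_def)
  have iter: "small (?B (c ^ n * 2))" for n
  proof (induction n)
    case 0
    then show ?case using base by simp
  next
    case (Suc n)
    then have "small (?B ((1 + b) / 2 * (c ^ n * 2)))" using c by (intro step) simp_all
    then show ?case by (simp add: c_def[symmetric] mult.assoc)
  qed
  obtain n where "c ^ n < e / 2" using real_arch_pow_inv[of "e / 2" c] e c by auto
  then have "c ^ n * 2 \<le> e" by simp
  then show ?thesis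
    by (intro small_mono[OF iter adm]) (rule bad_rho_mono)
qed

text \<open>The recursion is \<kappa> \<mapsto> \<rho> \<rho>' (1 + r^2 \<kappa>) with \<rho>,
  \<rho>' the new diagonal entries near 2 b and 2 b'. It contracts by b b' once these entries are
  accurate to order d, so the bad events for them are joined to the event of the smaller matrix in
  each step.\<close>

lemma small_bad_kappa:
  fixes b b' :: real
  assumes z: "z = (b + 1 / b) / 2" and z': "z' = (b' + 1 / b') / 2" and c_def: "c = 4 * b * b' / (1 - b * b')"
    and b: "0 < b" "b < 1" and b': "0 < b'" "b' < 1"
    and \<delta>: "0 < \<delta>" "\<delta> \<le> 1 / 2" "1 + 3 * \<delta> < z" "1 + 3 * \<delta> < z'" and e: "0 < e"
  shows "small (bad_kappa \<delta> z z' c e :: 'i set \<Rightarrow> _)"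
proof -
  let ?B = "\<lambda>e. bad_kappa \<delta> z z' c e :: 'i set \<Rightarrow> _"
  let ?R = "\<lambda>e. bad_rho \<delta> z (2 * b) e :: 'i set \<Rightarrow> _"
  let ?R' = "\<lambda>e. bad_rho \<delta> z' (2 * b') e :: 'i set \<Rightarrow> _"
  have adm: "admissible (?B e)" "admissible (?R e)" "admissible (?R' e)" for e
    using \<delta> by (auto intro!: admissible_bad_rho admissible_bad_kappa)
  have bb: "0 < b * b'" "b * b' < 1" using b b' mult_strict_mono[of b 1 b' 1] by simp_all
  then have c: "0 < c" by (simp add: c_def)
  \<comment> \<open>The constant \<open>c\<close> is the fixed point of the recursion at r^2 = 1 /
    4.\<close>
  have fixc: "4 * b * b' * (1 + c / 4) = c"
  proof -
    have "c * (1 - b * b') = 4 * b * b'" using bb by (simp add: c_def)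
    then show ?thesis by (simp add: algebra_simps)
  qed
  have s: "0 < 1 / 2 + \<delta>" "1 / (1 / 2 + \<delta>) \<le> 2" using \<delta> by (simp_all add: field_simps)
  \<comment> \<open>A priori |y \<cdot> y'| is at most the sum of the two squared norms, each
    bounded through the gap; this starts the iteration.\<close>
  define e0 where "e0 = c + 1 / ((1 / 2 + \<delta>) * (z - (1 + 3 * \<delta>))) + 1 / ((1 / 2 + \<delta>) * (z' - (1 + 3 * \<delta>)))"
  have e0: "0 < e0" using c s \<delta> by (auto simp: e0_def intro!: add_pos_nonneg)
  have base: "small (?B e0)"
  proof (rule small_mono[OF small_bad_norm[OF \<delta>(1,2)] admissible_bad_norm])
    fix I :: "'i set" and u A assume bad: "?B e0 I u A"
    show "bad_norm \<delta> I u A"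
    proof (rule ccontr)
      assume good: "\<not> bad_norm \<delta> I u A"
      then have fb: "form_bound I A (1 + 3 * \<delta>) (1 / 2 + \<delta>) u" by (simp add: bad_norm_def)
      obtain y y' where y: "resolves I A z u y" "resolves I A z' u y'" "e0 < \<bar>dot I y y' - c\<bar>"
        using bad good by (auto simp: bad_kappa_def)
      have yy: "dot I y y \<le> 1 / ((1 / 2 + \<delta>) * (z - (1 + 3 * \<delta>)))"
        "dot I y' y' \<le> 1 / ((1 / 2 + \<delta>) * (z' - (1 + 3 * \<delta>)))"
        using resolves_dot_bounds(3)[OF fb y(1) s(1) \<delta>(3)] resolves_dot_bounds(3)[OF fb y(2) s(1) \<delta>(4)] by auto
      have "(dot I y y')\<^sup>2 \<le> dot I y y * dot I y' y'" by (rule dot_Cauchy_Schwarz)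
      also have "\<dots> \<le> (dot I y y + dot I y' y')\<^sup>2"
        using dot_self_nonneg[of I y] dot_self_nonneg[of I y'] by (simp add: power2_sum)
      finally have "\<bar>dot I y y'\<bar> \<le> dot I y y + dot I y' y'"
        using dot_self_nonneg[of I y] dot_self_nonneg[of I y'] by (simp add: abs_le_square_iff[symmetric])
      then show False using yy y(3) c by (simp add: e0_def)
    qed
  qed
  have step: "small (?B ((1 + b * b') / 2 * e))" if small: "small (?B e)" and e: "0 < e" for e
  proof -
    \<comment> \<open>The error in the product of the two entries gives 160 (1 + c + e) d, the
      replacement of r^2 by 1 / 4 gives 8 (c + e) d; the constant 168 covers both.\<close>
    define D where "D = 168 * (1 + c + e)"
    have D: "0 < D" using c e by (simp add: D_def)
    define d where "d = min (\<delta> / 4) ((1 - b * b') * e / 2 / D)"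
    have d: "0 < d" "d \<le> \<delta>" "d \<le> 1 / 8" using \<delta> bb e D by (auto simp: d_def)
    have "D * d \<le> D * ((1 - b * b') * e / 2 / D)" using D by (intro mult_left_mono) (auto simp: d_def)
    also have "\<dots> = (1 - b * b') * e / 2" using D by simp
    finally have de: "b * b' * e + D * d \<le> (1 + b * b') / 2 * e"
      by (simp add: left_diff_distrib distrib_right diff_divide_distrib add_divide_distrib)
    have small3: "small (\<lambda>I u A. (?R (20 * d) I u A \<or> ?R' (20 * d) I u A) \<or> ?B e I u A)"
      using \<delta> d by (intro small_disj admissible_disj adm small_bad_rho[OF z b] small_bad_rho[OF z' b'] small) auto
    show ?thesis
    proof (rule small_step[OF _ adm(1) small3 d(1)])
      show "admissible (\<lambda>I u A. (?R (20 * d) I u A \<or> ?R' (20 * d) I u A) \<or> ?B e I u A)"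
        by (intro admissible_disj adm)
      show "d \<le> 1 / 2" using d by simp
      fix J :: "'i set" and i A v r
      assume A: "finite J" "i \<notin> J" "symm_on (insert i J) A" "\<bar>A i i\<bar> \<le> d" "0 \<le> r" "r\<^sup>2 \<le> 1 / 4 + d"
        "1 / 4 - 2 * d \<le> r\<^sup>2" "dot J v v = 1" "\<And>j. j \<in> J \<Longrightarrow> A i j = r * v j"
        and bad: "?B ((1 + b * b') / 2 * e) (insert i J) (unitv i) A"
      show "(?R (20 * d) J v A \<or> ?R' (20 * d) J v A) \<or> ?B e J v A"
      proof (rule ccontr)
        assume "\<not> ((?R (20 * d) J v A \<or> ?R' (20 * d) J v A) \<or> ?B e J v A)"
        then have good: "\<not> ?R (20 * d) J v A" "\<not> ?R' (20 * d) J v A" "\<not> ?B e J v A" by auto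
        have st: "\<bar>y i - 2 * b\<bar> \<le> b * (20 * d) + 20 * d"
          if "resolves (insert i J) A z (unitv i) y" for y
          using rho_step(4)[OF z b \<delta>(1,3) d(1,2) A(1-7,9) good(1) that] by simp
        have st': "0 \<le> y i" "y i \<le> 2" "\<bar>y i - 2 * b'\<bar> \<le> b' * (20 * d) + 20 * d"
          if "resolves (insert i J) A z' (unitv i) y" for y
          using rho_step(2-4)[OF z' b' \<delta>(1,4) d(1,2) A(1-7,9) good(2) that] by simp_all
        have gJ: "\<not> bad_norm \<delta> J v A" using good(3) by (auto simp: bad_kappa_def)
        then have fb: "form_bound J A (1 + 3 * \<delta>) (1 / 2 + \<delta>) v" by (simp add: bad_norm_def)
        have "\<not> bad_norm \<delta> (insert i J) (unitv i) A"
        proof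
          assume bad: "bad_norm \<delta> (insert i J) (unitv i) A"
          have "\<bar>A i i\<bar> \<le> \<delta>" "r\<^sup>2 \<le> 1 / 4 + \<delta>" "0 \<le> \<delta>" using A d \<delta> by auto
          from bad_norm_insert[OF A(1-3) this(1) A(5) this(2,3) A(9) bad] gJ
          show False by blast
        qed
        then obtain y y' where y: "resolves (insert i J) A z (unitv i) y" "resolves (insert i J) A z' (unitv i) y'"
          and far: "(1 + b * b') / 2 * e < \<bar>dot (insert i J) y y' - c\<bar>"
          using bad by (auto simp: bad_kappa_def)
        have symJ: "symm_on J A" using A(3) by (auto simp: symm_on_def)
        obtain Y where Y: "resolves J A z v Y"
          using ex_resolves[OF A(1) symJ fb \<delta>(3)] s(1) by auto
        obtain Y' where Y': "resolves J A z' v Y'"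
          using ex_resolves[OF A(1) symJ fb \<delta>(4)] s(1) by auto
        define \<kappa> where "\<kappa> = dot J Y Y'"
        have \<kappa>: "\<bar>\<kappa> - c\<bar> \<le> e" using good(3) Y Y' by (auto simp: bad_kappa_def \<kappa>_def not_less)
        have eq: "dot (insert i J) y y' = y i * y' i * (1 + r\<^sup>2 * \<kappa>)"
          unfolding \<kappa>_def
          by (intro resolves_insert_dot A(1,2)
              resolves_insert(1)[OF A(1-3) fb \<delta>(3) less_imp_le[OF s(1)] A(9) y(1) Y]
              resolves_insert(1)[OF A(1-3) fb \<delta>(4) less_imp_le[OF s(1)] A(9) y(2) Y'])
        \<comment> \<open>On \<open>J\<close> the entries are accurate to 20 d; one removal step
          leaves at most b (20 d) + 20 d on \<open>insert i J\<close>.\<close>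
        have f: "\<bar>y i - 2 * b\<bar> \<le> 40 * d" "\<bar>y' i - 2 * b'\<bar> \<le> 40 * d"
        proof -
          have "b * (20 * d) \<le> 1 * (20 * d)" "b' * (20 * d) \<le> 1 * (20 * d)"
            using b b' d by (intro mult_right_mono; simp)+
          then show "\<bar>y i - 2 * b\<bar> \<le> 40 * d" "\<bar>y' i - 2 * b'\<bar> \<le> 40 * d"
            using st[OF y(1)] st'(3)[OF y(2)] by linarith+
        qed
        have "y i * y' i - 4 * b * b' = (y i - 2 * b) * y' i + 2 * b * (y' i - 2 * b')" by (simp add: algebra_simps)
        moreover have "\<bar>(y i - 2 * b) * y' i\<bar> \<le> 40 * d * 2"
          unfolding abs_mult using f st'(1,2)[OF y(2)] d by (intro mult_mono) auto
        moreover have "\<bar>2 * b * (y' i - 2 * b')\<bar> \<le> 2 * (40 * d)"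
          unfolding abs_mult using f b d by (intro mult_mono) auto
        ultimately have p1: "\<bar>y i * y' i - 4 * b * b'\<bar> \<le> 160 * d" by linarith
        have k1: "\<bar>\<kappa>\<bar> \<le> c + e" using \<kappa> c by linarith
        have "\<bar>r\<^sup>2 * \<kappa>\<bar> \<le> 1 * (c + e)"
          unfolding abs_mult using k1 A d c e by (intro mult_mono) auto
        then have p2: "\<bar>1 + r\<^sup>2 * \<kappa>\<bar> \<le> 1 + c + e"
          using abs_triangle_ineq[of 1 "r\<^sup>2 * \<kappa>"] by simp
        have p3: "\<bar>(y i * y' i - 4 * b * b') * (1 + r\<^sup>2 * \<kappa>)\<bar> \<le> 160 * d * (1 + c + e)"
          unfolding abs_mult using p1 p2 d by (intro mult_mono) auto
        have "r\<^sup>2 * \<kappa> - c / 4 = (r\<^sup>2 - 1 / 4) * \<kappa> + (\<kappa> - c) / 4"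
          by (simp add: left_diff_distrib diff_divide_distrib)
        moreover have "\<bar>(r\<^sup>2 - 1 / 4) * \<kappa>\<bar> \<le> 2 * d * (c + e)"
          unfolding abs_mult using k1 A d by (intro mult_mono) (auto simp: abs_le_iff)
        moreover have "\<bar>x + w / 4\<bar> \<le> 2 * d * (c + e) + e / 4"
          if "\<bar>x\<bar> \<le> 2 * d * (c + e)" "\<bar>w\<bar> \<le> e" for x w :: real
          using that by linarith
        ultimately have p4: "\<bar>r\<^sup>2 * \<kappa> - c / 4\<bar> \<le> 2 * d * (c + e) + e / 4" using \<kappa> by metis
        have "\<bar>4 * b * b' * (r\<^sup>2 * \<kappa> - c / 4)\<bar> = 4 * (b * b') * \<bar>r\<^sup>2 * \<kappa> - c / 4\<bar>"
          using b b' by (simp add: abs_mult)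
        also have "\<dots> \<le> 4 * (b * b') * (2 * d * (c + e) + e / 4)"
          using p4 bb by (intro mult_left_mono) auto
        also have "\<dots> = (b * b') * (8 * d * (c + e)) + b * b' * e" by (simp add: algebra_simps)
        also have "(b * b') * (8 * d * (c + e)) \<le> 1 * (8 * d * (c + e))"
          using bb d c e by (intro mult_right_mono) auto
        finally have p5: "\<bar>4 * b * b' * (r\<^sup>2 * \<kappa> - c / 4)\<bar> \<le> 8 * d * (c + e) + b * b' * e" by simp
        have "dot (insert i J) y y' - c = (y i * y' i - 4 * b * b') * (1 + r\<^sup>2 * \<kappa>) + 4 * b * b' * (r\<^sup>2 * \<kappa> - c / 4)"
          unfolding eq using fixc by (simp add: algebra_simps)
        then have "\<bar>dot (insert i J) y y' - c\<bar> \<le> 160 * d * (1 + c + e) + (8 * d * (c + e) + b * b' * e)"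
          using order_trans[OF abs_triangle_ineq add_mono[OF p3 p5]] by simp
        also have "\<dots> \<le> b * b' * e + D * d" using d by (simp add: D_def algebra_simps)
        finally show False using far de by linarith
      qed
    qed
  qed
  define q where "q = (1 + b * b') / 2"
  have q: "0 < q" "q < 1" using bb by (auto simp: q_def)
  have iter: "small (?B (q ^ n * e0))" for n
  proof (induction n)
    case 0
    then show ?case using base by simp
  next
    case (Suc n)
    then have "small (?B ((1 + b * b') / 2 * (q ^ n * e0)))" using q e0 by (intro step) simp_all
    then show ?case by (simp add: q_def[symmetric] mult.assoc)
  qed
  obtain n where "q ^ n < e / e0" using real_arch_pow_inv[of "e / e0" q] e e0 q by auto
  then have "q ^ n * e0 \<le> e" using e0 by (simp add: field_simps)
  then show ?thesis
    by (intro small_mono[OF iter adm(1)]) (rule bad_kappa_mono)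
qed

text \<open>Each diagonal entry converges in probability, but without a rate that would survive a
  union over \<open>N\<close> indices. Markov's inequality for the number of bad indices leaves
  fewer than t N of them, and each contributes at most \<open>K\<close> because the gap bounds the
  resolvent.\<close>

lemma trace_concentration:
  fixes b :: real
  assumes z: "z = (b + 1 / b) / 2" and b: "0 < b" "b < 1"
    and \<delta>: "0 < \<delta>" "\<delta> \<le> 1 / 2" "1 + 3 * \<delta> < z" and e: "0 < e" and \<eta>: "0 < \<eta>"
  shows "\<exists>N0. \<forall>N\<ge>N0. \<forall>I :: 'i set. finite I \<longrightarrow> card I = N \<longrightarrow>
    (\<exists>S\<in>sets (gaussP (I \<times> I)). emeasure (gaussP (I \<times> I)) S \<le> ennreal \<eta> \<and>
      (\<forall>g\<in>space (gaussP (I \<times> I)) - S. \<forall>u r. form_bound I (gmat N g) (1 + 3 * \<delta>) (1 / 2 + \<delta>) u \<longrightarrow>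
        (\<forall>i\<in>I. resolves I (gmat N g) z (unitv i) (r i)) \<longrightarrow> \<bar>(\<Sum>i\<in>I. r i i) / N - 2 * b\<bar> \<le> e))"
proof -
  let ?B = "bad_rho \<delta> z (2 * b) (e / 2) :: 'i set \<Rightarrow> _"
  have adm: "admissible ?B" using \<delta> by (intro admissible_bad_rho) auto
  have small: "small ?B" using e by (intro small_bad_rho[OF z b \<delta>]) simp
  \<comment> \<open>A diagonal entry of the resolvent lies between 0 and the inverse gap, and 2 b
    lies between 0 and 2.\<close>
  define K where "K = 1 / (z - (1 + 3 * \<delta>)) + 2"
  have K: "0 < K" using \<delta> by (auto simp: K_def add_pos_pos)
  \<comment> \<open>A fraction t of bad indices costs t K = e / 2; the good indices cost another e /
    2.\<close>
  define t where "t = e / (2 * K)"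
  have t: "0 < t" using e K by (simp add: t_def)
  have "0 < t * \<eta>" using t \<eta> by simp
  then obtain N0 where "\<forall>N\<ge>N0. \<forall>(I :: 'i set) u. finite I \<longrightarrow> card I + 0 = N \<longrightarrow> dot I u u = 1 \<longrightarrow>
     emeasure (gaussP (I \<times> I)) (event N I u ?B) \<le> ennreal (t * \<eta>)"
    using small unfolding small_def by meson
  then have N0: "emeasure (gaussP (I \<times> I)) (event (card I) I u ?B) \<le> ennreal (t * \<eta>)"
    if "N0 \<le> card I" "finite I" "dot I u u = 1" for I :: "'i set" and u
    using that by auto
  show ?thesis
  proof (intro exI[of _ "max N0 1"] allI impI)
    fix N and I :: "'i set" assume N: "max N0 1 \<le> N" and I: "finite I" "card I = N"
    let ?M = "gaussP (I \<times> I)"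
    have N1: "N0 \<le> card I" "0 < N" using N I by auto
    let ?E = "\<lambda>i. event N I (unitv i) ?B"
    define F where "F g = (\<Sum>i\<in>I. indicator (?E i) g :: ennreal)" for g
    have E_sets [measurable]: "?E i \<in> sets ?M" for i by (rule admissible_sets[OF adm I(1)])
    have [measurable]: "F \<in> borel_measurable ?M" unfolding F_def by measurable
    have "(\<integral>\<^sup>+g. F g \<partial>?M) = (\<Sum>i\<in>I. emeasure ?M (?E i))"
      unfolding F_def by (simp add: nn_integral_sum)
    also have "\<dots> \<le> (\<Sum>i\<in>I. ennreal (t * \<eta>))"
    proof (rule sum_mono)
      fix i assume "i \<in> I"
      then have "dot I (unitv i) (unitv i) = 1" using I by (simp add: dot_unitv) (simp add: unitv_def)
      then show "emeasure ?M (?E i) \<le> ennreal (t * \<eta>)" using N0[OF N1(1) I(1)] I by simp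
    qed
    also have "\<dots> = ennreal (N * (t * \<eta>))" using I \<open>0 < t * \<eta>\<close> by (simp add: ennreal_mult ennreal_of_nat_eq_real_of_nat)
    finally have F_int: "(\<integral>\<^sup>+g. F g \<partial>?M) \<le> ennreal (N * (t * \<eta>))" .
    define S where "S = {g \<in> space ?M. 1 \<le> ennreal (1 / (t * N)) * F g}"
    have S: "S \<in> sets ?M" unfolding S_def by measurable
    have "emeasure ?M S \<le> ennreal (1 / (t * N)) * (\<integral>\<^sup>+g. F g * indicator (space ?M) g \<partial>?M)"
      unfolding S_def by (rule nn_integral_Markov_inequality) measurable
    also have "\<dots> = ennreal (1 / (t * N)) * (\<integral>\<^sup>+g. F g \<partial>?M)"
      by (auto intro!: arg_cong[where f = "\<lambda>x. ennreal (1 / (t * N)) * x"] nn_integral_cong)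
    also have "\<dots> \<le> ennreal (1 / (t * N)) * ennreal (N * (t * \<eta>))"
      by (intro mult_left_mono F_int) simp
    also have "\<dots> = ennreal \<eta>"
      using t \<eta> N1 by (simp flip: ennreal_mult)
    finally have "emeasure ?M S \<le> ennreal \<eta>" .
    moreover have "\<bar>(\<Sum>i\<in>I. r i i) / N - 2 * b\<bar> \<le> e"
      if g: "g \<in> space ?M - S" and fb: "form_bound I (gmat N g) (1 + 3 * \<delta>) (1 / 2 + \<delta>) u"
        and r: "\<forall>i\<in>I. resolves I (gmat N g) z (unitv i) (r i)" for g u r
    proof -
      define C where "C = {i \<in> I. g \<in> ?E i}"
      have C: "C \<subseteq> I" "finite C" using I by (auto simp: C_def)
      have "F g = ennreal (card C)"
        using I by (simp add: F_def indicator_def C_def sum.If_cases Int_def ennreal_of_nat_eq_real_of_nat)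
      then have "ennreal (1 / (t * N)) * ennreal (card C) < 1" using g by (simp add: S_def not_le)
      then have "card C / (t * N) < 1" using t by (simp add: ennreal_less_one_iff flip: ennreal_mult)
      then have cardC: "card C < t * N" using t N1 by (simp add: field_simps)
      have each: "\<bar>r i i - 2 * b\<bar> \<le> (if i \<in> C then K else 0) + e / 2" if i: "i \<in> I" for i
      proof (cases "i \<in> C")
        case True
        have res: "resolves I (gmat N g) z (unitv i) (r i)" using r i by simp
        have di: "dot I (unitv i) (r i) = r i i" using I i by (simp add: dot_unitv)
        have "(1 / 2 + \<delta>) * (dot I u (r i))\<^sup>2 + (z - (1 + 3 * \<delta>)) * dot I (r i) (r i) \<le> r i i"
          using resolves_dot[OF fb res] di by simp
        moreover have "0 \<le> (1 / 2 + \<delta>) * (dot I u (r i))\<^sup>2" using \<delta> by simp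
        moreover have "(z - (1 + 3 * \<delta>)) * (r i i * r i i) \<le> (z - (1 + 3 * \<delta>)) * dot I (r i) (r i)"
          using \<delta> I i unfolding dot_def by (intro mult_left_mono member_le_sum) auto
        ultimately have q: "(z - (1 + 3 * \<delta>)) * r i i * r i i \<le> 1 * r i i" by (simp add: mult.assoc)
        have "0 \<le> (z - (1 + 3 * \<delta>)) * (r i i * r i i)" using \<delta> by simp
        then have nonneg: "0 \<le> r i i" using q by (simp add: mult.assoc)
        have "(z - (1 + 3 * \<delta>)) * r i i \<le> 1"
        proof (cases "r i i = 0")
          case False
          then show ?thesis using q nonneg by (intro mult_right_le_imp_le[of _ "r i i" 1]) auto
        qed simp
        then have "r i i \<le> 1 / (z - (1 + 3 * \<delta>))" using \<delta> by (simp add: pos_le_divide_eq mult.commute)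
        moreover have "0 \<le> 1 / (z - (1 + 3 * \<delta>))" using \<delta> by simp
        ultimately have "\<bar>r i i - 2 * b\<bar> \<le> K" unfolding K_def using nonneg b by linarith
        then show ?thesis using True e by simp
      next
        case False
        then have "\<not> ?B I (unitv i) (gmat N g)" using i g by (simp add: C_def event_def)
        then have "\<bar>dot I (unitv i) (r i) - 2 * b\<bar> \<le> e / 2" using r i by (auto simp: bad_rho_def not_less)
        then show ?thesis using False I i by (simp add: dot_unitv)
      qed
      have "(\<Sum>i\<in>I. r i i) / N - 2 * b = (\<Sum>i\<in>I. r i i - 2 * b) / N"
        using I N1 by (simp add: sum_subtractf diff_divide_distrib)
      then have "\<bar>(\<Sum>i\<in>I. r i i) / N - 2 * b\<bar> = \<bar>\<Sum>i\<in>I. r i i - 2 * b\<bar> / N" by simp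
      also have "\<dots> \<le> (\<Sum>i\<in>I. (if i \<in> C then K else 0) + e / 2) / N"
        by (intro divide_right_mono order_trans[OF sum_abs] sum_mono each) simp_all
      also have "(\<Sum>i\<in>I. (if i \<in> C then K else 0) + e / 2) = card C * K + N * (e / 2)"
        using I C by (simp add: sum.distrib sum.If_cases Int_absorb1 Int_absorb2)
      also have "\<dots> \<le> (t * N) * K + N * (e / 2)" using cardC K by (intro add_right_mono mult_right_mono) simp_all
      also have "\<dots> = N * e" using K by (simp add: t_def)
      finally show ?thesis using N1 by (simp add: divide_right_mono del: of_nat_0_le_iff)
    qed
    ultimately show "\<exists>S\<in>sets ?M. emeasure ?M S \<le> ennreal \<eta> \<and>
      (\<forall>g\<in>space ?M - S. \<forall>u r. form_bound I (gmat N g) (1 + 3 * \<delta>) (1 / 2 + \<delta>) u \<longrightarrow>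
        (\<forall>i\<in>I. resolves I (gmat N g) z (unitv i) (r i)) \<longrightarrow> \<bar>(\<Sum>i\<in>I. r i i) / N - 2 * b\<bar> \<le> e)"
      using S by blast
  qed
qed

section \<open>Gaussian measures with bounded precision\<close>

text \<open>For n \<ge> k the power t^n is at most t^k, so the tail of the series at t y is at most
  t^k times the series at y. This remainder is integrable as soon as cosh y is.\<close>

lemma cosh_Taylor:
  fixes t y :: real
  assumes t: "0 \<le> t" "t \<le> 1" and k: "even k"
  defines "p \<equiv> \<Sum>n<k. if even n then (t * y) ^ n /\<^sub>R fact n else 0"
  shows "p \<le> cosh (t * y)" "cosh (t * y) - p \<le> t ^ k * cosh y"
proof -
  define f :: "real \<Rightarrow> nat \<Rightarrow> real" where "f x n = (if even n then x ^ n /\<^sub>R fact n else 0)" for x n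
  have f_nonneg: "0 \<le> f x n" for x n by (simp add: f_def zero_le_even_power)
  have s1: "(\<lambda>n. f (t * y) (n + k)) sums (cosh (t * y) - p)"
    using sums_split_initial_segment[OF cosh_converges[of "t * y"], of k] by (simp add: f_def p_def)
  have s2: "(\<lambda>n. t ^ k * f y (n + k)) sums (t ^ k * (cosh y - (\<Sum>n<k. f y n)))"
    using sums_split_initial_segment[OF cosh_converges[of y], of k] by (intro sums_mult) (simp add: f_def)
  have "0 \<le> cosh (t * y) - p" using s1 by (rule sums_le[OF _ sums_zero, rotated]) (rule f_nonneg)
  then show "p \<le> cosh (t * y)" by simp
  have "f (t * y) (n + k) \<le> t ^ k * f y (n + k)" for n
  proof (cases "even n")
    case True
    then have ev: "even (n + k)" using k by simp
    have "t ^ (n + k) \<le> t ^ k" using t by (intro power_decreasing) auto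
    then have "t ^ (n + k) * (y ^ (n + k) / fact (n + k)) \<le> t ^ k * (y ^ (n + k) / fact (n + k))"
      using ev by (intro mult_right_mono) (auto intro!: divide_nonneg_pos zero_le_even_power)
    then show ?thesis using ev by (simp add: f_def power_mult_distrib divide_inverse mult_ac)
  next
    case False
    then show ?thesis using k by (simp add: f_def)
  qed
  then have "cosh (t * y) - p \<le> t ^ k * (cosh y - (\<Sum>n<k. f y n))"
    by (rule sums_le[OF _ s1 s2])
  also have "\<dots> \<le> t ^ k * cosh y"
    using t by (intro mult_left_mono) (simp_all add: sum_nonneg f_nonneg)
  finally show "cosh (t * y) - p \<le> t ^ k * cosh y" .
qed

text \<open>The expectation of cosh (t Y) is exp (t^2 v / 2). Subtracting Taylor polynomials,
  dividing by t^2 or t^4 and letting t tend to 0 identifies the moments without differentiation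
  under the integral.\<close>

lemma (in prob_space) moments_from_mgf:
  fixes Y :: "'a \<Rightarrow> real"
  assumes [measurable]: "Y \<in> borel_measurable M"
    and mgf: "\<And>s. (\<integral>\<^sup>+x. ennreal (exp (s * Y x)) \<partial>M) = ennreal (exp (s\<^sup>2 * v / 2))"
  shows "integrable M (\<lambda>x. (Y x)\<^sup>2)" "integrable M (\<lambda>x. (Y x) ^ 4)"
    "expectation (\<lambda>x. (Y x)\<^sup>2) = v" "expectation (\<lambda>x. (Y x) ^ 4) = 3 * v\<^sup>2"
proof -
  have exp_int: "integrable M (\<lambda>x. exp (s * Y x))" for s
    by (rule integrableI_nonneg) (use mgf in auto)
  have exp_E: "expectation (\<lambda>x. exp (s * Y x)) = exp (s\<^sup>2 * v / 2)" for s
    using nn_integral_eq_integral[OF exp_int[of s]] mgf[of s] by simp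
  have cosh_eq: "cosh (s * Y x) = (exp (s * Y x) + exp ((- s) * Y x)) / 2" for s x
    by (simp add: cosh_def)
  have cosh_int: "integrable M (\<lambda>x. cosh (s * Y x))" for s
    unfolding cosh_eq using exp_int[of s] exp_int[of "- s"]
    by (intro integrable_divide Bochner_Integration.integrable_add)
  have cosh_E: "expectation (\<lambda>x. cosh (s * Y x)) = exp (s\<^sup>2 * v / 2)" for s
    unfolding cosh_eq using exp_int[of s] exp_int[of "- s"] exp_E[of s] exp_E[of "- s"] by simp
  have cosh_int1: "integrable M (\<lambda>x. cosh (Y x))" using cosh_int[of 1] by simp
  have cosh_E1: "expectation (\<lambda>x. cosh (Y x)) = exp (v / 2)" using cosh_E[of 1] by simp
  have sum4: "(\<Sum>n<4. if even n then x ^ n /\<^sub>R fact n else 0) = 1 + x\<^sup>2 / 2" for x :: real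
    by (simp add: lessThan_nat_numeral fact_numeral)
  have sum6: "(\<Sum>n<6. if even n then x ^ n /\<^sub>R fact n else 0) = 1 + x\<^sup>2 / 2 + x ^ 4 / 24" for x :: real
    by (simp add: lessThan_nat_numeral fact_numeral)
  have c4: "1 + (t * y)\<^sup>2 / 2 \<le> cosh (t * y)" "cosh (t * y) - (1 + (t * y)\<^sup>2 / 2) \<le> t ^ 4 * cosh y"
    if "0 \<le> t" "t \<le> 1" for t y :: real
    using cosh_Taylor[OF that, of 4 y] unfolding sum4 by simp_all
  have c6: "1 + (t * y)\<^sup>2 / 2 + (t * y) ^ 4 / 24 \<le> cosh (t * y)"
    "cosh (t * y) - (1 + (t * y)\<^sup>2 / 2 + (t * y) ^ 4 / 24) \<le> t ^ 6 * cosh y"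
    if "0 \<le> t" "t \<le> 1" for t y :: real
    using cosh_Taylor[OF that, of 6 y] unfolding sum6 by simp_all
  show int2: "integrable M (\<lambda>x. (Y x)\<^sup>2)"
  proof (rule Bochner_Integration.integrable_bound[where f = "\<lambda>x. 2 * cosh (Y x)"])
    show "integrable M (\<lambda>x. 2 * cosh (Y x))" using cosh_int1 by simp
    show "AE x in M. norm ((Y x)\<^sup>2) \<le> norm (2 * cosh (Y x))"
      using c4(1)[of 1] by (intro AE_I2) (smt (verit) mult_1 real_norm_def zero_le_power2 field_sum_of_halves)
  qed measurable
  show int4: "integrable M (\<lambda>x. (Y x) ^ 4)"
  proof (rule Bochner_Integration.integrable_bound[where f = "\<lambda>x. 24 * cosh (Y x)"])
    show "integrable M (\<lambda>x. 24 * cosh (Y x))" using cosh_int1 by simp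
    have "(Y x) ^ 4 \<le> 24 * cosh (Y x)" for x
    proof -
      have "1 + (Y x)\<^sup>2 / 2 + (Y x) ^ 4 / 24 \<le> cosh (Y x)" using c6(1)[of 1 "Y x"] by simp
      then show ?thesis using zero_le_power2[of "Y x"] by linarith
    qed
    then show "AE x in M. norm ((Y x) ^ 4) \<le> norm (24 * cosh (Y x))"
      by (intro AE_I2) (simp add: order_trans[OF _ abs_ge_self])
  qed measurable
  define m2 where "m2 = expectation (\<lambda>x. (Y x)\<^sup>2)"
  define m4 where "m4 = expectation (\<lambda>x. (Y x) ^ 4)"
  have E4: "0 \<le> exp (t\<^sup>2 * v / 2) - (1 + t\<^sup>2 * m2 / 2)" "exp (t\<^sup>2 * v / 2) - (1 + t\<^sup>2 * m2 / 2) \<le> t ^ 4 * exp (v / 2)"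
    if t: "0 \<le> t" "t \<le> 1" for t
  proof -
    have int: "integrable M (\<lambda>x. cosh (t * Y x) - (1 + t\<^sup>2 * (Y x)\<^sup>2 / 2))"
      using cosh_int int2 by (intro Bochner_Integration.integrable_diff Bochner_Integration.integrable_add) auto
    have eq: "expectation (\<lambda>x. cosh (t * Y x) - (1 + t\<^sup>2 * (Y x)\<^sup>2 / 2)) = exp (t\<^sup>2 * v / 2) - (1 + t\<^sup>2 * m2 / 2)"
      using cosh_int int2 by (simp add: cosh_E m2_def prob_space)
    have "0 \<le> expectation (\<lambda>x. cosh (t * Y x) - (1 + t\<^sup>2 * (Y x)\<^sup>2 / 2))"
      using c4(1)[OF t] by (intro Bochner_Integration.integral_nonneg) (simp add: power_mult_distrib)
    then show "0 \<le> exp (t\<^sup>2 * v / 2) - (1 + t\<^sup>2 * m2 / 2)" using eq by simp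
    have "expectation (\<lambda>x. cosh (t * Y x) - (1 + t\<^sup>2 * (Y x)\<^sup>2 / 2)) \<le> expectation (\<lambda>x. t ^ 4 * cosh (Y x))"
      using c4(2)[OF t] cosh_int1 int by (intro integral_mono) (simp_all add: power_mult_distrib)
    then show "exp (t\<^sup>2 * v / 2) - (1 + t\<^sup>2 * m2 / 2) \<le> t ^ 4 * exp (v / 2)" using eq by (simp add: cosh_E1)
  qed
  have E6: "0 \<le> exp (t\<^sup>2 * v / 2) - (1 + t\<^sup>2 * m2 / 2 + t ^ 4 * m4 / 24)"
    "exp (t\<^sup>2 * v / 2) - (1 + t\<^sup>2 * m2 / 2 + t ^ 4 * m4 / 24) \<le> t ^ 6 * exp (v / 2)"
    if t: "0 \<le> t" "t \<le> 1" for t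
  proof -
    let ?h = "\<lambda>x. cosh (t * Y x) - (1 + t\<^sup>2 * (Y x)\<^sup>2 / 2 + t ^ 4 * (Y x) ^ 4 / 24)"
    have int: "integrable M ?h"
      using cosh_int int2 int4 by (intro Bochner_Integration.integrable_diff Bochner_Integration.integrable_add) auto
    have eq: "expectation ?h = exp (t\<^sup>2 * v / 2) - (1 + t\<^sup>2 * m2 / 2 + t ^ 4 * m4 / 24)"
      using cosh_int int2 int4 by (simp add: cosh_E m2_def m4_def prob_space)
    have "0 \<le> expectation ?h"
      using c6(1)[OF t] by (intro Bochner_Integration.integral_nonneg) (simp add: power_mult_distrib)
    then show "0 \<le> exp (t\<^sup>2 * v / 2) - (1 + t\<^sup>2 * m2 / 2 + t ^ 4 * m4 / 24)" using eq by simp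
    have "expectation ?h \<le> expectation (\<lambda>x. t ^ 6 * cosh (Y x))"
      using c6(2)[OF t] cosh_int1 int by (intro integral_mono) (simp_all add: power_mult_distrib)
    then show "exp (t\<^sup>2 * v / 2) - (1 + t\<^sup>2 * m2 / 2 + t ^ 4 * m4 / 24) \<le> t ^ 6 * exp (v / 2)" using eq by (simp add: cosh_E1)
  qed
  define T where "T n = 1 / real (Suc n)" for n
  have T: "0 < T n" "T n \<le> 1" for n by (simp_all add: T_def)
  have "m2 = v"
  proof -
    have "(\<lambda>n. (exp ((T n)\<^sup>2 * v / 2) - (1 + (T n)\<^sup>2 * m2 / 2)) / (T n)\<^sup>2) \<longlonglongrightarrow> (v - m2) / 2"
      unfolding T_def by (real_asymp simp: field_simps)
    moreover have "(\<lambda>n. (exp ((T n)\<^sup>2 * v / 2) - (1 + (T n)\<^sup>2 * m2 / 2)) / (T n)\<^sup>2) \<longlonglongrightarrow> 0"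
    proof (rule tendsto_sandwich)
      show "\<forall>\<^sub>F n in sequentially. 0 \<le> (exp ((T n)\<^sup>2 * v / 2) - (1 + (T n)\<^sup>2 * m2 / 2)) / (T n)\<^sup>2"
        by (intro always_eventually allI divide_nonneg_pos zero_less_power T E4(1) less_imp_le[OF T(1)])
      show "\<forall>\<^sub>F n in sequentially. (exp ((T n)\<^sup>2 * v / 2) - (1 + (T n)\<^sup>2 * m2 / 2)) / (T n)\<^sup>2 \<le> (T n)\<^sup>2 * exp (v / 2)"
      proof (intro always_eventually allI)
        fix n
        have "(exp ((T n)\<^sup>2 * v / 2) - (1 + (T n)\<^sup>2 * m2 / 2)) / (T n)\<^sup>2 \<le> (T n) ^ 4 * exp (v / 2) / (T n)\<^sup>2"
          using E4(2)[of "T n"] T[of n] by (intro divide_right_mono) auto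
        also have "\<dots> = (T n)\<^sup>2 * exp (v / 2)" using T[of n] by (simp add: power4_eq_xxxx power2_eq_square)
        finally show "(exp ((T n)\<^sup>2 * v / 2) - (1 + (T n)\<^sup>2 * m2 / 2)) / (T n)\<^sup>2 \<le> (T n)\<^sup>2 * exp (v / 2)" .
      qed
      show "(\<lambda>n. (T n)\<^sup>2 * exp (v / 2)) \<longlonglongrightarrow> 0" unfolding T_def by real_asymp
    qed simp
    ultimately have "(v - m2) / 2 = 0" by (rule LIMSEQ_unique)
    then show ?thesis by simp
  qed
  then show "expectation (\<lambda>x. (Y x)\<^sup>2) = v" by (simp add: m2_def)
  have "m4 = 3 * v\<^sup>2"
  proof -
    have "(\<lambda>n. (exp ((T n)\<^sup>2 * v / 2) - (1 + (T n)\<^sup>2 * v / 2 + (T n) ^ 4 * m4 / 24)) / (T n) ^ 4) \<longlonglongrightarrow> (3 * v\<^sup>2 - m4) / 24"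
      unfolding T_def by (real_asymp simp: field_simps power2_eq_square)
    moreover have "(\<lambda>n. (exp ((T n)\<^sup>2 * v / 2) - (1 + (T n)\<^sup>2 * v / 2 + (T n) ^ 4 * m4 / 24)) / (T n) ^ 4) \<longlonglongrightarrow> 0"
    proof (rule tendsto_sandwich)
      show "\<forall>\<^sub>F n in sequentially. 0 \<le> (exp ((T n)\<^sup>2 * v / 2) - (1 + (T n)\<^sup>2 * v / 2 + (T n) ^ 4 * m4 / 24)) / (T n) ^ 4"
        by (intro always_eventually allI divide_nonneg_pos zero_less_power T E6(1)[unfolded \<open>m2 = v\<close>] less_imp_le[OF T(1)])
      show "\<forall>\<^sub>F n in sequentially. (exp ((T n)\<^sup>2 * v / 2) - (1 + (T n)\<^sup>2 * v / 2 + (T n) ^ 4 * m4 / 24)) / (T n) ^ 4 \<le> (T n)\<^sup>2 * exp (v / 2)"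
      proof (intro always_eventually allI)
        fix n
        have "(exp ((T n)\<^sup>2 * v / 2) - (1 + (T n)\<^sup>2 * v / 2 + (T n) ^ 4 * m4 / 24)) / (T n) ^ 4 \<le> (T n) ^ 6 * exp (v / 2) / (T n) ^ 4"
          using E6(2)[of "T n"] T[of n] unfolding \<open>m2 = v\<close> by (intro divide_right_mono) auto
        also have "\<dots> = (T n)\<^sup>2 * exp (v / 2)" using T[of n] by (simp add: eval_nat_numeral)
        finally show "(exp ((T n)\<^sup>2 * v / 2) - (1 + (T n)\<^sup>2 * v / 2 + (T n) ^ 4 * m4 / 24)) / (T n) ^ 4 \<le> (T n)\<^sup>2 * exp (v / 2)" .
      qed
      show "(\<lambda>n. (T n)\<^sup>2 * exp (v / 2)) \<longlonglongrightarrow> 0" unfolding T_def by real_asymp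
    qed simp
    ultimately have "(3 * v\<^sup>2 - m4) / 24 = 0" by (rule LIMSEQ_unique)
    then show ?thesis by simp
  qed
  then show "expectation (\<lambda>x. (Y x) ^ 4) = 3 * v\<^sup>2" by (simp add: m4_def)
qed

text \<open>The setting for the density proportional to exp (- x \<cdot> P x): precision 2 P,
  covariance P^-1 / 2. All quantitative bounds are expressed through the lower bound
  \<open>c\<close> of the form.\<close>

locale gaussian_form =
  fixes I :: "'i set" and P :: "'i \<Rightarrow> 'i \<Rightarrow> real" and c :: real
  assumes fin: "finite I" and symm: "symm_on I P" and c: "0 < c"
    and coercive: "\<And>y. c * dot I y y \<le> dot I y (mv I P y)"
begin

definition weight :: "('i \<Rightarrow> real) \<Rightarrow> real" where
  "weight x = exp (- dot I x (mv I P x))"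

definition Z :: real where
  "Z = enn2real (\<integral>\<^sup>+x. ennreal (weight x) \<partial>lebP I)"

definition \<gamma> :: "('i \<Rightarrow> real) measure" where
  "\<gamma> = density (lebP I) (\<lambda>x. ennreal (weight x / Z))"

lemma weight_pos: "0 < weight x"
  by (simp add: weight_def)

lemma dot_measurable: "(\<lambda>x. dot I t x) \<in> borel_measurable (lebP I)"
  unfolding dot_def by (intro borel_measurable_sum borel_measurable_times) simp_all

lemma weight_measurable [measurable]: "weight \<in> borel_measurable (lebP I)"
proof -
  have [measurable]: "(\<lambda>x. dot I x (mv I P x)) \<in> borel_measurable (lebP I)"
    unfolding dot_def mv_def by (intro borel_measurable_sum borel_measurable_times) simp_all
  show ?thesis unfolding weight_def by measurable
qed

lemma Z: "0 < Z" "(\<integral>\<^sup>+x. ennreal (weight x) \<partial>lebP I) = ennreal Z"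
proof -
  interpret product_sigma_finite "\<lambda>_::'i. lborel :: real measure" ..
  define \<sigma> where "\<sigma> = sqrt (1 / (2 * c))"
  have \<sigma>: "\<sigma> > 0" "\<sigma>\<^sup>2 = 1 / (2 * c)" using c by (simp_all add: \<sigma>_def)
  define k where "k = sqrt (2 * pi * \<sigma>\<^sup>2)"
  have k: "k > 0" using \<sigma>(1) by (simp add: k_def)
  have exp_eq: "exp (- (c * x\<^sup>2)) = k * normal_density 0 \<sigma> x" for x
    unfolding normal_density_def k_def[symmetric] using k c by (simp add: \<sigma>(2) mult.commute)
  have one: "(\<integral>\<^sup>+x. ennreal (normal_density 0 \<sigma> x) \<partial>lborel) = 1"
    using \<sigma>(1) integral_normal_density[OF \<sigma>(1), of 0] integrable_normal_density[OF \<sigma>(1), of 0]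
    by (subst nn_integral_eq_integral) auto
  have "(\<integral>\<^sup>+x. ennreal (exp (- (c * x\<^sup>2))) \<partial>lborel) = (\<integral>\<^sup>+x. ennreal k * ennreal (normal_density 0 \<sigma> x) \<partial>lborel)"
    using k by (intro nn_integral_cong) (simp add: exp_eq ennreal_mult)
  also have "\<dots> = ennreal k * (\<integral>\<^sup>+x. ennreal (normal_density 0 \<sigma> x) \<partial>lborel)"
    by (rule nn_integral_cmult) simp
  finally have 1: "(\<integral>\<^sup>+x. ennreal (exp (- (c * x\<^sup>2))) \<partial>lborel) = ennreal k" using one by simp
  \<comment> \<open>Coercivity dominates the weight by a product of one-dimensional Gaussians, which
    gives finiteness.\<close>
  have le: "ennreal (weight x) \<le> (\<Prod>i\<in>I. ennreal (exp (- (c * (x i)\<^sup>2))))" for x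
  proof -
    have "(\<Prod>i\<in>I. ennreal (exp (- (c * (x i)\<^sup>2)))) = ennreal (\<Prod>i\<in>I. exp (- (c * (x i)\<^sup>2)))"
      by (rule prod_ennreal) simp
    also have "(\<Prod>i\<in>I. exp (- (c * (x i)\<^sup>2))) = exp (- (c * dot I x x))"
      using fin by (simp add: exp_sum[symmetric] dot_def sum_distrib_left sum_negf power2_eq_square)
    finally show ?thesis using coercive[of x] by (simp add: weight_def ennreal_leI)
  qed
  have "(\<integral>\<^sup>+x. ennreal (weight x) \<partial>lebP I) \<le> (\<integral>\<^sup>+x. (\<Prod>i\<in>I. ennreal (exp (- (c * (x i)\<^sup>2)))) \<partial>lebP I)"
    by (intro nn_integral_mono le)
  also have "\<dots> = (\<Prod>i\<in>I. \<integral>\<^sup>+x. ennreal (exp (- (c * x\<^sup>2))) \<partial>lborel)"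
    by (rule product_nn_integral_prod[OF fin]) simp
  also have "\<dots> = ennreal (k ^ card I)" using k by (simp add: 1 ennreal_power)
  also have "\<dots> < \<infinity>" by simp
  finally have finite: "(\<integral>\<^sup>+x. ennreal (weight x) \<partial>lebP I) < \<infinity>" .
  then show eq: "(\<integral>\<^sup>+x. ennreal (weight x) \<partial>lebP I) = ennreal Z" by (simp add: Z_def)
  have "(\<integral>\<^sup>+x. ennreal (weight x) \<partial>lebP I) \<noteq> 0"
  proof
    assume "(\<integral>\<^sup>+x. ennreal (weight x) \<partial>lebP I) = 0"
    then have "AE x in lebP I. ennreal (weight x) = 0" by (subst (asm) nn_integral_0_iff_AE) simp_all
    then have "AE x in lebP I. False" using weight_pos by (auto simp: ennreal_eq_0_iff not_le)
    then have "emeasure (lebP I) (space (lebP I)) = 0"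
      by (simp only: eventually_False ae_filter_eq_bot_iff)
    moreover have "emeasure (lebP I) (I \<rightarrow>\<^sub>E {0..1}) \<le> emeasure (lebP I) (space (lebP I))"
      by (rule emeasure_space)
    moreover have "emeasure (lebP I) (I \<rightarrow>\<^sub>E {0..1}) = (\<Prod>i\<in>I. emeasure lborel {0..1::real})"
      by (rule emeasure_PiM[OF fin]) simp
    ultimately show False by simp
  qed
  then show "0 < Z" unfolding eq by (simp add: ennreal_eq_0_iff not_le)
qed

lemma sets_\<gamma> [simp, measurable_cong]: "sets \<gamma> = sets (lebP I)"
  and space_\<gamma>: "space \<gamma> = space (lebP I)"
  by (simp_all add: \<gamma>_def)

lemma nn_integral_\<gamma>:
  assumes "f \<in> borel_measurable (lebP I)"
  shows "(\<integral>\<^sup>+x. f x \<partial>\<gamma>) = (\<integral>\<^sup>+x. ennreal (weight x / Z) * f x \<partial>lebP I)"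
  unfolding \<gamma>_def by (rule nn_integral_density[OF _ assms]) measurable

text \<open>Translation by y / 2 = P^-1 t / 2 completes the square, so the normalisation
  \<open>Z\<close> cancels and no determinant appears.\<close>

lemma mgf:
  assumes y: "\<forall>i\<in>I. mv I P y i = t i"
  shows "(\<integral>\<^sup>+x. ennreal (exp (dot I t x)) \<partial>\<gamma>) = ennreal (exp (dot I t y / 4))"
proof -
  have [measurable]: "(\<lambda>x. dot I t x) \<in> borel_measurable (lebP I)" by (rule dot_measurable)
  have shift: "weight (plusP I x (\<lambda>i. y i / 2)) * exp (dot I t (plusP I x (\<lambda>i. y i / 2))) = exp (dot I t y / 4) * weight x"
    for x
  proof -
    define w where "w i = x i + 1 / 2 * y i" for i
    have w: "dot I u (plusP I x (\<lambda>i. y i / 2)) = dot I u w" "mv I P (plusP I x (\<lambda>i. y i / 2)) i = mv I P w i" for u i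
      by (auto intro!: dot_cong mv_cong simp: plusP_def w_def)
    have w': "weight (plusP I x (\<lambda>i. y i / 2)) = weight w"
    proof -
      have "dot I (plusP I x (\<lambda>i. y i / 2)) (mv I P (plusP I x (\<lambda>i. y i / 2))) = dot I w (mv I P w)"
        by (intro dot_cong w(2)) (simp add: plusP_def w_def)
      then show ?thesis by (simp only: weight_def)
    qed
    have Py: "dot I u (mv I P y) = dot I u t" for u using y by (intro dot_cong) simp_all
    have "dot I y (mv I P x) = dot I x t" using dot_mv_symm[OF symm, of y x] Py[of x] by (simp add: dot_commute)
    moreover have "mv I P w = (\<lambda>i. mv I P x i + 1 / 2 * mv I P y i)"
      by (rule ext) (simp only: w_def[abs_def] mv_add mv_scale)
    then have "dot I w (mv I P w) = dot I x (mv I P x) + 1 / 2 * dot I x (mv I P y)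
      + 1 / 2 * (dot I y (mv I P x) + 1 / 2 * dot I y (mv I P y))"
      unfolding w_def[abs_def]
      by (simp only: dot_add_left dot_add_right dot_scale_left dot_scale_right distrib_left add.assoc)
    moreover have "dot I t w = dot I x t + 1 / 2 * dot I y t"
      unfolding w_def[abs_def] dot_add_right dot_scale_right by (simp only: dot_commute)
    ultimately have "- dot I w (mv I P w) + dot I t w = dot I t y / 4 + - dot I x (mv I P x)"
      by (simp add: Py dot_commute[of I t y] add_divide_distrib)
    then show ?thesis
      unfolding w' w(1) unfolding weight_def exp_add[symmetric] by (simp only:)
  qed
  have "(\<integral>\<^sup>+x. ennreal (exp (dot I t x)) \<partial>\<gamma>) = (\<integral>\<^sup>+x. ennreal (weight x / Z) * ennreal (exp (dot I t x)) \<partial>lebP I)"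
    by (rule nn_integral_\<gamma>) measurable
  also have "\<dots> = (\<integral>\<^sup>+x. ennreal (weight x * exp (dot I t x) / Z) \<partial>lebP I)"
  proof (rule nn_integral_cong)
    fix x
    have "0 \<le> weight x / Z" using Z(1) weight_pos[of x] by simp
    then have "ennreal (weight x / Z) * ennreal (exp (dot I t x)) = ennreal (weight x / Z * exp (dot I t x))"
      by (rule ennreal_mult[symmetric]) simp
    then show "ennreal (weight x / Z) * ennreal (exp (dot I t x)) = ennreal (weight x * exp (dot I t x) / Z)" by simp
  qed
  also have "\<dots> = (\<integral>\<^sup>+x. ennreal (weight (plusP I x (\<lambda>i. y i / 2)) * exp (dot I t (plusP I x (\<lambda>i. y i / 2))) / Z) \<partial>lebP I)"
    by (rule nn_integral_translate[OF fin, symmetric, of "\<lambda>x. ennreal (weight x * exp (dot I t x) / Z)"]) measurable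
  also have "\<dots> = (\<integral>\<^sup>+x. ennreal (exp (dot I t y / 4) / Z) * ennreal (weight x) \<partial>lebP I)"
  proof (rule nn_integral_cong)
    fix x
    have "0 \<le> exp (dot I t y / 4) / Z" using Z(1) by simp
    then have "ennreal (exp (dot I t y / 4) / Z) * ennreal (weight x) = ennreal (exp (dot I t y / 4) / Z * weight x)"
      using weight_pos[of x] by (intro ennreal_mult[symmetric]) simp_all
    then show "ennreal (weight (plusP I x (\<lambda>i. y i / 2)) * exp (dot I t (plusP I x (\<lambda>i. y i / 2))) / Z)
      = ennreal (exp (dot I t y / 4) / Z) * ennreal (weight x)" by (simp add: shift)
  qed
  also have "\<dots> = ennreal (exp (dot I t y / 4) / Z) * ennreal Z"
    using Z by (simp add: nn_integral_cmult)
  also have "\<dots> = ennreal (exp (dot I t y / 4))"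
    using Z(1) by (simp add: ennreal_mult[symmetric])
  finally show ?thesis .
qed

text \<open>The total mass is the moment generating function at t = 0.\<close>

lemma prob_space_\<gamma>: "prob_space \<gamma>"
proof (rule prob_spaceI)
  have "mv I P (\<lambda>_. 0) i = 0" for i by (simp add: mv_def)
  then have "(\<integral>\<^sup>+x. ennreal (exp (dot I (\<lambda>_. 0) x)) \<partial>\<gamma>) = ennreal (exp (dot I (\<lambda>_. 0) (\<lambda>_. 0) / 4))"
    by (intro mgf) simp
  then show "emeasure \<gamma> (space \<gamma>) = 1" by (simp add: dot_def)
qed

sublocale prob_space \<gamma> by (rule prob_space_\<gamma>)

lemma pos_def: "pos_def I P"
  unfolding pos_def_def
proof (intro conjI symm allI impI)
  fix y :: "'i \<Rightarrow> real" assume "\<exists>i\<in>I. y i \<noteq> 0"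
  then have "0 < c * dot I y y" using dot_self_pos[OF fin] c by auto
  then show "0 < dot I y (mv I P y)" using coercive[of y] by simp
qed

lemma ex_solution: "\<exists>y. \<forall>i\<in>I. mv I P y i = t i"
  using measurable_solution[of I "\<lambda>_::unit. P" "count_space UNIV" "\<lambda>_. t"] fin pos_def by auto

lemma solution_bounds:
  assumes y: "\<forall>i\<in>I. mv I P y i = t i"
  shows "0 \<le> dot I t y" "dot I t y \<le> dot I t t / c" "dot I y y \<le> dot I t t / c\<^sup>2"
proof -
  have eq: "dot I y (mv I P y) = dot I t y" using y by (subst dot_commute) (auto intro!: dot_cong)
  have 1: "c * dot I y y \<le> dot I t y" using coercive[of y] eq by simp
  then show nonneg: "0 \<le> dot I t y" 
  proof -
    have "0 \<le> c * dot I y y" using c dot_self_nonneg[of I y] by simp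
    then show ?thesis using 1 by linarith
  qed
  have "(c * dot I y y)\<^sup>2 \<le> (dot I t y)\<^sup>2" using 1 c dot_self_nonneg[of I y] by (intro power_mono) auto
  also have "\<dots> \<le> dot I t t * dot I y y" by (rule dot_Cauchy_Schwarz)
  also have "(c * dot I y y)\<^sup>2 = c\<^sup>2 * dot I y y * dot I y y" by (simp add: power2_eq_square)
  finally have 2: "c\<^sup>2 * dot I y y * dot I y y \<le> dot I t t * dot I y y" .
  have 3: "c\<^sup>2 * dot I y y \<le> dot I t t"
  proof (cases "dot I y y = 0")
    case True
    then show ?thesis by (simp add: dot_self_nonneg)
  next
    case False
    then have "0 < dot I y y" using dot_self_nonneg[of I y] by simp
    with 2 show ?thesis by (rule mult_right_le_imp_le)
  qed
  then show yy: "dot I y y \<le> dot I t t / c\<^sup>2" using c by (simp add: pos_le_divide_eq mult.commute)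
  have "(dot I t y)\<^sup>2 \<le> dot I t t * dot I y y" by (rule dot_Cauchy_Schwarz)
  also have "\<dots> \<le> dot I t t * (dot I t t / c\<^sup>2)" using yy by (intro mult_left_mono dot_self_nonneg)
  also have "\<dots> = (dot I t t / c)\<^sup>2" by (simp add: power2_eq_square)
  finally show "dot I t y \<le> dot I t t / c"
    by (rule power2_le_imp_le) (use c dot_self_nonneg[of I t] in simp)
qed

lemma moments:
  assumes y: "\<forall>i\<in>I. mv I P y i = t i"
  shows "integrable \<gamma> (\<lambda>x. (dot I t x)\<^sup>2)" "integrable \<gamma> (\<lambda>x. (dot I t x) ^ 4)"
    "expectation (\<lambda>x. (dot I t x)\<^sup>2) = dot I t y / 2" "expectation (\<lambda>x. (dot I t x) ^ 4) = 3 * (dot I t y / 2)\<^sup>2"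
proof -
  have meas: "(\<lambda>x. dot I t x) \<in> borel_measurable \<gamma>" using dot_measurable by simp
  have "(\<integral>\<^sup>+x. ennreal (exp (s * dot I t x)) \<partial>\<gamma>) = ennreal (exp (s\<^sup>2 * (dot I t y / 2) / 2))" for s
  proof -
    have "\<forall>i\<in>I. mv I P (\<lambda>i. s * y i) i = s * t i" using y by (simp add: mv_scale)
    from mgf[OF this] show ?thesis
      by (simp add: dot_scale_left dot_scale_right power2_eq_square mult.assoc)
  qed
  from moments_from_mgf[OF meas this]
  show "integrable \<gamma> (\<lambda>x. (dot I t x)\<^sup>2)" "integrable \<gamma> (\<lambda>x. (dot I t x) ^ 4)"
    "expectation (\<lambda>x. (dot I t x)\<^sup>2) = dot I t y / 2" "expectation (\<lambda>x. (dot I t x) ^ 4) = 3 * (dot I t y / 2)\<^sup>2" .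
qed

text \<open>Chernoff bound with the optimal parameter s = 2 a c / K for the variance bound K / (2
  c): the exponent is a^2 c / K - 2 a^2 c / K.\<close>

lemma linear_tail:
  assumes t: "dot I t t \<le> K" and K: "0 < K" and a: "0 \<le> a"
  shows "emeasure \<gamma> {x \<in> space \<gamma>. a \<le> \<bar>dot I t x\<bar>} \<le> ennreal (2 * exp (- (a\<^sup>2 * c / K)))"
proof -
  obtain y where y: "\<forall>i\<in>I. mv I P y i = t i" using ex_solution by blast
  have [measurable]: "(\<lambda>x. dot I t x) \<in> borel_measurable (lebP I)" by (rule dot_measurable)
  define s where "s = 2 * a * c / K"
  have s: "0 \<le> s" using a c K by (simp add: s_def)
  have "dot I t t / c \<le> K / c" using t c by (intro divide_right_mono) simp_all
  then have "dot I t y \<le> K / c" using solution_bounds(2)[OF y] by linarith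
  then have "s\<^sup>2 * dot I t y / 4 \<le> s\<^sup>2 * (K / c) / 4" by (intro divide_right_mono mult_left_mono) auto
  also have "\<dots> = a\<^sup>2 * c / K" using c K by (simp add: s_def power2_eq_square field_simps)
  finally have v: "s\<^sup>2 * dot I t y / 4 \<le> a\<^sup>2 * c / K" .
  have sa: "s * a = 2 * (a\<^sup>2 * c / K)" by (simp add: s_def power2_eq_square)
  have one: "(\<integral>\<^sup>+x. ennreal (exp (r * dot I t x - s * a)) \<partial>\<gamma>) \<le> ennreal (exp (- (a\<^sup>2 * c / K)))" if "r\<^sup>2 = s\<^sup>2" for r
  proof -
    have "\<forall>i\<in>I. mv I P (\<lambda>i. r * y i) i = r * t i" using y by (simp add: mv_scale)
    from mgf[OF this] have "(\<integral>\<^sup>+x. ennreal (exp (r * dot I t x)) \<partial>\<gamma>) = ennreal (exp (r\<^sup>2 * dot I t y / 4))"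
      by (simp add: dot_scale_left dot_scale_right power2_eq_square mult.assoc)
    then have m: "(\<integral>\<^sup>+x. ennreal (exp (r * dot I t x)) \<partial>\<gamma>) = ennreal (exp (s\<^sup>2 * dot I t y / 4))"
      by (simp only: that)
    have "(\<integral>\<^sup>+x. ennreal (exp (r * dot I t x - s * a)) \<partial>\<gamma>) = (\<integral>\<^sup>+x. ennreal (exp (- (s * a))) * ennreal (exp (r * dot I t x)) \<partial>\<gamma>)"
      by (intro nn_integral_cong) (simp flip: ennreal_mult exp_add)
    also have "\<dots> = ennreal (exp (- (s * a))) * ennreal (exp (s\<^sup>2 * dot I t y / 4))"
      unfolding m[symmetric] by (rule nn_integral_cmult) measurable
    also have "\<dots> = ennreal (exp (s\<^sup>2 * dot I t y / 4 - s * a))" by (simp flip: ennreal_mult exp_add)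
    also have "\<dots> \<le> ennreal (exp (- (a\<^sup>2 * c / K)))"
    proof -
      have "s\<^sup>2 * dot I t y / 4 - s * a \<le> - (a\<^sup>2 * c / K)" using v sa by linarith
      then show ?thesis by (intro ennreal_leI) (simp only: exp_le_cancel_iff)
    qed
    finally show ?thesis .
  qed
  have "emeasure \<gamma> {x \<in> space \<gamma>. a \<le> \<bar>dot I t x\<bar>} = (\<integral>\<^sup>+x. indicator {x \<in> space \<gamma>. a \<le> \<bar>dot I t x\<bar>} x \<partial>\<gamma>)"
    by (rule nn_integral_indicator[symmetric]) measurable
  also have "\<dots> \<le> (\<integral>\<^sup>+x. ennreal (exp (s * dot I t x - s * a)) + ennreal (exp (- s * dot I t x - s * a)) \<partial>\<gamma>)"
  proof (intro nn_integral_mono)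
    fix x
    have "1 \<le> exp (s * dot I t x - s * a) + exp (- s * dot I t x - s * a)" if "a \<le> \<bar>dot I t x\<bar>"
    proof (cases "0 \<le> dot I t x")
      case True
      then have "s * a \<le> s * dot I t x" using that s by (intro mult_left_mono) auto
      then have "1 \<le> exp (s * dot I t x - s * a)" by simp
      then show ?thesis using exp_ge_zero[of "- s * dot I t x - s * a"] by linarith
    next
      case False
      then have "s * a \<le> s * (- dot I t x)" using that s by (intro mult_left_mono) auto
      then have "1 \<le> exp (- s * dot I t x - s * a)" by simp
      then show ?thesis using exp_ge_zero[of "s * dot I t x - s * a"] by linarith
    qed
    then show "indicator {x \<in> space \<gamma>. a \<le> \<bar>dot I t x\<bar>} x \<le> ennreal (exp (s * dot I t x - s * a)) + ennreal (exp (- s * dot I t x - s * a))"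
      by (auto simp: indicator_def ennreal_plus[symmetric] simp del: ennreal_plus)
  qed
  also have "\<dots> = (\<integral>\<^sup>+x. ennreal (exp (s * dot I t x - s * a)) \<partial>\<gamma>) + (\<integral>\<^sup>+x. ennreal (exp (- s * dot I t x - s * a)) \<partial>\<gamma>)"
    by (rule nn_integral_add) measurable
  also have "\<dots> \<le> ennreal (exp (- (a\<^sup>2 * c / K))) + ennreal (exp (- (a\<^sup>2 * c / K)))"
    by (intro add_mono one) simp_all
  also have "\<dots> = ennreal (2 * exp (- (a\<^sup>2 * c / K)))" by (simp flip: ennreal_plus)
  finally show ?thesis .
qed

end

section \<open>Spherical shells\<close>

context gaussian_form
begin

text \<open>Wick's formula E x_i^2 x_j^2 = C_ii C_jj + 2 C_ij^2 makes the variance of x \<cdot> x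
  twice the sum of all C_ij^2. The j-th column of C is half of \<open>r j\<close>, whose norm is at
  most 1 / c.\<close>

lemma norm_variance:
  assumes r: "\<And>j. j \<in> I \<Longrightarrow> \<forall>i\<in>I. mv I P (r j) i = unitv j i"
  defines "\<tau> \<equiv> (\<Sum>i\<in>I. r i i) / 2"
  shows "integrable \<gamma> (\<lambda>x. (dot I x x - \<tau>)\<^sup>2)"
    and "expectation (\<lambda>x. (dot I x x - \<tau>)\<^sup>2) \<le> card I / (2 * c\<^sup>2)"
proof -
  \<comment> \<open>The covariance matrix P^-1 / 2.\<close>
  define C where "C i j = r j i / 2" for i j
  have sym: "C i j = C j i" if "i \<in> I" "j \<in> I" for i j
  proof -
    have "r j i = dot I (unitv i) (r j)" using fin that by (simp add: dot_unitv)
    also have "\<dots> = dot I (mv I P (r i)) (r j)" using r[OF that(1)] by (intro dot_cong) simp_all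
    also have "\<dots> = dot I (r i) (mv I P (r j))" by (simp add: dot_mv_symm[OF symm])
    also have "\<dots> = dot I (r i) (unitv j)" using r[OF that(2)] by (intro dot_cong) simp_all
    also have "\<dots> = r i j" using fin that by (subst dot_commute) (simp add: dot_unitv)
    finally show ?thesis by (simp add: C_def)
  qed
  have m1: "integrable \<gamma> (\<lambda>x. (x i)\<^sup>2)" "integrable \<gamma> (\<lambda>x. (x i) ^ 4)"
    "expectation (\<lambda>x. (x i)\<^sup>2) = C i i" "expectation (\<lambda>x. (x i) ^ 4) = 3 * (C i i)\<^sup>2" if i: "i \<in> I" for i
    using moments[OF r[OF i]] fin i by (simp_all add: dot_unitv C_def)
  have m2: "integrable \<gamma> (\<lambda>x. (x i + s * x j) ^ 4)"
    "expectation (\<lambda>x. (x i + s * x j) ^ 4) = 3 * (C i i + 2 * s * C i j + C j j)\<^sup>2"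
    if i: "i \<in> I" and j: "j \<in> I" and s: "s * s = 1" for i j s
  proof -
    have sol: "\<forall>k\<in>I. mv I P (\<lambda>k. r i k + s * r j k) k = unitv i k + s * unitv j k"
      using r[OF i] r[OF j] by (simp add: mv_add mv_scale)
    have t: "dot I (\<lambda>k. unitv i k + s * unitv j k) x = x i + s * x j" for x
      using fin i j by (simp add: dot_add_left dot_scale_left dot_unitv)
    have "(r i i + s * r j i + s * (r i j + s * r j j)) / 2 = C i i + s * C i j + s * C j i + (s * s) * C j j"
      by (simp add: C_def add_divide_distrib algebra_simps)
    also have "\<dots> = C i i + 2 * s * C i j + C j j"
      unfolding s using sym[OF i j] by simp
    finally have v: "(r i i + s * r j i + s * (r i j + s * r j j)) / 2 = C i i + 2 * s * C i j + C j j" .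
    show "integrable \<gamma> (\<lambda>x. (x i + s * x j) ^ 4)" "expectation (\<lambda>x. (x i + s * x j) ^ 4) = 3 * (C i i + 2 * s * C i j + C j j)\<^sup>2"
      using moments(2,4)[OF sol] unfolding t v by simp_all
  qed
  have m3: "integrable \<gamma> (\<lambda>x. (x i)\<^sup>2 * (x j)\<^sup>2)"
    "expectation (\<lambda>x. (x i)\<^sup>2 * (x j)\<^sup>2) = C i i * C j j + 2 * (C i j)\<^sup>2"
    if i: "i \<in> I" and j: "j \<in> I" for i j
  proof -
    \<comment> \<open>Polarisation reduces the mixed moment to fourth moments of linear
      functionals.\<close>
    have polar: "(a\<^sup>2 * b\<^sup>2 :: real) = ((a + 1 * b) ^ 4 + (a + (- 1) * b) ^ 4 - 2 * a ^ 4 - 2 * b ^ 4) / 12" for a b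
      by (simp add: power4_eq_xxxx power2_eq_square algebra_simps)
    show "integrable \<gamma> (\<lambda>x. (x i)\<^sup>2 * (x j)\<^sup>2)"
      unfolding polar using m1[OF i] m1[OF j] m2[OF i j, of 1] m2[OF i j, of "-1"] by simp
    have "expectation (\<lambda>x. (x i)\<^sup>2 * (x j)\<^sup>2)
      = (3 * (C i i + 2 * 1 * C i j + C j j)\<^sup>2 + 3 * (C i i + 2 * (- 1) * C i j + C j j)\<^sup>2
        - 2 * (3 * (C i i)\<^sup>2) - 2 * (3 * (C j j)\<^sup>2)) / 12"
      unfolding polar using m1[OF i] m1[OF j] m2[OF i j, of 1] m2[OF i j, of "-1"] by simp
    also have "\<dots> = C i i * C j j + 2 * (C i j)\<^sup>2" by (simp add: power2_eq_square algebra_simps)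
    finally show "expectation (\<lambda>x. (x i)\<^sup>2 * (x j)\<^sup>2) = C i i * C j j + 2 * (C i j)\<^sup>2" .
  qed
  have \<tau>: "\<tau> = (\<Sum>i\<in>I. C i i)" by (simp add: \<tau>_def C_def sum_divide_distrib)
  have sq: "(dot I x x - \<tau>)\<^sup>2
    = (\<Sum>i\<in>I. \<Sum>j\<in>I. (x i)\<^sup>2 * (x j)\<^sup>2 - C j j * (x i)\<^sup>2 - C i i * (x j)\<^sup>2 + C i i * C j j)" for x
  proof -
    have "dot I x x - \<tau> = (\<Sum>i\<in>I. (x i)\<^sup>2 - C i i)" by (simp add: \<tau> dot_def sum_subtractf power2_eq_square)
    then have "(dot I x x - \<tau>)\<^sup>2 = (\<Sum>i\<in>I. \<Sum>j\<in>I. ((x i)\<^sup>2 - C i i) * ((x j)\<^sup>2 - C j j))"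
      by (simp add: power2_eq_square[of "sum _ _"] sum_product)
    then show ?thesis by (simp add: algebra_simps)
  qed
  show "integrable \<gamma> (\<lambda>x. (dot I x x - \<tau>)\<^sup>2)"
    unfolding sq using m1(1) m3(1) by (intro Bochner_Integration.integrable_sum) simp
  have "expectation (\<lambda>x. (dot I x x - \<tau>)\<^sup>2) = (\<Sum>i\<in>I. \<Sum>j\<in>I. 2 * (C i j)\<^sup>2)"
  proof -
    have "expectation (\<lambda>x. (dot I x x - \<tau>)\<^sup>2) = (\<Sum>i\<in>I. \<Sum>j\<in>I.
      expectation (\<lambda>x. (x i)\<^sup>2 * (x j)\<^sup>2 - C j j * (x i)\<^sup>2 - C i i * (x j)\<^sup>2 + C i i * C j j))"
      unfolding sq using m1(1) m3(1)
      by (subst Bochner_Integration.integral_sum)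
         (auto intro!: Bochner_Integration.integrable_sum sum.cong Bochner_Integration.integral_sum)
    also have "\<dots> = (\<Sum>i\<in>I. \<Sum>j\<in>I. 2 * (C i j)\<^sup>2)"
      using m1(1,3) m3 by (intro sum.cong refl) (simp add: prob_space mult.commute)
    finally show ?thesis .
  qed
  also have "\<dots> = (\<Sum>j\<in>I. \<Sum>i\<in>I. 2 * (C i j)\<^sup>2)" by (rule sum.swap)
  also have "\<dots> = (\<Sum>j\<in>I. dot I (r j) (r j) / 2)"
    by (simp add: dot_def C_def power2_eq_square sum_divide_distrib)
  also have "\<dots> \<le> (\<Sum>j\<in>I. 1 / (2 * c\<^sup>2))"
  proof (rule sum_mono)
    fix j assume j: "j \<in> I"
    have "dot I (unitv j) (unitv j) = 1" using fin j by (simp add: dot_unitv) (simp add: unitv_def)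
    then have "dot I (r j) (r j) \<le> 1 / c\<^sup>2" using solution_bounds(3)[OF r[OF j]] by simp
    then show "dot I (r j) (r j) / 2 \<le> 1 / (2 * c\<^sup>2)" by simp
  qed
  also have "\<dots> = card I / (2 * c\<^sup>2)" by simp
  finally show "expectation (\<lambda>x. (dot I x x - \<tau>)\<^sup>2) \<le> card I / (2 * c\<^sup>2)" .
qed

text \<open>The width \<delta> N is shared out: a quarter for the fluctuation of x \<cdot> x
  (Chebyshev, whence 8 / (c^2 \<delta>^2 N)), a quarter for 2 m \<cdot> x (linear tail), a quarter
  for the error of the mean.\<close>

lemma shell_probability:
  assumes r: "\<And>j. j \<in> I \<Longrightarrow> \<forall>i\<in>I. mv I P (r j) i = unitv j i"
    and \<delta>: "0 < \<delta>" and K: "0 < K" and N: "card I = N" "0 < N"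
    and m: "dot I m m \<le> K * N"
    and norm: "\<bar>((\<Sum>i\<in>I. r i i) / 2 + dot I m m) / N - 1\<bar> \<le> \<delta> / 4"
    and large: "8 / (c\<^sup>2 * \<delta>\<^sup>2 * N) + 2 * exp (- (\<delta>\<^sup>2 * c / (64 * K) * N)) \<le> 1 / 2"
  shows "ennreal (1 / 2) \<le> emeasure \<gamma> {x \<in> space \<gamma>. N * (1 - \<delta>) < dot I (plusP I x m) (plusP I x m) \<and>
    dot I (plusP I x m) (plusP I x m) \<le> N * (1 + \<delta>)}"
proof -
  define \<tau> where "\<tau> = (\<Sum>i\<in>I. r i i) / 2"
  have dxx [measurable]: "(\<lambda>x. dot I x x) \<in> borel_measurable (lebP I)"
    unfolding dot_def by (intro borel_measurable_sum borel_measurable_times) simp_all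
  have [measurable]: "(\<lambda>x. dot I m x) \<in> borel_measurable (lebP I)" by (rule dot_measurable)
  have [measurable]: "(\<lambda>x. dot I (plusP I x m) (plusP I x m)) \<in> borel_measurable (lebP I)"
    by (rule measurable_compose[OF plusP_const_measurable dxx])
  let ?A = "{x \<in> space \<gamma>. (\<delta> * N / 4)\<^sup>2 \<le> (dot I x x - \<tau>)\<^sup>2}"
  let ?B = "{x \<in> space \<gamma>. \<delta> * N / 8 \<le> \<bar>dot I m x\<bar>}"
  let ?S = "{x \<in> space \<gamma>. N * (1 - \<delta>) < dot I (plusP I x m) (plusP I x m) \<and>
    dot I (plusP I x m) (plusP I x m) \<le> N * (1 + \<delta>)}"
  have sets: "?A \<in> sets \<gamma>" "?B \<in> sets \<gamma>" "?S \<in> sets \<gamma>" by measurable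
  have "measure \<gamma> ?A \<le> expectation (\<lambda>x. (dot I x x - \<tau>)\<^sup>2) / (\<delta> * N / 4)\<^sup>2"
    using norm_variance(1)[OF r] \<delta> N unfolding \<tau>_def[symmetric]
    by (intro integral_Markov_inequality_measure[where A = "space \<gamma>"] sets.top) simp_all
  also have "\<dots> \<le> (card I / (2 * c\<^sup>2)) / (\<delta> * N / 4)\<^sup>2"
    using norm_variance(2)[OF r] unfolding \<tau>_def by (intro divide_right_mono) simp_all
  also have "\<dots> = 8 / (c\<^sup>2 * \<delta>\<^sup>2 * N)" using N \<delta> c by (simp add: power2_eq_square field_simps)
  finally have A: "measure \<gamma> ?A \<le> 8 / (c\<^sup>2 * \<delta>\<^sup>2 * N)" .
  have "emeasure \<gamma> ?B \<le> ennreal (2 * exp (- ((\<delta> * N / 8)\<^sup>2 * c / (K * N))))"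
    using m K N \<delta> by (intro linear_tail) auto
  also have "(\<delta> * N / 8)\<^sup>2 * c / (K * N) = \<delta>\<^sup>2 * c / (64 * K) * N"
    using N K by (simp add: power2_eq_square field_simps)
  finally have B: "measure \<gamma> ?B \<le> 2 * exp (- (\<delta>\<^sup>2 * c / (64 * K) * N))"
    by (simp add: emeasure_eq_measure)
  have "space \<gamma> - ?S \<subseteq> ?A \<union> ?B"
  proof
    fix x assume x: "x \<in> space \<gamma> - ?S"
    show "x \<in> ?A \<union> ?B"
    proof (rule ccontr)
      assume "x \<notin> ?A \<union> ?B"
      then have a: "(dot I x x - \<tau>)\<^sup>2 < (\<delta> * N / 4)\<^sup>2" and b: "\<bar>dot I m x\<bar> < \<delta> * N / 8" using x by auto
      have a': "\<bar>dot I x x - \<tau>\<bar> < \<delta> * N / 4"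
        using power2_less_imp_less[of "\<bar>dot I x x - \<tau>\<bar>" "\<delta> * N / 4"] a \<delta> by simp
      have "dot I (plusP I x m) (plusP I x m) = dot I (\<lambda>i. x i + m i) (\<lambda>i. x i + m i)"
        by (intro dot_cong) (simp_all add: plusP_def)
      also have "\<dots> = dot I x x + 2 * dot I m x + dot I m m"
        by (simp add: dot_add_left dot_add_right dot_commute)
      finally have d: "dot I (plusP I x m) (plusP I x m) = dot I x x + 2 * dot I m x + dot I m m" .
      have "(\<tau> + dot I m m) / N - 1 = (\<tau> + dot I m m - N) / N"
        using N by (simp add: diff_divide_distrib)
      then have "\<bar>(\<tau> + dot I m m) / N - 1\<bar> = \<bar>\<tau> + dot I m m - N\<bar> / N"
        by (simp only: abs_divide abs_of_nat)
      then have n: "\<bar>\<tau> + dot I m m - N\<bar> \<le> \<delta> * N / 4"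
        using norm N unfolding \<tau>_def[symmetric] by (simp add: pos_divide_le_eq)
      have "0 < \<delta> * N" using \<delta> N by simp
      then have "N - \<delta> * N < dot I x x + 2 * dot I m x + dot I m m \<and> dot I x x + 2 * dot I m x + dot I m m \<le> N + \<delta> * N"
        using a' b n by linarith
      then have "x \<in> ?S" using x by (simp add: d right_diff_distrib distrib_left mult.commute)
      then show False using x by blast
    qed
  qed
  then have "measure \<gamma> (space \<gamma> - ?S) \<le> measure \<gamma> ?A + measure \<gamma> ?B"
    using sets by (intro order_trans[OF finite_measure_mono measure_Un_le]) auto
  also have "\<dots> \<le> 1 / 2" using A B large by linarith
  finally have "1 / 2 \<le> measure \<gamma> ?S" using prob_compl[OF sets(3)] by simp
  then show ?thesis by (simp only: emeasure_eq_measure ennreal_leI)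
qed

end

section \<open>Cone measure on the sphere and integrals over shells\<close>

lemma norm_N_dot: "(norm_N N x)\<^sup>2 = dot {..<N} x x"
  by (simp add: norm_N_def dot_def sum_nonneg power2_eq_square)

lemma norm_N_le_iff: "0 \<le> R \<Longrightarrow> norm_N N x \<le> sqrt R \<longleftrightarrow> dot {..<N} x x \<le> R"
  by (simp add: norm_N_def dot_def power2_eq_square)

lemma radial_projection_scale:
  assumes "0 < s"
  shows "radial_projection N (\<lambda>i\<in>{..<N}. s * x i) = radial_projection N x"
proof -
  have "norm_N N (\<lambda>i\<in>{..<N}. s * x i) = sqrt (\<Sum>i<N. s\<^sup>2 * (x i)\<^sup>2)"
    by (simp add: norm_N_def power_mult_distrib)
  also have "\<dots> = s * norm_N N x"
    using assms by (simp add: norm_N_def real_sqrt_mult flip: sum_distrib_left)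
  finally show ?thesis using assms by (auto simp: radial_projection_def fun_eq_iff)
qed

lemma radial_projection_sphere:
  assumes "0 < dot {..<N} x x"
  shows "radial_projection N x \<in> sphere_N N"
proof -
  have n: "0 < norm_N N x" using assms by (simp add: norm_N_def dot_def power2_eq_square)
  have "(\<Sum>i<N. (radial_projection N x i)\<^sup>2) = (\<Sum>i<N. N / (norm_N N x)\<^sup>2 * (x i)\<^sup>2)"
    by (simp add: radial_projection_def power_divide power_mult_distrib)
  also have "\<dots> = N / (norm_N N x)\<^sup>2 * (\<Sum>i<N. (x i)\<^sup>2)" by (simp only: sum_distrib_left)
  also have "(\<Sum>i<N. (x i)\<^sup>2) = (norm_N N x)\<^sup>2" by (simp add: norm_N_def sum_nonneg)
  finally have "(\<Sum>i<N. (radial_projection N x i)\<^sup>2) = N" using n by simp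
  then show ?thesis by (simp add: sphere_N_def norm_N_def radial_projection_def)
qed

text \<open>Were the measure of the ball 0 or infinite, the uniform distribution on it would be the
  zero measure, against the fact that the sphere carries a probability measure.\<close>

lemma emeasure_unit_ball:
  assumes "N \<ge> 1"
  shows "emeasure (lborel_N N) (unit_ball_N N) \<noteq> 0" "emeasure (lborel_N N) (unit_ball_N N) \<noteq> \<infinity>"
proof -
  interpret prob_space "uniform_sphere N" using assms by (rule prob_space_uniform_sphere)
  have "emeasure (uniform_sphere N) (space (uniform_sphere N)) = 0"
    if "emeasure (lborel_N N) (unit_ball_N N) = 0 \<or> emeasure (lborel_N N) (unit_ball_N N) = \<infinity>"
  proof -
    have z: "emeasure (uniform_measure (lborel_N N) (unit_ball_N N)) B = 0" if "B \<in> sets (lborel_N N)" for B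
    proof -
      have "emeasure (lborel_N N) (unit_ball_N N \<inter> B) \<le> emeasure (lborel_N N) (unit_ball_N N)"
        by (intro emeasure_mono) auto
      then show ?thesis using \<open>_ \<or> _\<close> that by auto
    qed
    have "emeasure (uniform_sphere N) (space (uniform_sphere N)) =
      emeasure (distr (uniform_measure (lborel_N N) (unit_ball_N N)) (lborel_N N) (radial_projection N)) (sphere_N N \<inter> space (lborel_N N))"
      unfolding uniform_sphere_def by (subst emeasure_restrict_space) (auto simp: space_restrict_space)
    also have "\<dots> = emeasure (uniform_measure (lborel_N N) (unit_ball_N N))
        (radial_projection N -` (sphere_N N \<inter> space (lborel_N N)) \<inter> space (uniform_measure (lborel_N N) (unit_ball_N N)))"
      by (rule emeasure_distr) measurable
    also have "\<dots> = 0"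
      by (rule z)
         (use measurable_sets[OF radial_projection_measurable, of "sphere_N N \<inter> space (lborel_N N)" N] in simp)
    finally show ?thesis .
  qed
  then show "emeasure (lborel_N N) (unit_ball_N N) \<noteq> 0" "emeasure (lborel_N N) (unit_ball_N N) \<noteq> \<infinity>"
    using emeasure_space_1 by auto
qed

lemma nn_integral_uniform_sphere:
  assumes [measurable]: "F \<in> borel_measurable (lborel_N N)"
  shows "(\<integral>\<^sup>+\<sigma>. F \<sigma> \<partial>uniform_sphere N) =
    (\<integral>\<^sup>+x. F (radial_projection N x) * indicator (sphere_N N) (radial_projection N x) * indicator (unit_ball_N N) x \<partial>lborel_N N)
      / emeasure (lborel_N N) (unit_ball_N N)"
proof -
  let ?U = "uniform_measure (lborel_N N) (unit_ball_N N)"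
  have "(\<integral>\<^sup>+\<sigma>. F \<sigma> \<partial>uniform_sphere N) = (\<integral>\<^sup>+\<sigma>. F \<sigma> * indicator (sphere_N N) \<sigma> \<partial>distr ?U (lborel_N N) (radial_projection N))"
    unfolding uniform_sphere_def by (rule nn_integral_restrict_space) simp
  also have "\<dots> = (\<integral>\<^sup>+x. F (radial_projection N x) * indicator (sphere_N N) (radial_projection N x) \<partial>?U)"
    by (rule nn_integral_distr) measurable
  also have "\<dots> = (\<integral>\<^sup>+x. F (radial_projection N x) * indicator (sphere_N N) (radial_projection N x) * indicator (unit_ball_N N) x \<partial>lborel_N N)
      / emeasure (lborel_N N) (unit_ball_N N)"
    by (rule nn_integral_uniform_measure) measurable
  finally show ?thesis .
qed

text \<open>A dilation is a linear bijection and multiplies Lebesgue integrals by one constant C for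
  all integrands; a function constant on rays does not feel it. That C is neither 0 nor infinite
  follows from f = 1; its value is never computed.\<close>

lemma ball_scaling:
  assumes N: "N \<ge> 1" and R: "0 < R"
  shows "\<exists>k::real. 0 < k \<and> (\<forall>f\<in>borel_measurable (lborel_N N). (\<forall>s>0. \<forall>x. f (\<lambda>i\<in>{..<N}. s * x i) = f x) \<longrightarrow>
    (\<integral>\<^sup>+x. f x * indicator {x. dot {..<N} x x \<le> R} x \<partial>lborel_N N)
      = ennreal k * (\<integral>\<^sup>+x. f x * indicator (unit_ball_N N) x \<partial>lborel_N N))"
proof -
  let ?I = "{..<N}" and ?\<nu> = "lborel_N N"
  define T where "T s x = (\<lambda>i\<in>?I. s * x i)" for s :: real and x :: "nat \<Rightarrow> real"
  define s where "s = sqrt R"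
  have s: "0 < s" "s * s = R" using R by (simp_all add: s_def)
  have [measurable]: "T s \<in> ?\<nu> \<rightarrow>\<^sub>M ?\<nu>" unfolding T_def by (intro measurable_restrict) simp
  define g where "g x = (\<Prod>k\<in>?I. ennreal (std_normal_density (x k)))" for x :: "nat \<Rightarrow> real"
  have [measurable]: "g \<in> borel_measurable ?\<nu>" unfolding g_def by measurable
  have g: "(\<integral>\<^sup>+x. g x \<partial>?\<nu>) = 1"
  proof -
    interpret prob_space "gaussP ?I" by (rule prob_space_gaussP)
    have "(\<integral>\<^sup>+x. 1 \<partial>gaussP ?I) = (\<integral>\<^sup>+x. g x * 1 \<partial>?\<nu>)"
      unfolding gaussP_eq_density[OF finite_lessThan] g_def by (rule nn_integral_density) measurable
    then show ?thesis using emeasure_space_1 by simp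
  qed
  define C where "C = (\<integral>\<^sup>+x. g (minusP ?I (T s x)) \<partial>?\<nu>)"
  have scale: "(\<integral>\<^sup>+x. f (T s x) \<partial>?\<nu>) = C * (\<integral>\<^sup>+x. f x \<partial>?\<nu>)" if f: "f \<in> borel_measurable ?\<nu>" for f
  proof -
    have inv: "T (1 / s) y \<in> space ?\<nu> \<and> T s (T (1 / s) y) = y" if "y \<in> space ?\<nu>" for y
      using s(1) that by (auto simp: T_def space_PiM PiE_def extensional_def fun_eq_iff)
    have add: "T s (plusP ?I x y) = plusP ?I (T s x) (T s y)" for x y
      by (auto simp: T_def plusP_def distrib_left)
    have "(\<integral>\<^sup>+x. f (T s x) \<partial>?\<nu>) * (\<integral>\<^sup>+x. g x \<partial>?\<nu>) = C * (\<integral>\<^sup>+x. f x \<partial>?\<nu>)"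
      unfolding C_def by (rule nn_integral_linear_bijection[where T' = "T (1 / s)"]) (use inv add f in simp_all)
    then show ?thesis by (simp add: g)
  qed
  have dT: "dot ?I (T s x) (T s x) = R * dot ?I x x" for x
    by (simp add: T_def dot_def sum_distrib_left s(2)[symmetric] mult_ac)
  have [measurable]: "(\<lambda>x. dot ?I x x) \<in> borel_measurable ?\<nu>"
    unfolding dot_def by (intro borel_measurable_sum borel_measurable_times) simp_all
  have ball: "indicator {x. dot ?I x x \<le> R} (T s x) = (indicator (unit_ball_N N) x :: ennreal)" if "x \<in> space ?\<nu>" for x
  proof -
    have "norm_N N x \<le> 1 \<longleftrightarrow> dot ?I x x \<le> 1" using norm_N_le_iff[of 1 N x] by simp
    then show ?thesis using that R by (auto simp: indicator_def dT unit_ball_N_def space_PiM)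
  qed
  have main: "(\<integral>\<^sup>+x. f x * indicator (unit_ball_N N) x \<partial>?\<nu>)
      = C * (\<integral>\<^sup>+x. f x * indicator {x. dot ?I x x \<le> R} x \<partial>?\<nu>)"
    if f [measurable]: "f \<in> borel_measurable ?\<nu>" and inv: "\<forall>s>0. \<forall>x. f (\<lambda>i\<in>{..<N}. s * x i) = f x" for f
  proof -
    have "(\<integral>\<^sup>+x. f x * indicator (unit_ball_N N) x \<partial>?\<nu>) = (\<integral>\<^sup>+x. f (T s x) * indicator {x. dot ?I x x \<le> R} (T s x) \<partial>?\<nu>)"
    proof (rule nn_integral_cong)
      fix x assume "x \<in> space ?\<nu>"
      moreover have "f (T s x) = f x" using inv s(1) by (simp add: T_def)
      ultimately show "f x * indicator (unit_ball_N N) x = f (T s x) * indicator {x. dot ?I x x \<le> R} (T s x)"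
        by (simp only: ball)
    qed
    also have "\<dots> = C * (\<integral>\<^sup>+x. f x * indicator {x. dot ?I x x \<le> R} x \<partial>?\<nu>)"
    proof (rule scale[of "\<lambda>x. f x * indicator {x. dot ?I x x \<le> R} x"])
      have "(\<lambda>x. f x * indicator {x. dot ?I x x \<le> R} x) = (\<lambda>x. if dot ?I x x \<le> R then f x else 0)"
        by (auto simp: indicator_def)
      then show "(\<lambda>x. f x * indicator {x. dot ?I x x \<le> R} x) \<in> borel_measurable ?\<nu>" by simp
    qed
    finally show ?thesis .
  qed
  let ?V = "emeasure ?\<nu> (unit_ball_N N)" and ?W = "\<integral>\<^sup>+x. 1 * indicator {x. dot ?I x x \<le> R} x \<partial>?\<nu>"
  have VW: "?V = C * ?W" using main[of "\<lambda>_. 1"] by simp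
  have V: "?V \<noteq> 0" "?V \<noteq> \<infinity>" using emeasure_unit_ball[OF N] by auto
  have C: "C \<noteq> 0" "C \<noteq> \<infinity>"
    using V VW by (auto simp: ennreal_mult_eq_top_iff)
  then obtain k' where k': "C = ennreal k'" "0 < k'"
    by (cases C) (auto simp: less_le)
  show ?thesis
  proof (intro exI[of _ "1 / k'"] conjI ballI impI)
    show "0 < 1 / k'" using k' by simp
    fix f :: "(nat \<Rightarrow> real) \<Rightarrow> ennreal"
    assume f: "f \<in> borel_measurable ?\<nu>" "\<forall>s>0. \<forall>x. f (\<lambda>i\<in>{..<N}. s * x i) = f x"
    have "ennreal (1 / k') * (\<integral>\<^sup>+x. f x * indicator (unit_ball_N N) x \<partial>?\<nu>)
      = (ennreal (1 / k') * ennreal k') * (\<integral>\<^sup>+x. f x * indicator {x. dot ?I x x \<le> R} x \<partial>?\<nu>)"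
      unfolding main[OF f] k'(1) by (simp only: mult.assoc)
    also have "ennreal (1 / k') * ennreal k' = 1" using k'(2) by (simp flip: ennreal_mult)
    finally show "(\<integral>\<^sup>+x. f x * indicator {x. dot ?I x x \<le> R} x \<partial>?\<nu>)
      = ennreal (1 / k') * (\<integral>\<^sup>+x. f x * indicator (unit_ball_N N) x \<partial>?\<nu>)" by simp
  qed
qed

text \<open>The parameters are squared radii. Half open, so that the larger closed ball is the
  disjoint union of the smaller one and the shell.\<close>

definition shell :: "nat \<Rightarrow> real \<Rightarrow> real \<Rightarrow> (nat \<Rightarrow> real) set" where
  "shell N R R' = {x. R < dot {..<N} x x \<and> dot {..<N} x x \<le> R'}"

text \<open>The constant k is the same for all \<open>F\<close>, which lets it cancel in a quotient
  of two spherical integrals. It comes from the difference of two ball constants; boundedness of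
  \<open>F\<close> keeps the subtraction away from infinity.\<close>

lemma sphere_shell:
  assumes N: "N \<ge> 1" and R: "0 < R" "R \<le> R'"
  shows "\<exists>k::ennreal. \<forall>F\<in>borel_measurable (lborel_N N). \<forall>B::real. (\<forall>\<sigma>\<in>sphere_N N. F \<sigma> \<le> ennreal B) \<longrightarrow>
    (\<integral>\<^sup>+x. F (radial_projection N x) * indicator (shell N R R') x \<partial>lborel_N N) = k * (\<integral>\<^sup>+\<sigma>. F \<sigma> \<partial>uniform_sphere N)"
proof -
  let ?\<nu> = "lborel_N N" and ?I = "{..<N}"
  let ?V = "emeasure ?\<nu> (unit_ball_N N)"
  have V: "?V \<noteq> 0" "?V \<noteq> \<infinity>" using emeasure_unit_ball[OF N] by auto
  have R': "0 < R'" using R by simp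
  obtain k where k: "0 < k" "\<And>f. f \<in> borel_measurable ?\<nu> \<Longrightarrow> \<forall>s>0. \<forall>x. f (\<lambda>i\<in>{..<N}. s * x i) = f x \<Longrightarrow>
    (\<integral>\<^sup>+x. f x * indicator {x. dot ?I x x \<le> R} x \<partial>?\<nu>) = ennreal k * (\<integral>\<^sup>+x. f x * indicator (unit_ball_N N) x \<partial>?\<nu>)"
    using ball_scaling[OF N R(1)] by blast
  obtain k' where k': "0 < k'" "\<And>f. f \<in> borel_measurable ?\<nu> \<Longrightarrow> \<forall>s>0. \<forall>x. f (\<lambda>i\<in>{..<N}. s * x i) = f x \<Longrightarrow>
    (\<integral>\<^sup>+x. f x * indicator {x. dot ?I x x \<le> R'} x \<partial>?\<nu>) = ennreal k' * (\<integral>\<^sup>+x. f x * indicator (unit_ball_N N) x \<partial>?\<nu>)"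
    using ball_scaling[OF N R'] by blast
  have [measurable]: "(\<lambda>x. dot ?I x x) \<in> borel_measurable ?\<nu>"
    unfolding dot_def by (intro borel_measurable_sum borel_measurable_times) simp_all
  show ?thesis
  proof (intro exI[of _ "(ennreal k' - ennreal k) * ?V"] ballI allI impI)
    fix F and B :: real
    assume F [measurable]: "F \<in> borel_measurable ?\<nu>" and B: "\<forall>\<sigma>\<in>sphere_N N. F \<sigma> \<le> ennreal B"
    define f where "f x = F (radial_projection N x) * indicator (sphere_N N) (radial_projection N x)" for x
    have f [measurable]: "f \<in> borel_measurable ?\<nu>" unfolding f_def by measurable
    have inv: "\<forall>s>0. \<forall>x. f (\<lambda>i\<in>{..<N}. s * x i) = f x"
      by (simp add: f_def radial_projection_scale)
    define J where "J = (\<integral>\<^sup>+x. f x * indicator (unit_ball_N N) x \<partial>?\<nu>)"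
    have f_le: "f x \<le> ennreal B" for x using B by (auto simp: f_def indicator_def)
    have "J \<le> (\<integral>\<^sup>+x. ennreal B * indicator (unit_ball_N N) x \<partial>?\<nu>)"
      unfolding J_def by (intro nn_integral_mono mult_right_mono f_le) simp
    also have "\<dots> = ennreal B * ?V" by (rule nn_integral_cmult_indicator) simp
    also have "\<dots> < \<infinity>" using V by (simp add: ennreal_mult_less_top less_top)
    finally have J: "J \<noteq> \<infinity>" by simp
    have first: "(\<integral>\<^sup>+x. F (radial_projection N x) * indicator (shell N R R') x \<partial>?\<nu>)
      = (\<integral>\<^sup>+x. f x * indicator (shell N R R') x \<partial>?\<nu>)"
    proof (rule nn_integral_cong)
      fix x
      show "F (radial_projection N x) * indicator (shell N R R') x = f x * indicator (shell N R R') x"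
      proof (cases "x \<in> shell N R R'")
        case True
        then have "0 < dot ?I x x" using R(1) by (simp add: shell_def)
        then show ?thesis using radial_projection_sphere by (simp add: f_def)
      qed simp
    qed
    have "(\<integral>\<^sup>+x. f x * indicator {x. dot ?I x x \<le> R'} x \<partial>?\<nu>)
      = (\<integral>\<^sup>+x. f x * indicator {x. dot ?I x x \<le> R} x \<partial>?\<nu>) + (\<integral>\<^sup>+x. f x * indicator (shell N R R') x \<partial>?\<nu>)"
    proof -
      have m: "(\<lambda>x. f x * indicator {x. dot ?I x x \<le> R} x) \<in> borel_measurable ?\<nu>"
        "(\<lambda>x. f x * indicator (shell N R R') x) \<in> borel_measurable ?\<nu>"
      proof -
        have "(\<lambda>x. f x * indicator {x. dot ?I x x \<le> R} x) = (\<lambda>x. if dot ?I x x \<le> R then f x else 0)"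
          "(\<lambda>x. f x * indicator (shell N R R') x) = (\<lambda>x. if R < dot ?I x x \<and> dot ?I x x \<le> R' then f x else 0)"
          by (auto simp: indicator_def shell_def)
        then show "(\<lambda>x. f x * indicator {x. dot ?I x x \<le> R} x) \<in> borel_measurable ?\<nu>"
          "(\<lambda>x. f x * indicator (shell N R R') x) \<in> borel_measurable ?\<nu>" by simp_all
      qed
      have "f x * indicator {x. dot ?I x x \<le> R'} x = f x * indicator {x. dot ?I x x \<le> R} x + f x * indicator (shell N R R') x" for x
        using R by (auto simp: indicator_def shell_def)
      then show ?thesis using nn_integral_add[OF m] by simp
    qed
    then have "ennreal k' * J = ennreal k * J + (\<integral>\<^sup>+x. f x * indicator (shell N R R') x \<partial>?\<nu>)"
      unfolding k(2)[OF f inv] k'(2)[OF f inv] J_def .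
    then have "(\<integral>\<^sup>+x. f x * indicator (shell N R R') x \<partial>?\<nu>) = ennreal k' * J - ennreal k * J"
      using J by (simp add: ennreal_mult_eq_top_iff)
    also have "\<dots> = (ennreal k' - ennreal k) * J"
    proof (cases J)
      case (real j)
      have "ennreal k' * J - ennreal k * J = ennreal (k' * j - k * j)"
        using k(1) k'(1) real by (simp add: ennreal_minus flip: ennreal_mult)
      also have "k' * j - k * j = (k' - k) * j" by (simp add: left_diff_distrib)
      also have "ennreal ((k' - k) * j) = ennreal (k' - k) * ennreal j" by (rule ennreal_mult''[OF real(1)])
      also have "ennreal (k' - k) = ennreal k' - ennreal k" using k(1) by (simp add: ennreal_minus)
      finally show ?thesis using real(2) by simp
    qed (use J in simp)
    also have "J = ?V * (\<integral>\<^sup>+\<sigma>. F \<sigma> \<partial>uniform_sphere N)"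
      unfolding nn_integral_uniform_sphere[OF F] J_def f_def using V
      by (simp add: ennreal_times_divide mult_divide_eq_ennreal mult.commute[of ?V])
    finally have "(\<integral>\<^sup>+x. f x * indicator (shell N R R') x \<partial>?\<nu>) = (ennreal k' - ennreal k) * ?V * (\<integral>\<^sup>+\<sigma>. F \<sigma> \<partial>uniform_sphere N)"
      by (simp only: mult.assoc)
    then show "(\<integral>\<^sup>+x. F (radial_projection N x) * indicator (shell N R R') x \<partial>?\<nu>)
      = (ennreal k' - ennreal k) * ?V * (\<integral>\<^sup>+\<sigma>. F \<sigma> \<partial>uniform_sphere N)"
      unfolding first .
  qed
qed

section \<open>Gibbs measures as conditioned Gaussians\<close>

abbreviation coupling :: "nat \<Rightarrow> (nat \<Rightarrow> nat \<Rightarrow> real) \<Rightarrow> nat \<Rightarrow> nat \<Rightarrow> real" where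
  "coupling N a \<equiv> gmat N (\<lambda>(i, j). a i j)"

lemma hamiltonian_dot: "hamiltonian N a x = dot {..<N} x (mv {..<N} (coupling N a) x)"
proof -
  have "dot {..<N} x (mv {..<N} (coupling N a) x)
    = ((\<Sum>i<N. \<Sum>j<N. a i j * x i * x j) + (\<Sum>i<N. \<Sum>j<N. a j i * x i * x j)) / (2 * sqrt (2 * real N))"
    by (simp add: dot_def mv_def gmat_def sum_distrib_left sum_divide_distrib add_divide_distrib
        distrib_left distrib_right sum.distrib mult_ac)
  also have "(\<Sum>i<N. \<Sum>j<N. a j i * x i * x j) = (\<Sum>j<N. \<Sum>i<N. a j i * x j * x i)"
    by (subst sum.swap) (simp add: mult_ac)
  finally show ?thesis by (simp add: hamiltonian_def real_sqrt_mult)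
qed

lemma gibbs_weight_dot:
  "gibbs_weight N a \<beta> h x = exp (\<beta> * dot {..<N} x (mv {..<N} (coupling N a) x) + h * (\<Sum>i<N. x i))"
  by (simp add: gibbs_weight_def hamiltonian_dot)

lemma gibbs_weight_measurable_lborel [measurable]: "gibbs_weight N a \<beta> h \<in> borel_measurable (lborel_N N)"
  unfolding gibbs_weight_def hamiltonian_def by measurable

lemma space_uniform_sphere: "space (uniform_sphere N) = sphere_N N"
  by (auto simp: uniform_sphere_def space_restrict_space sphere_N_def space_PiM)

lemma space_gibbs_measure: "space (gibbs_measure N a \<beta> h) = sphere_N N"
  by (simp add: gibbs_measure_def space_uniform_sphere)

lemma sets_gibbs_measure: "sets (gibbs_measure N a \<beta> h) = sets (uniform_sphere N)"
  by (simp add: gibbs_measure_def)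

lemma measurable_uniform_sphere: "f \<in> M \<rightarrow>\<^sub>M B \<Longrightarrow> sets M = sets (lborel_N N) \<Longrightarrow> f \<in> uniform_sphere N \<rightarrow>\<^sub>M B"
  unfolding uniform_sphere_def by (intro measurable_restrict_space1) (simp cong: measurable_cong_sets)

lemma partition_function_nn:
  assumes "N \<ge> 1"
  shows "0 < partition_function N a \<beta> h"
    and "(\<integral>\<^sup>+\<sigma>. ennreal (gibbs_weight N a \<beta> h \<sigma>) \<partial>uniform_sphere N) = ennreal (partition_function N a \<beta> h)"
proof -
  interpret prob_space "uniform_sphere N" using assms by (rule prob_space_uniform_sphere)
  interpret G: prob_space "gibbs_measure N a \<beta> h" using assms by (rule prob_space_gibbs_measure)
  have pos: "gibbs_weight N a \<beta> h \<sigma> > 0" for \<sigma> by (simp add: gibbs_weight_def)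
  obtain B where B: "\<And>\<sigma>. \<sigma> \<in> sphere_N N \<Longrightarrow> gibbs_weight N a \<beta> h \<sigma> \<le> B"
    using gibbs_weight_bound by blast
  have int: "integrable (uniform_sphere N) (gibbs_weight N a \<beta> h)"
    using B pos by (intro integrable_const_bound[of _ B]) (auto simp: less_imp_le space_uniform_sphere intro!: AE_I2)
  show eq: "(\<integral>\<^sup>+\<sigma>. ennreal (gibbs_weight N a \<beta> h \<sigma>) \<partial>uniform_sphere N) = ennreal (partition_function N a \<beta> h)"
    unfolding partition_function_def using int pos by (intro nn_integral_eq_integral) (auto simp: less_imp_le)
  have "partition_function N a \<beta> h \<noteq> 0"
  proof
    assume "partition_function N a \<beta> h = 0"
    then have "emeasure (gibbs_measure N a \<beta> h) (space (gibbs_measure N a \<beta> h)) = 0"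
      by (simp add: gibbs_measure_def emeasure_density)
    then show False using G.emeasure_space_1 by simp
  qed
  moreover have "partition_function N a \<beta> h \<ge> 0"
    unfolding partition_function_def using pos by (intro integral_nonneg_AE AE_I2 less_imp_le)
  ultimately show "0 < partition_function N a \<beta> h" by simp
qed

text \<open>Stated as a product, which avoids division in the extended reals.\<close>

lemma nn_integral_gibbs:
  assumes N: "N \<ge> 1" and f: "f \<in> borel_measurable (uniform_sphere N)"
  shows "(\<integral>\<^sup>+\<sigma>. f \<sigma> \<partial>gibbs_measure N a \<beta> h) * ennreal (partition_function N a \<beta> h)
    = (\<integral>\<^sup>+\<sigma>. ennreal (gibbs_weight N a \<beta> h \<sigma>) * f \<sigma> \<partial>uniform_sphere N)"
proof -
  let ?Z = "partition_function N a \<beta> h"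
  have Z: "0 < ?Z" by (rule partition_function_nn[OF N])
  have "(\<integral>\<^sup>+\<sigma>. f \<sigma> \<partial>gibbs_measure N a \<beta> h) = (\<integral>\<^sup>+\<sigma>. ennreal (gibbs_weight N a \<beta> h \<sigma> / ?Z) * f \<sigma> \<partial>uniform_sphere N)"
    unfolding gibbs_measure_def using f by (intro nn_integral_density) simp_all
  also have "\<dots> = (\<integral>\<^sup>+\<sigma>. ennreal (1 / ?Z) * (ennreal (gibbs_weight N a \<beta> h \<sigma>) * f \<sigma>) \<partial>uniform_sphere N)"
  proof (rule nn_integral_cong)
    fix \<sigma>
    have "ennreal (gibbs_weight N a \<beta> h \<sigma> / ?Z) = ennreal (1 / ?Z) * ennreal (gibbs_weight N a \<beta> h \<sigma>)"
      using Z by (simp add: gibbs_weight_def flip: ennreal_mult)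
    then show "ennreal (gibbs_weight N a \<beta> h \<sigma> / ?Z) * f \<sigma> = ennreal (1 / ?Z) * (ennreal (gibbs_weight N a \<beta> h \<sigma>) * f \<sigma>)"
      by (simp only: mult.assoc)
  qed
  also have "\<dots> = ennreal (1 / ?Z) * (\<integral>\<^sup>+\<sigma>. ennreal (gibbs_weight N a \<beta> h \<sigma>) * f \<sigma> \<partial>uniform_sphere N)"
    using f by (intro nn_integral_cmult) measurable
  finally have "(\<integral>\<^sup>+\<sigma>. f \<sigma> \<partial>gibbs_measure N a \<beta> h) * ennreal ?Z
    = (ennreal (1 / ?Z) * ennreal ?Z) * (\<integral>\<^sup>+\<sigma>. ennreal (gibbs_weight N a \<beta> h \<sigma>) * f \<sigma> \<partial>uniform_sphere N)"
    by (simp only: mult_ac)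
  also have "ennreal (1 / ?Z) * ennreal ?Z = 1" using Z by (simp flip: ennreal_mult)
  finally show ?thesis by simp
qed

section \<open>Comparison of the Gibbs measure with a Gaussian\<close>

lemma gaussian_form_coupling:
  assumes "0 < \<beta>" "L < \<zeta>" and norm: "\<And>y. \<bar>dot {..<N} y (mv {..<N} (coupling N a) y)\<bar> \<le> L * dot {..<N} y y"
  shows "gaussian_form {..<N} (\<lambda>i j. \<beta> * shifted \<zeta> (coupling N a) i j) (\<beta> * (\<zeta> - L))"
proof
  show "symm_on {..<N} (\<lambda>i j. \<beta> * shifted \<zeta> (coupling N a) i j)"
    using symm_on_shifted[OF symm_on_gmat[of "{..<N}" N "\<lambda>(i, j). a i j"], of \<zeta>] by (auto simp: symm_on_def)
  show "0 < \<beta> * (\<zeta> - L)" using assms by simp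
  fix y :: "nat \<Rightarrow> real"
  have "mv {..<N} (\<lambda>i j. \<beta> * shifted \<zeta> (coupling N a) i j) y = (\<lambda>i. \<beta> * mv {..<N} (shifted \<zeta> (coupling N a)) y i)"
    by (simp add: mv_def fun_eq_iff sum_distrib_left mult.assoc)
  then have "dot {..<N} y (mv {..<N} (\<lambda>i j. \<beta> * shifted \<zeta> (coupling N a) i j) y)
    = \<beta> * (\<zeta> * dot {..<N} y y - dot {..<N} y (mv {..<N} (coupling N a) y))"
    by (simp only: dot_scale_right dot_shifted[OF finite_lessThan])
  moreover have "\<beta> * ((\<zeta> - L) * dot {..<N} y y) \<le> \<beta> * (\<zeta> * dot {..<N} y y - dot {..<N} y (mv {..<N} (coupling N a) y))"
    using assms(1) norm[of y] by (intro mult_left_mono) (auto simp: left_diff_distrib abs_le_iff)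
  ultimately show "\<beta> * (\<zeta> - L) * dot {..<N} y y \<le> dot {..<N} y (mv {..<N} (\<lambda>i j. \<beta> * shifted \<zeta> (coupling N a) i j) y)"
    by (simp add: mult.assoc)
qed simp

lemma abs_sum_le_dot:
  fixes N :: nat
  shows "\<bar>\<Sum>i<N. x i\<bar> \<le> sqrt N * sqrt (dot {..<N} x x)"
  using abs_dot_le[of "{..<N}" "\<lambda>_. 1" x] by (simp add: dot_def)

text \<open>On the sphere the term \<open>\<beta> \<zeta> (x \<cdot> x)\<close> is constant, so there the exponents of the Gibbs weight and of
  the Gaussian differ by a constant only; the error comes from the width of the shell.\<close>

lemma gibbs_weight_radial:
  fixes N :: nat and \<delta> \<beta> \<zeta> L h :: real
  assumes N: "N \<ge> 1" and \<delta>: "0 < \<delta>" "\<delta> < 1" and \<beta>: "0 < \<beta>" and \<zeta>: "0 \<le> L" "L < \<zeta>"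
    and norm: "\<And>y. \<bar>dot {..<N} y (mv {..<N} (coupling N a) y)\<bar> \<le> L * dot {..<N} y y"
    and m: "resolves {..<N} (coupling N a) \<zeta> (\<lambda>_. h) (\<lambda>i. 2 * \<beta> * m i)"
    and x: "x \<in> shell N (N * (1 - \<delta>)) (N * (1 + \<delta>))"
  defines "P \<equiv> \<lambda>i j. \<beta> * shifted \<zeta> (coupling N a) i j" and "X \<equiv> radial_projection N x"
  defines "u \<equiv> dot {..<N} m (mv {..<N} P m) + \<beta> * \<zeta> * N"
  shows "\<bar>ln (gibbs_weight N a \<beta> h X) - (u - dot {..<N} (\<lambda>i. x i - m i) (mv {..<N} P (\<lambda>i. x i - m i)))\<bar>
      \<le> \<delta> * (\<beta> * L + \<bar>h\<bar> + \<beta> * \<zeta>) * N"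
    and "dot {..<N} X X = N" and "\<bar>dot {..<N} x t - dot {..<N} X t\<bar> \<le> \<delta> * \<bar>dot {..<N} X t\<bar>"
proof -
  let ?I = "{..<N}" and ?A = "coupling N a"
  have fin: "finite ?I" by simp
  \<comment> \<open>The point is x = \<rho> X with X on the sphere, and \<rho>^2 is within \<delta>
    of 1 on the shell.\<close>
  define \<rho> where "\<rho> = norm_N N x / sqrt N"
  have dx: "N * (1 - \<delta>) < dot ?I x x" "dot ?I x x \<le> N * (1 + \<delta>)" using x by (simp_all add: shell_def)
  have "0 < N * (1 - \<delta>)" using N \<delta> by simp
  then have dpos: "0 < dot ?I x x" using dx by linarith
  have rho2: "\<rho>\<^sup>2 = dot ?I x x / N" using N by (simp add: \<rho>_def power_divide norm_N_dot)
  have nx: "0 < norm_N N x" using dpos by (simp add: norm_N_def dot_def power2_eq_square)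
  have rho: "0 < \<rho>" using nx N by (simp add: \<rho>_def)
  have rho2': "\<bar>\<rho>\<^sup>2 - 1\<bar> \<le> \<delta>"
  proof -
    have "1 - \<delta> < \<rho>\<^sup>2" "\<rho>\<^sup>2 \<le> 1 + \<delta>" using dx N by (simp_all add: rho2 field_simps)
    then show ?thesis by linarith
  qed
  have rho1: "\<bar>\<rho> - 1\<bar> \<le> \<delta>"
  proof -
    have "\<bar>\<rho> - 1\<bar> * 1 \<le> \<bar>\<rho> - 1\<bar> * (\<rho> + 1)" using rho by (intro mult_left_mono) auto
    also have "\<dots> = \<bar>\<rho>\<^sup>2 - 1\<bar>"
    proof -
      have "\<rho>\<^sup>2 - 1 = (\<rho> - 1) * (\<rho> + 1)" by (simp add: power2_eq_square algebra_simps)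
      then show ?thesis using rho by (simp add: abs_mult)
    qed
    finally show ?thesis using rho2' by simp
  qed
  have xX: "x i = \<rho> * X i" if "i \<in> ?I" for i
    using that nx N by (simp add: X_def radial_projection_def \<rho>_def)
  have dxX: "dot ?I x t = \<rho> * dot ?I X t" for t
    using xX by (simp add: dot_def sum_distrib_left mult.assoc)
  have dX: "dot ?I X X = N"
  proof -
    have "X \<in> sphere_N N" unfolding X_def using dpos by (rule radial_projection_sphere)
    then show ?thesis using norm_N_dot[of N X] by (simp add: sphere_N_def)
  qed
  then show "dot ?I X X = N" .
  have "dot ?I x t - dot ?I X t = (\<rho> - 1) * dot ?I X t" by (simp add: dxX left_diff_distrib)
  then show "\<bar>dot ?I x t - dot ?I X t\<bar> \<le> \<delta> * \<bar>dot ?I X t\<bar>"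
    using rho1 by (simp add: abs_mult mult_right_mono)
  define E where "E = dot ?I X (mv ?I ?A X)"
  define S where "S = (\<Sum>i<N. X i)"
  have E: "\<bar>E\<bar> \<le> L * N" using norm[of X] dX by (simp add: E_def)
  have S: "\<bar>S\<bar> \<le> N" using abs_sum_le_dot[of X N] dX by (simp add: S_def)
  have lnW: "ln (gibbs_weight N a \<beta> h X) = \<beta> * E + h * S" by (simp add: gibbs_weight_dot E_def S_def)
  have mvx: "mv ?I ?A x i = \<rho> * mv ?I ?A X i" for i
    using xX by (simp add: mv_def sum_distrib_left mult_ac)
  have Ex: "dot ?I x (mv ?I ?A x) = \<rho>\<^sup>2 * E"
  proof -
    have "dot ?I x (mv ?I ?A x) = \<rho> * dot ?I X (\<lambda>i. \<rho> * mv ?I ?A X i)" by (simp only: dxX mvx[abs_def])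
    then show ?thesis by (simp add: dot_scale_right E_def power2_eq_square)
  qed
  have mvP: "mv ?I P y i = \<beta> * mv ?I (shifted \<zeta> ?A) y i" for y i
    by (simp add: P_def mv_def sum_distrib_left mult.assoc)
  have dotP: "dot ?I y (mv ?I P w) = \<beta> * (\<zeta> * dot ?I y w - dot ?I y (mv ?I ?A w))" for y w
    by (simp only: mvP[abs_def] dot_scale_right dot_shifted[OF fin])
  have symP: "symm_on ?I P"
    using symm_on_shifted[OF symm_on_gmat[of ?I N "\<lambda>(i, j). a i j"], of \<zeta>] by (auto simp: symm_on_def P_def)
  \<comment> \<open>By the choice of the centre, P m is the constant h / 2, so the cross term 2 x
    \<cdot> P m is exactly the external field at \<open>x\<close>.\<close>
  have Pm: "mv ?I P m i = h / 2" if i: "i \<in> ?I" for i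
  proof -
    have "\<zeta> * (2 * \<beta> * m i) - mv ?I ?A (\<lambda>i. 2 * \<beta> * m i) i = h" using m i by (simp add: resolves_def)
    moreover have "mv ?I ?A (\<lambda>i. 2 * \<beta> * m i) i = 2 * \<beta> * mv ?I ?A m i" by (rule mv_scale)
    ultimately have "2 * (\<beta> * (\<zeta> * m i - mv ?I ?A m i)) = h" by (simp add: algebra_simps)
    then show ?thesis unfolding mvP mv_shifted[OF fin i] by simp
  qed
  have xPm: "dot ?I x (mv ?I P m) = h / 2 * (\<rho> * S)"
  proof -
    have "dot ?I x (mv ?I P m) = dot ?I x (\<lambda>_. h / 2)" using Pm by (intro dot_cong) simp_all
    also have "\<dots> = \<rho> * dot ?I X (\<lambda>_. h / 2)" by (rule dxX)
    also have "dot ?I X (\<lambda>_. h / 2) = S * (h / 2)" unfolding dot_def S_def by (rule sum_distrib_right[symmetric])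
    finally show ?thesis by simp
  qed
  have "dot ?I (\<lambda>i. x i - m i) (mv ?I P (\<lambda>i. x i - m i))
    = dot ?I x (mv ?I P x) - 2 * dot ?I x (mv ?I P m) + dot ?I m (mv ?I P m)"
  proof -
    have "mv ?I P (\<lambda>i. x i - m i) = (\<lambda>i. mv ?I P x i - mv ?I P m i)" by (simp add: mv_diff fun_eq_iff)
    moreover have "dot ?I m (mv ?I P x) = dot ?I x (mv ?I P m)"
      using dot_mv_symm[OF symP, of m x] by (simp add: dot_commute)
    ultimately show ?thesis by (simp add: dot_diff_left dot_diff_right)
  qed
  then have Q: "dot ?I (\<lambda>i. x i - m i) (mv ?I P (\<lambda>i. x i - m i))
    = \<beta> * (\<zeta> * (\<rho>\<^sup>2 * N) - \<rho>\<^sup>2 * E) - h * (\<rho> * S) + dot ?I m (mv ?I P m)"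
    using N by (simp add: xPm dotP[of x x] Ex rho2)
  \<comment> \<open>Every term carries a factor 1 - \<rho> or 1 - \<rho>^2: after subtraction of the
    constant \<open>u\<close> the exponents agree on the sphere itself.\<close>
  have eq: "ln (gibbs_weight N a \<beta> h X) - (u - dot ?I (\<lambda>i. x i - m i) (mv ?I P (\<lambda>i. x i - m i)))
    = (1 - \<rho>\<^sup>2) * (\<beta> * E) + (1 - \<rho>) * (h * S) + (\<rho>\<^sup>2 - 1) * (\<beta> * \<zeta> * N)"
    unfolding lnW Q u_def by (simp add: algebra_simps)
  have 1: "\<bar>(1 - \<rho>\<^sup>2) * (\<beta> * E)\<bar> \<le> \<delta> * (\<beta> * (L * N))"
    unfolding abs_mult using rho2' E \<beta> \<delta> by (intro mult_mono) (auto simp: abs_minus_commute)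
  have 2: "\<bar>(1 - \<rho>) * (h * S)\<bar> \<le> \<delta> * (\<bar>h\<bar> * N)"
    unfolding abs_mult using rho1 S \<delta> by (intro mult_mono) (auto simp: abs_minus_commute)
  have 3: "\<bar>(\<rho>\<^sup>2 - 1) * (\<beta> * \<zeta> * N)\<bar> \<le> \<delta> * (\<beta> * \<zeta> * N)"
    unfolding abs_mult using rho2' \<beta> \<zeta> \<delta> by (intro mult_mono) auto
  have "\<delta> * (\<beta> * L + \<bar>h\<bar> + \<beta> * \<zeta>) * N = \<delta> * (\<beta> * (L * N)) + \<delta> * (\<bar>h\<bar> * N) + \<delta> * (\<beta> * \<zeta> * N)"
    by (simp add: algebra_simps)
  then show "\<bar>ln (gibbs_weight N a \<beta> h X) - (u - dot ?I (\<lambda>i. x i - m i) (mv ?I P (\<lambda>i. x i - m i)))\<bar>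
      \<le> \<delta> * (\<beta> * L + \<bar>h\<bar> + \<beta> * \<zeta>) * N"
    unfolding eq using 1 2 3 by (smt (verit) abs_triangle_ineq)
qed

text \<open>Numerator and denominator of the Gibbs probability are integrals over one shell with one
  constant k. Replacing the Gibbs weight by exp u times the Gaussian weight costs exp (\<eta> N) in
  each. The shell has Gaussian mass at least 1 / 2 and the deviation at most 2 exp (- (\<epsilon>^2
  c / (4 K)) N), whence the factor 4; the rate is halved because 2 \<eta> may use up the other
  half.\<close>

lemma gibbs_linear_deviation_aux:
  fixes N :: nat and \<delta> \<beta> \<zeta> L h K \<epsilon> c :: real
  assumes N: "N \<ge> 1" and \<delta>: "0 < \<delta>" "\<delta> < 1" and \<beta>: "0 < \<beta>" and \<zeta>: "0 \<le> L" "L < \<zeta>" and K: "0 < K" and \<epsilon>: "0 < \<epsilon>"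
    and norm: "\<And>y. \<bar>dot {..<N} y (mv {..<N} (coupling N a) y)\<bar> \<le> L * dot {..<N} y y"
    and m: "resolves {..<N} (coupling N a) \<zeta> (\<lambda>_. h) (\<lambda>i. 2 * \<beta> * m i)"
    and r: "\<And>j. j < N \<Longrightarrow> resolves {..<N} (coupling N a) \<zeta> (unitv j) (r j)"
    and trace: "\<bar>((\<Sum>j<N. r j j) / (2 * \<beta>) + dot {..<N} m m) / N - 1\<bar> \<le> \<delta> / 4"
    and mK: "dot {..<N} m m \<le> K * N" and tK: "dot {..<N} t t \<le> K * N"
    and c_def: "c = \<beta> * (\<zeta> - L)"
    and large: "8 / (c\<^sup>2 * \<delta>\<^sup>2 * N) + 2 * exp (- (\<delta>\<^sup>2 * c / (64 * K) * N)) \<le> 1 / 2"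
    and \<delta>K: "\<delta> * sqrt K \<le> \<epsilon> / 2" and \<delta>\<eta>: "2 * (\<delta> * (\<beta> * L + \<bar>h\<bar> + \<beta> * \<zeta>)) \<le> \<epsilon>\<^sup>2 * c / (8 * K)"
  shows "emeasure (gibbs_measure N a \<beta> h) {\<sigma> \<in> sphere_N N. \<epsilon> * N \<le> \<bar>dot {..<N} \<sigma> t - dot {..<N} m t\<bar>}
    \<le> ennreal (4 * exp (- (\<epsilon>\<^sup>2 * c / (8 * K)) * N))"
proof -
  let ?I = "{..<N}" and ?\<nu> = "lborel_N N" and ?\<pi> = "radial_projection N"
  define P where "P i j = \<beta> * shifted \<zeta> (coupling N a) i j" for i j
  interpret gaussian_form ?I P c
    unfolding P_def c_def by (rule gaussian_form_coupling[OF \<beta> \<zeta>(2) norm])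
  define \<eta> where "\<eta> = \<delta> * (\<beta> * L + \<bar>h\<bar> + \<beta> * \<zeta>)"
  define u where "u = dot ?I m (mv ?I P m) + \<beta> * \<zeta> * N"
  let ?S = "shell N (N * (1 - \<delta>)) (N * (1 + \<delta>))"
  let ?W = "gibbs_weight N a \<beta> h"
  let ?B = "{\<sigma> \<in> sphere_N N. \<epsilon> * N \<le> \<bar>dot ?I \<sigma> t - dot ?I m t\<bar>}"
  have N0: "0 < N" using N by simp
  have dott [measurable]: "(\<lambda>x. dot ?I t x) \<in> borel_measurable ?\<nu>" for t by (rule dot_measurable)
  have B_sets [measurable]: "?B \<in> sets ?\<nu>"
  proof -
    have "?B = {\<sigma> \<in> space ?\<nu>. \<sigma> \<in> sphere_N N \<and> \<epsilon> * N \<le> \<bar>dot ?I t \<sigma> - dot ?I m t\<bar>}"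
      by (auto simp: sphere_N_def space_PiM dot_commute)
    then show ?thesis by simp
  qed
  have dxx [measurable]: "(\<lambda>x. dot ?I x x) \<in> borel_measurable ?\<nu>"
    unfolding dot_def by (intro borel_measurable_sum borel_measurable_times) simp_all
  have W_exp: "?W \<sigma> = exp (ln (?W \<sigma>))" for \<sigma> by (simp add: gibbs_weight_def)
  have rad: "\<bar>ln (?W (?\<pi> x)) - (u - dot ?I (\<lambda>i. x i - m i) (mv ?I P (\<lambda>i. x i - m i)))\<bar> \<le> \<eta> * N"
    "dot ?I (?\<pi> x) (?\<pi> x) = N" "\<bar>dot ?I x t - dot ?I (?\<pi> x) t\<bar> \<le> \<delta> * \<bar>dot ?I (?\<pi> x) t\<bar>"
    if "x \<in> ?S" for x t
    using gibbs_weight_radial(1,2)[OF N \<delta> \<beta> \<zeta> norm m that] gibbs_weight_radial(3)[OF N \<delta> \<beta> \<zeta> norm m that, of t]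
    unfolding P_def[abs_def, symmetric] u_def \<eta>_def by auto
  have wt: "weight (plusP ?I x (\<lambda>i. - m i)) = exp (- dot ?I (\<lambda>i. x i - m i) (mv ?I P (\<lambda>i. x i - m i)))" for x
  proof -
    have "dot ?I (plusP ?I x (\<lambda>i. - m i)) (mv ?I P (plusP ?I x (\<lambda>i. - m i))) = dot ?I (\<lambda>i. x i - m i) (mv ?I P (\<lambda>i. x i - m i))"
      by (intro dot_cong mv_cong) (simp_all add: plusP_def)
    then show ?thesis by (simp add: weight_def)
  qed
  have upper: "?W (?\<pi> x) \<le> exp (u + \<eta> * N) * weight (plusP ?I x (\<lambda>i. - m i))" if "x \<in> ?S" for x
  proof -
    have "exp (ln (?W (?\<pi> x))) \<le> exp (u + \<eta> * N + - dot ?I (\<lambda>i. x i - m i) (mv ?I P (\<lambda>i. x i - m i)))"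
      using rad(1)[OF that] by (simp add: abs_le_iff)
    then show ?thesis by (simp only: wt exp_add W_exp[symmetric])
  qed
  have lower: "exp (u - \<eta> * N) * weight (plusP ?I x (\<lambda>i. - m i)) \<le> ?W (?\<pi> x)" if "x \<in> ?S" for x
  proof -
    have "exp (u - \<eta> * N + - dot ?I (\<lambda>i. x i - m i) (mv ?I P (\<lambda>i. x i - m i))) \<le> exp (ln (?W (?\<pi> x)))"
      using rad(1)[OF that] by (simp add: abs_le_iff)
    then show ?thesis by (simp only: wt exp_add W_exp[symmetric])
  qed
  have mp: "plusP ?I (plusP ?I x m) (\<lambda>i. - m i) = x" if "x \<in> space ?\<nu>" for x
  proof
    fix i
    show "plusP ?I (plusP ?I x m) (\<lambda>i. - m i) i = x i"
    proof (cases "i \<in> ?I")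
      case False
      then have "x i = undefined" using that unfolding space_PiM by (intro PiE_arb)
      then show ?thesis using False by (simp add: plusP_def)
    qed (simp add: plusP_def)
  qed
  \<comment> \<open>Translation by the centre \<open>m\<close> carries the shifted weight to the
    centred Gaussian.\<close>
  have to_\<gamma>: "(\<integral>\<^sup>+x. ennreal (weight (plusP ?I x (\<lambda>i. - m i))) * indicator A x \<partial>?\<nu>)
      = ennreal Z * emeasure \<gamma> {x \<in> space \<gamma>. plusP ?I x m \<in> A}" if A [measurable]: "A \<in> sets ?\<nu>" for A
  proof -
    have sets: "{x \<in> space \<gamma>. plusP ?I x m \<in> A} \<in> sets ?\<nu>"
      unfolding space_\<gamma> by measurable
    have "(\<integral>\<^sup>+x. ennreal (weight (plusP ?I x (\<lambda>i. - m i))) * indicator A x \<partial>?\<nu>)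
      = (\<integral>\<^sup>+x. ennreal (weight (plusP ?I (plusP ?I x m) (\<lambda>i. - m i))) * indicator A (plusP ?I x m) \<partial>?\<nu>)"
      by (rule nn_integral_translate[OF fin, symmetric, of "\<lambda>x. ennreal (weight (plusP ?I x (\<lambda>i. - m i))) * indicator A x"])
         measurable
    also have "\<dots> = (\<integral>\<^sup>+x. ennreal Z * (ennreal (weight x / Z) * indicator {x \<in> space \<gamma>. plusP ?I x m \<in> A} x) \<partial>?\<nu>)"
    proof (rule nn_integral_cong)
      fix x assume x: "x \<in> space ?\<nu>"
      have "ennreal (weight x) = ennreal Z * ennreal (weight x / Z)"
        using Z(1) weight_pos[of x] by (simp flip: ennreal_mult)
      then show "ennreal (weight (plusP ?I (plusP ?I x m) (\<lambda>i. - m i))) * indicator A (plusP ?I x m)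
        = ennreal Z * (ennreal (weight x / Z) * indicator {x \<in> space \<gamma>. plusP ?I x m \<in> A} x)"
        using x by (simp add: mp space_\<gamma> indicator_def)
    qed
    also have "\<dots> = ennreal Z * (\<integral>\<^sup>+x. ennreal (weight x / Z) * indicator {x \<in> space \<gamma>. plusP ?I x m \<in> A} x \<partial>?\<nu>)"
      using sets by (intro nn_integral_cmult) measurable
    also have "(\<integral>\<^sup>+x. ennreal (weight x / Z) * indicator {x \<in> space \<gamma>. plusP ?I x m \<in> A} x \<partial>?\<nu>)
      = emeasure \<gamma> {x \<in> space \<gamma>. plusP ?I x m \<in> A}"
      unfolding \<gamma>_def by (rule emeasure_density[symmetric]) (use sets in \<open>simp_all add: \<gamma>_def\<close>)
    finally show ?thesis .
  qed
  obtain k where k: "\<And>F B. F \<in> borel_measurable ?\<nu> \<Longrightarrow> \<forall>\<sigma>\<in>sphere_N N. F \<sigma> \<le> ennreal B \<Longrightarrow>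
    (\<integral>\<^sup>+x. F (?\<pi> x) * indicator ?S x \<partial>?\<nu>) = k * (\<integral>\<^sup>+\<sigma>. F \<sigma> \<partial>uniform_sphere N)"
    using sphere_shell[OF N, of "N * (1 - \<delta>)" "N * (1 + \<delta>)"] N \<delta> by auto
  obtain b where b: "\<And>\<sigma>. \<sigma> \<in> sphere_N N \<Longrightarrow> ?W \<sigma> \<le> b"
    using gibbs_weight_bound by blast
  have kW: "(\<integral>\<^sup>+x. ennreal (?W (?\<pi> x)) * indicator ?S x \<partial>?\<nu>) = k * (\<integral>\<^sup>+\<sigma>. ennreal (?W \<sigma>) \<partial>uniform_sphere N)"
    using b by (intro k[of _ b]) (auto intro!: ennreal_leI)
  have kB: "(\<integral>\<^sup>+x. ennreal (?W (?\<pi> x)) * indicator ?B (?\<pi> x) * indicator ?S x \<partial>?\<nu>)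
    = k * (\<integral>\<^sup>+\<sigma>. ennreal (?W \<sigma>) * indicator ?B \<sigma> \<partial>uniform_sphere N)"
  proof (rule k[of "\<lambda>\<sigma>. ennreal (?W \<sigma>) * indicator ?B \<sigma>" b])
    show "(\<lambda>\<sigma>. ennreal (?W \<sigma>) * indicator ?B \<sigma>) \<in> borel_measurable ?\<nu>" by measurable
    show "\<forall>\<sigma>\<in>sphere_N N. ennreal (?W \<sigma>) * indicator ?B \<sigma> \<le> ennreal b"
      using b by (auto simp: indicator_def intro!: ennreal_leI)
  qed
  have "B_meas": "?B \<in> sets (uniform_sphere N)"
    unfolding uniform_sphere_def by (subst sets_restrict_space_iff) (auto simp: space_restrict_space)
  have G: "emeasure (gibbs_measure N a \<beta> h) ?B * (\<integral>\<^sup>+\<sigma>. ennreal (?W \<sigma>) \<partial>uniform_sphere N)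
    = (\<integral>\<^sup>+\<sigma>. ennreal (?W \<sigma>) * indicator ?B \<sigma> \<partial>uniform_sphere N)"
    using nn_integral_gibbs[OF N borel_measurable_indicator[OF B_meas], of a \<beta> h] B_meas
    by (simp add: partition_function_nn[OF N] sets_gibbs_measure)
  have S_sets [measurable]: "?S \<inter> space ?\<nu> \<in> sets ?\<nu>"
  proof -
    have "?S \<inter> space ?\<nu> = {x \<in> space ?\<nu>. N * (1 - \<delta>) < dot ?I x x \<and> dot ?I x x \<le> N * (1 + \<delta>)}"
      by (auto simp: shell_def)
    then show ?thesis by simp
  qed
  define D where "D = ?\<pi> -` ?B \<inter> (?S \<inter> space ?\<nu>)"
  have D_sets [measurable]: "D \<in> sets ?\<nu>"
  proof -
    have "D = (?\<pi> -` ?B \<inter> space ?\<nu>) \<inter> (?S \<inter> space ?\<nu>)" by (auto simp: D_def)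
    then show ?thesis using measurable_sets[OF radial_projection_measurable B_sets] S_sets by simp
  qed
  let ?g = "\<lambda>x. ennreal (weight (plusP ?I x (\<lambda>i. - m i)))"
  have g_meas: "?g \<in> borel_measurable ?\<nu>" by measurable
  have X: "ennreal (exp (u - \<eta> * N)) * (ennreal Z * emeasure \<gamma> {x \<in> space \<gamma>. plusP ?I x m \<in> ?S \<inter> space ?\<nu>})
    \<le> (\<integral>\<^sup>+x. ennreal (?W (?\<pi> x)) * indicator ?S x \<partial>?\<nu>)"
  proof -
    have "ennreal (exp (u - \<eta> * N)) * (ennreal Z * emeasure \<gamma> {x \<in> space \<gamma>. plusP ?I x m \<in> ?S \<inter> space ?\<nu>})
      = (\<integral>\<^sup>+x. ennreal (exp (u - \<eta> * N)) * (?g x * indicator (?S \<inter> space ?\<nu>) x) \<partial>?\<nu>)"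
      unfolding to_\<gamma>[OF S_sets, symmetric] using g_meas by (intro nn_integral_cmult[symmetric]) measurable
    also have "\<dots> \<le> (\<integral>\<^sup>+x. ennreal (?W (?\<pi> x)) * indicator ?S x \<partial>?\<nu>)"
    proof (rule nn_integral_mono)
      fix x assume "x \<in> space ?\<nu>"
      then show "ennreal (exp (u - \<eta> * N)) * (?g x * indicator (?S \<inter> space ?\<nu>) x) \<le> ennreal (?W (?\<pi> x)) * indicator ?S x"
        using lower[of x] weight_pos
        by (cases "x \<in> ?S") (auto simp: less_imp_le ennreal_mult[symmetric] intro!: ennreal_leI)
    qed
    finally show ?thesis .
  qed
  have Y: "(\<integral>\<^sup>+x. ennreal (?W (?\<pi> x)) * indicator ?B (?\<pi> x) * indicator ?S x \<partial>?\<nu>)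
    \<le> ennreal (exp (u + \<eta> * N)) * (ennreal Z * emeasure \<gamma> {x \<in> space \<gamma>. plusP ?I x m \<in> D})"
  proof -
    have "(\<integral>\<^sup>+x. ennreal (?W (?\<pi> x)) * indicator ?B (?\<pi> x) * indicator ?S x \<partial>?\<nu>)
      \<le> (\<integral>\<^sup>+x. ennreal (exp (u + \<eta> * N)) * (?g x * indicator D x) \<partial>?\<nu>)"
    proof (rule nn_integral_mono)
      fix x assume x: "x \<in> space ?\<nu>"
      show "ennreal (?W (?\<pi> x)) * indicator ?B (?\<pi> x) * indicator ?S x \<le> ennreal (exp (u + \<eta> * N)) * (?g x * indicator D x)"
      proof (cases "?\<pi> x \<in> ?B \<and> x \<in> ?S")
        case True
        then have "indicator D x = (1 :: ennreal)" "indicator ?B (?\<pi> x) = (1 :: ennreal)" "indicator ?S x = (1 :: ennreal)"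
          using x unfolding D_def indicator_def by auto
        then show ?thesis using upper[of x] True weight_pos
          by (simp only: mult_1_right) (auto simp: less_imp_le ennreal_mult[symmetric] intro!: ennreal_leI)
      next
        case False
        then have "indicator ?B (?\<pi> x) * indicator ?S x = (0 :: ennreal)" by (auto simp: indicator_def)
        then show ?thesis by (simp only: mult.assoc mult_zero_right zero_le)
      qed
    qed
    also have "\<dots> = ennreal (exp (u + \<eta> * N)) * (ennreal Z * emeasure \<gamma> {x \<in> space \<gamma>. plusP ?I x m \<in> D})"
      unfolding to_\<gamma>[OF D_sets, symmetric] using g_meas by (intro nn_integral_cmult) measurable
    finally show ?thesis .
  qed
  have shellp: "ennreal (1 / 2) \<le> emeasure \<gamma> {x \<in> space \<gamma>. plusP ?I x m \<in> ?S \<inter> space ?\<nu>}"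
  proof -
    \<comment> \<open>The columns of P^-1 are the resolvent vectors over \<beta>, so the trace of
      the covariance P^-1 / 2 is the sum of the r_jj over 2 \<beta>.\<close>
    have sol: "\<forall>i\<in>?I. mv ?I P (\<lambda>i. r j i / \<beta>) i = unitv j i" if "j \<in> ?I" for j
    proof
      fix i assume i: "i \<in> ?I"
      have "mv ?I P (\<lambda>i. r j i / \<beta>) i = mv ?I (shifted \<zeta> (coupling N a)) (r j) i"
        using \<beta> by (simp add: mv_def P_def)
      also have "\<dots> = unitv j i" using r[of j] that i by (simp add: resolves_iff_shifted)
      finally show "mv ?I P (\<lambda>i. r j i / \<beta>) i = unitv j i" .
    qed
    have "(\<Sum>i\<in>?I. r i i / \<beta>) / 2 = (\<Sum>j<N. r j j) / (2 * \<beta>)" by (simp add: sum_divide_distrib[symmetric])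
    then have "ennreal (1 / 2) \<le> emeasure \<gamma> {x \<in> space \<gamma>. N * (1 - \<delta>) < dot ?I (plusP ?I x m) (plusP ?I x m) \<and>
      dot ?I (plusP ?I x m) (plusP ?I x m) \<le> N * (1 + \<delta>)}"
      using trace by (intro shell_probability[OF sol \<delta>(1) K _ N0 mK _ large]) (simp_all add: mult.commute)
    then show ?thesis by (simp add: shell_def)
  qed
  have dev: "emeasure \<gamma> {x \<in> space \<gamma>. plusP ?I x m \<in> D} \<le> ennreal (2 * exp (- (\<epsilon>\<^sup>2 * c / (4 * K) * N)))"
  proof -
    \<comment> \<open>Projection to the sphere moves the functional by at most \<delta> sqrt K N
      \<le> \<epsilon> N / 2, so half of the deviation survives for the Gaussian.\<close>
    have "{x \<in> space \<gamma>. plusP ?I x m \<in> D} \<subseteq> {x \<in> space \<gamma>. \<epsilon> * N / 2 \<le> \<bar>dot ?I t x\<bar>}"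
    proof safe
      fix x assume x: "x \<in> space \<gamma>" "plusP ?I x m \<in> D"
      let ?y = "plusP ?I x m"
      have y: "?y \<in> ?S" "\<epsilon> * N \<le> \<bar>dot ?I (?\<pi> ?y) t - dot ?I m t\<bar>" using x by (auto simp: D_def)
      have "\<bar>dot ?I (?\<pi> ?y) t\<bar> \<le> sqrt N * sqrt (dot ?I t t)" using abs_dot_le[of ?I "?\<pi> ?y" t] rad(2)[OF y(1)] by simp
      also have "\<dots> \<le> sqrt N * sqrt (K * N)" using tK by (intro mult_left_mono) simp_all
      also have "\<dots> = sqrt K * N" by (simp add: real_sqrt_mult)
      finally have "\<delta> * \<bar>dot ?I (?\<pi> ?y) t\<bar> \<le> \<delta> * (sqrt K * N)" using \<delta> by (intro mult_left_mono) simp_all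
      also have "\<dots> \<le> \<epsilon> / 2 * N" using \<delta>K by (simp only: mult.assoc[symmetric]) (intro mult_right_mono, simp_all)
      finally have d: "\<bar>dot ?I ?y t - dot ?I (?\<pi> ?y) t\<bar> \<le> \<epsilon> / 2 * N" using rad(3)[OF y(1), of t] by linarith
      have "dot ?I ?y t = dot ?I (\<lambda>i. x i + m i) t" by (intro dot_cong) (simp_all add: plusP_def)
      then have "dot ?I ?y t = dot ?I t x + dot ?I m t" by (simp add: dot_add_left dot_commute)
      moreover have "w / 2 \<le> \<bar>X\<bar>" if "w \<le> \<bar>A - B\<bar>" "\<bar>C - A\<bar> \<le> w / 2" "C = X + B" for A B C X w :: real
        using that by linarith
      moreover have "\<epsilon> / 2 * N = \<epsilon> * N / 2" by simp
      ultimately show "\<epsilon> * N / 2 \<le> \<bar>dot ?I t x\<bar>" using y(2) d by metis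
    qed
    then have "emeasure \<gamma> {x \<in> space \<gamma>. plusP ?I x m \<in> D} \<le> emeasure \<gamma> {x \<in> space \<gamma>. \<epsilon> * N / 2 \<le> \<bar>dot ?I t x\<bar>}"
      by (intro emeasure_mono) measurable
    also have "\<dots> \<le> ennreal (2 * exp (- ((\<epsilon> * N / 2)\<^sup>2 * c / (K * N))))"
      using tK K N \<epsilon> by (intro linear_tail) auto
    also have "(\<epsilon> * N / 2)\<^sup>2 * c / (K * N) = \<epsilon>\<^sup>2 * c / (4 * K) * N"
      using N K by (simp add: power2_eq_square field_simps)
    finally show ?thesis .
  qed
  define p where "p = measure (gibbs_measure N a \<beta> h) ?B"
  interpret G: prob_space "gibbs_measure N a \<beta> h" using N by (rule prob_space_gibbs_measure)
  have p: "emeasure (gibbs_measure N a \<beta> h) ?B = ennreal p" "0 \<le> p" by (simp_all add: p_def G.emeasure_eq_measure)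
  \<comment> \<open>The unknown k enters and leaves in the middle of this chain, where the Gibbs
    measure turns p times the full integral into the integral over the event.\<close>
  have "ennreal p * (ennreal (exp (u - \<eta> * N)) * (ennreal Z * ennreal (1 / 2)))
    \<le> ennreal p * (ennreal (exp (u - \<eta> * N)) * (ennreal Z * emeasure \<gamma> {x \<in> space \<gamma>. plusP ?I x m \<in> ?S \<inter> space ?\<nu>}))"
    by (intro mult_left_mono shellp) simp_all
  also have "\<dots> \<le> ennreal p * (k * (\<integral>\<^sup>+\<sigma>. ennreal (?W \<sigma>) \<partial>uniform_sphere N))"
    using X unfolding kW by (rule mult_left_mono) simp
  also have "\<dots> = k * (\<integral>\<^sup>+\<sigma>. ennreal (?W \<sigma>) * indicator ?B \<sigma> \<partial>uniform_sphere N)"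
    unfolding G[symmetric] p(1) by (simp only: mult_ac)
  also have "\<dots> \<le> ennreal (exp (u + \<eta> * N)) * (ennreal Z * emeasure \<gamma> {x \<in> space \<gamma>. plusP ?I x m \<in> D})"
    using Y unfolding kB .
  also have "\<dots> \<le> ennreal (exp (u + \<eta> * N)) * (ennreal Z * ennreal (2 * exp (- (\<epsilon>\<^sup>2 * c / (4 * K) * N))))"
    by (intro mult_left_mono dev) simp_all
  finally have "ennreal (p * (exp (u - \<eta> * N) * (Z * (1 / 2))))
    \<le> ennreal (exp (u + \<eta> * N) * (Z * (2 * exp (- (\<epsilon>\<^sup>2 * c / (4 * K) * N)))))"
    using p(2) Z(1) by (simp only: ennreal_mult mult_nonneg_nonneg exp_ge_zero less_imp_le)
  then have "p * (exp (u - \<eta> * N) * (Z * (1 / 2))) \<le> exp (u + \<eta> * N) * (Z * (2 * exp (- (\<epsilon>\<^sup>2 * c / (4 * K) * N))))"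
    using Z(1) by (subst (asm) ennreal_le_iff) simp_all
  also have "\<dots> = 4 * exp (2 * (\<eta> * N)) * exp (- (\<epsilon>\<^sup>2 * c / (4 * K) * N)) * (exp (u - \<eta> * N) * (Z * (1 / 2)))"
  proof -
    have "exp (u + \<eta> * N) = exp (2 * (\<eta> * N)) * exp (u - \<eta> * N)" by (simp flip: exp_add)
    then show ?thesis by simp
  qed
  finally have "p \<le> 4 * exp (2 * (\<eta> * N)) * exp (- (\<epsilon>\<^sup>2 * c / (4 * K) * N))"
    by (rule mult_right_le_imp_le) (use Z(1) in simp)
  also have "\<dots> = 4 * exp (2 * (\<eta> * N) - \<epsilon>\<^sup>2 * c / (4 * K) * N)" by (simp flip: exp_add)
  also have "\<dots> \<le> 4 * exp (- (\<epsilon>\<^sup>2 * c / (8 * K)) * N)"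
  proof -
    have "2 * \<eta> * N \<le> \<epsilon>\<^sup>2 * c / (8 * K) * N" using \<delta>\<eta> unfolding \<eta>_def[symmetric] by (intro mult_right_mono) simp_all
    moreover have "\<epsilon>\<^sup>2 * c / (4 * K) * N = 2 * (\<epsilon>\<^sup>2 * c / (8 * K) * N)" by simp
    ultimately have "2 * (\<eta> * N) - \<epsilon>\<^sup>2 * c / (4 * K) * N \<le> - (\<epsilon>\<^sup>2 * c / (8 * K)) * N" by linarith
    then show ?thesis by simp
  qed
  finally show ?thesis unfolding p(1) by (rule ennreal_leI)
qed

text \<open>The width \<delta> meets three demands: below 1, projection error \<delta> sqrt K \<le>
  \<epsilon> / 2, and twice the weight error at most half of the Gaussian rate. All constants are
  independent of the disorder and of \<open>t\<close>, so \<open>t\<close> may be another replica or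
  the centre of another system.\<close>

lemma gibbs_linear_deviation:
  fixes \<beta> \<zeta> L h K \<epsilon> :: real
  assumes \<beta>: "0 < \<beta>" and \<zeta>: "0 \<le> L" "L < \<zeta>" and K: "0 < K" and \<epsilon>: "0 < \<epsilon>"
  shows "\<exists>\<delta>>0. \<exists>c>0. \<exists>N0. \<forall>N\<ge>N0. \<forall>a m r t.
    (\<forall>y. \<bar>dot {..<N} y (mv {..<N} (coupling N a) y)\<bar> \<le> L * dot {..<N} y y) \<longrightarrow>
    resolves {..<N} (coupling N a) \<zeta> (\<lambda>_. h) (\<lambda>i. 2 * \<beta> * m i) \<longrightarrow>
    (\<forall>j<N. resolves {..<N} (coupling N a) \<zeta> (unitv j) (r j)) \<longrightarrow>
    \<bar>((\<Sum>j<N. r j j) / (2 * \<beta>) + dot {..<N} m m) / N - 1\<bar> \<le> \<delta> \<longrightarrow>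
    dot {..<N} m m \<le> K * N \<longrightarrow> dot {..<N} t t \<le> K * N \<longrightarrow>
    emeasure (gibbs_measure N a \<beta> h) {\<sigma> \<in> sphere_N N. \<epsilon> * N \<le> \<bar>dot {..<N} \<sigma> t - dot {..<N} m t\<bar>}
    \<le> ennreal (4 * exp (- c * N))"
proof -
  define c where "c = \<beta> * (\<zeta> - L)"
  define H where "H = \<beta> * L + \<bar>h\<bar> + \<beta> * \<zeta>"
  have c: "0 < c" using \<beta> \<zeta> by (simp add: c_def)
  have H: "0 < H" using \<beta> \<zeta> by (auto simp: H_def intro!: add_nonneg_pos)
  define \<delta> where "\<delta> = min (1 / 2) (min (\<epsilon> / (2 * sqrt K)) (\<epsilon>\<^sup>2 * c / (16 * K * H)))"
  have \<delta>: "0 < \<delta>" "\<delta> < 1" using \<epsilon> K c H by (auto simp: \<delta>_def)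
  have "\<delta> \<le> \<epsilon> / (2 * sqrt K)" by (simp add: \<delta>_def)
  then have \<delta>K: "\<delta> * sqrt K \<le> \<epsilon> / 2" using K by (simp add: pos_le_divide_eq mult_ac)
  have "\<delta> \<le> \<epsilon>\<^sup>2 * c / (16 * K * H)" by (simp add: \<delta>_def)
  then have "\<delta> * (16 * K * H) \<le> \<epsilon>\<^sup>2 * c" using K H by (simp add: pos_le_divide_eq)
  then have \<delta>H: "2 * (\<delta> * H) \<le> \<epsilon>\<^sup>2 * c / (8 * K)" using K by (simp add: pos_le_divide_eq mult_ac)
  define k where "k = \<delta>\<^sup>2 * c / (64 * K)"
  have k: "0 < k" using \<delta> c K by (simp add: k_def)
  define k' where "k' = 8 / (c\<^sup>2 * \<delta>\<^sup>2)"
  have "(\<lambda>N. k' / real N + 2 * exp (- (k * real N))) \<longlonglongrightarrow> 0" using k by real_asymp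
  then have "\<forall>\<^sub>F N in sequentially. k' / real N + 2 * exp (- (k * real N)) < 1 / 2"
    by (rule order_tendstoD) simp
  then obtain N1 where N1: "\<And>N. N \<ge> N1 \<Longrightarrow> k' / real N + 2 * exp (- (k * real N)) < 1 / 2"
    unfolding eventually_sequentially by blast
  show ?thesis
  proof (rule exI[of _ "\<delta> / 4"], rule conjI[rotated], rule exI[of _ "\<epsilon>\<^sup>2 * c / (8 * K)"], rule conjI[rotated],
      rule exI[of _ "max 1 N1"], intro allI impI)
    show "0 < \<delta> / 4" "0 < \<epsilon>\<^sup>2 * c / (8 * K)" using \<delta> \<epsilon> c K by simp_all
    fix N a m r t
    assume N: "max 1 N1 \<le> N"
      and *: "\<forall>y. \<bar>dot {..<N} y (mv {..<N} (coupling N a) y)\<bar> \<le> L * dot {..<N} y y"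
        "resolves {..<N} (coupling N a) \<zeta> (\<lambda>_. h) (\<lambda>i. 2 * \<beta> * m i)"
        "\<forall>j<N. resolves {..<N} (coupling N a) \<zeta> (unitv j) (r j)"
        "\<bar>((\<Sum>j<N. r j j) / (2 * \<beta>) + dot {..<N} m m) / N - 1\<bar> \<le> \<delta> / 4"
        "dot {..<N} m m \<le> K * N" "dot {..<N} t t \<le> K * N"
    have "8 / (c\<^sup>2 * \<delta>\<^sup>2 * N) + 2 * exp (- (\<delta>\<^sup>2 * c / (64 * K) * N)) \<le> 1 / 2"
      using N1[of N] N by (simp add: k_def k'_def)
    then show "emeasure (gibbs_measure N a \<beta> h) {\<sigma> \<in> sphere_N N. \<epsilon> * N \<le> \<bar>dot {..<N} \<sigma> t - dot {..<N} m t\<bar>}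
      \<le> ennreal (4 * exp (- (\<epsilon>\<^sup>2 * c / (8 * K)) * N))"
      using N by (intro gibbs_linear_deviation_aux[OF _ \<delta> \<beta> \<zeta> K \<epsilon> *(1)[rule_format] *(2) *(3)[rule_format] *(4-6) c_def _ \<delta>K
          \<delta>H[unfolded H_def]]) simp_all
  qed
qed

section \<open>Concentration of the overlap\<close>

text \<open>With b = \<beta> (1 - q), multiplication by (1 - q)^2 brings the equation into the form
  h^2 (1 - q)^2 = q (1 - b^2). The left side is positive, which forces b < 1.\<close>

lemma q_param_facts:
  fixes \<beta> h :: real
  assumes \<beta>: "0 < \<beta>" and h: "h \<noteq> 0"
  defines "q \<equiv> q_param \<beta> h"
  shows "0 < q" "q < 1" "0 < \<beta> * (1 - q)" "\<beta> * (1 - q) < 1" "h\<^sup>2 * (1 - q)\<^sup>2 = q * (1 - (\<beta> * (1 - q))\<^sup>2)"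
proof -
  have "q \<in> {0..1} \<and> q_equation \<beta> h q"
    unfolding q_def q_param_def using theI'[OF q_equation_ex1[OF h, of \<beta>]] h by simp
  then have q: "0 \<le> q" "q \<le> 1" and eq: "h\<^sup>2 + \<beta>\<^sup>2 * q = q / (1 - q)\<^sup>2" by (auto simp: q_equation_def)
  have h2: "0 < h\<^sup>2" using h by simp
  have "q \<noteq> 1" using eq h2 q by (auto simp: add_pos_nonneg dest: sym)
  then show q1: "q < 1" using q by simp
  have "q \<noteq> 0" using eq h2 by auto
  then show q0: "0 < q" using q by simp
  show b0: "0 < \<beta> * (1 - q)" using \<beta> q1 by simp
  have "(h\<^sup>2 + \<beta>\<^sup>2 * q) * (1 - q)\<^sup>2 = q" using eq q1 by simp
  then show eq': "h\<^sup>2 * (1 - q)\<^sup>2 = q * (1 - (\<beta> * (1 - q))\<^sup>2)"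
    unfolding power_mult_distrib by (simp only: distrib_right right_diff_distrib mult_1_right) (simp add: mult_ac)
  have "0 < h\<^sup>2 * (1 - q)\<^sup>2" using h2 q1 by simp
  then have "0 < 1 - (\<beta> * (1 - q))\<^sup>2" unfolding eq' using q0 zero_less_mult_pos by blast
  then have "(\<beta> * (1 - q))\<^sup>2 < 1\<^sup>2" by simp
  then show "\<beta> * (1 - q) < 1" using power2_less_imp_less by fastforce
qed

lemma emeasure_event_small:
  assumes "small B" and "0 < (\<eta>::real)"
  shows "\<exists>N0. \<forall>N\<ge>N0. emeasure (gaussP ({..<N} \<times> {..<N})) (event N {..<N} (\<lambda>_. 1 / sqrt N) B) \<le> ennreal \<eta>"
proof -
  obtain N0 where N0: "\<forall>N\<ge>N0. \<forall>I u. finite I \<longrightarrow> card I + 0 = N \<longrightarrow> dot I u u = 1 \<longrightarrow>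
     emeasure (gaussP (I \<times> I)) (event N I u B) \<le> ennreal \<eta>"
    using assms unfolding small_def by meson
  show ?thesis
  proof (intro exI[of _ "max 1 N0"] allI impI)
    fix N assume N: "max 1 N0 \<le> N"
    have "dot {..<N} (\<lambda>_. 1 / sqrt N) (\<lambda>_. 1 / sqrt N) = 1" using N by (simp add: dot_def)
    then show "emeasure (gaussP ({..<N} \<times> {..<N})) (event N {..<N} (\<lambda>_. 1 / sqrt N) B) \<le> ennreal \<eta>"
      using N0 N by simp
  qed
qed

text \<open>The centre of the Gaussian approximation of the Gibbs measure is a multiple of the
  resolvent applied to \<open>u = (1, \<dots>, 1) / sqrt N\<close>.\<close>

definition concentrates :: "nat \<Rightarrow> real \<Rightarrow> real \<Rightarrow> real \<Rightarrow> real \<Rightarrow> real \<Rightarrow> real \<Rightarrow> (nat \<times> nat \<Rightarrow> real) \<Rightarrow> bool" where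
  "concentrates N \<beta> h z \<delta> \<epsilon> c g \<longleftrightarrow>
    form_bound {..<N} (gmat N g) (1 + 3 * \<delta>) (1 / 2 + \<delta>) (\<lambda>_. 1 / sqrt (real N)) \<and>
    (\<forall>y m. resolves {..<N} (gmat N g) z (\<lambda>_. 1 / sqrt (real N)) y \<longrightarrow> m = (\<lambda>i. h * sqrt (real N) / (2 * \<beta>) * y i) \<longrightarrow>
      dot {..<N} m m \<le> 2 * real N \<and>
      (\<forall>t. dot {..<N} t t \<le> 2 * real N \<longrightarrow>
        emeasure (gibbs_measure N (\<lambda>i j. g (i, j)) \<beta> h)
          {\<sigma> \<in> sphere_N N. \<epsilon> * real N \<le> \<bar>dot {..<N} \<sigma> t - dot {..<N} m t\<bar>} \<le> ennreal (4 * exp (- c * real N))))"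

text \<open>The shell condition: m \<cdot> m / N tends to h^2 / (4 \<beta>^2) times 4 b^2 / (1 -
  b^2), which is q, and the trace term tends to 2 b / (2 \<beta>) = 1 - q. The rate \<open>c\<close>
  is fixed before \<eta>; only the threshold for \<open>N\<close> depends on the probability allowed
  for bad disorder.\<close>

lemma system_good:
  fixes \<beta> h q b z \<delta> \<epsilon> :: real
  assumes \<beta>: "0 < \<beta>" and h: "h \<noteq> 0" and q: "0 < q" "q < 1" and b_def: "b = \<beta> * (1 - q)" and b: "0 < b" "b < 1"
    and eq: "h\<^sup>2 * (1 - q)\<^sup>2 = q * (1 - b\<^sup>2)" and z: "z = (b + 1 / b) / 2"
    and \<delta>: "0 < \<delta>" "\<delta> \<le> 1 / 2" "1 + 3 * \<delta> < z" and \<epsilon>: "0 < \<epsilon>"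
  shows "\<exists>c>0. \<forall>\<eta>>0. \<exists>N0\<ge>1. \<forall>N\<ge>N0. \<exists>S\<in>sets (gaussP ({..<N} \<times> {..<N})).
    emeasure (gaussP ({..<N} \<times> {..<N})) S \<le> ennreal \<eta> \<and>
    (\<forall>g\<in>space (gaussP ({..<N} \<times> {..<N})) - S. concentrates N \<beta> h z \<delta> \<epsilon> c g)" (is "\<exists>c>0. \<forall>\<eta>>0. \<exists>N0\<ge>1. \<forall>N\<ge>N0. ?P c \<eta> N")
proof -
  let ?L = "1 + 3 * \<delta>"
  have dev_ex: "\<exists>d>0. \<exists>c>0. \<exists>N0. \<forall>N\<ge>N0. \<forall>a m r t.
    (\<forall>y. \<bar>dot {..<N} y (mv {..<N} (coupling N a) y)\<bar> \<le> ?L * dot {..<N} y y) \<longrightarrow>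
    resolves {..<N} (coupling N a) z (\<lambda>_. h) (\<lambda>i. 2 * \<beta> * m i) \<longrightarrow>
    (\<forall>j<N. resolves {..<N} (coupling N a) z (unitv j) (r j)) \<longrightarrow>
    \<bar>((\<Sum>j<N. r j j) / (2 * \<beta>) + dot {..<N} m m) / N - 1\<bar> \<le> d \<longrightarrow>
    dot {..<N} m m \<le> 2 * real N \<longrightarrow> dot {..<N} t t \<le> 2 * real N \<longrightarrow>
    emeasure (gibbs_measure N a \<beta> h) {\<sigma> \<in> sphere_N N. \<epsilon> * real N \<le> \<bar>dot {..<N} \<sigma> t - dot {..<N} m t\<bar>}
    \<le> ennreal (4 * exp (- c * real N))"
    by (rule gibbs_linear_deviation[OF \<beta> _ \<delta>(3) _ \<epsilon>]) (use \<delta> in simp_all)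
  obtain d c N1 where d: "0 < d" and c: "0 < c" and dev': "\<forall>N\<ge>N1. \<forall>a m r t.
    (\<forall>y. \<bar>dot {..<N} y (mv {..<N} (coupling N a) y)\<bar> \<le> ?L * dot {..<N} y y) \<longrightarrow>
    resolves {..<N} (coupling N a) z (\<lambda>_. h) (\<lambda>i. 2 * \<beta> * m i) \<longrightarrow>
    (\<forall>j<N. resolves {..<N} (coupling N a) z (unitv j) (r j)) \<longrightarrow>
    \<bar>((\<Sum>j<N. r j j) / (2 * \<beta>) + dot {..<N} m m) / N - 1\<bar> \<le> d \<longrightarrow>
    dot {..<N} m m \<le> 2 * real N \<longrightarrow> dot {..<N} t t \<le> 2 * real N \<longrightarrow>
    emeasure (gibbs_measure N a \<beta> h) {\<sigma> \<in> sphere_N N. \<epsilon> * real N \<le> \<bar>dot {..<N} \<sigma> t - dot {..<N} m t\<bar>}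
    \<le> ennreal (4 * exp (- c * real N))"
    using dev_ex by (elim exE conjE)
  note dev = dev'[rule_format]
  define \<kappa> where "\<kappa> = 4 * b * b / (1 - b * b)"
  \<comment> \<open>Multiplied by h^2 / (4 \<beta>^2) the error is min (d / 2, 1): half of the
    tolerance \<open>d\<close> of the shell condition, and at most 1 so that m \<cdot> m \<le> 2
    N.\<close>
  define e where "e = min (d / 2) 1 * (4 * \<beta>\<^sup>2 / h\<^sup>2)"
  have e: "0 < e" using d \<beta> h by (simp add: e_def)
  have small: "small (bad_kappa \<delta> z z \<kappa> e :: nat set \<Rightarrow> _)"
    using \<delta> e by (intro small_bad_kappa[OF z z \<kappa>_def b b]) auto
  have adm: "admissible (bad_kappa \<delta> z z \<kappa> e :: nat set \<Rightarrow> _)"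
    using \<delta> by (intro admissible_bad_kappa) auto
  have bb: "b * b < 1" using b mult_strict_mono[of b 1 b 1] by simp
  have h\<kappa>: "h\<^sup>2 / (4 * \<beta>\<^sup>2) * \<kappa> = q"
  proof -
    have "h\<^sup>2 * (b * b) = q * \<beta>\<^sup>2 * (1 - b * b)"
    proof -
      have "h\<^sup>2 * (b * b) = \<beta>\<^sup>2 * (h\<^sup>2 * (1 - q)\<^sup>2)" by (simp add: b_def power2_eq_square mult_ac)
      then show ?thesis unfolding eq by (simp add: power2_eq_square mult_ac)
    qed
    then show ?thesis using \<beta> bb by (simp add: \<kappa>_def field_simps)
  qed
  \<comment> \<open>The trace error \<beta> d becomes d / 2, the other half of the tolerance, on
    division by 2 \<beta>.\<close>
  have e2: "0 < \<beta> * d" using \<beta> d by simp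
  show ?thesis
  proof (rule exI[of _ c], rule conjI[OF c], intro allI impI)
    fix \<eta> :: real assume "0 < \<eta>"
    then have \<eta>: "0 < \<eta> / 2" by simp
    obtain N2 where N2: "\<forall>N\<ge>N2. emeasure (gaussP ({..<N} \<times> {..<N})) (event N {..<N} (\<lambda>_. 1 / sqrt (real N)) (bad_kappa \<delta> z z \<kappa> e)) \<le> ennreal (\<eta> / 2)"
      using emeasure_event_small[OF small \<eta>] by blast
    obtain N3 where N3: "\<forall>N\<ge>N3. \<forall>I :: nat set. finite I \<longrightarrow> card I = N \<longrightarrow>
      (\<exists>S\<in>sets (gaussP (I \<times> I)). emeasure (gaussP (I \<times> I)) S \<le> ennreal (\<eta> / 2) \<and>
      (\<forall>g\<in>space (gaussP (I \<times> I)) - S. \<forall>u r. form_bound I (gmat N g) ?L (1 / 2 + \<delta>) u \<longrightarrow>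
        (\<forall>i\<in>I. resolves I (gmat N g) z (unitv i) (r i)) \<longrightarrow> \<bar>(\<Sum>i\<in>I. r i i) / N - 2 * b\<bar> \<le> \<beta> * d))"
      using trace_concentration[OF z b \<delta> e2 \<eta>] by blast
    show "\<exists>N0\<ge>1. \<forall>N\<ge>N0. ?P c \<eta> N"
    proof (rule exI[of _ "max (max 1 N1) (max N2 N3)"], rule conjI, simp, intro allI impI)
      fix N assume "max (max 1 N1) (max N2 N3) \<le> N"
      then have N: "1 \<le> N" "N1 \<le> N" "N2 \<le> N" "N3 \<le> N" by auto
      let ?I = "{..<N}" and ?u = "\<lambda>_::nat. 1 / sqrt (real N)"
      let ?M = "gaussP (?I \<times> ?I)"
      obtain S where S: "S \<in> sets ?M" "emeasure ?M S \<le> ennreal (\<eta> / 2)"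
        and tr: "\<And>g u r. g \<in> space ?M - S \<Longrightarrow> form_bound ?I (gmat N g) ?L (1 / 2 + \<delta>) u \<Longrightarrow>
          \<forall>i\<in>?I. resolves ?I (gmat N g) z (unitv i) (r i) \<Longrightarrow> \<bar>(\<Sum>i\<in>?I. r i i) / N - 2 * b\<bar> \<le> \<beta> * d"
        using N3[rule_format, OF N(4), of ?I] by auto
      let ?E = "event N ?I ?u (bad_kappa \<delta> z z \<kappa> e)"
      have E: "?E \<in> sets ?M" by (rule admissible_sets[OF adm]) simp
      show "?P c \<eta> N"
        unfolding concentrates_def
      proof (rule bexI[of _ "?E \<union> S"], rule conjI, rule_tac[2] ballI)
        show "?E \<union> S \<in> sets ?M" using E S by blast
        have "emeasure ?M (?E \<union> S) \<le> emeasure ?M ?E + emeasure ?M S" by (rule emeasure_subadditive[OF E S(1)])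
        also have "\<dots> \<le> ennreal (\<eta> / 2) + ennreal (\<eta> / 2)" using N2 N(3) S(2) by (intro add_mono) blast+
        also have "\<dots> = ennreal \<eta>" using \<open>0 < \<eta>\<close> by (simp flip: ennreal_plus)
        finally show "emeasure ?M (?E \<union> S) \<le> ennreal \<eta>" .
        fix g assume g: "g \<in> space ?M - (?E \<union> S)"
        have nb: "\<not> bad_kappa \<delta> z z \<kappa> e ?I ?u (gmat N g)" using g by (simp add: event_def)
        then have fb: "form_bound ?I (gmat N g) ?L (1 / 2 + \<delta>) ?u" by (simp add: bad_kappa_def bad_norm_def)
        have coup: "coupling N (\<lambda>i j. g (i, j)) = gmat N g" by simp
        have norm: "\<forall>y. \<bar>dot ?I y (mv ?I (gmat N g) y)\<bar> \<le> ?L * dot ?I y y"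
        proof
          fix y
          have "\<bar>dot ?I y (mv ?I (gmat N g) y)\<bar> \<le> ?L * dot ?I y y - (1 / 2 + \<delta>) * (dot ?I ?u y)\<^sup>2"
            using fb unfolding form_bound_def by blast
          moreover have "0 \<le> (1 / 2 + \<delta>) * (dot ?I ?u y)\<^sup>2" using \<delta> by simp
          ultimately show "\<bar>dot ?I y (mv ?I (gmat N g) y)\<bar> \<le> ?L * dot ?I y y" by linarith
        qed
        have "\<exists>r. \<forall>i\<in>?I. resolves ?I (gmat N g) z (unitv i) (r i)"
          using ex_resolves[OF finite_lessThan symm_on_gmat fb \<delta>(3)] \<delta>(1) by (intro bchoice) simp
        then obtain r where r: "\<forall>i\<in>?I. resolves ?I (gmat N g) z (unitv i) (r i)" by blast
        have trace: "\<bar>(\<Sum>i\<in>?I. r i i) / N - 2 * b\<bar> \<le> \<beta> * d" using g by (intro tr[OF _ fb r]) blast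
        show "form_bound ?I (gmat N g) ?L (1 / 2 + \<delta>) ?u \<and>
          (\<forall>y m. resolves ?I (gmat N g) z ?u y \<longrightarrow> m = (\<lambda>i. h * sqrt (real N) / (2 * \<beta>) * y i) \<longrightarrow>
          dot ?I m m \<le> 2 * real N \<and>
          (\<forall>t. dot ?I t t \<le> 2 * real N \<longrightarrow>
            emeasure (gibbs_measure N (\<lambda>i j. g (i, j)) \<beta> h) {\<sigma> \<in> sphere_N N. \<epsilon> * real N \<le> \<bar>dot ?I \<sigma> t - dot ?I m t\<bar>}
            \<le> ennreal (4 * exp (- c * real N))))"
        proof (rule conjI[OF fb], intro allI impI conjI)
          fix y m assume y: "resolves ?I (gmat N g) z ?u y" and m: "m = (\<lambda>i. h * sqrt (real N) / (2 * \<beta>) * y i)"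
          have \<kappa>: "\<bar>dot ?I y y - \<kappa>\<bar> \<le> e" using nb y unfolding bad_kappa_def by (meson not_less)
          have mm: "dot ?I m m = h\<^sup>2 / (4 * \<beta>\<^sup>2) * dot ?I y y * N"
            unfolding m dot_scale_left dot_scale_right using N by (simp add: power2_eq_square field_simps)
          have "dot ?I m m / N - q = h\<^sup>2 / (4 * \<beta>\<^sup>2) * (dot ?I y y - \<kappa>)"
            using N by (simp add: mm h\<kappa>[symmetric] right_diff_distrib)
          then have "\<bar>dot ?I m m / N - q\<bar> = h\<^sup>2 / (4 * \<beta>\<^sup>2) * \<bar>dot ?I y y - \<kappa>\<bar>" by (simp add: abs_mult)
          also have "\<dots> \<le> h\<^sup>2 / (4 * \<beta>\<^sup>2) * e" using \<kappa> by (intro mult_left_mono) simp_all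
          also have "\<dots> = min (d / 2) 1" using h \<beta> by (simp add: e_def)
          finally have mq: "\<bar>dot ?I m m / N - q\<bar> \<le> min (d / 2) 1" .
          then have "dot ?I m m / N \<le> 2" using q by linarith
          then have mm2: "dot ?I m m \<le> 2 * real N" using N by (simp add: pos_divide_le_eq)
          have "(\<Sum>i\<in>?I. r i i) / (2 * \<beta>) / N - (1 - q) = ((\<Sum>i\<in>?I. r i i) / N - 2 * b) / (2 * \<beta>)"
            using \<beta> by (simp add: b_def field_simps)
          then have "\<bar>(\<Sum>i\<in>?I. r i i) / (2 * \<beta>) / N - (1 - q)\<bar> = \<bar>(\<Sum>i\<in>?I. r i i) / N - 2 * b\<bar> / (2 * \<beta>)"
            using \<beta> by simp
          also have "\<dots> \<le> \<beta> * d / (2 * \<beta>)" using trace \<beta> by (intro divide_right_mono) simp_all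
          also have "\<dots> = d / 2" using \<beta> by simp
          finally have tq: "\<bar>(\<Sum>i\<in>?I. r i i) / (2 * \<beta>) / N - (1 - q)\<bar> \<le> d / 2" .
          have "((\<Sum>j<N. r j j) / (2 * \<beta>) + dot ?I m m) / N = (\<Sum>i\<in>?I. r i i) / (2 * \<beta>) / N + dot ?I m m / N"
            by (simp only: add_divide_distrib)
          moreover have "\<bar>dot ?I m m / N - q\<bar> \<le> d / 2" using mq by simp
          ultimately have tot: "\<bar>((\<Sum>j<N. r j j) / (2 * \<beta>) + dot ?I m m) / N - 1\<bar> \<le> d" using tq by linarith
          have res: "resolves ?I (gmat N g) z (\<lambda>_. h) (\<lambda>i. 2 * \<beta> * m i)"
            unfolding resolves_def
          proof
            fix i assume "i \<in> ?I"
            then have "z * y i - mv ?I (gmat N g) y i = 1 / sqrt (real N)" using y by (simp add: resolves_def)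
            moreover have "(\<lambda>i. 2 * \<beta> * m i) = (\<lambda>i. (h * sqrt (real N)) * y i)" using \<beta> by (simp add: m)
            moreover have "z * ((h * sqrt (real N)) * y i) - (h * sqrt (real N)) * mv ?I (gmat N g) y i
              = (h * sqrt (real N)) * (z * y i - mv ?I (gmat N g) y i)" by (simp add: algebra_simps)
            ultimately show "z * (2 * \<beta> * m i) - mv ?I (gmat N g) (\<lambda>i. 2 * \<beta> * m i) i = h"
              using N by (simp only: mv_scale fun_eq_iff) simp
          qed
          show "dot ?I m m \<le> 2 * real N" by (rule mm2)
          fix t assume t: "dot ?I t t \<le> 2 * real N"
          have r': "\<forall>j<N. resolves ?I (gmat N g) z (unitv j) (r j)" using r by simp
          show "emeasure (gibbs_measure N (\<lambda>i j. g (i, j)) \<beta> h) {\<sigma> \<in> sphere_N N. \<epsilon> * real N \<le> \<bar>dot ?I \<sigma> t - dot ?I m t\<bar>}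
            \<le> ennreal (4 * exp (- c * real N))"
            using norm res r' tot mm2 t by (intro dev[OF N(2), of "\<lambda>i j. g (i, j)" m r t]) (simp_all only: coup)
        qed
      qed
    qed
  qed
qed

section \<open>From linear functionals to the overlap\<close>

lemma gibbs_measure_cong:
  assumes "\<And>i j. i < N \<Longrightarrow> j < N \<Longrightarrow> a i j = a' i j"
  shows "gibbs_measure N a \<beta> h = gibbs_measure N a' \<beta> h"
proof -
  have "gibbs_weight N a \<beta> h = gibbs_weight N a' \<beta> h"
    using assms by (simp add: gibbs_weight_def hamiltonian_def fun_eq_iff)
  then show ?thesis by (simp add: gibbs_measure_def partition_function_def)
qed

lemma dot_measurable_pair:
  "(\<lambda>(\<sigma>, \<tau>). dot {..<N} \<sigma> \<tau>) \<in> borel_measurable (gibbs_measure N a \<beta> h \<Otimes>\<^sub>M gibbs_measure N a' \<beta>' h')"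
proof -
  have id: "(\<lambda>x. x) \<in> uniform_sphere N \<rightarrow>\<^sub>M lborel_N N" by (rule measurable_uniform_sphere) simp_all
  have comp: "(\<lambda>\<sigma>. \<sigma> i) \<in> borel_measurable (gibbs_measure N a \<beta> h)" if "i \<in> {..<N}" for i a \<beta> h
    using measurable_lebP_component[OF id that] by (simp cong: measurable_cong_sets add: sets_gibbs_measure)
  have "(\<lambda>x. fst x i * snd x i) \<in> borel_measurable (gibbs_measure N a \<beta> h \<Otimes>\<^sub>M gibbs_measure N a' \<beta>' h')" if "i \<in> {..<N}" for i
    by (intro borel_measurable_times measurable_compose[OF measurable_fst comp[OF that]]
        measurable_compose[OF measurable_snd comp[OF that]])
  then show ?thesis unfolding dot_def split_beta by (intro borel_measurable_sum)
qed

lemma dot_measurable_gibbs: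
  "(\<lambda>\<sigma>. dot {..<N} \<sigma> t) \<in> borel_measurable (gibbs_measure N a \<beta> h)"
proof -
  have id: "(\<lambda>x. x) \<in> uniform_sphere N \<rightarrow>\<^sub>M lborel_N N" by (rule measurable_uniform_sphere) simp_all
  have "(\<lambda>\<sigma>. \<sigma> i) \<in> borel_measurable (gibbs_measure N a \<beta> h)" if "i \<in> {..<N}" for i
    using measurable_lebP_component[OF id that] by (simp cong: measurable_cong_sets add: sets_gibbs_measure)
  then show ?thesis unfolding dot_def by (intro borel_measurable_sum borel_measurable_times) auto
qed

text \<open>Conditioning on one replica, the overlap is a linear functional of the other.\<close>

lemma overlap_deviation:
  fixes N :: nat and \<epsilon> v :: real
  assumes N: "N \<ge> 1"
    and p1: "\<And>\<tau>. \<tau> \<in> sphere_N N \<Longrightarrow> emeasure (gibbs_measure N a \<beta> h)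
      {\<sigma> \<in> sphere_N N. \<epsilon> * N \<le> \<bar>dot {..<N} \<sigma> \<tau> - dot {..<N} m \<tau>\<bar>} \<le> p1"
    and p2: "emeasure (gibbs_measure N a' \<beta>' h') {\<tau> \<in> sphere_N N. \<epsilon> * N \<le> \<bar>dot {..<N} \<tau> m - v * N\<bar>} \<le> p2"
    and u: "\<bar>v - u\<bar> \<le> \<epsilon>"
  shows "ennreal (\<integral>(\<sigma>, \<tau>). indicator {(\<sigma>, \<tau>). \<bar>overlap N \<sigma> \<tau> - u\<bar> \<ge> 3 * \<epsilon>} (\<sigma>, \<tau>)
    \<partial>(gibbs_measure N a \<beta> h \<Otimes>\<^sub>M gibbs_measure N a' \<beta>' h')) \<le> p1 + p2"
    and "ennreal (\<integral>(\<tau>, \<sigma>). indicator {(\<tau>, \<sigma>). \<bar>overlap N \<tau> \<sigma> - u\<bar> \<ge> 3 * \<epsilon>} (\<tau>, \<sigma>)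
    \<partial>(gibbs_measure N a' \<beta>' h' \<Otimes>\<^sub>M gibbs_measure N a \<beta> h)) \<le> p1 + p2"
proof -
  let ?G = "gibbs_measure N a \<beta> h" and ?G' = "gibbs_measure N a' \<beta>' h'" and ?I = "{..<N}"
  interpret G: prob_space ?G using N by (rule prob_space_gibbs_measure)
  interpret G': prob_space ?G' using N by (rule prob_space_gibbs_measure)
  interpret P: pair_prob_space ?G ?G' ..
  interpret P': pair_prob_space ?G' ?G ..
  have N0: "0 < real N" using N by simp
  \<comment> \<open>One \<epsilon> for replacing \<sigma> by its centre \<open>m\<close>, one for
    replacing \<tau> \<cdot> m / N by v, one for v against u: if the first two replacements succeed,
    the overlap is closer than 3 \<epsilon>.\<close>
  have split: "\<epsilon> * N \<le> \<bar>dot ?I \<sigma> \<tau> - dot ?I m \<tau>\<bar> \<or> \<epsilon> * N \<le> \<bar>dot ?I \<tau> m - v * N\<bar>"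
    if "3 * \<epsilon> \<le> \<bar>overlap N \<sigma> \<tau> - u\<bar>" for \<sigma> \<tau>
  proof -
    have "overlap N \<sigma> \<tau> - u = (dot ?I \<sigma> \<tau> - u * N) / N" using N0 by (simp add: overlap_def dot_def diff_divide_distrib)
    then have "\<bar>overlap N \<sigma> \<tau> - u\<bar> = \<bar>dot ?I \<sigma> \<tau> - u * N\<bar> / N" by simp
    then have 1: "3 * \<epsilon> * N \<le> \<bar>dot ?I \<sigma> \<tau> - u * N\<bar>" using that N0 by (simp add: pos_le_divide_eq)
    have "\<bar>v * N - u * N\<bar> = \<bar>v - u\<bar> * N" by (simp add: left_diff_distrib[symmetric] abs_mult)
    then have 2: "\<bar>v * N - u * N\<bar> \<le> \<epsilon> * N" using u N0 by (simp add: mult_right_mono)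
    have "3 * \<epsilon> * N = 3 * (\<epsilon> * N)" by simp
    then show ?thesis using 1 2 dot_commute[of ?I m \<tau>] by linarith
  qed
  have dG: "(\<lambda>\<sigma>. dot ?I \<sigma> t) \<in> borel_measurable ?G" "(\<lambda>\<sigma>. dot ?I \<sigma> t) \<in> borel_measurable ?G'" for t
    by (rule dot_measurable_gibbs)+
  have s2: "{\<tau> \<in> sphere_N N. \<epsilon> * N \<le> \<bar>dot ?I \<tau> m - v * N\<bar>} \<in> sets ?G'"
  proof -
    have "{\<tau> \<in> space ?G'. \<epsilon> * N \<le> \<bar>dot ?I \<tau> m - v * N\<bar>} \<in> sets ?G'" using dG(2)[of m] by measurable
    then show ?thesis by (simp only: space_gibbs_measure)
  qed
  have s1: "{\<sigma> \<in> sphere_N N. \<epsilon> * N \<le> \<bar>dot ?I \<sigma> \<tau> - dot ?I m \<tau>\<bar>} \<in> sets ?G" for \<tau>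
  proof -
    have "{\<sigma> \<in> space ?G. \<epsilon> * N \<le> \<bar>dot ?I \<sigma> \<tau> - dot ?I m \<tau>\<bar>} \<in> sets ?G" using dG(1)[of \<tau>] by measurable
    then show ?thesis by (simp only: space_gibbs_measure)
  qed
  show "ennreal (\<integral>(\<sigma>, \<tau>). indicator {(\<sigma>, \<tau>). \<bar>overlap N \<sigma> \<tau> - u\<bar> \<ge> 3 * \<epsilon>} (\<sigma>, \<tau>) \<partial>(?G \<Otimes>\<^sub>M ?G')) \<le> p1 + p2"
  proof -
    let ?D = "{(\<sigma>, \<tau>). \<bar>overlap N \<sigma> \<tau> - u\<bar> \<ge> 3 * \<epsilon>} \<inter> space (?G \<Otimes>\<^sub>M ?G')"
    have D: "?D \<in> sets (?G \<Otimes>\<^sub>M ?G')"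
    proof -
      have "(\<lambda>p. overlap N (fst p) (snd p)) \<in> borel_measurable (?G \<Otimes>\<^sub>M ?G')"
        using dot_measurable_pair[of N a \<beta> h a' \<beta>' h'] unfolding overlap_def dot_def split_beta by simp
      then have "{p \<in> space (?G \<Otimes>\<^sub>M ?G'). 3 * \<epsilon> \<le> \<bar>overlap N (fst p) (snd p) - u\<bar>} \<in> sets (?G \<Otimes>\<^sub>M ?G')" by measurable
      moreover have "{p \<in> space (?G \<Otimes>\<^sub>M ?G'). 3 * \<epsilon> \<le> \<bar>overlap N (fst p) (snd p) - u\<bar>} = ?D" by auto
      ultimately show ?thesis by simp
    qed
    have "(\<integral>(\<sigma>, \<tau>). indicator {(\<sigma>, \<tau>). \<bar>overlap N \<sigma> \<tau> - u\<bar> \<ge> 3 * \<epsilon>} (\<sigma>, \<tau>) \<partial>(?G \<Otimes>\<^sub>M ?G')) = measure (?G \<Otimes>\<^sub>M ?G') ?D"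
      unfolding case_prod_eta by (rule Bochner_Integration.integral_indicator)
    then have "ennreal (\<integral>(\<sigma>, \<tau>). indicator {(\<sigma>, \<tau>). \<bar>overlap N \<sigma> \<tau> - u\<bar> \<ge> 3 * \<epsilon>} (\<sigma>, \<tau>) \<partial>(?G \<Otimes>\<^sub>M ?G')) = emeasure (?G \<Otimes>\<^sub>M ?G') ?D"
      by (simp add: P.emeasure_eq_measure)
    also have "\<dots> = (\<integral>\<^sup>+\<tau>. emeasure ?G ((\<lambda>\<sigma>. (\<sigma>, \<tau>)) -` ?D) \<partial>?G')" by (rule P.emeasure_pair_measure_alt2[OF D])
    also have "\<dots> \<le> (\<integral>\<^sup>+\<tau>. p1 + indicator {\<tau> \<in> sphere_N N. \<epsilon> * N \<le> \<bar>dot ?I \<tau> m - v * N\<bar>} \<tau> \<partial>?G')"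
    proof (rule nn_integral_mono)
      fix \<tau> assume "\<tau> \<in> space ?G'"
      then have \<tau>: "\<tau> \<in> sphere_N N" by (simp only: space_gibbs_measure)
      show "emeasure ?G ((\<lambda>\<sigma>. (\<sigma>, \<tau>)) -` ?D) \<le> p1 + indicator {\<tau> \<in> sphere_N N. \<epsilon> * N \<le> \<bar>dot ?I \<tau> m - v * N\<bar>} \<tau>"
      proof (cases "\<epsilon> * N \<le> \<bar>dot ?I \<tau> m - v * N\<bar>")
        case True
        have "emeasure ?G ((\<lambda>\<sigma>. (\<sigma>, \<tau>)) -` ?D) \<le> 1" by (rule G.measure_le_1)
        also have "\<dots> \<le> p1 + 1" by simp
        finally show ?thesis using True \<tau> by simp
      next
        case False
        have "(\<lambda>\<sigma>. (\<sigma>, \<tau>)) -` ?D \<subseteq> {\<sigma> \<in> sphere_N N. \<epsilon> * N \<le> \<bar>dot ?I \<sigma> \<tau> - dot ?I m \<tau>\<bar>}"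
          using split False by (auto simp: space_pair_measure space_gibbs_measure)
        then have "emeasure ?G ((\<lambda>\<sigma>. (\<sigma>, \<tau>)) -` ?D) \<le> emeasure ?G {\<sigma> \<in> sphere_N N. \<epsilon> * N \<le> \<bar>dot ?I \<sigma> \<tau> - dot ?I m \<tau>\<bar>}"
          by (rule emeasure_mono[OF _ s1])
        also have "\<dots> \<le> p1" by (rule p1[OF \<tau>])
        finally show ?thesis using False by simp
      qed
    qed
    also have "\<dots> = (\<integral>\<^sup>+\<tau>. p1 \<partial>?G') + emeasure ?G' {\<tau> \<in> sphere_N N. \<epsilon> * N \<le> \<bar>dot ?I \<tau> m - v * N\<bar>}"
      using s2 by (subst nn_integral_add) simp_all
    also have "\<dots> \<le> p1 + p2" using G'.emeasure_space_1 p2 by (simp add: add_left_mono)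
    finally show ?thesis .
  qed
  show "ennreal (\<integral>(\<tau>, \<sigma>). indicator {(\<tau>, \<sigma>). \<bar>overlap N \<tau> \<sigma> - u\<bar> \<ge> 3 * \<epsilon>} (\<tau>, \<sigma>) \<partial>(?G' \<Otimes>\<^sub>M ?G)) \<le> p1 + p2"
  proof -
    let ?D = "{(\<tau>, \<sigma>). \<bar>overlap N \<tau> \<sigma> - u\<bar> \<ge> 3 * \<epsilon>} \<inter> space (?G' \<Otimes>\<^sub>M ?G)"
    have sym: "overlap N \<tau> \<sigma> = overlap N \<sigma> \<tau>" for \<sigma> \<tau> by (simp add: overlap_def mult.commute)
    have D: "?D \<in> sets (?G' \<Otimes>\<^sub>M ?G)"
    proof -
      have "(\<lambda>p. overlap N (fst p) (snd p)) \<in> borel_measurable (?G' \<Otimes>\<^sub>M ?G)"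
        using dot_measurable_pair[of N a' \<beta>' h' a \<beta> h] unfolding overlap_def dot_def split_beta by simp
      then have "{p \<in> space (?G' \<Otimes>\<^sub>M ?G). 3 * \<epsilon> \<le> \<bar>overlap N (fst p) (snd p) - u\<bar>} \<in> sets (?G' \<Otimes>\<^sub>M ?G)" by measurable
      moreover have "{p \<in> space (?G' \<Otimes>\<^sub>M ?G). 3 * \<epsilon> \<le> \<bar>overlap N (fst p) (snd p) - u\<bar>} = ?D" by auto
      ultimately show ?thesis by simp
    qed
    have "(\<integral>(\<tau>, \<sigma>). indicator {(\<tau>, \<sigma>). \<bar>overlap N \<tau> \<sigma> - u\<bar> \<ge> 3 * \<epsilon>} (\<tau>, \<sigma>) \<partial>(?G' \<Otimes>\<^sub>M ?G)) = measure (?G' \<Otimes>\<^sub>M ?G) ?D"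
      unfolding case_prod_eta by (rule Bochner_Integration.integral_indicator)
    then have "ennreal (\<integral>(\<tau>, \<sigma>). indicator {(\<tau>, \<sigma>). \<bar>overlap N \<tau> \<sigma> - u\<bar> \<ge> 3 * \<epsilon>} (\<tau>, \<sigma>) \<partial>(?G' \<Otimes>\<^sub>M ?G)) = emeasure (?G' \<Otimes>\<^sub>M ?G) ?D"
      by (simp add: P'.emeasure_eq_measure)
    also have "\<dots> = (\<integral>\<^sup>+\<tau>. emeasure ?G (Pair \<tau> -` ?D) \<partial>?G')" by (rule G.emeasure_pair_measure_alt[OF D])
    also have "\<dots> \<le> (\<integral>\<^sup>+\<tau>. p1 + indicator {\<tau> \<in> sphere_N N. \<epsilon> * N \<le> \<bar>dot ?I \<tau> m - v * N\<bar>} \<tau> \<partial>?G')"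
    proof (rule nn_integral_mono)
      fix \<tau> assume "\<tau> \<in> space ?G'"
      then have \<tau>: "\<tau> \<in> sphere_N N" by (simp only: space_gibbs_measure)
      show "emeasure ?G (Pair \<tau> -` ?D) \<le> p1 + indicator {\<tau> \<in> sphere_N N. \<epsilon> * N \<le> \<bar>dot ?I \<tau> m - v * N\<bar>} \<tau>"
      proof (cases "\<epsilon> * N \<le> \<bar>dot ?I \<tau> m - v * N\<bar>")
        case True
        have "emeasure ?G (Pair \<tau> -` ?D) \<le> 1" by (rule G.measure_le_1)
        also have "\<dots> \<le> p1 + 1" by simp
        finally show ?thesis using True \<tau> by simp
      next
        case False
        have "Pair \<tau> -` ?D \<subseteq> {\<sigma> \<in> sphere_N N. \<epsilon> * N \<le> \<bar>dot ?I \<sigma> \<tau> - dot ?I m \<tau>\<bar>}"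
          using split False sym[of \<tau>] by (auto simp: space_pair_measure space_gibbs_measure)
        then have "emeasure ?G (Pair \<tau> -` ?D) \<le> emeasure ?G {\<sigma> \<in> sphere_N N. \<epsilon> * N \<le> \<bar>dot ?I \<sigma> \<tau> - dot ?I m \<tau>\<bar>}"
          by (rule emeasure_mono[OF _ s1])
        also have "\<dots> \<le> p1" by (rule p1[OF \<tau>])
        finally show ?thesis using False by simp
      qed
    qed
    also have "\<dots> = (\<integral>\<^sup>+\<tau>. p1 \<partial>?G') + emeasure ?G' {\<tau> \<in> sphere_N N. \<epsilon> * N \<le> \<bar>dot ?I \<tau> m - v * N\<bar>}"
      using s2 by (subst nn_integral_add) simp_all
    also have "\<dots> \<le> p1 + p2" using G'.emeasure_space_1 p2 by (simp add: add_left_mono)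
    finally show ?thesis .
  qed
qed

text \<open>If \<open>f\<close> is not integrable, its Bochner integral is 0 and the bound is
  trivial. This bounds the disorder average of a Gibbs average without a proof that the latter is
  measurable.\<close>

lemma ennreal_integral_le_nn_integral:
  fixes f :: "'a \<Rightarrow> real"
  assumes "\<And>x. x \<in> space M \<Longrightarrow> 0 \<le> f x" "\<And>x. x \<in> space M \<Longrightarrow> ennreal (f x) \<le> g x"
  shows "ennreal (\<integral>x. f x \<partial>M) \<le> (\<integral>\<^sup>+x. g x \<partial>M)"
proof (cases "integrable M f")
  case True
  then have "ennreal (\<integral>x. f x \<partial>M) = (\<integral>\<^sup>+x. ennreal (f x) \<partial>M)"
    using assms(1) by (intro nn_integral_eq_integral[symmetric]) auto
  also have "\<dots> \<le> (\<integral>\<^sup>+x. g x \<partial>M)" by (intro nn_integral_mono assms(2))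
  finally show ?thesis .
qed (simp add: not_integrable_integral_eq)

text \<open>For given \<open>N\<close> only a finite block of the infinite array matters; its law is
  the product measure on which all estimates live.\<close>

lemma distr_disorder:
  fixes g :: "nat \<Rightarrow> nat \<Rightarrow> 'a \<Rightarrow> real"
  assumes M: "prob_space M" and indep: "prob_space.indep_vars M (\<lambda>_. borel) (\<lambda>(i, j). g i j) UNIV"
    and dist: "\<And>i j. distributed M lborel (g i j) (\<lambda>x. ennreal (std_normal_density x))"
    and N: "N \<ge> 1"
  defines "K \<equiv> {..<N} \<times> {..<N}"
  shows "(\<lambda>\<omega>. \<lambda>(i, j)\<in>K. g i j \<omega>) \<in> M \<rightarrow>\<^sub>M gaussP K"
    and "distr M (gaussP K) (\<lambda>\<omega>. \<lambda>(i, j)\<in>K. g i j \<omega>) = gaussP K"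
proof -
  interpret prob_space M by fact
  have K: "K \<noteq> {}" using N by (auto simp: K_def lessThan_empty_iff)
  have rv: "random_variable borel ((\<lambda>(i, j). g i j) p)" for p
    using distributed_measurable[OF dist] by (cases p) simp
  have law: "distr M borel ((\<lambda>(i, j). g i j) p) = std_gauss" for p
  proof -
    have "distr M lborel (g (fst p) (snd p)) = std_gauss"
      using distributed_distr_eq_density[OF dist] by (simp add: std_gauss_def)
    then show ?thesis by (simp add: split_beta cong: distr_cong)
  qed
  have "indep_vars (\<lambda>_. borel) (\<lambda>(i, j). g i j) K" using indep by (rule indep_vars_subset) simp
  then have eq: "distr M (\<Pi>\<^sub>M p\<in>K. borel) (\<lambda>x. \<lambda>p\<in>K. (\<lambda>(i, j). g i j) p x) = (\<Pi>\<^sub>M p\<in>K. distr M borel ((\<lambda>(i, j). g i j) p))"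
    using indep_vars_iff_distr_eq_PiM[OF K, where M' = "\<lambda>_. borel" and X = "\<lambda>(i, j). g i j"] rv by simp
  have sets: "sets (\<Pi>\<^sub>M p\<in>K. borel) = sets (gaussP K)" by (intro sets_PiM_cong) auto
  have fun_eq: "(\<lambda>x. \<lambda>p\<in>K. (\<lambda>(i, j). g i j) p x) = (\<lambda>\<omega>. \<lambda>(i, j)\<in>K. g i j \<omega>)"
    by (auto simp: fun_eq_iff restrict_def split_beta)
  show "(\<lambda>\<omega>. \<lambda>(i, j)\<in>K. g i j \<omega>) \<in> M \<rightarrow>\<^sub>M gaussP K"
    unfolding fun_eq[symmetric] using rv by (intro measurable_restrict) (simp add: std_gauss_def)
  have "distr M (gaussP K) (\<lambda>\<omega>. \<lambda>(i, j)\<in>K. g i j \<omega>) = distr M (\<Pi>\<^sub>M p\<in>K. borel) (\<lambda>\<omega>. \<lambda>(i, j)\<in>K. g i j \<omega>)"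
    by (rule distr_cong) (simp_all add: sets)
  also have "\<dots> = gaussP K" using eq unfolding fun_eq law .
  finally show "distr M (gaussP K) (\<lambda>\<omega>. \<lambda>(i, j)\<in>K. g i j \<omega>) = gaussP K" .
qed

section \<open>Sign averaging\<close>

text \<open>The set lists the coordinates whose sign is reversed, so that the sign patterns form a
  power set.\<close>

definition flip :: "nat set \<Rightarrow> nat \<Rightarrow> real" where
  "flip A i = (if i \<in> A then - 1 else 1)"

definition flipm :: "nat set \<Rightarrow> nat \<Rightarrow> nat \<Rightarrow> real" where
  "flipm A i j = flip A i * unitv i j"

lemma mv_flipm: "finite I \<Longrightarrow> i \<in> I \<Longrightarrow> mv I (flipm A) x i = flip A i * x i"
  unfolding mv_def flipm_def unitv_def
  by (subst sum.remove[of _ i]) (auto intro!: sum.neutral)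

lemma orth_flipm:
  assumes "finite I"
  shows "orth I (flipm A)"
  unfolding orth_def
proof (intro conjI ballI)
  show "symm_on I (flipm A)" by (auto simp: symm_on_def flipm_def unitv_def)
  fix i j assume "i \<in> I" "j \<in> I"
  then have "mv I (flipm A) (\<lambda>k. flipm A k j) i = unitv i j"
    using assms by (simp add: mv_flipm) (simp add: flipm_def flip_def)
  then show "(\<Sum>k\<in>I. flipm A i k * flipm A k j) = unitv i j" by (simp add: mv_def)
qed

text \<open>Orthogonality of random signs, as a sum over all patterns; the constant \<open>c\<close>
  absorbs the coordinate that the induction removes.\<close>

lemma sum_Pow_flip:
  assumes "finite J"
  shows "(\<Sum>A\<in>Pow J. (c + (\<Sum>j\<in>J. flip A j * w j))\<^sup>2) = 2 ^ card J * (c\<^sup>2 + (\<Sum>j\<in>J. (w j)\<^sup>2))"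
  using assms
proof (induction J arbitrary: c)
  case (insert k J)
  have inj: "inj_on (insert k) (Pow J)" using insert.hyps by (auto simp: inj_on_def)
  have disj: "Pow J \<inter> insert k ` Pow J = {}" using insert.hyps by auto
  have 1: "flip A k = 1" "flip (insert k A) k = - 1" if "A \<in> Pow J" for A
    using that insert.hyps by (auto simp: flip_def)
  have 2: "(\<Sum>j\<in>J. flip (insert k A) j * w j) = (\<Sum>j\<in>J. flip A j * w j)" for A
    using insert.hyps by (intro sum.cong) (auto simp: flip_def)
  have "(\<Sum>A\<in>Pow (insert k J). (c + (\<Sum>j\<in>insert k J. flip A j * w j))\<^sup>2)
    = (\<Sum>A\<in>Pow J. (c + (\<Sum>j\<in>insert k J. flip A j * w j))\<^sup>2)
    + (\<Sum>A\<in>Pow J. (c + (\<Sum>j\<in>insert k J. flip (insert k A) j * w j))\<^sup>2)"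
    unfolding Pow_insert using insert.hyps disj
    by (subst sum.union_disjoint) (simp_all add: sum.reindex[OF inj])
  also have "(\<Sum>A\<in>Pow J. (c + (\<Sum>j\<in>insert k J. flip A j * w j))\<^sup>2)
    = (\<Sum>A\<in>Pow J. ((c + w k) + (\<Sum>j\<in>J. flip A j * w j))\<^sup>2)"
    using insert.hyps 1(1) by (intro sum.cong refl) (simp add: add.assoc)
  also have "\<dots> = 2 ^ card J * ((c + w k)\<^sup>2 + (\<Sum>j\<in>J. (w j)\<^sup>2))" by (rule insert.IH)
  also have "(\<Sum>A\<in>Pow J. (c + (\<Sum>j\<in>insert k J. flip (insert k A) j * w j))\<^sup>2)
    = (\<Sum>A\<in>Pow J. ((c - w k) + (\<Sum>j\<in>J. flip A j * w j))\<^sup>2)"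
    using insert.hyps 1(2) by (intro sum.cong refl arg_cong[of _ _ "\<lambda>x. x\<^sup>2"]) (simp add: 2)
  also have "\<dots> = 2 ^ card J * ((c - w k)\<^sup>2 + (\<Sum>j\<in>J. (w j)\<^sup>2))" by (rule insert.IH)
  finally show ?case using insert.hyps by (simp add: power2_eq_square algebra_simps)
qed simp

text \<open>The cone measure inherits the invariance of Lebesgue measure, because an orthogonal map
  commutes with the radial projection and preserves ball and sphere.\<close>

lemma nn_integral_sphere_orth:
  assumes Q: "orth {..<N} Q" and F [measurable]: "F \<in> borel_measurable (lborel_N N)"
  shows "(\<integral>\<^sup>+\<sigma>. F (restrict (mv {..<N} Q \<sigma>) {..<N}) \<partial>uniform_sphere N) = (\<integral>\<^sup>+\<sigma>. F \<sigma> \<partial>uniform_sphere N)"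
proof -
  let ?I = "{..<N}" and ?T = "\<lambda>x. restrict (mv {..<N} Q x) {..<N}"
  interpret T: isometric_involution ?I ?T by (rule isometric_involution_mv[OF _ Q]) simp
  have norm: "norm_N N (?T x) = norm_N N x" for x
  proof -
    have "dot ?I (?T x) (?T x) = dot ?I (mv ?I Q x) (mv ?I Q x)" by (intro dot_cong) simp_all
    also have "\<dots> = dot ?I x x" using orth_dot[OF _ Q] by simp
    finally have "(norm_N N (?T x))\<^sup>2 = (norm_N N x)\<^sup>2" by (simp only: norm_N_dot)
    then show ?thesis by (simp add: norm_N_def sum_nonneg)
  qed
  have proj: "?T (radial_projection N x) = radial_projection N (?T x)" for x
    by (rule ext) (simp add: radial_projection_def norm mv_def sum_distrib_left sum_divide_distrib mult_ac)
  have sphere: "?T y \<in> sphere_N N \<longleftrightarrow> y \<in> sphere_N N" if "y \<in> space (lborel_N N)" for y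
    using that by (auto simp: sphere_N_def norm space_PiM)
  have ball: "?T y \<in> unit_ball_N N \<longleftrightarrow> y \<in> unit_ball_N N" if "y \<in> space (lborel_N N)" for y
    using that by (auto simp: unit_ball_N_def norm space_PiM)
  have FT: "(\<lambda>x. F (?T x)) \<in> borel_measurable (lborel_N N)" by measurable
  let ?H = "\<lambda>x. F (radial_projection N x) * indicator (sphere_N N) (radial_projection N x) * indicator (unit_ball_N N) x"
  have H: "?H \<in> borel_measurable (lborel_N N)" by measurable
  have "(\<integral>\<^sup>+x. F (?T (radial_projection N x)) * indicator (sphere_N N) (radial_projection N x) * indicator (unit_ball_N N) x \<partial>lborel_N N)
    = (\<integral>\<^sup>+x. ?H (?T x) \<partial>lborel_N N)"
  proof (rule nn_integral_cong)
    fix x assume x: "x \<in> space (lborel_N N)"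
    have "radial_projection N x \<in> space (lborel_N N)" by (simp add: radial_projection_def space_PiM)
    then have "radial_projection N (?T x) \<in> sphere_N N \<longleftrightarrow> radial_projection N x \<in> sphere_N N"
      using sphere proj by metis
    then show "F (?T (radial_projection N x)) * indicator (sphere_N N) (radial_projection N x) * indicator (unit_ball_N N) x = ?H (?T x)"
      using ball[OF x] unfolding proj indicator_def by simp
  qed
  also have "\<dots> = (\<integral>\<^sup>+x. ?H x \<partial>lborel_N N)" by (rule T.nn_integral_lebP[OF H])
  finally show ?thesis unfolding nn_integral_uniform_sphere[OF F] nn_integral_uniform_sphere[OF FT] by simp
qed

text \<open>Without field the weight of Q \<sigma> under the conjugated disorder is the weight of
  \<sigma>, so conjugation only moves the Gibbs measure by Q. A field in a fixed direction would
  break this.\<close>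

lemma nn_integral_gibbs_conjP:
  fixes g :: "nat \<times> nat \<Rightarrow> real"
  assumes N: "N \<ge> 1" and Q: "orth {..<N} Q" and f [measurable]: "f \<in> borel_measurable (lborel_N N)"
  shows "(\<integral>\<^sup>+\<sigma>. f \<sigma> \<partial>gibbs_measure N (\<lambda>i j. conjP {..<N} Q g (i, j)) \<beta> 0)
    = (\<integral>\<^sup>+\<sigma>. f (restrict (mv {..<N} Q \<sigma>) {..<N}) \<partial>gibbs_measure N (\<lambda>i j. g (i, j)) \<beta> 0)"
proof -
  let ?I = "{..<N}" and ?T = "\<lambda>x. restrict (mv {..<N} Q x) {..<N}"
  let ?W' = "gibbs_weight N (\<lambda>i j. conjP {..<N} Q g (i, j)) \<beta> 0" and ?W = "gibbs_weight N (\<lambda>i j. g (i, j)) \<beta> 0"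
  let ?Z' = "partition_function N (\<lambda>i j. conjP {..<N} Q g (i, j)) \<beta> 0" and ?Z = "partition_function N (\<lambda>i j. g (i, j)) \<beta> 0"
  interpret T: isometric_involution ?I ?T by (rule isometric_involution_mv[OF _ Q]) simp
  have W: "?W' (?T x) = ?W x" for x
  proof -
    have QT: "mv ?I Q (?T x) i = x i" if "i \<in> ?I" for i
    proof -
      have "mv ?I Q (?T x) i = mv ?I Q (mv ?I Q x) i" by (intro mv_cong) simp_all
      also have "\<dots> = x i" using that by (intro orth_mv_mv[OF _ Q]) simp_all
      finally show ?thesis .
    qed
    have "dot ?I (?T x) (mv ?I (gmat N (conjP ?I Q g)) (?T x)) = dot ?I (?T x) (mv ?I (conjm ?I Q (gmat N g)) (?T x))"
      by (intro dot_cong mv_cong gmat_conjP) simp_all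
    also have "\<dots> = dot ?I (mv ?I Q (?T x)) (mv ?I (gmat N g) (mv ?I Q (?T x)))"
      by (rule dot_conjm[OF _ Q]) simp
    also have "\<dots> = dot ?I x (mv ?I (gmat N g) x)" by (intro dot_cong mv_cong) (simp_all add: QT)
    finally show ?thesis by (simp add: gibbs_weight_dot)
  qed
  have fU: "f \<in> borel_measurable (uniform_sphere N)" "(\<lambda>\<sigma>. f (?T \<sigma>)) \<in> borel_measurable (uniform_sphere N)"
    by (rule measurable_uniform_sphere; measurable)+
  have Z: "?Z' = ?Z"
  proof -
    have "ennreal ?Z' = (\<integral>\<^sup>+\<sigma>. ennreal (?W' (?T \<sigma>)) \<partial>uniform_sphere N)"
      unfolding partition_function_nn(2)[OF N, symmetric]
      by (rule nn_integral_sphere_orth[OF Q, symmetric, of "\<lambda>\<sigma>. ennreal (?W' \<sigma>)"]) measurable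
    also have "\<dots> = ennreal ?Z" by (simp only: W partition_function_nn(2)[OF N])
    finally show ?thesis
      using partition_function_nn(1)[OF N] by (simp add: less_imp_le)
  qed
  have "(\<integral>\<^sup>+\<sigma>. f \<sigma> \<partial>gibbs_measure N (\<lambda>i j. conjP {..<N} Q g (i, j)) \<beta> 0) * ennreal ?Z'
    = (\<integral>\<^sup>+\<sigma>. ennreal (?W' \<sigma>) * f \<sigma> \<partial>uniform_sphere N)" by (rule nn_integral_gibbs[OF N fU(1)])
  also have "\<dots> = (\<integral>\<^sup>+\<sigma>. ennreal (?W' (?T \<sigma>)) * f (?T \<sigma>) \<partial>uniform_sphere N)"
    by (rule nn_integral_sphere_orth[OF Q, symmetric, of "\<lambda>\<sigma>. ennreal (?W' \<sigma>) * f \<sigma>"]) measurable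
  also have "\<dots> = (\<integral>\<^sup>+\<sigma>. f (?T \<sigma>) \<partial>gibbs_measure N (\<lambda>i j. g (i, j)) \<beta> 0) * ennreal ?Z"
    unfolding W by (rule nn_integral_gibbs[OF N fU(2), symmetric])
  finally have eq: "(\<integral>\<^sup>+\<sigma>. f \<sigma> \<partial>gibbs_measure N (\<lambda>i j. conjP {..<N} Q g (i, j)) \<beta> 0) * ennreal ?Z
    = (\<integral>\<^sup>+\<sigma>. f (?T \<sigma>) \<partial>gibbs_measure N (\<lambda>i j. g (i, j)) \<beta> 0) * ennreal ?Z" unfolding Z .
  have "x = y" if "x * ennreal ?Z = y * ennreal ?Z" for x y
    using that partition_function_nn(1)[OF N, of "\<lambda>i j. g (i, j)" \<beta> 0]
    by (metis ennreal_eq_0_iff ennreal_less_top mult_divide_eq_ennreal not_le order_less_imp_not_eq2 top.not_eq_extremum)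
  then show ?thesis using eq by blast
qed

lemma resolves_dot_symm:
  assumes "symm_on I A" "resolves I A z u y" "resolves I A z v w"
  shows "dot I v y = dot I u w"
proof -
  have "dot I u w = dot I (\<lambda>i. z * y i - mv I A y i) w"
    using assms(2) by (intro dot_cong) (simp_all add: resolves_def)
  also have "\<dots> = dot I y (\<lambda>i. z * w i - mv I A w i)"
    using dot_mv_symm[OF assms(1), of y w]
    by (simp add: dot_diff_left dot_diff_right dot_scale_left dot_scale_right)
  also have "\<dots> = dot I y v" using assms(3) by (intro dot_cong) (simp_all add: resolves_def)
  finally show ?thesis by (simp add: dot_commute)
qed

lemma resolves_norm:
  assumes "form_bound I A L 0 u'" "resolves I A z u y" "L < z"
  shows "dot I y y \<le> dot I u u / (z - L)\<^sup>2"
proof (cases "dot I y y = 0")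
  case True
  then show ?thesis by (simp add: dot_def sum_nonneg)
next
  case False
  have "0 \<le> dot I y y" by (simp add: dot_def sum_nonneg)
  with False have pos: "0 < dot I y y" by simp
  have le: "(z - L) * dot I y y \<le> dot I u y" using resolves_dot[OF assms(1,2)] by simp
  have "((z - L) * dot I y y)\<^sup>2 \<le> (dot I u y)\<^sup>2" using le pos assms(3) by (intro power_mono) simp_all
  also have "\<dots> \<le> dot I u u * dot I y y" by (rule dot_Cauchy_Schwarz)
  finally have "((z - L)\<^sup>2 * dot I y y) * dot I y y \<le> dot I u u * dot I y y"
    by (simp add: power2_eq_square mult_ac)
  then have "(z - L)\<^sup>2 * dot I y y \<le> dot I u u" using pos by (rule mult_right_le_imp_le)
  then show ?thesis using assms(3) by (simp add: pos_le_divide_eq mult.commute)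
qed


lemma coupling_curry: "coupling N (\<lambda>i j. g (i, j)) = gmat N g"
  by simp

text \<open>The average over a measure that depends on the disorder is a quotient of two integrals
  over the fixed uniform measure, whose integrands are jointly measurable in disorder and
  configuration.\<close>

lemma gibbs_second_moment_measurable:
  assumes N: "N \<ge> 1" and Y: "\<And>i. i < N \<Longrightarrow> (\<lambda>g. Y g i) \<in> borel_measurable (gaussP ({..<N} \<times> {..<N}))"
  shows "(\<lambda>g. \<integral>\<^sup>+\<tau>. ennreal ((dot {..<N} \<tau> (Y g))\<^sup>2) \<partial>gibbs_measure N (\<lambda>i j. g (i, j)) \<beta> h)
    \<in> borel_measurable (gaussP ({..<N} \<times> {..<N}))"
proof -
  let ?I = "{..<N}" and ?U = "uniform_sphere N"
  let ?M = "gaussP (?I \<times> ?I)"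
  interpret U: prob_space ?U by (rule prob_space_uniform_sphere[OF N])
  have comp: "(\<lambda>p. snd p i) \<in> borel_measurable (?M \<Otimes>\<^sub>M ?U)" if "i \<in> ?I" for i
  proof -
    have "(\<lambda>x. x) \<in> ?U \<rightarrow>\<^sub>M lborel_N N" by (rule measurable_uniform_sphere) simp_all
    then have "(\<lambda>x. x i) \<in> borel_measurable ?U" using that by (rule measurable_lebP_component)
    then show ?thesis by (rule measurable_compose[OF measurable_snd])
  qed
  have Yc: "(\<lambda>p. Y (fst p) i) \<in> borel_measurable (?M \<Otimes>\<^sub>M ?U)" if "i \<in> ?I" for i
    using Y[of i] that by (intro measurable_compose[OF measurable_fst]) simp
  have gc: "(\<lambda>p. gmat N (fst p) i j) \<in> borel_measurable (?M \<Otimes>\<^sub>M ?U)" if "i \<in> ?I" "j \<in> ?I" for i j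
    using gmat_component_measurable[OF that] by (rule measurable_compose[OF measurable_fst])
  have W: "(\<lambda>p. ennreal (gibbs_weight N (\<lambda>i j. fst p (i, j)) \<beta> h (snd p))) \<in> borel_measurable (?M \<Otimes>\<^sub>M ?U)"
    unfolding gibbs_weight_dot coupling_curry dot_def mv_def
    by (intro measurable_compose[OF _ measurable_ennreal] measurable_compose[OF _ borel_measurable_exp]
        borel_measurable_add borel_measurable_times borel_measurable_sum borel_measurable_const comp gc) simp_all
  have V: "(\<lambda>p. ennreal ((dot ?I (snd p) (Y (fst p)))\<^sup>2)) \<in> borel_measurable (?M \<Otimes>\<^sub>M ?U)"
    unfolding dot_def
    by (intro measurable_compose[OF _ measurable_ennreal] borel_measurable_power
        borel_measurable_times borel_measurable_sum comp Yc) simp_all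
  have num: "(\<lambda>g. \<integral>\<^sup>+\<tau>. ennreal (gibbs_weight N (\<lambda>i j. g (i, j)) \<beta> h \<tau>) * ennreal ((dot ?I \<tau> (Y g))\<^sup>2) \<partial>?U) \<in> borel_measurable ?M"
    by (rule U.borel_measurable_nn_integral) (use borel_measurable_times_ennreal[OF W V] in \<open>simp add: split_beta'\<close>)
  have den: "(\<lambda>g. \<integral>\<^sup>+\<tau>. ennreal (gibbs_weight N (\<lambda>i j. g (i, j)) \<beta> h \<tau>) \<partial>?U) \<in> borel_measurable ?M"
    by (rule U.borel_measurable_nn_integral) (use W in \<open>simp add: split_beta'\<close>)
  have "(\<integral>\<^sup>+\<tau>. ennreal ((dot {..<N} \<tau> (Y g))\<^sup>2) \<partial>gibbs_measure N (\<lambda>i j. g (i, j)) \<beta> h)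
    = (\<integral>\<^sup>+\<tau>. ennreal (gibbs_weight N (\<lambda>i j. g (i, j)) \<beta> h \<tau>) * ennreal ((dot ?I \<tau> (Y g))\<^sup>2) \<partial>?U)
      / (\<integral>\<^sup>+\<tau>. ennreal (gibbs_weight N (\<lambda>i j. g (i, j)) \<beta> h \<tau>) \<partial>?U)" for g
  proof -
    have f: "(\<lambda>\<tau>. ennreal ((dot ?I \<tau> (Y g))\<^sup>2)) \<in> borel_measurable ?U"
      using dot_measurable_gibbs[of N "Y g" "\<lambda>_ _. 0" 0 0]
      by (simp cong: measurable_cong_sets add: sets_gibbs_measure)
    have "x = y / ennreal z" if "x * ennreal z = y" "0 < z" for x y z
      using that by (metis ennreal_eq_0_iff ennreal_less_top mult_divide_eq_ennreal not_le order_less_imp_not_eq2 top.not_eq_extremum)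
    from this[OF nn_integral_gibbs[OF N f] partition_function_nn(1)[OF N]]
    show ?thesis unfolding partition_function_nn(2)[OF N] .
  qed
  then show ?thesis using borel_measurable_divide_ennreal[OF num den] by simp
qed

text \<open>The law of the disorder is invariant under conjugation by the diagonal sign matrices;
  averaging over all of them decouples the field direction \<open>u\<close> from the Gibbs measure without field.\<close>

lemma second_moment_bound:
  fixes L z \<beta> :: real
  assumes N: "N \<ge> 1" and L: "L < z"
  shows "\<exists>\<Phi>\<in>borel_measurable (gaussP ({..<N} \<times> {..<N})).
    (\<integral>\<^sup>+g. \<Phi> g \<partial>gaussP ({..<N} \<times> {..<N})) \<le> ennreal (1 / (z - L)\<^sup>2) \<and>
    (\<forall>g\<in>space (gaussP ({..<N} \<times> {..<N})). \<forall>y. form_bound {..<N} (gmat N g) L 0 (\<lambda>_. 0) \<longrightarrow>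
      resolves {..<N} (gmat N g) z (\<lambda>_. 1 / sqrt (real N)) y \<longrightarrow>
      (\<integral>\<^sup>+\<tau>. ennreal ((dot {..<N} \<tau> y)\<^sup>2) \<partial>gibbs_measure N (\<lambda>i j. g (i, j)) \<beta> 0) = \<Phi> g)"
proof -
  let ?I = "{..<N}" and ?u = "\<lambda>_::nat. 1 / sqrt (real N)"
  let ?M = "gaussP (?I \<times> ?I)"
  let ?F = "\<lambda>g. form_bound ?I (gmat N g) L 0 (\<lambda>_. 0)"
  let ?G = "\<lambda>g. gibbs_measure N (\<lambda>i j. g (i, j)) \<beta> 0"
  have fin: "finite ?I" by simp
  \<comment> \<open>A measurable choice of the resolvent vector for all disorders at once.\<close>
  have "\<exists>Y. (\<forall>i\<in>?I. (\<lambda>g. Y g i) \<in> borel_measurable ?M) \<and>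
    (\<forall>g. pos_def ?I (shifted z (gmat N g)) \<longrightarrow> (\<forall>i\<in>?I. mv ?I (shifted z (gmat N g)) (Y g) i = ?u i))"
    by (rule measurable_solution)
       (auto simp: shifted_def intro!: borel_measurable_diff gmat_component_measurable)
  then obtain Y where Ym: "\<forall>i\<in>?I. (\<lambda>g. Y g i) \<in> borel_measurable ?M"
    and Ys: "\<forall>g. pos_def ?I (shifted z (gmat N g)) \<longrightarrow> (\<forall>i\<in>?I. mv ?I (shifted z (gmat N g)) (Y g) i = ?u i)"
    by blast
  have Y: "resolves ?I (gmat N g) z ?u (Y g)" if "?F g" for g
  proof -
    have "pos_def ?I (shifted z (gmat N g))"
      by (rule form_bound_pos_def[OF fin symm_on_gmat that L]) simp
    then show ?thesis using Ys resolves_iff_shifted[OF fin] by metis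
  qed
  define \<Psi> where "\<Psi> g = (\<integral>\<^sup>+\<tau>. ennreal ((dot ?I \<tau> (Y g))\<^sup>2) \<partial>?G g)" for g
  define S where "S = {g \<in> space ?M. ?F g}"
  have S: "S \<in> sets ?M" unfolding S_def by (rule form_bound_sets[OF fin])
  \<comment> \<open>Cut off to the disorders with the form bound; elsewhere the chosen vector is
    arbitrary and the average uncontrolled.\<close>
  define \<Phi> where "\<Phi> g = indicator S g * \<Psi> g" for g
  have \<Psi>m: "\<Psi> \<in> borel_measurable ?M"
    unfolding \<Psi>_def[abs_def] using Ym by (intro gibbs_second_moment_measurable[OF N]) simp
  have \<Phi>m: "\<Phi> \<in> borel_measurable ?M"
    unfolding \<Phi>_def[abs_def] using S \<Psi>m by (intro borel_measurable_times_ennreal borel_measurable_indicator)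
  have \<Phi>l: "\<Phi> \<in> borel_measurable (lebP (?I \<times> ?I))"
    using \<Phi>m by (simp cong: measurable_cong_sets add: sets_gaussP)
  let ?T = "\<lambda>A. conjP ?I (flipm A)"
  have inv: "(\<integral>\<^sup>+g. \<Phi> (?T A g) \<partial>?M) = (\<integral>\<^sup>+g. \<Phi> g \<partial>?M)" for A
    using isometric_involution.nn_integral_gaussP[OF isometric_involution_conjP[OF fin orth_flipm[OF fin]] \<Phi>l] .
  have Tm: "(\<lambda>g. \<Phi> (?T A g)) \<in> borel_measurable ?M" for A
    using measurable_compose[OF isometric_involution.T_measurable[OF isometric_involution_conjP[OF fin orth_flipm[OF fin]]] \<Phi>l]
    by (simp cong: measurable_cong_sets add: sets_gaussP)
  have avg: "(\<Sum>A\<in>Pow ?I. \<Phi> (?T A g)) \<le> ennreal (2 ^ N / (z - L)\<^sup>2)" if g: "g \<in> space ?M" for g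
  proof (cases "?F g")
    case False
    have "\<not> ?F (?T A g)" for A
    proof -
      have "?F (?T A g) \<longleftrightarrow> form_bound ?I (conjm ?I (flipm A) (gmat N g)) L 0 (mv ?I (flipm A) (\<lambda>_. 0))"
        by (intro form_bound_cong) (simp_all add: gmat_conjP mv_def)
      then show ?thesis using False form_bound_conjm_iff[OF fin orth_flipm[OF fin]] by blast
    qed
    then have "\<Phi> (?T A g) = 0" for A by (simp add: \<Phi>_def S_def)
    then show ?thesis by simp
  next
    case True
    interpret G: prob_space "?G g" by (rule prob_space_gibbs_measure[OF N])
    have "\<exists>r. resolves ?I (gmat N g) z \<tau> r" for \<tau>
      by (rule ex_resolves[OF fin symm_on_gmat True L]) simp
    then obtain R where R: "\<And>\<tau>. resolves ?I (gmat N g) z \<tau> (R \<tau>)" by metis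
    have FT: "?F (?T A g)" for A
    proof -
      have "?F (?T A g) \<longleftrightarrow> form_bound ?I (conjm ?I (flipm A) (gmat N g)) L 0 (mv ?I (flipm A) (\<lambda>_. 0))"
        by (intro form_bound_cong) (simp_all add: gmat_conjP mv_def)
      then show ?thesis using True form_bound_conjm_iff[OF fin orth_flipm[OF fin]] by blast
    qed
    \<comment> \<open>The signs pass from \<tau> to the resolvent vector; conjugation turns this
      into the resolvent of the original disorder applied to the signed direction \<open>u\<close>,
      and symmetry of the resolvent moves it to \<tau>. Only signs in front of fixed coefficients
      remain.\<close>
    have dotY: "dot ?I (restrict (mv ?I (flipm A) \<tau>) ?I) (Y (?T A g)) = (\<Sum>i\<in>?I. flip A i * (R \<tau> i / sqrt N))" for A \<tau>
    proof -
      let ?Q = "flipm A"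
      have Q: "orth ?I ?Q" by (rule orth_flipm[OF fin])
      have "resolves ?I (conjm ?I ?Q (gmat N g)) z ?u (Y (?T A g))"
        using Y[OF FT[of A]] resolves_cong[of ?I ?u ?u "gmat N (?T A g)" "conjm ?I ?Q (gmat N g)"] by (simp add: gmat_conjP)
      then have "resolves ?I (conjm ?I ?Q (conjm ?I ?Q (gmat N g))) z (mv ?I ?Q ?u) (mv ?I ?Q (Y (?T A g)))"
        by (rule resolves_conjm[OF fin Q])
      then have res: "resolves ?I (gmat N g) z (mv ?I ?Q ?u) (mv ?I ?Q (Y (?T A g)))"
        using resolves_cong[of ?I "mv ?I ?Q ?u" "mv ?I ?Q ?u" "conjm ?I ?Q (conjm ?I ?Q (gmat N g))" "gmat N g"]
        by (simp add: conjm_conjm[OF fin Q])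
      have "dot ?I (restrict (mv ?I ?Q \<tau>) ?I) (Y (?T A g)) = dot ?I (mv ?I ?Q \<tau>) (Y (?T A g))"
        by (intro dot_cong) simp_all
      also have "\<dots> = dot ?I \<tau> (mv ?I ?Q (Y (?T A g)))" by (rule dot_mv_symm[OF orth_symm[OF Q], symmetric])
      also have "\<dots> = dot ?I (mv ?I ?Q ?u) (R \<tau>)" by (rule resolves_dot_symm[OF symm_on_gmat res R])
      also have "\<dots> = (\<Sum>i\<in>?I. flip A i * (R \<tau> i / sqrt N))"
        unfolding dot_def by (intro sum.cong refl) (simp add: mv_flipm)
      finally show ?thesis .
    qed
    have meas: "(\<lambda>\<tau>. ennreal ((dot ?I \<tau> t)\<^sup>2)) \<in> borel_measurable (lborel_N N)" for t
      unfolding dot_def by measurable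
    have "\<Phi> (?T A g) \<le> (\<integral>\<^sup>+\<tau>. ennreal ((\<Sum>i\<in>?I. flip A i * (R \<tau> i / sqrt N))\<^sup>2) \<partial>?G g)" for A
    proof -
      have "\<Phi> (?T A g) \<le> \<Psi> (?T A g)" by (simp add: \<Phi>_def indicator_def)
      also have "\<dots> = (\<integral>\<^sup>+\<tau>. ennreal ((dot ?I (restrict (mv ?I (flipm A) \<tau>) ?I) (Y (?T A g)))\<^sup>2) \<partial>?G g)"
        unfolding \<Psi>_def by (rule nn_integral_gibbs_conjP[OF N orth_flipm[OF fin] meas])
      finally show ?thesis unfolding dotY .
    qed
    then have "(\<Sum>A\<in>Pow ?I. \<Phi> (?T A g)) \<le> (\<Sum>A\<in>Pow ?I. \<integral>\<^sup>+\<tau>. ennreal ((\<Sum>i\<in>?I. flip A i * (R \<tau> i / sqrt N))\<^sup>2) \<partial>?G g)"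
      by (intro sum_mono)
    also have "\<dots> = (\<integral>\<^sup>+\<tau>. (\<Sum>A\<in>Pow ?I. ennreal ((\<Sum>i\<in>?I. flip A i * (R \<tau> i / sqrt N))\<^sup>2)) \<partial>?G g)"
    proof (rule nn_integral_sum[symmetric])
      fix A
      have "(\<lambda>\<tau>. ennreal ((dot ?I (restrict (mv ?I (flipm A) \<tau>) ?I) (Y (?T A g)))\<^sup>2)) \<in> borel_measurable (lborel_N N)"
        by (rule measurable_compose[OF isometric_involution.T_measurable[OF isometric_involution_mv[OF fin orth_flipm[OF fin]]] meas])
      then have "(\<lambda>\<tau>. ennreal ((\<Sum>i\<in>?I. flip A i * (R \<tau> i / sqrt N))\<^sup>2)) \<in> borel_measurable (uniform_sphere N)"
        unfolding dotY by (rule measurable_uniform_sphere) simp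
      then show "(\<lambda>\<tau>. ennreal ((\<Sum>i\<in>?I. flip A i * (R \<tau> i / sqrt N))\<^sup>2)) \<in> borel_measurable (?G g)"
        by (simp cong: measurable_cong_sets add: sets_gibbs_measure)
    qed
    also have "\<dots> \<le> (\<integral>\<^sup>+\<tau>. ennreal (2 ^ N / (z - L)\<^sup>2) \<partial>?G g)"
    proof (rule nn_integral_mono)
      fix \<tau> assume "\<tau> \<in> space (?G g)"
      then have "\<tau> \<in> sphere_N N" by (simp only: space_gibbs_measure)
      then have \<tau>: "dot ?I \<tau> \<tau> = N" using norm_N_dot[of N \<tau>] by (simp add: sphere_N_def)
      have "(\<Sum>A\<in>Pow ?I. ennreal ((\<Sum>i\<in>?I. flip A i * (R \<tau> i / sqrt N))\<^sup>2))
        = ennreal (\<Sum>A\<in>Pow ?I. (\<Sum>i\<in>?I. flip A i * (R \<tau> i / sqrt N))\<^sup>2)" by (rule sum_ennreal) simp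
      \<comment> \<open>Averaging over signs removes all cross terms and leaves |R \<tau>|^2 / N,
        which the norm of the resolvent bounds by 1 / (z - L)^2 on the sphere.\<close>
      also have "(\<Sum>A\<in>Pow ?I. (\<Sum>i\<in>?I. flip A i * (R \<tau> i / sqrt N))\<^sup>2) = 2 ^ N * (\<Sum>i\<in>?I. (R \<tau> i / sqrt N)\<^sup>2)"
        using sum_Pow_flip[OF fin, of 0 "\<lambda>i. R \<tau> i / sqrt N"] by simp
      also have "(\<Sum>i\<in>?I. (R \<tau> i / sqrt N)\<^sup>2) = dot ?I (R \<tau>) (R \<tau>) / N"
        by (simp add: dot_def power_divide power2_eq_square sum_divide_distrib)
      also have "ennreal (2 ^ N * (dot ?I (R \<tau>) (R \<tau>) / N)) \<le> ennreal (2 ^ N * (1 / (z - L)\<^sup>2))"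
      proof (intro ennreal_leI mult_left_mono)
        have "dot ?I (R \<tau>) (R \<tau>) \<le> N / (z - L)\<^sup>2" using resolves_norm[OF True R L, of \<tau>] \<tau> by simp
        then have "dot ?I (R \<tau>) (R \<tau>) / N \<le> N / (z - L)\<^sup>2 / N" by (rule divide_right_mono) simp
        then show "dot ?I (R \<tau>) (R \<tau>) / N \<le> 1 / (z - L)\<^sup>2" using N by simp
      qed simp
      finally show "(\<Sum>A\<in>Pow ?I. ennreal ((\<Sum>i\<in>?I. flip A i * (R \<tau> i / sqrt N))\<^sup>2)) \<le> ennreal (2 ^ N / (z - L)\<^sup>2)"
        by simp
    qed
    also have "\<dots> = ennreal (2 ^ N / (z - L)\<^sup>2)" by (simp add: G.emeasure_space_1)
    finally show ?thesis .
  qed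
  interpret P: prob_space ?M by (rule prob_space_gaussP)
  \<comment> \<open>By invariance of the law all 2^N conjugated copies of \<Phi> have the same
    integral, so the pointwise bound on their sum bounds each.\<close>
  have "ennreal (2 ^ N) * (\<integral>\<^sup>+g. \<Phi> g \<partial>?M) = (\<Sum>A\<in>Pow ?I. \<integral>\<^sup>+g. \<Phi> (?T A g) \<partial>?M)"
    unfolding inv by (simp add: card_Pow ennreal_power[symmetric])
  also have "\<dots> = (\<integral>\<^sup>+g. (\<Sum>A\<in>Pow ?I. \<Phi> (?T A g)) \<partial>?M)" by (rule nn_integral_sum[symmetric]) (rule Tm)
  also have "\<dots> \<le> (\<integral>\<^sup>+g. ennreal (2 ^ N / (z - L)\<^sup>2) \<partial>?M)" by (intro nn_integral_mono avg)
  also have "\<dots> = ennreal (2 ^ N) * ennreal (1 / (z - L)\<^sup>2)"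
    by (simp add: P.emeasure_space_1 flip: ennreal_mult)
  finally have le: "ennreal (2 ^ N) * (\<integral>\<^sup>+g. \<Phi> g \<partial>?M) \<le> ennreal (2 ^ N) * ennreal (1 / (z - L)\<^sup>2)" .
  have E: "(\<integral>\<^sup>+g. \<Phi> g \<partial>?M) \<le> ennreal (1 / (z - L)\<^sup>2)"
    using le by (subst (asm) ennreal_mult_le_mult_iff) simp_all
  show ?thesis
  proof (rule bexI[OF _ \<Phi>m], rule conjI[OF E], intro ballI allI impI)
    fix g y assume g: "g \<in> space ?M" and F: "?F g" and y: "resolves ?I (gmat N g) z ?u y"
    have "Y g i = y i" if "i \<in> ?I" for i
      by (rule resolves_unique[OF fin symm_on_gmat F L _ Y[OF F] y that]) simp
    then have "dot ?I \<tau> y = dot ?I \<tau> (Y g)" for \<tau> by (intro dot_cong) simp_all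
    then show "(\<integral>\<^sup>+\<tau>. ennreal ((dot ?I \<tau> y)\<^sup>2) \<partial>?G g) = \<Phi> g"
      using g F by (simp add: \<Phi>_def \<Psi>_def S_def)
  qed
qed

section \<open>The limit\<close>

definition misfit ::
  "nat \<Rightarrow> (nat \<Rightarrow> nat \<Rightarrow> real) \<Rightarrow> real \<Rightarrow> real \<Rightarrow> real \<Rightarrow> real \<Rightarrow> real \<Rightarrow> real \<Rightarrow> real" where
  "misfit N a \<beta> h \<beta>' h' u \<epsilon> = (\<integral>(\<sigma>, \<tau>). indicator {(\<sigma>, \<tau>). \<bar>overlap N \<sigma> \<tau> - u\<bar> \<ge> \<epsilon>} (\<sigma>, \<tau>)
    \<partial>(gibbs_measure N a \<beta> h \<Otimes>\<^sub>M gibbs_measure N a \<beta>' h'))"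

lemma misfit_bounds:
  assumes N: "N \<ge> 1"
  shows "0 \<le> misfit N a \<beta> h \<beta>' h' u \<epsilon>" "misfit N a \<beta> h \<beta>' h' u \<epsilon> \<le> 1"
proof -
  interpret G: prob_space "gibbs_measure N a \<beta> h" using N by (rule prob_space_gibbs_measure)
  interpret G': prob_space "gibbs_measure N a \<beta>' h'" using N by (rule prob_space_gibbs_measure)
  interpret P: pair_prob_space "gibbs_measure N a \<beta> h" "gibbs_measure N a \<beta>' h'" ..
  show "0 \<le> misfit N a \<beta> h \<beta>' h' u \<epsilon>" "misfit N a \<beta> h \<beta>' h' u \<epsilon> \<le> 1"
    unfolding misfit_def case_prod_eta Bochner_Integration.integral_indicator by simp_all
qed

text \<open>A measurable majorant on the Gaussian product space suffices: it is pulled back along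
  the law of the finite block, and the Gibbs average itself enters only through the pointwise
  bound.\<close>

lemma misfit_tendsto_0:
  fixes g :: "nat \<Rightarrow> nat \<Rightarrow> 'a \<Rightarrow> real"
  assumes M: "prob_space M" "prob_space.indep_vars M (\<lambda>_. borel) (\<lambda>(i, j). g i j) UNIV"
      "\<And>i j. distributed M lborel (g i j) (\<lambda>x. ennreal (std_normal_density x))"
    and bound: "\<And>\<eta>. 0 < \<eta> \<Longrightarrow> \<exists>N0\<ge>1. \<forall>N\<ge>N0. \<exists>f\<in>borel_measurable (gaussP ({..<N} \<times> {..<N})).
      (\<integral>\<^sup>+x. f x \<partial>gaussP ({..<N} \<times> {..<N})) \<le> ennreal \<eta> \<and>
      (\<forall>x\<in>space (gaussP ({..<N} \<times> {..<N})). ennreal (misfit N (\<lambda>i j. x (i, j)) \<beta> h \<beta>' h' u \<epsilon>) \<le> f x)"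
  shows "(\<lambda>N. \<integral>\<omega>. misfit N (\<lambda>i j. g i j \<omega>) \<beta> h \<beta>' h' u \<epsilon> \<partial>M) \<longlonglongrightarrow> 0"
proof (rule LIMSEQ_I)
  fix r :: real assume r: "0 < r"
  then have "0 < r / 2" by simp
  then obtain N0 where N0: "N0 \<ge> 1" and f: "\<forall>N\<ge>N0. \<exists>f\<in>borel_measurable (gaussP ({..<N} \<times> {..<N})).
      (\<integral>\<^sup>+x. f x \<partial>gaussP ({..<N} \<times> {..<N})) \<le> ennreal (r / 2) \<and>
      (\<forall>x\<in>space (gaussP ({..<N} \<times> {..<N})). ennreal (misfit N (\<lambda>i j. x (i, j)) \<beta> h \<beta>' h' u \<epsilon>) \<le> f x)"
    using bound by blast
  show "\<exists>no. \<forall>N\<ge>no. norm ((\<integral>\<omega>. misfit N (\<lambda>i j. g i j \<omega>) \<beta> h \<beta>' h' u \<epsilon> \<partial>M) - 0) < r"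
  proof (intro exI[of _ N0] allI impI)
    fix N assume N: "N0 \<le> N"
    let ?K = "{..<N} \<times> {..<N}"
    have N1: "N \<ge> 1" using N N0 by simp
    let ?X = "\<lambda>\<omega>. \<lambda>(i, j)\<in>?K. g i j \<omega>"
    have X: "?X \<in> M \<rightarrow>\<^sub>M gaussP ?K" "distr M (gaussP ?K) ?X = gaussP ?K"
      using distr_disorder[OF M N1] by simp_all
    obtain f where fm: "f \<in> borel_measurable (gaussP ?K)" and fI: "(\<integral>\<^sup>+x. f x \<partial>gaussP ?K) \<le> ennreal (r / 2)"
      and fb: "\<And>x. x \<in> space (gaussP ?K) \<Longrightarrow> ennreal (misfit N (\<lambda>i j. x (i, j)) \<beta> h \<beta>' h' u \<epsilon>) \<le> f x"
      using f N by blast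
    have eq: "misfit N (\<lambda>i j. g i j \<omega>) \<beta> h \<beta>' h' u \<epsilon> = misfit N (\<lambda>i j. ?X \<omega> (i, j)) \<beta> h \<beta>' h' u \<epsilon>" for \<omega>
    proof -
      have "gibbs_measure N (\<lambda>i j. g i j \<omega>) b k = gibbs_measure N (\<lambda>i j. ?X \<omega> (i, j)) b k" for b k
        by (rule gibbs_measure_cong) simp
      then show ?thesis by (simp only: misfit_def)
    qed
    have "ennreal (\<integral>\<omega>. misfit N (\<lambda>i j. g i j \<omega>) \<beta> h \<beta>' h' u \<epsilon> \<partial>M) \<le> (\<integral>\<^sup>+\<omega>. f (?X \<omega>) \<partial>M)"
    proof (rule ennreal_integral_le_nn_integral)
      fix \<omega> assume \<omega>: "\<omega> \<in> space M"
      show "0 \<le> misfit N (\<lambda>i j. g i j \<omega>) \<beta> h \<beta>' h' u \<epsilon>" by (rule misfit_bounds[OF N1])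
      show "ennreal (misfit N (\<lambda>i j. g i j \<omega>) \<beta> h \<beta>' h' u \<epsilon>) \<le> f (?X \<omega>)"
        unfolding eq by (rule fb[OF measurable_space[OF X(1) \<omega>]])
    qed
    also have "\<dots> = (\<integral>\<^sup>+x. f x \<partial>distr M (gaussP ?K) ?X)" by (rule nn_integral_distr[OF X(1), symmetric]) (use fm in simp)
    also have "\<dots> \<le> ennreal (r / 2)" unfolding X(2) by (rule fI)
    finally have "(\<integral>\<omega>. misfit N (\<lambda>i j. g i j \<omega>) \<beta> h \<beta>' h' u \<epsilon> \<partial>M) \<le> r / 2" using r by simp
    moreover have "0 \<le> (\<integral>\<omega>. misfit N (\<lambda>i j. g i j \<omega>) \<beta> h \<beta>' h' u \<epsilon> \<partial>M)"
      by (intro integral_nonneg_AE AE_I2 misfit_bounds[OF N1])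
    ultimately show "norm ((\<integral>\<omega>. misfit N (\<lambda>i j. g i j \<omega>) \<beta> h \<beta>' h' u \<epsilon> \<partial>M) - 0) < r" using r by simp
  qed
qed

lemma half_sum_inverse_gt_1:
  fixes b :: real
  assumes "0 < b" "b < 1"
  shows "1 < (b + 1 / b) / 2"
proof -
  have "0 < (1 - b)\<^sup>2" using assms by simp
  then have "2 * b < b * b + 1" by (simp add: power2_eq_square algebra_simps)
  then show ?thesis using assms by (simp add: field_simps)
qed

lemma exp_bound_eventually:
  fixes c \<eta> :: real
  assumes "0 < c" "0 < \<eta>"
  shows "\<exists>N0. \<forall>N\<ge>N0. 4 * exp (- c * real N) \<le> \<eta>"
proof -
  have "(\<lambda>N. 4 * exp (- c * real N)) \<longlonglongrightarrow> 0" using assms by real_asymp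
  then have "\<forall>\<^sub>F N in sequentially. 4 * exp (- c * real N) < \<eta>" using assms(2) by (rule order_tendstoD)
  then show ?thesis unfolding eventually_sequentially by (meson less_imp_le)
qed

text \<open>Both replicas act like their centres on the relevant vectors, so the overlap becomes m'
  \<cdot> m / N = C y \<cdot> y' with the two resolvent vectors, and C \<kappa> = u. Five
  exceptional probabilities share \<eta>: three for the disorder, two for the Gibbs
  measures.\<close>

lemma misfit_both_fields:
  fixes \<beta> h \<beta>' h' q q' u \<epsilon> \<eta> :: real
  assumes \<beta>: "0 < \<beta>" and h: "h \<noteq> 0" and \<beta>': "0 < \<beta>'" and h': "h' \<noteq> 0"
    and q: "q = q_param \<beta> h" and q': "q' = q_param \<beta>' h'"
    and u: "u = h * h' * (1 - q) * (1 - q') / (1 - \<beta> * \<beta>' * (1 - q) * (1 - q'))"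
    and \<epsilon>: "0 < \<epsilon>" and \<eta>: "0 < \<eta>"
  shows "\<exists>N0\<ge>1. \<forall>N\<ge>N0. \<exists>f\<in>borel_measurable (gaussP ({..<N} \<times> {..<N})).
      (\<integral>\<^sup>+x. f x \<partial>gaussP ({..<N} \<times> {..<N})) \<le> ennreal \<eta> \<and>
      (\<forall>x\<in>space (gaussP ({..<N} \<times> {..<N})). ennreal (misfit N (\<lambda>i j. x (i, j)) \<beta> h \<beta>' h' u (3 * \<epsilon>)) \<le> f x)"
proof -
  note Q = q_param_facts[OF \<beta> h, folded q] and Q' = q_param_facts[OF \<beta>' h', folded q']
  define b where "b = \<beta> * (1 - q)"
  define b' where "b' = \<beta>' * (1 - q')"
  define z where "z = (b + 1 / b) / 2"
  define z' where "z' = (b' + 1 / b') / 2"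
  have b: "0 < b" "b < 1" using Q by (simp_all add: b_def)
  have b': "0 < b'" "b' < 1" using Q' by (simp_all add: b'_def)
  have z1: "1 < z" "1 < z'" using half_sum_inverse_gt_1[OF b] half_sum_inverse_gt_1[OF b'] by (simp_all add: z_def z'_def)
  \<comment> \<open>The form bound 1 + 3 \<delta> stays at most halfway between 1 and each spectral
    parameter. A common \<delta> lets one norm event serve both resolvents.\<close>
  define \<delta> where "\<delta> = min (1 / 2) (min ((z - 1) / 6) ((z' - 1) / 6))"
  have \<delta>: "0 < \<delta>" "\<delta> \<le> 1 / 2" using z1 by (simp_all add: \<delta>_def)
  have "\<delta> \<le> (z - 1) / 6" "\<delta> \<le> (z' - 1) / 6" unfolding \<delta>_def by linarith+
  then have "6 * \<delta> \<le> z - 1" "6 * \<delta> \<le> z' - 1" by simp_all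
  then have \<delta>z: "1 + 3 * \<delta> < z" "1 + 3 * \<delta> < z'" using \<delta>(1) by linarith+
  obtain c where c: "0 < c" and good: "\<forall>\<eta>>0. \<exists>N0\<ge>1. \<forall>N\<ge>N0. \<exists>S\<in>sets (gaussP ({..<N} \<times> {..<N})).
    emeasure (gaussP ({..<N} \<times> {..<N})) S \<le> ennreal \<eta> \<and>
    (\<forall>g\<in>space (gaussP ({..<N} \<times> {..<N})) - S. concentrates N \<beta> h z \<delta> \<epsilon> c g)"
    using system_good[OF \<beta> h Q(1,2) b_def b _ z_def \<delta> \<delta>z(1) \<epsilon>] Q(5) by (auto simp: b_def)
  obtain c' where c': "0 < c'" and good': "\<forall>\<eta>>0. \<exists>N0\<ge>1. \<forall>N\<ge>N0. \<exists>S\<in>sets (gaussP ({..<N} \<times> {..<N})).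
    emeasure (gaussP ({..<N} \<times> {..<N})) S \<le> ennreal \<eta> \<and>
    (\<forall>g\<in>space (gaussP ({..<N} \<times> {..<N})) - S. concentrates N \<beta>' h' z' \<delta> \<epsilon> c' g)"
    using system_good[OF \<beta>' h' Q'(1,2) b'_def b' _ z'_def \<delta> \<delta>z(2) \<epsilon>] Q'(5) by (auto simp: b'_def)
  define \<kappa> where "\<kappa> = 4 * b * b' / (1 - b * b')"
  define C where "C = h * h' / (4 * \<beta> * \<beta>')"
  have C0: "0 < \<bar>C\<bar>" using \<beta> \<beta>' h h' by (simp add: C_def)
  have C\<kappa>: "C * \<kappa> = u"
  proof -
    have "h * h' / (4 * \<beta> * \<beta>') * (4 * (\<beta> * p) * (\<beta>' * p') / (1 - \<beta> * p * (\<beta>' * p')))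
      = h * h' * p * p' / (1 - \<beta> * \<beta>' * p * p')" for p p'
      using \<beta> \<beta>' by (simp add: mult_ac)
    then show ?thesis unfolding C_def \<kappa>_def u b_def b'_def .
  qed
  define e where "e = \<epsilon> / \<bar>C\<bar>"
  have e: "0 < e" using \<epsilon> C0 by (simp add: e_def)
  have small: "small (bad_kappa \<delta> z z' \<kappa> e :: nat set \<Rightarrow> _)"
    by (rule small_bad_kappa[OF z_def z'_def \<kappa>_def b b' \<delta> \<delta>z e])
  have adm: "admissible (bad_kappa \<delta> z z' \<kappa> e :: nat set \<Rightarrow> _)"
    using \<delta> \<delta>z by (intro admissible_bad_kappa) auto
  have \<eta>5: "0 < \<eta> / 5" using \<eta> by simp
  obtain N1 where N1: "N1 \<ge> 1" "\<forall>N\<ge>N1. \<exists>S\<in>sets (gaussP ({..<N} \<times> {..<N})).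
    emeasure (gaussP ({..<N} \<times> {..<N})) S \<le> ennreal (\<eta> / 5) \<and>
    (\<forall>g\<in>space (gaussP ({..<N} \<times> {..<N})) - S. concentrates N \<beta> h z \<delta> \<epsilon> c g)"
    using good \<eta>5 by blast
  obtain N2 where N2: "N2 \<ge> 1" "\<forall>N\<ge>N2. \<exists>S\<in>sets (gaussP ({..<N} \<times> {..<N})).
    emeasure (gaussP ({..<N} \<times> {..<N})) S \<le> ennreal (\<eta> / 5) \<and>
    (\<forall>g\<in>space (gaussP ({..<N} \<times> {..<N})) - S. concentrates N \<beta>' h' z' \<delta> \<epsilon> c' g)"
    using good' \<eta>5 by blast
  obtain N3 where N3: "\<forall>N\<ge>N3. emeasure (gaussP ({..<N} \<times> {..<N})) (event N {..<N} (\<lambda>_. 1 / sqrt N) (bad_kappa \<delta> z z' \<kappa> e)) \<le> ennreal (\<eta> / 5)"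
    using emeasure_event_small[OF small \<eta>5] by blast
  obtain N4 where N4: "\<forall>N\<ge>N4. 4 * exp (- c * real N) \<le> \<eta> / 5" using exp_bound_eventually[OF c \<eta>5] by blast
  obtain N5 where N5: "\<forall>N\<ge>N5. 4 * exp (- c' * real N) \<le> \<eta> / 5" using exp_bound_eventually[OF c' \<eta>5] by blast
  show ?thesis
  proof (rule exI[of _ "max (max N1 N2) (max N3 (max N4 N5))"], rule conjI, use N1(1) in simp, intro allI impI)
    fix N assume "max (max N1 N2) (max N3 (max N4 N5)) \<le> N"
    then have N: "N1 \<le> N" "N2 \<le> N" "N3 \<le> N" "N4 \<le> N" "N5 \<le> N" and N0: "1 \<le> N" using N1(1) by auto
    let ?I = "{..<N}" and ?u = "\<lambda>_::nat. 1 / sqrt (real N)"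
    let ?M = "gaussP (?I \<times> ?I)"
    obtain S1 where S1: "S1 \<in> sets ?M" "emeasure ?M S1 \<le> ennreal (\<eta> / 5)"
      and G1: "\<And>g. g \<in> space ?M - S1 \<Longrightarrow> concentrates N \<beta> h z \<delta> \<epsilon> c g" using N1(2) N(1) by blast
    obtain S2 where S2: "S2 \<in> sets ?M" "emeasure ?M S2 \<le> ennreal (\<eta> / 5)"
      and G2: "\<And>g. g \<in> space ?M - S2 \<Longrightarrow> concentrates N \<beta>' h' z' \<delta> \<epsilon> c' g" using N2(2) N(2) by blast
    define S3 where "S3 = event N ?I ?u (bad_kappa \<delta> z z' \<kappa> e)"
    have S3: "S3 \<in> sets ?M" "emeasure ?M S3 \<le> ennreal (\<eta> / 5)"
      using admissible_sets[OF adm, of ?I] N3 N(3) by (simp_all add: S3_def)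
    define f :: "(nat \<times> nat \<Rightarrow> real) \<Rightarrow> ennreal"
      where "f x = indicator S1 x + indicator S2 x + indicator S3 x + ennreal (2 * \<eta> / 5)" for x
    interpret P: prob_space ?M by (rule prob_space_gaussP)
    have fm: "f \<in> borel_measurable ?M" unfolding f_def[abs_def] using S1 S2 S3 by simp
    have "(\<integral>\<^sup>+x. f x \<partial>?M) = emeasure ?M S1 + emeasure ?M S2 + emeasure ?M S3 + ennreal (2 * \<eta> / 5)"
      unfolding f_def using S1(1) S2(1) S3(1) by (simp add: nn_integral_add P.emeasure_space_1)
    also have "\<dots> \<le> ennreal (\<eta> / 5) + ennreal (\<eta> / 5) + ennreal (\<eta> / 5) + ennreal (2 * \<eta> / 5)"
      using S1(2) S2(2) S3(2) by (intro add_mono) simp_all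
    also have "\<dots> = ennreal \<eta>" using \<eta> by (simp flip: ennreal_plus)
    finally have fI: "(\<integral>\<^sup>+x. f x \<partial>?M) \<le> ennreal \<eta>" .
    show "\<exists>f\<in>borel_measurable ?M. (\<integral>\<^sup>+x. f x \<partial>?M) \<le> ennreal \<eta> \<and>
      (\<forall>x\<in>space ?M. ennreal (misfit N (\<lambda>i j. x (i, j)) \<beta> h \<beta>' h' u (3 * \<epsilon>)) \<le> f x)"
    proof (intro bexI[OF _ fm] conjI[OF fI] ballI)
      fix x assume x: "x \<in> space ?M"
      let ?x = "\<lambda>i j. x (i, j)"
      show "ennreal (misfit N ?x \<beta> h \<beta>' h' u (3 * \<epsilon>)) \<le> f x"
      proof (cases "x \<in> S1 \<or> x \<in> S2 \<or> x \<in> S3")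
        case True
        have "ennreal (misfit N ?x \<beta> h \<beta>' h' u (3 * \<epsilon>)) \<le> 1" using misfit_bounds[OF N0] by (simp add: ennreal_le_1)
        also have "1 \<le> indicator S1 x + indicator S2 x + (indicator S3 x :: ennreal)"
          using True by (auto simp: indicator_def)
        also have "\<dots> \<le> f x" by (simp add: f_def)
        finally show ?thesis .
      next
        case False
        have gd: "concentrates N \<beta> h z \<delta> \<epsilon> c x" "concentrates N \<beta>' h' z' \<delta> \<epsilon> c' x" using False x G1 G2 by blast+
        then have fb: "form_bound ?I (gmat N x) (1 + 3 * \<delta>) (1 / 2 + \<delta>) ?u" by (simp add: concentrates_def)
        obtain y where y: "resolves ?I (gmat N x) z ?u y"
          using ex_resolves[OF finite_lessThan symm_on_gmat fb \<delta>z(1)] \<delta> by auto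
        obtain y' where y': "resolves ?I (gmat N x) z' ?u y'"
          using ex_resolves[OF finite_lessThan symm_on_gmat fb \<delta>z(2)] \<delta> by auto
        define m where "m = (\<lambda>i. h * sqrt (real N) / (2 * \<beta>) * y i)"
        define m' where "m' = (\<lambda>i. h' * sqrt (real N) / (2 * \<beta>') * y' i)"
        have m: "dot ?I m m \<le> 2 * real N" "\<And>t. dot ?I t t \<le> 2 * real N \<Longrightarrow> emeasure (gibbs_measure N ?x \<beta> h)
          {\<sigma> \<in> sphere_N N. \<epsilon> * real N \<le> \<bar>dot ?I \<sigma> t - dot ?I m t\<bar>} \<le> ennreal (4 * exp (- c * real N))"
          using gd(1) y m_def unfolding concentrates_def by blast+
        have m': "\<And>t. dot ?I t t \<le> 2 * real N \<Longrightarrow> emeasure (gibbs_measure N ?x \<beta>' h')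
          {\<sigma> \<in> sphere_N N. \<epsilon> * real N \<le> \<bar>dot ?I \<sigma> t - dot ?I m' t\<bar>} \<le> ennreal (4 * exp (- c' * real N))"
          using gd(2) y' m'_def unfolding concentrates_def by blast
        have "\<not> bad_kappa \<delta> z z' \<kappa> e ?I ?u (gmat N x)" using False x by (simp add: S3_def event_def)
        then have \<kappa>: "\<bar>dot ?I y y' - \<kappa>\<bar> \<le> e" using y y' unfolding bad_kappa_def by (meson not_less)
        define v where "v = dot ?I m' m / N"
        have "dot ?I m' m = C * dot ?I y y' * N"
          unfolding m_def m'_def dot_scale_left dot_scale_right
          using N0 \<beta> \<beta>' by (simp add: C_def dot_commute[of _ y' y] field_simps)
        then have v: "v = C * dot ?I y y'" "dot ?I m' m = v * N" using N0 by (simp_all add: v_def)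
        have "v - u = C * (dot ?I y y' - \<kappa>)" by (simp add: v(1) C\<kappa>[symmetric] right_diff_distrib)
        then have "\<bar>v - u\<bar> = \<bar>C\<bar> * \<bar>dot ?I y y' - \<kappa>\<bar>" by (simp add: abs_mult)
        also have "\<dots> \<le> \<bar>C\<bar> * e" using \<kappa> by (intro mult_left_mono) simp_all
        also have "\<dots> = \<epsilon>" using C0 by (simp add: e_def)
        finally have vu: "\<bar>v - u\<bar> \<le> \<epsilon>" .
        \<comment> \<open>The first system is tested against the other replica, the second against
          the centre \<open>m\<close> of the first; both vectors have squared norm at most 2
          N.\<close>
        have "ennreal (misfit N ?x \<beta> h \<beta>' h' u (3 * \<epsilon>))
          \<le> ennreal (4 * exp (- c * real N)) + ennreal (4 * exp (- c' * real N))"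
          unfolding misfit_def
        proof (rule overlap_deviation(1)[OF N0 _ _ vu, of _ _ _ m])
          fix \<tau> assume "\<tau> \<in> sphere_N N"
          then have "dot ?I \<tau> \<tau> = N" using norm_N_dot[of N \<tau>] by (simp add: sphere_N_def)
          then show "emeasure (gibbs_measure N ?x \<beta> h)
            {\<sigma> \<in> sphere_N N. \<epsilon> * real N \<le> \<bar>dot ?I \<sigma> \<tau> - dot ?I m \<tau>\<bar>} \<le> ennreal (4 * exp (- c * real N))"
            by (intro m(2)) simp
        next
          show "emeasure (gibbs_measure N ?x \<beta>' h')
            {\<tau> \<in> sphere_N N. \<epsilon> * real N \<le> \<bar>dot ?I \<tau> m - v * real N\<bar>} \<le> ennreal (4 * exp (- c' * real N))"
            using m'[OF m(1)] unfolding v(2) .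
        qed
        also have "\<dots> \<le> ennreal (\<eta> / 5) + ennreal (\<eta> / 5)"
          using N4 N5 N by (intro add_mono ennreal_leI) blast+
        also have "\<dots> = ennreal (2 * \<eta> / 5)" using \<eta> by (simp flip: ennreal_plus)
        also have "\<dots> \<le> f x" by (simp add: f_def)
        finally show ?thesis .
      qed
    qed
  qed
qed

text \<open>Conditioned on \<tau> from the system without field, the other replica acts like its
  centre m, a multiple of order sqrt N of the resolvent vector y. Since \<tau> \<cdot> y has bounded
  second moment over Gibbs measure and good disorder, \<tau> \<cdot> m is negligible against
  \<epsilon> N.\<close>

lemma misfit_no_field:
  fixes \<beta> \<beta>' h' \<epsilon> \<eta> :: real
  assumes \<beta>': "0 < \<beta>'" and h': "h' \<noteq> 0" and \<epsilon>: "0 < \<epsilon>" and \<eta>: "0 < \<eta>"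
  shows "\<exists>N0\<ge>1. \<forall>N\<ge>N0. \<exists>f\<in>borel_measurable (gaussP ({..<N} \<times> {..<N})).
      (\<integral>\<^sup>+x. f x \<partial>gaussP ({..<N} \<times> {..<N})) \<le> ennreal \<eta> \<and>
      (\<forall>x\<in>space (gaussP ({..<N} \<times> {..<N})). ennreal (misfit N (\<lambda>i j. x (i, j)) \<beta> 0 \<beta>' h' 0 (3 * \<epsilon>)) \<le> f x)"
proof -
  define q where "q = q_param \<beta>' h'"
  note Q = q_param_facts[OF \<beta>' h', folded q_def]
  define b where "b = \<beta>' * (1 - q)"
  define z where "z = (b + 1 / b) / 2"
  have b: "0 < b" "b < 1" using Q by (simp_all add: b_def)
  have z1: "1 < z" using half_sum_inverse_gt_1[OF b] by (simp add: z_def)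
  define \<delta> where "\<delta> = min (1 / 2) ((z - 1) / 6)"
  have \<delta>: "0 < \<delta>" "\<delta> \<le> 1 / 2" using z1 by (simp_all add: \<delta>_def)
  have "\<delta> \<le> (z - 1) / 6" unfolding \<delta>_def by linarith
  then have "6 * \<delta> \<le> z - 1" by simp
  then have \<delta>z: "1 + 3 * \<delta> < z" using \<delta>(1) by linarith
  define L where "L = 1 + 3 * \<delta>"
  obtain c where c: "0 < c" and good: "\<forall>\<eta>>0. \<exists>N0\<ge>1. \<forall>N\<ge>N0. \<exists>S\<in>sets (gaussP ({..<N} \<times> {..<N})).
    emeasure (gaussP ({..<N} \<times> {..<N})) S \<le> ennreal \<eta> \<and>
    (\<forall>g\<in>space (gaussP ({..<N} \<times> {..<N})) - S. concentrates N \<beta>' h' z \<delta> \<epsilon> c g)"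
    using system_good[OF \<beta>' h' Q(1,2) b_def b _ z_def \<delta> \<delta>z \<epsilon>] Q(5) by (auto simp: b_def)
  have \<eta>3: "0 < \<eta> / 3" using \<eta> by simp
  obtain N1 where N1: "N1 \<ge> 1" "\<forall>N\<ge>N1. \<exists>S\<in>sets (gaussP ({..<N} \<times> {..<N})).
    emeasure (gaussP ({..<N} \<times> {..<N})) S \<le> ennreal (\<eta> / 3) \<and>
    (\<forall>g\<in>space (gaussP ({..<N} \<times> {..<N})) - S. concentrates N \<beta>' h' z \<delta> \<epsilon> c g)"
    using good \<eta>3 by blast
  obtain N2 where N2: "\<forall>N\<ge>N2. 4 * exp (- c * real N) \<le> \<eta> / 3" using exp_bound_eventually[OF c \<eta>3] by blast
  \<comment> \<open>Chosen so that (\<tau> \<cdot> m)^2 / (\<epsilon> N)^2 = K (\<tau> \<cdot> y)^2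
    / N in the Chebyshev bound.\<close>
  define K where "K = h'\<^sup>2 / (4 * \<beta>'\<^sup>2 * \<epsilon>\<^sup>2)"
  define k where "k = K / (z - L)\<^sup>2"
  have K: "0 \<le> K" by (simp add: K_def)
  have "(\<lambda>N. k / real N) \<longlonglongrightarrow> 0" by real_asymp
  then have "\<forall>\<^sub>F N in sequentially. k / real N < \<eta> / 3" using \<eta>3 by (rule order_tendstoD)
  then obtain N3 where N3: "\<And>N. N \<ge> N3 \<Longrightarrow> k / real N < \<eta> / 3" unfolding eventually_sequentially by blast
  show ?thesis
  proof (rule exI[of _ "max N1 (max N2 N3)"], rule conjI, use N1(1) in simp, intro allI impI)
    fix N assume "max N1 (max N2 N3) \<le> N"
    then have N: "N1 \<le> N" "N2 \<le> N" "N3 \<le> N" and N0: "1 \<le> N" using N1(1) by auto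
    let ?I = "{..<N}" and ?u = "\<lambda>_::nat. 1 / sqrt (real N)"
    let ?M = "gaussP (?I \<times> ?I)"
    obtain S where S: "S \<in> sets ?M" "emeasure ?M S \<le> ennreal (\<eta> / 3)"
      and G: "\<And>g. g \<in> space ?M - S \<Longrightarrow> concentrates N \<beta>' h' z \<delta> \<epsilon> c g" using N1(2) N(1) by blast
    have Lz: "L < z" using \<delta>z by (simp add: L_def)
    obtain \<Phi> where \<Phi>m: "\<Phi> \<in> borel_measurable ?M" and \<Phi>I: "(\<integral>\<^sup>+g. \<Phi> g \<partial>?M) \<le> ennreal (1 / (z - L)\<^sup>2)"
      and \<Phi>: "\<And>g y. g \<in> space ?M \<Longrightarrow> form_bound ?I (gmat N g) L 0 (\<lambda>_. 0) \<Longrightarrow> resolves ?I (gmat N g) z ?u y \<Longrightarrow>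
        (\<integral>\<^sup>+\<tau>. ennreal ((dot ?I \<tau> y)\<^sup>2) \<partial>gibbs_measure N (\<lambda>i j. g (i, j)) \<beta> 0) = \<Phi> g"
      using second_moment_bound[OF N0 Lz, of \<beta>] by blast
    \<comment> \<open>The middle term stays random: the Gibbs second moment is bounded only after
      integration over the disorder.\<close>
    define f :: "(nat \<times> nat \<Rightarrow> real) \<Rightarrow> ennreal"
      where "f x = indicator S x + ennreal (K / N) * \<Phi> x + ennreal (\<eta> / 3)" for x
    interpret P: prob_space ?M by (rule prob_space_gaussP)
    have fm: "f \<in> borel_measurable ?M" unfolding f_def[abs_def] using S \<Phi>m by simp
    have "(\<integral>\<^sup>+x. f x \<partial>?M) = emeasure ?M S + ennreal (K / N) * (\<integral>\<^sup>+x. \<Phi> x \<partial>?M) + ennreal (\<eta> / 3)"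
      unfolding f_def using S(1) \<Phi>m by (simp add: nn_integral_add nn_integral_cmult P.emeasure_space_1)
    also have "\<dots> \<le> ennreal (\<eta> / 3) + ennreal (K / N) * ennreal (1 / (z - L)\<^sup>2) + ennreal (\<eta> / 3)"
      using S(2) \<Phi>I by (intro add_mono mult_left_mono) simp_all
    also have "ennreal (K / N) * ennreal (1 / (z - L)\<^sup>2) = ennreal (k / N)"
      using K by (simp add: k_def mult.commute flip: ennreal_mult)
    also have "ennreal (\<eta> / 3) + ennreal (k / N) + ennreal (\<eta> / 3) \<le> ennreal (\<eta> / 3) + ennreal (\<eta> / 3) + ennreal (\<eta> / 3)"
      using N3[OF N(3)] by (intro add_mono ennreal_leI) simp_all
    also have "\<dots> = ennreal \<eta>" using \<eta> by (simp flip: ennreal_plus)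
    finally have fI: "(\<integral>\<^sup>+x. f x \<partial>?M) \<le> ennreal \<eta>" .
    show "\<exists>f\<in>borel_measurable ?M. (\<integral>\<^sup>+x. f x \<partial>?M) \<le> ennreal \<eta> \<and>
      (\<forall>x\<in>space ?M. ennreal (misfit N (\<lambda>i j. x (i, j)) \<beta> 0 \<beta>' h' 0 (3 * \<epsilon>)) \<le> f x)"
    proof (intro bexI[OF _ fm] conjI[OF fI] ballI)
      fix x assume x: "x \<in> space ?M"
      let ?x = "\<lambda>i j. x (i, j)"
      show "ennreal (misfit N ?x \<beta> 0 \<beta>' h' 0 (3 * \<epsilon>)) \<le> f x"
      proof (cases "x \<in> S")
        case True
        have "ennreal (misfit N ?x \<beta> 0 \<beta>' h' 0 (3 * \<epsilon>)) \<le> 1" using misfit_bounds[OF N0] by (simp add: ennreal_le_1)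
        also have "1 \<le> indicator S x + (ennreal (K / N) * \<Phi> x + ennreal (\<eta> / 3))" using True by simp
        also have "\<dots> = f x" by (simp add: f_def add.assoc)
        finally show ?thesis .
      next
        case False
        have gd: "concentrates N \<beta>' h' z \<delta> \<epsilon> c x" using False x G by blast
        then have fb: "form_bound ?I (gmat N x) L (1 / 2 + \<delta>) ?u" by (simp add: concentrates_def L_def)
        obtain y where y: "resolves ?I (gmat N x) z ?u y"
          using ex_resolves[OF finite_lessThan symm_on_gmat fb Lz] \<delta> by auto
        have fb0: "form_bound ?I (gmat N x) L 0 (\<lambda>_. 0)"
          unfolding form_bound_def
        proof
          fix w
          have "\<bar>dot ?I w (mv ?I (gmat N x) w)\<bar> \<le> L * dot ?I w w - (1 / 2 + \<delta>) * (dot ?I ?u w)\<^sup>2"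
            using fb unfolding form_bound_def by blast
          moreover have "0 \<le> (1 / 2 + \<delta>) * (dot ?I ?u w)\<^sup>2" using \<delta> by simp
          ultimately show "\<bar>dot ?I w (mv ?I (gmat N x) w)\<bar> \<le> L * dot ?I w w - 0 * (dot ?I (\<lambda>_. 0) w)\<^sup>2" by linarith
        qed
        define s where "s = h' * sqrt (real N) / (2 * \<beta>')"
        define m where "m = (\<lambda>i. s * y i)"
        have m: "\<And>t. dot ?I t t \<le> 2 * real N \<Longrightarrow> emeasure (gibbs_measure N ?x \<beta>' h')
          {\<sigma> \<in> sphere_N N. \<epsilon> * real N \<le> \<bar>dot ?I \<sigma> t - dot ?I m t\<bar>} \<le> ennreal (4 * exp (- c * real N))"
          using gd y m_def unfolding concentrates_def s_def by blast
        let ?G = "gibbs_measure N ?x \<beta> 0"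
        have dm: "(\<lambda>\<tau>. dot ?I \<tau> y) \<in> borel_measurable ?G" by (rule dot_measurable_gibbs)
        have "emeasure ?G {\<tau> \<in> sphere_N N. \<epsilon> * real N \<le> \<bar>dot ?I \<tau> m - 0 * real N\<bar>}
          \<le> emeasure ?G {\<tau> \<in> space ?G. 1 \<le> ennreal (K / N) * ennreal ((dot ?I \<tau> y)\<^sup>2)}"
        proof (rule emeasure_mono)
          show "{\<tau> \<in> space ?G. 1 \<le> ennreal (K / N) * ennreal ((dot ?I \<tau> y)\<^sup>2)} \<in> sets ?G" using dm by measurable
          show "{\<tau> \<in> sphere_N N. \<epsilon> * real N \<le> \<bar>dot ?I \<tau> m - 0 * real N\<bar>}
            \<subseteq> {\<tau> \<in> space ?G. 1 \<le> ennreal (K / N) * ennreal ((dot ?I \<tau> y)\<^sup>2)}"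
          proof
            fix \<tau> assume "\<tau> \<in> {\<tau> \<in> sphere_N N. \<epsilon> * real N \<le> \<bar>dot ?I \<tau> m - 0 * real N\<bar>}"
            then have \<tau>: "\<tau> \<in> sphere_N N" "\<epsilon> * real N \<le> \<bar>dot ?I \<tau> m\<bar>" by auto
            have "(\<epsilon> * real N)\<^sup>2 \<le> \<bar>dot ?I \<tau> m\<bar>\<^sup>2" using \<tau>(2) \<epsilon> by (intro power_mono) simp_all
            also have "\<dots> = s\<^sup>2 * (dot ?I \<tau> y)\<^sup>2" by (simp add: m_def dot_scale_right power_mult_distrib)
            also have "s\<^sup>2 = K * \<epsilon>\<^sup>2 * N" using \<epsilon> by (simp add: s_def K_def power_divide power_mult_distrib)
            finally have "(\<epsilon>\<^sup>2 * N) * N \<le> (\<epsilon>\<^sup>2 * N) * (K * (dot ?I \<tau> y)\<^sup>2)"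
              by (simp add: power2_eq_square mult_ac)
            moreover have "0 < \<epsilon>\<^sup>2 * N" using \<epsilon> N0 by simp
            ultimately have "N \<le> K * (dot ?I \<tau> y)\<^sup>2" by (rule mult_left_le_imp_le)
            then have "1 \<le> K / N * (dot ?I \<tau> y)\<^sup>2" using N0 by (simp add: pos_le_divide_eq)
            then have "ennreal 1 \<le> ennreal (K / N * (dot ?I \<tau> y)\<^sup>2)" by (rule ennreal_leI)
            moreover have "ennreal (K / N * (dot ?I \<tau> y)\<^sup>2) = ennreal (K / N) * ennreal ((dot ?I \<tau> y)\<^sup>2)"
              using K by (intro ennreal_mult) simp_all
            ultimately have "1 \<le> ennreal (K / N) * ennreal ((dot ?I \<tau> y)\<^sup>2)" by (simp only: ennreal_1)
            then show "\<tau> \<in> {\<tau> \<in> space ?G. 1 \<le> ennreal (K / N) * ennreal ((dot ?I \<tau> y)\<^sup>2)}"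
              using \<tau>(1) by (simp add: space_gibbs_measure)
          qed
        qed
        also have "\<dots> \<le> ennreal (K / N) * (\<integral>\<^sup>+\<tau>. ennreal ((dot ?I \<tau> y)\<^sup>2) * indicator (space ?G) \<tau> \<partial>?G)"
          using dm by (intro nn_integral_Markov_inequality) simp_all
        also have "(\<integral>\<^sup>+\<tau>. ennreal ((dot ?I \<tau> y)\<^sup>2) * indicator (space ?G) \<tau> \<partial>?G) = (\<integral>\<^sup>+\<tau>. ennreal ((dot ?I \<tau> y)\<^sup>2) \<partial>?G)"
          by (rule nn_integral_cong) simp
        also have "\<dots> = \<Phi> x" by (rule \<Phi>[OF x fb0 y])
        finally have p2: "emeasure ?G {\<tau> \<in> sphere_N N. \<epsilon> * real N \<le> \<bar>dot ?I \<tau> m - 0 * real N\<bar>} \<le> ennreal (K / N) * \<Phi> x" .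
        \<comment> \<open>The system without field stands first in the pair but is the one
          conditioned on, hence the version with exchanged factors, at v = u = 0.\<close>
        have "ennreal (misfit N ?x \<beta> 0 \<beta>' h' 0 (3 * \<epsilon>)) \<le> ennreal (4 * exp (- c * real N)) + ennreal (K / N) * \<Phi> x"
          unfolding misfit_def
        proof (rule overlap_deviation(2)[OF N0 _ p2])
          fix \<tau> assume "\<tau> \<in> sphere_N N"
          then have "dot ?I \<tau> \<tau> = N" using norm_N_dot[of N \<tau>] by (simp add: sphere_N_def)
          then show "emeasure (gibbs_measure N ?x \<beta>' h')
            {\<sigma> \<in> sphere_N N. \<epsilon> * real N \<le> \<bar>dot ?I \<sigma> \<tau> - dot ?I m \<tau>\<bar>} \<le> ennreal (4 * exp (- c * real N))"
            by (intro m) simp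
        qed (use \<epsilon> in simp)
        also have "\<dots> \<le> ennreal (\<eta> / 3) + ennreal (K / N) * \<Phi> x"
          using N2 N by (intro add_mono ennreal_leI) auto
        also have "\<dots> \<le> f x" using False by (simp add: f_def add.commute)
        finally show ?thesis .
      qed
    qed
  qed
qed

theorem theorem3:
  fixes M :: "'a measure" and g :: "nat \<Rightarrow> nat \<Rightarrow> 'a \<Rightarrow> real"
    and \<beta>\<^sub>1 h\<^sub>1 \<beta>\<^sub>2 h\<^sub>2 q\<^sub>1 q\<^sub>2 u\<^sub>0 \<epsilon> :: real
  assumes "prob_space M"
    and "prob_space.indep_vars M (\<lambda>_. borel) (\<lambda>(i, j). g i j) UNIV"
    and "\<And>i j. distributed M lborel (g i j) (\<lambda>x. ennreal (std_normal_density x))"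
    and "h\<^sub>1 = 0 \<Longrightarrow> \<beta>\<^sub>1 > 1" and "h\<^sub>1 \<noteq> 0 \<Longrightarrow> \<beta>\<^sub>1 > 0"
    and "h\<^sub>2 = 0 \<Longrightarrow> \<beta>\<^sub>2 > 1" and "h\<^sub>2 \<noteq> 0 \<Longrightarrow> \<beta>\<^sub>2 > 0"
    and "q\<^sub>1 = q_param \<beta>\<^sub>1 h\<^sub>1" and "q\<^sub>2 = q_param \<beta>\<^sub>2 h\<^sub>2"
    and "(h\<^sub>1 = 0 \<and> h\<^sub>2 \<noteq> 0 \<and> u\<^sub>0 = 0) \<or>
         (h\<^sub>1 \<noteq> 0 \<and> h\<^sub>2 \<noteq> 0 \<and>
          u\<^sub>0 = h\<^sub>1 * h\<^sub>2 * (1 - q\<^sub>1) * (1 - q\<^sub>2) / (1 - \<beta>\<^sub>1 * \<beta>\<^sub>2 * (1 - q\<^sub>1) * (1 - q\<^sub>2)))"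
    and "\<epsilon> > 0"
  shows "(\<lambda>N. \<integral>\<omega>. (\<integral>(\<sigma>, \<tau>). indicator {(\<sigma>, \<tau>). \<bar>overlap N \<sigma> \<tau> - u\<^sub>0\<bar> \<ge> \<epsilon>} (\<sigma>, \<tau>)
              \<partial>(gibbs_measure N (\<lambda>i j. g i j \<omega>) \<beta>\<^sub>1 h\<^sub>1 \<Otimes>\<^sub>M gibbs_measure N (\<lambda>i j. g i j \<omega>) \<beta>\<^sub>2 h\<^sub>2))
            \<partial>M) \<longlonglongrightarrow> (0 :: real)"
  unfolding misfit_def[symmetric]
proof (rule misfit_tendsto_0[OF assms(1-3)])
  fix \<eta> :: real assume \<eta>: "0 < \<eta>"
  \<comment> \<open>A third of \<epsilon> for each of the three replacements behind the overlap
    bound.\<close>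
  have \<epsilon>: "0 < \<epsilon> / 3" "3 * (\<epsilon> / 3) = \<epsilon>" using assms(11) by simp_all
  show "\<exists>N0\<ge>1. \<forall>N\<ge>N0. \<exists>f\<in>borel_measurable (gaussP ({..<N} \<times> {..<N})).
      (\<integral>\<^sup>+x. f x \<partial>gaussP ({..<N} \<times> {..<N})) \<le> ennreal \<eta> \<and>
      (\<forall>x\<in>space (gaussP ({..<N} \<times> {..<N})). ennreal (misfit N (\<lambda>i j. x (i, j)) \<beta>\<^sub>1 h\<^sub>1 \<beta>\<^sub>2 h\<^sub>2 u\<^sub>0 \<epsilon>) \<le> f x)"
    using assms(10)
  proof (elim disjE conjE)
    assume "h\<^sub>1 = 0" "h\<^sub>2 \<noteq> 0" "u\<^sub>0 = 0"
    then show ?thesis using misfit_no_field[OF assms(7) _ \<epsilon>(1) \<eta>, where \<beta> = \<beta>\<^sub>1] unfolding \<epsilon>(2) by blast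
  next
    assume "h\<^sub>1 \<noteq> 0" "h\<^sub>2 \<noteq> 0" "u\<^sub>0 = h\<^sub>1 * h\<^sub>2 * (1 - q\<^sub>1) * (1 - q\<^sub>2) / (1 - \<beta>\<^sub>1 * \<beta>\<^sub>2 * (1 - q\<^sub>1) * (1 - q\<^sub>2))"
    then show ?thesis
      using misfit_both_fields[OF assms(5) _ assms(7) _ assms(8,9) _ \<epsilon>(1) \<eta>] unfolding \<epsilon>(2) by blast
  qed
qed

end
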